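(* Let $1<q<\infty$, let $w$ and $a$ be weights on $\mathbb{R}^n$ with $w\in A_q(\mathbb{R}^n)$ and $a\in L^q(\mathbb{R}^n,w)$, and let $\delta>0$ be such that $a^\delta\in A_q(\mathbb{R}^n)$. Then $f\in W^{1,q)}_a(\mathbb{R}^n,w)$ if and only if $f\in L^{q)}_a(\mathbb{R}^n,w)$ and there exists a non-negative function $g\in L^{q)}_a(\mathbb{R}^n,w)$ such that the inequality $$|f(x)-f(y)|\le|x-y|\,(g(x)+g(y))$$ holds for a.e. $x,y\in\mathbb{R}^n$, i.e. for all $x,y\in\mathbb{R}^n\setminus S$ with some set $S$ of Lebesgue measure zero.
   Context: A weight is a measurable function that is positive and finite a.e. A weight $w$ belongs to the Muckenhoupt class $A_q(\mathbb{R}^n)$, $1<q<\infty$, if $$\sup_{Q}\left(\frac1{|Q|}\int_Q w\,dx\right)\left(\frac1{|Q|}\int_Q w^{-\frac1{q-1}}\,dx\right)^{q-1}<\infty,$$ the supremum being over all cubes $Q\subset\mathbb{R}^n$ with edges parallel to the coordinate axes. $L^q(\mathbb{R}^n,w)$ is the space of measurable $f$ with $\left(\int_{\mathbb{R}^n}|f|^qw\,dx\right)^{1/q}<\infty$. For weights $w,a$ with $wa^\varepsilon\in L^1_{\mathrm{loc}}(\mathbb{R}^n)$ for all $\varepsilon\in(0,q-1)$, the generalized grand Lebesgue space $L^{q)}_a(\mathbb{R}^n,w)$ consists of all measurable $g$ on $\mathbb{R}^n$ with $$\|g\|_{L^{q)}_a(\mathbb{R}^n,w)}=\sup_{0<\varepsilon<q-1}\left(\varepsilon\int_{\mathbb{R}^n}|g(x)|^{q-\varepsilon}w(x)a^\varepsilon(x)\,dx\right)^{\frac1{q-\varepsilon}}<\infty.$$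 The generalized grand Sobolev space $W^{1,q)}_a(\mathbb{R}^n,w)$ is the collection of all $f\in L^{q)}_a(\mathbb{R}^n,w)$ having a weak gradient $\nabla f$ with $|\nabla f|\in L^{q)}_a(\mathbb{R}^n,w)$. (A weak gradient requires $f,\nabla f\in L^1_{\mathrm{loc}}$.) *)

theory Defs
  imports "HOL-Analysis.Analysis"
begin

(* Functions on R^n are real-valued representatives and "measurable" is Lebesgue measurability;
   "finite a.e." is therefore automatic.  All norms are computed in ennreal, so that a divergent
   integral has the value infinity and is not silently replaced by 0. *)

definition epowr :: "ennreal \<Rightarrow> real \<Rightarrow> ennreal" where
  "epowr t p = (if t = \<infinity> then \<infinity> else ennreal (enn2real t powr p))"
  (* used for p > 0 only *)

definition weight :: "(real ^ 'n \<Rightarrow> real) \<Rightarrow> bool" where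
  "weight w \<longleftrightarrow> w \<in> borel_measurable lebesgue \<and> (AE x in lebesgue. 0 < w x)"

definition cube :: "real ^ 'n \<Rightarrow> real \<Rightarrow> (real ^ 'n) set" where
  "cube c r = cbox c (c + (\<chi> i. r))"

definition ennavg :: "(real ^ 'n) set \<Rightarrow> (real ^ 'n \<Rightarrow> real) \<Rightarrow> ennreal" where
  "ennavg Q f = (\<integral>\<^sup>+x\<in>Q. ennreal (f x) \<partial>lebesgue) / emeasure lebesgue Q"

definition Muckenhoupt :: "real \<Rightarrow> (real ^ 'n \<Rightarrow> real) \<Rightarrow> bool" where
  "Muckenhoupt q w \<longleftrightarrow> weight w \<and>
     (SUP Q \<in> {cube c r | c r. 0 < r}.
        ennavg Q w * epowr (ennavg Q (\<lambda>x. w x powr (- 1 / (q - 1)))) (q - 1)) < \<infinity>"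

definition weighted_Lebesgue :: "real \<Rightarrow> (real ^ 'n \<Rightarrow> real) \<Rightarrow> (real ^ 'n \<Rightarrow> real) set" where
  "weighted_Lebesgue q w = {f \<in> borel_measurable lebesgue.
     epowr (\<integral>\<^sup>+x. ennreal (\<bar>f x\<bar> powr q * w x) \<partial>lebesgue) (1 / q) < \<infinity>}"

(* The space below is meant for weights w, a such that w a^eps is locally integrable for all
   0 < eps < q - 1.  This holds whenever w is locally integrable (e.g. w in A_q) and a is in
   L^q(w), because w a^eps <= w (1 + a^q) a.e. *)
definition grand_norm ::
    "real \<Rightarrow> (real ^ 'n \<Rightarrow> real) \<Rightarrow> (real ^ 'n \<Rightarrow> real) \<Rightarrow> (real ^ 'n \<Rightarrow> real) \<Rightarrow> ennreal" where
  "grand_norm q a w g = (SUP \<epsilon> \<in> {0<..<q - 1}.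
     epowr (ennreal \<epsilon> * (\<integral>\<^sup>+x. ennreal (\<bar>g x\<bar> powr (q - \<epsilon>) * w x * a x powr \<epsilon>) \<partial>lebesgue))
       (1 / (q - \<epsilon>)))"

definition grand_Lebesgue ::
    "real \<Rightarrow> (real ^ 'n \<Rightarrow> real) \<Rightarrow> (real ^ 'n \<Rightarrow> real) \<Rightarrow> (real ^ 'n \<Rightarrow> real) set" where
  "grand_Lebesgue q a w = {g \<in> borel_measurable lebesgue. grand_norm q a w g < \<infinity>}"

definition locally_integrable :: "(real ^ 'n \<Rightarrow> 'b::euclidean_space) \<Rightarrow> bool" where
  "locally_integrable f \<longleftrightarrow> (\<forall>K. compact K \<longrightarrow> f absolutely_integrable_on K)"

definition partial_deriv :: "'n \<Rightarrow> (real ^ 'n \<Rightarrow> real) \<Rightarrow> real ^ 'n \<Rightarrow> real" where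
  "partial_deriv i \<phi> x = frechet_derivative \<phi> (at x) (axis i 1)"

fun C_class :: "nat \<Rightarrow> (real ^ 'n \<Rightarrow> real) \<Rightarrow> bool" where
  "C_class 0 \<phi> \<longleftrightarrow> continuous_on UNIV \<phi>"
| "C_class (Suc k) \<phi> \<longleftrightarrow>
     (\<forall>x. \<phi> differentiable (at x)) \<and> (\<forall>i. C_class k (partial_deriv i \<phi>))"

definition test_function :: "(real ^ 'n \<Rightarrow> real) \<Rightarrow> bool" where
  "test_function \<phi> \<longleftrightarrow> (\<forall>k. C_class k \<phi>) \<and> compact (closure {x. \<phi> x \<noteq> 0})"

definition weak_gradient :: "(real ^ 'n \<Rightarrow> real) \<Rightarrow> (real ^ 'n \<Rightarrow> real ^ 'n) \<Rightarrow> bool" where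
  "weak_gradient f G \<longleftrightarrow> locally_integrable f \<and> locally_integrable G \<and>
     (\<forall>\<phi>. test_function \<phi> \<longrightarrow>
       (\<forall>i. (LINT x|lebesgue. f x * partial_deriv i \<phi> x) = - (LINT x|lebesgue. G x $ i * \<phi> x)))"

definition grand_Sobolev ::
    "real \<Rightarrow> (real ^ 'n \<Rightarrow> real) \<Rightarrow> (real ^ 'n \<Rightarrow> real) \<Rightarrow> (real ^ 'n \<Rightarrow> real) set" where
  "grand_Sobolev q a w = {f \<in> grand_Lebesgue q a w.
     \<exists>G. weak_gradient f G \<and> (\<lambda>x. norm (G x)) \<in> grand_Lebesgue q a w}"

end

theory Submission
  imports Defs
begin

text \<open>
  In one direction the function \<open>g\<close> is a maximal function of the gradient; in the other the pointwise
  inequality bounds difference quotients by \<open>g\<close>, so that the weak derivatives exist and are bounded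
  by \<open>2 * g\<close>. The substance lies in the fact that the maximal operator acts on the grand Lebesgue space.

  Instead of the maximal operator over all cubes, the sum of the dyadic maximal operators
  of \<open>2 ^ CARD('n)\<close> adjacent grids is used. Any two points lie in a common cube of one of these grids
  whose side is comparable to their distance (\<open>adjacent_dcube\<close>). Comparing \<open>f x\<close> and \<open>f y\<close> with
  the mean of \<open>f\<close> over this cube, and this mean with those over the smaller cubes at \<open>x\<close> and \<open>y\<close>, the
  Poincare inequality gives the pointwise inequality with a multiple of the sum of these maximal functions
  of the gradient (\<open>weak_gradient_pointwise\<close>). The Poincare inequality itself is derived from the
  definition of the weak gradient by integrating along segments (\<open>weak_gradient_translation\<close>).

  The grand norm is the supremum over \<open>\<epsilon>\<close> of norms with exponent \<open>q - \<epsilon>\<close> and weight \<open>w * a powr \<epsilon>\<close>. As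
  \<open>a powr q * w\<close> is integrable, small \<open>\<epsilon>\<close> suffice (\<open>grand_bounded_extend\<close>). For small \<open>\<epsilon>\<close> these weights
  belong to the Muckenhoupt class of the exponent \<open>q - \<epsilon>\<close> with a uniform bound (\<open>dyadic_Ap_perturb\<close>);
  this follows from the reverse Hoelder inequality for \<open>w\<close> and its dual weight (\<open>reverse_Holder\<close>) together with the
  assumption on the power of \<open>a\<close>. Muckenhoupt's theorem with a constant depending only on the
  exponent and on the Muckenhoupt bound (\<open>dyadic_max_Muckenhoupt\<close>) then bounds the maximal operators
  uniformly in \<open>\<epsilon>\<close>. The same weights show that functions in the grand space are locally integrable
  (\<open>grand_bounded_locally_integrable\<close>).

  For the converse, moving difference quotients from a test function \<open>\<phi>\<close> to \<open>f\<close> shows that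
  \<open>\<phi> \<mapsto> \<integral> f * \<partial>\<^sub>i \<phi>\<close> is bounded by \<open>2 * \<integral> g * |\<phi>|\<close> (\<open>pointwise_functional_bound\<close>). Such a functional
  has a density bounded by \<open>2 * g\<close>: it is represented in a weighted space of square integrable
  functions by minimising a quadratic energy (\<open>quadratic_Riesz\<close>, \<open>test_functional_representation\<close>),
  and the bound is read off by testing with bump functions (\<open>bound_of_tests\<close>).
\<close>

section \<open>Adjacent dyadic grids\<close>

text \<open>The index of the interval of length \<open>2 powi (-k)\<close> that contains \<open>u\<close>. In the shifted
  grid the endpoints are moved by a third of that length, to the right for even \<open>k\<close> and to the
  left for odd \<open>k\<close>; the alternating sign is what keeps the shifted grids nested.\<close>

definition dcell :: "bool \<Rightarrow> int \<Rightarrow> real \<Rightarrow> int" where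
  "dcell t k u = \<lfloor>2 powi k * u - (if t then (-1) powi k / 3 else 0)\<rfloor>"

text \<open>The half-open cube of side \<open>2 powi (-k)\<close> around \<open>x\<close> in the grid that is shifted in the
  coordinates in \<open>T\<close>. The \<open>2 ^ CARD('n)\<close> grids obtained in this way are called adjacent.\<close>

definition dcube :: "'n set \<Rightarrow> int \<Rightarrow> real ^ 'n \<Rightarrow> (real ^ 'n::finite) set" where
  "dcube T k x = {y. \<forall>i. dcell (i \<in> T) k (y $ i) = dcell (i \<in> T) k (x $ i)}"

lemma dcube_self [simp]: "x \<in> dcube T k x"
  by (simp add: dcube_def)

lemma dcube_eq: "y \<in> dcube T k x \<Longrightarrow> dcube T k y = dcube T k x"
  by (auto simp: dcube_def)

text \<open>Passing to the coarser level halves the cell index. For the shifted grid this works because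
  \<open>2/3 = 1 - 1/3\<close>: doubling a shift by one third gives, up to a whole cell, the shift by one third
  in the opposite direction.\<close>

lemma dcell_parent:
  "dcell t k u = (dcell t (k + 1) u - (if t then (if even k then 1 else -1) else 0)) div 2"
proof -
  define s :: int where "s = (if t then (if even k then 1 else -1) else 0)"
  have pw: "(-1::real) powi k = (if even k then 1 else -1)"
    by (auto simp: power_int_minus_left)
  have pw1: "(-1::real) powi (k + 1) = (if even k then -1 else 1)"
    by (auto simp: power_int_minus_left)
  define z where "z = 2 powi (k + 1) * u - (if t then (-1) powi (k + 1) / 3 else 0)"
  have h: "2 powi k * u - (if t then (-1) powi k / 3 else 0) = (z - of_int s) / 2"
    unfolding z_def s_def pw pw1 by (auto simp: power_int_add field_simps)
  have "dcell t k u = \<lfloor>(z - of_int s) / of_int 2\<rfloor>"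
    unfolding dcell_def h by simp
  also have "\<dots> = \<lfloor>z - of_int s\<rfloor> div 2"
    using floor_divide_real_eq_div[of 2 "z - of_int s"] by simp
  also have "\<dots> = (\<lfloor>z\<rfloor> - s) div 2"
    by simp
  finally show ?thesis
    by (simp add: s_def z_def dcell_def)
qed

lemma dcube_Suc_subset: "dcube T (k + 1) x \<subseteq> dcube T k x"
proof
  fix y assume "y \<in> dcube T (k + 1) x"
  then have "dcell (i \<in> T) (k + 1) (y $ i) = dcell (i \<in> T) (k + 1) (x $ i)" for i
    by (auto simp: dcube_def)
  then have "dcell (i \<in> T) k (y $ i) = dcell (i \<in> T) k (x $ i)" for i
    using dcell_parent[of "i \<in> T" k "y $ i"] dcell_parent[of "i \<in> T" k "x $ i"] by simp
  then show "y \<in> dcube T k x"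
    by (auto simp: dcube_def)
qed

lemma dcube_mono: "j \<le> k \<Longrightarrow> dcube T k x \<subseteq> dcube T j x"
proof (induction k rule: int_ge_induct)
  case (step k)
  with dcube_Suc_subset[of T k x] show ?case by blast
qed simp

lemma dcube_countable: "countable (range (dcube T k :: real ^ 'n \<Rightarrow> (real ^ 'n::finite) set))"
proof -
  let ?F = "\<lambda>v::int^'n. {y::real^'n. \<forall>i. dcell (i \<in> T) k (y $ i) = v $ i}"
  have inj: "inj (\<lambda>v::int^'n. vec_nth v)"
    by (auto simp: inj_def vec_eq_iff fun_eq_iff)
  have "countable (UNIV :: ('n \<Rightarrow> int) set)"
    by simp
  then have "countable (UNIV :: (int^'n) set)"
    using inj countable_image_inj_on[of "\<lambda>v::int^'n. vec_nth v" UNIV]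
    by (meson countable_subset subset_UNIV)
  then have "countable (range ?F)"
    by (rule countable_image)
  moreover have "range (dcube T k) \<subseteq> range ?F"
  proof safe
    fix x :: "real^'n"
    have "dcube T k x = ?F (\<chi> i. dcell (i \<in> T) k (x $ i))"
      by (auto simp: dcube_def)
    then show "dcube T k x \<in> range ?F" by blast
  qed
  ultimately show ?thesis
    by (rule countable_subset[rotated])
qed

definition dcorner :: "'n set \<Rightarrow> int \<Rightarrow> real ^ 'n \<Rightarrow> real ^ 'n::finite" where
  "dcorner T k x = (\<chi> i. 2 powi (- k) * (dcell (i \<in> T) k (x $ i) + (if i \<in> T then (-1) powi k / 3 else 0)))"

lemma dcube_alt:
  "dcube T k x = {y. \<forall>i. dcorner T k x $ i \<le> y $ i \<and> y $ i < dcorner T k x $ i + 2 powi (-k)}"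
proof -
  have "dcell t k u = m \<longleftrightarrow> 2 powi (- k) * (m + (if t then (-1) powi k / 3 else 0)) \<le> u \<and>
      u < 2 powi (- k) * (m + (if t then (-1) powi k / 3 else 0)) + 2 powi (-k)" for t u and m :: int
  proof -
    define s :: real where "s = (if t then (-1) powi k / 3 else 0)"
    define r :: real where "r = 2 powi k"
    have r: "r > 0" by (simp add: r_def)
    have "dcell t k u = m \<longleftrightarrow> m \<le> r * u - s \<and> r * u - s < m + 1"
      unfolding dcell_def s_def[symmetric] r_def[symmetric] by (simp add: floor_eq_iff)
    also have "\<dots> \<longleftrightarrow> inverse r * (m + s) \<le> u \<and> u < inverse r * (m + s) + inverse r"
      using r by (simp add: field_simps)
    finally show ?thesis
      by (simp add: power_int_minus r_def s_def)
  qed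
  then show ?thesis
    by (auto simp: dcube_def dcorner_def)
qed

lemma dcube_boxes:
  "box (dcorner T k x) (dcorner T k x + (\<chi> i. 2 powi (-k))) \<subseteq> dcube T k x"
  "dcube T k x \<subseteq> cube (dcorner T k x) (2 powi (-k))"
  unfolding dcube_alt cube_def by (auto simp: mem_box_cart less_imp_le)

lemma dcube_borel [measurable]: "dcube T k x \<in> sets borel"
proof -
  have "dcube T k x = {y. \<forall>i. dcorner T k x $ i \<le> y $ i \<and> y $ i < dcorner T k x $ i + 2 powi (-k)}"
    by (rule dcube_alt)
  also have "\<dots> = {y \<in> space borel. \<forall>i. dcorner T k x $ i \<le> y $ i \<and> y $ i < dcorner T k x $ i + 2 powi (-k)}"
    by simp
  also have "\<dots> \<in> sets borel"
    by measurable
  finally show ?thesis .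
qed

lemma prod_Basis_cart: "(\<Prod>b\<in>(Basis::(real^'n::finite) set). f b) = (\<Prod>i\<in>UNIV. f (axis i 1))"
proof -
  have "bij_betw (\<lambda>i. axis i (1::real)) (UNIV::'n set) Basis"
    by (auto simp: bij_betw_def inj_on_def axis_eq_axis Basis_vec_def)
  then show ?thesis
    using prod.reindex_bij_betw[of "\<lambda>i. axis i (1::real)" UNIV Basis f] by simp
qed

lemma emeasure_cube: 
  assumes "0 \<le> r" shows "emeasure lborel (cube c r :: (real^'n::finite) set) = ennreal (r ^ CARD('n))"
    "emeasure lborel (box c (c + (\<chi> i. r)) :: (real^'n::finite) set) = ennreal (r ^ CARD('n))"
proof -
  have "c \<bullet> b \<le> (c + (\<chi> i. r)) \<bullet> b" if "b \<in> Basis" for b :: "real^'n"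
    using that assms by (auto simp: Basis_vec_def inner_axis)
  moreover have "(\<Prod>b\<in>Basis. (c + (\<chi> i. r) - c) \<bullet> b) = r ^ CARD('n)"
    unfolding prod_Basis_cart by (simp add: inner_axis)
  ultimately show "emeasure lborel (cube c r) = ennreal (r ^ CARD('n))"
      "emeasure lborel (box c (c + (\<chi> i. r))) = ennreal (r ^ CARD('n))"
    unfolding cube_def by (auto simp: emeasure_lborel_cbox_eq emeasure_lborel_box_eq)
qed

lemma emeasure_dcube: "emeasure lborel (dcube T k x :: (real^'n::finite) set) = ennreal ((2 powi (-k)) ^ CARD('n))"
proof (rule antisym)
  show "emeasure lborel (dcube T k x) \<le> ennreal ((2 powi (-k)) ^ CARD('n))"
  proof -
    have "cube (dcorner T k x) (2 powi (-k)) \<in> sets lborel"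
      by (simp add: cube_def)
    from emeasure_mono[OF dcube_boxes(2) this] show ?thesis
      by (subst (asm) emeasure_cube) auto
  qed
  show "ennreal ((2 powi (-k)) ^ CARD('n)) \<le> emeasure lborel (dcube T k x)"
    using emeasure_mono[OF dcube_boxes(1)[of T k x], of lborel]
    by (simp add: emeasure_cube)
qed

lemma dcube_diff:
  assumes "y \<in> dcube T k x" "z \<in> dcube T k x" shows "\<bar>y $ i - z $ i\<bar> \<le> 2 powi (-k)"
  using assms unfolding dcube_alt by (auto simp: abs_le_iff) (smt (verit))+

lemma dcube_convex: "convex (dcube T k x)"
proof -
  have conv: "convex {y::real^'a. y $ i \<in> A}" if "convex A" for A i
    using that unfolding convex_def by auto
  have "dcube T k x = (\<Inter>i. {y. y $ i \<in> {dcorner T k x $ i..<dcorner T k x $ i + 2 powi (-k)}})"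
    unfolding dcube_alt by auto
  also have "convex \<dots>"
    by (intro convex_INT conv convex_real_interval)
  finally show ?thesis .
qed

section \<open>Stopping cubes\<close>

lemma measurable_dcube_fun:
  assumes "range (\<lambda>x. h (dcube T k x)) \<subseteq> space N"
  shows "(\<lambda>x. h (dcube T k x)) \<in> measurable borel N"
proof (rule measurableI)
  fix A assume "A \<in> sets N"
  have "(\<lambda>x. h (dcube T k x)) -` A \<inter> space borel = \<Union>{B \<in> range (dcube T k). h B \<in> A}"
    using dcube_eq by fastforce
  also have "\<dots> \<in> sets borel"
    by (rule sets.countable_Union) (auto intro: countable_subset[OF _ dcube_countable])
  finally show "(\<lambda>x. h (dcube T k x)) -` A \<inter> space borel \<in> sets borel" .
qed (use assms in auto)

lemma dcube_pred_borel: "{x. P (dcube T k x)} \<in> sets borel"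
proof -
  have "(\<lambda>x. P (dcube T k x)) \<in> measurable borel (count_space UNIV)"
    by (rule measurable_dcube_fun) auto
  then have "{x\<in>space borel. P (dcube T k x)} \<in> sets borel"
    by (simp add: pred_def)
  then show ?thesis by simp
qed

lemma stopping_set_borel: "{x. \<exists>k\<ge>K. P (dcube T k x)} \<in> sets borel"
proof -
  have "{x. \<exists>k\<ge>K. P (dcube T k x)} = (\<Union>k\<in>{K..}. {x. P (dcube T k x)})"
    by auto
  also have "\<dots> \<in> sets borel"
    by (intro sets.countable_UN'' ) (auto simp: dcube_pred_borel)
  finally show ?thesis .
qed

text \<open>Among the cubes of level at least \<open>K\<close> with property \<open>P\<close>, the first ones on each descending
  chain are pairwise disjoint, countable in number, and cover the same set as all of them. So an
  inequality between two measures on these first cubes passes to the union. Every covering argument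
  below is an instance of this.\<close>

lemma stopping_cubes:
  fixes \<mu> \<nu> :: "(real^'n::finite) measure"
  assumes [measurable_cong]: "sets \<mu> = sets borel" "sets \<nu> = sets borel"
    and le: "\<And>x k. K \<le> k \<Longrightarrow> P (dcube T k x) \<Longrightarrow>
      (\<And>j. K \<le> j \<Longrightarrow> j < k \<Longrightarrow> \<not> P (dcube T j x)) \<Longrightarrow>
      emeasure \<mu> (dcube T k x) \<le> emeasure \<nu> (dcube T k x)"
  shows "emeasure \<mu> {x. \<exists>k\<ge>K. P (dcube T k x)} \<le> emeasure \<nu> {x. \<exists>k\<ge>K. P (dcube T k x)}"
proof -
  define F where "F = {dcube T k x |k x. K \<le> k \<and> P (dcube T k x) \<and>
      (\<forall>j. K \<le> j \<longrightarrow> j < k \<longrightarrow> \<not> P (dcube T j x))}"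
  have cF: "countable F"
  proof (rule countable_subset)
    show "F \<subseteq> (\<Union>k. range (dcube T k))" by (auto simp: F_def)
  qed (auto simp: dcube_countable)
  have bF: "A \<in> sets borel" if "A \<in> F" for A
    using that by (auto simp: F_def)
  have UF: "{x. \<exists>k\<ge>K. P (dcube T k x)} = (\<Union>A\<in>F. A)"
  proof safe
    fix x k assume k: "K \<le> k" "P (dcube T k x)"
    define m where "m = (LEAST m. P (dcube T (K + int m) x))"
    have "P (dcube T (K + int (nat (k - K))) x)" using k by simp
    then have m: "P (dcube T (K + int m) x)" unfolding m_def by (rule LeastI)
    have "\<not> P (dcube T j x)" if "K \<le> j" "j < K + int m" for j
    proof
      assume "P (dcube T j x)"
      then have "P (dcube T (K + int (nat (j - K))) x)" using that by simp
      then have "m \<le> nat (j - K)" unfolding m_def by (rule Least_le)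
      then show False using that by linarith
    qed
    then have "dcube T (K + int m) x \<in> F"
      using m unfolding F_def by (intro CollectI exI[of _ "K + int m"] exI[of _ x]) auto
    then show "x \<in> (\<Union>A\<in>F. A)" by (intro UN_I[of "dcube T (K + int m) x"]) auto
  next
    fix x A assume "x \<in> A" "A \<in> F"
    then obtain k y where k: "K \<le> k" "P (dcube T k y)" "A = dcube T k y"
      by (auto simp: F_def)
    with \<open>x \<in> A\<close> have "dcube T k x = A" by (simp add: dcube_eq)
    with k show "\<exists>k\<ge>K. P (dcube T k x)" by auto
  qed
  \<comment> \<open>Two first cubes that meet are nested, and the larger one has property P, so they coincide.\<close>
  have dF: "disjoint_family_on (\<lambda>A. A) F"
  proof (unfold disjoint_family_on_def, intro ballI impI, rule ccontr)
    fix A B assume AB: "A \<in> F" "B \<in> F" "A \<noteq> B" "A \<inter> B \<noteq> {}"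
    then obtain z where z: "z \<in> A" "z \<in> B" by auto
    obtain k x where k: "K \<le> k" "P (dcube T k x)" "A = dcube T k x"
        "\<And>j. K \<le> j \<Longrightarrow> j < k \<Longrightarrow> \<not> P (dcube T j x)"
      using AB(1) by (auto simp: F_def)
    obtain l y where l: "K \<le> l" "P (dcube T l y)" "B = dcube T l y"
        "\<And>j. K \<le> j \<Longrightarrow> j < l \<Longrightarrow> \<not> P (dcube T j y)"
      using AB(2) by (auto simp: F_def)
    have zx: "dcube T k z = A" and zy: "dcube T l z = B" using z k(3) l(3) by (auto simp: dcube_eq)
    consider "k < l" | "l < k" | "k = l" by linarith
    then show False
    proof cases
      case 1
      then have "z \<in> dcube T k y" using z(2) l(3) dcube_mono[of k l T y] by auto
      then have "dcube T k y = A" using zx dcube_eq by blast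
      then show False using l(4)[of k] 1 k by simp
    next
      case 2
      then have "z \<in> dcube T l x" using z(1) k(3) dcube_mono[of l k T x] by auto
      then have "dcube T l x = B" using zy dcube_eq by blast
      then show False using k(4)[of l] 2 l by simp
    next
      case 3
      then show False using zx zy AB by simp
    qed
  qed
  have "emeasure \<mu> (\<Union>A\<in>F. A) = (\<integral>\<^sup>+A. emeasure \<mu> A \<partial>count_space F)"
    by (rule emeasure_UN_countable) (auto simp: cF dF bF assms)
  also have "\<dots> \<le> (\<integral>\<^sup>+A. emeasure \<nu> A \<partial>count_space F)"
  proof (rule nn_integral_mono)
    fix A assume "A \<in> space (count_space F)"
    then have "A \<in> F" by simp
    then show "emeasure \<mu> A \<le> emeasure \<nu> A"
      unfolding F_def using le by auto
  qed
  also have "\<dots> = emeasure \<nu> (\<Union>A\<in>F. A)"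
    by (rule emeasure_UN_countable[symmetric]) (auto simp: cF dF bF assms)
  finally show ?thesis unfolding UF .
qed

section \<open>Comparison of densities on cubes\<close>

lemma dcube_norm:
  assumes "y \<in> dcube T k (x :: real^'n::finite)"
  shows "norm (y - x) \<le> real CARD('n) * 2 powi (-k)"
proof -
  have "norm (y - x) \<le> (\<Sum>i\<in>UNIV. \<bar>(y - x) $ i\<bar>)"
    by (rule norm_le_l1_cart)
  also have "\<dots> \<le> (\<Sum>i\<in>(UNIV::'n set). 2 powi (-k))"
    using dcube_diff[OF assms dcube_self] by (intro sum_mono) simp
  finally show ?thesis by simp
qed

lemma powi_small:
  assumes "0 < (e::real)" shows "\<exists>k\<ge>K. 2 powi (-k) < e"
proof -
  obtain m where m: "(1/2) ^ m < e"
    using real_arch_pow_inv[OF assms, of "1/2"] by auto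
  define k where "k = max K (int m)"
  have "(2::real) powi (-k) \<le> 2 powi (- int m)"
    by (rule power_int_increasing) (auto simp: k_def)
  also have "\<dots> = (1/2) ^ m"
    by (simp add: power_int_minus power_one_over inverse_eq_divide)
  finally show ?thesis using m by (intro exI[of _ k]) (auto simp: k_def)
qed

lemma dcube_in_open:
  assumes "open U" "x \<in> U" shows "\<exists>k\<ge>K. dcube T k (x :: real^'n::finite) \<subseteq> U"
proof -
  obtain e where e: "e > 0" "ball x e \<subseteq> U" using assms open_contains_ball by blast
  obtain k where k: "k \<ge> K" "2 powi (-k) < e / real CARD('n)"
    using powi_small[of "e / real CARD('n)" K] e by auto
  have "dcube T k x \<subseteq> ball x e"
  proof
    fix y assume "y \<in> dcube T k x"
    from dcube_norm[OF this] k(2) show "y \<in> ball x e"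
      by (auto simp: dist_norm norm_minus_commute field_simps)
  qed
  with e k show ?thesis by blast
qed

text \<open>A form of the Lebesgue differentiation theorem for dyadic cubes. On the set where \<open>v < u\<close> within
  \<open>E\<close>, cover by the cubes that meet \<open>E\<close> and lie in an open set only slightly larger; the cubewise
  hypothesis then gives \<open>\<integral> u \<le> \<integral> v\<close> on that set up to an arbitrarily small error, so the set is null.\<close>

lemma AE_le_of_cubes:
  fixes u v :: "real ^ 'n::finite \<Rightarrow> ennreal"
  assumes [measurable]: "u \<in> borel_measurable borel" "v \<in> borel_measurable borel" "E \<in> sets borel"
    and fin: "\<And>R. (\<integral>\<^sup>+x\<in>ball 0 R. (u x + v x) \<partial>lborel) < \<infinity>"
    and le: "\<And>x k. x \<in> E \<Longrightarrow> K \<le> k \<Longrightarrow>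
      (\<integral>\<^sup>+y\<in>dcube T k x. u y \<partial>lborel) \<le> (\<integral>\<^sup>+y\<in>dcube T k x. v y \<partial>lborel)"
  shows "AE x in lborel. x \<in> E \<longrightarrow> u x \<le> v x"
proof -
  have "AE x in lborel. x \<in> E \<longrightarrow> x \<in> ball 0 (real m) \<longrightarrow> u x \<le> v x" for m :: nat
  proof -
    define B :: "(real^'n) set" where "B = ball 0 (real m)"
    have [measurable]: "B \<in> sets borel" by (simp add: B_def)
    define E' where "E' = {x\<in>E. v x < u x} \<inter> B"
    have [measurable]: "E' \<in> sets borel" unfolding E'_def by measurable
    define M where "M = density lborel (\<lambda>x. (u x + v x) * indicator B x)"
    have sM: "sets M = sets borel" by (simp add: M_def)
    have MA: "emeasure M A = (\<integral>\<^sup>+x\<in>A \<inter> B. (u x + v x) \<partial>lborel)" if "A \<in> sets borel" for A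
      using that unfolding M_def
      by (subst emeasure_density) (auto intro!: nn_integral_cong simp: indicator_def)
    have finM: "emeasure M A \<noteq> \<infinity>" if "A \<in> sets borel" for A
    proof -
      have "emeasure M A \<le> (\<integral>\<^sup>+x\<in>B. (u x + v x) \<partial>lborel)"
        using that by (subst MA) (auto intro!: nn_integral_mono simp: indicator_def)
      with fin[of "real m"] show ?thesis by (auto simp: B_def top_unique)
    qed
    have spM: "space M = UNIV" by (simp add: M_def)
    have outer: "emeasure M E' = (INF U\<in>{U. E' \<subseteq> U \<and> open U}. emeasure M U)"
      by (rule outer_regular[OF sM]) (use finM[of UNIV] spM in auto)
    \<comment> \<open>The measure of E' is kept on both sides, so that the error appears as M U - M E' without subtraction.\<close>
    have key: "(\<integral>\<^sup>+x\<in>E'. u x \<partial>lborel) + emeasure M E' \<le> (\<integral>\<^sup>+x\<in>E'. v x \<partial>lborel) + emeasure M U"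
      if U: "E' \<subseteq> U" "open U" for U
    proof -
      have [measurable]: "U \<in> sets borel" using U by simp
      define P where "P = (\<lambda>A. A \<inter> E \<noteq> {} \<and> A \<subseteq> U \<inter> B)"
      define O' where "O' = {x. \<exists>k\<ge>K. P (dcube T k x)}"
      have [measurable]: "O' \<in> sets borel"
        unfolding O'_def by (rule stopping_set_borel)
      have sub: "O' \<subseteq> U \<inter> B"
        using dcube_self unfolding O'_def P_def by blast
      have sup: "E' \<subseteq> O'"
      proof
        fix x assume x: "x \<in> E'"
        then have "x \<in> U \<inter> B" using U by (auto simp: E'_def)
        moreover have "open (U \<inter> B)" using U by (auto simp: B_def)
        ultimately obtain k where "k \<ge> K" "dcube T k x \<subseteq> U \<inter> B"
          using dcube_in_open by blast
        moreover have "x \<in> dcube T k x \<inter> E" using x by (auto simp: E'_def)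
        ultimately show "x \<in> O'" unfolding O'_def P_def by blast
      qed
      have "emeasure (density lborel u) O' \<le> emeasure (density lborel v) O'"
        unfolding O'_def
      proof (rule stopping_cubes)
        fix x k assume k: "K \<le> k" "P (dcube T k x)"
        then obtain z where z: "z \<in> dcube T k x" "z \<in> E" by (auto simp: P_def)
        from le[OF z(2) k(1)] dcube_eq[OF z(1)]
        show "emeasure (density lborel u) (dcube T k x) \<le> emeasure (density lborel v) (dcube T k x)"
          by (simp add: emeasure_density)
      qed auto
      then have uv: "(\<integral>\<^sup>+x\<in>O'. u x \<partial>lborel) \<le> (\<integral>\<^sup>+x\<in>O'. v x \<partial>lborel)"
        by (simp add: emeasure_density)
      have "(\<integral>\<^sup>+x\<in>E'. u x \<partial>lborel) + emeasure M E' \<le> (\<integral>\<^sup>+x\<in>O'. u x \<partial>lborel) + emeasure M E'"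
        using sup by (intro add_mono nn_integral_mono) (auto simp: indicator_def)
      also have "\<dots> \<le> (\<integral>\<^sup>+x\<in>O'. v x \<partial>lborel) + emeasure M E'"
        using uv by (intro add_mono) auto
      also have "\<dots> = (\<integral>\<^sup>+x. v x * indicator O' x + (u x + v x) * indicator (E' \<inter> B) x \<partial>lborel)"
        by (subst MA) (auto simp: nn_integral_add)
      also have "\<dots> \<le> (\<integral>\<^sup>+x. v x * indicator E' x + (u x + v x) * indicator (U \<inter> B) x \<partial>lborel)"
        using sub sup U by (intro nn_integral_mono) (auto simp: indicator_def E'_def)
      also have "\<dots> = (\<integral>\<^sup>+x\<in>E'. v x \<partial>lborel) + emeasure M U"
        by (subst MA) (auto simp: nn_integral_add)
      finally show ?thesis .
    qed
    have "(\<integral>\<^sup>+x\<in>E'. u x \<partial>lborel) + emeasure M E' \<le> (\<integral>\<^sup>+x\<in>E'. v x \<partial>lborel) + emeasure M E'"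
    proof (rule ennreal_le_epsilon)
      fix e :: real assume e: "0 < e"
      have "(INF U\<in>{U. E' \<subseteq> U \<and> open U}. emeasure M U) < emeasure M E' + ennreal e"
        unfolding outer[symmetric] using e finM[of E']
        by (cases "emeasure M E'") (auto simp: ennreal_less_iff simp flip: ennreal_plus)
      then obtain U where U: "E' \<subseteq> U" "open U" "emeasure M U < emeasure M E' + ennreal e"
        by (auto simp: INF_less_iff)
      have "(\<integral>\<^sup>+x\<in>E'. v x \<partial>lborel) + emeasure M U
          \<le> (\<integral>\<^sup>+x\<in>E'. v x \<partial>lborel) + emeasure M E' + ennreal e"
        using U(3) by (simp add: add.assoc add_left_mono less_imp_le)
      with key[OF U(1,2)] show "(\<integral>\<^sup>+x\<in>E'. u x \<partial>lborel) + emeasure M E'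
          \<le> (\<integral>\<^sup>+x\<in>E'. v x \<partial>lborel) + emeasure M E' + ennreal e"
        by (rule order_trans)
    qed
    then have le': "(\<integral>\<^sup>+x\<in>E'. u x \<partial>lborel) \<le> (\<integral>\<^sup>+x\<in>E'. v x \<partial>lborel)"
      using finM[of E'] by (simp add: ennreal_add_left_cancel_le add.commute)
    have fv: "(\<integral>\<^sup>+x\<in>E'. v x \<partial>lborel) \<noteq> \<infinity>"
    proof -
      have "(\<integral>\<^sup>+x\<in>E'. v x \<partial>lborel) \<le> (\<integral>\<^sup>+x\<in>B. (u x + v x) \<partial>lborel)"
        by (intro nn_integral_mono) (auto simp: indicator_def E'_def)
      with fin[of "real m"] show ?thesis by (auto simp: B_def top_unique)
    qed
    have "AE x in lborel. u x * indicator E' x \<le> v x * indicator E' x"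
    proof (rule ccontr)
      assume "\<not> ?thesis"
      then have "(\<integral>\<^sup>+x\<in>E'. v x \<partial>lborel) < (\<integral>\<^sup>+x\<in>E'. u x \<partial>lborel)"
        using fv by (intro nn_integral_less) (auto simp: indicator_def E'_def less_imp_le)
      with le' show False by simp
    qed
    then show ?thesis
    proof eventually_elim
      case (elim x)
      show ?case
      proof (intro impI, rule ccontr)
        assume "x \<in> E" "x \<in> ball 0 (real m)" "\<not> u x \<le> v x"
        then have "x \<in> E'" by (simp add: E'_def B_def)
        with elim \<open>\<not> u x \<le> v x\<close> show False by simp
      qed
    qed
  qed
  then have "AE x in lborel. \<forall>m::nat. x \<in> E \<longrightarrow> x \<in> ball 0 (real m) \<longrightarrow> u x \<le> v x"
    by (subst AE_all_countable) blast
  then show ?thesis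
  proof eventually_elim
    case (elim x)
    obtain m :: nat where "norm x < real m" using reals_Archimedean2 by blast
    with elim show ?case by (auto simp: dist_norm)
  qed
qed

section \<open>Powers of extended nonnegative numbers\<close>

lemma epowr_ennreal [simp]: "0 \<le> b \<Longrightarrow> epowr (ennreal b) p = ennreal (b powr p)"
  by (simp add: epowr_def)

lemma epowr_top [simp]: "epowr top p = top"
  by (simp add: epowr_def)

lemma epowr_0 [simp]: "epowr 0 p = 0"
  by (simp add: epowr_def)

lemma epowr_mono: "s \<le> t \<Longrightarrow> 0 \<le> p \<Longrightarrow> epowr s p \<le> epowr t p"
  by (cases s; cases t) (auto simp: powr_mono2 top_unique intro!: ennreal_leI)

lemma epowr_mult: "epowr (s * t) p = epowr s p * epowr t p"
proof (cases s; cases t)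
  fix a b :: real assume "s = ennreal a" "0 \<le> a" "t = ennreal b" "0 \<le> b"
  then show ?thesis
    by (simp add: powr_mult flip: ennreal_mult)
qed (auto simp: ennreal_mult_eq_top_iff ennreal_top_mult ennreal_mult_top zero_less_iff_neq_zero)

lemma epowr_epowr: "epowr (epowr t p) r = epowr t (p * r)"
  by (cases t) (auto simp: powr_powr)

lemma epowr_add: "epowr t (p + r) = epowr t p * epowr t r"
  by (cases t) (auto simp: powr_add simp flip: ennreal_mult)

lemma epowr_1 [simp]: "epowr t 1 = t"
  by (cases t) auto

lemma epowr_eq_0_iff: "epowr t p = 0 \<longleftrightarrow> t = 0"
  by (cases t) (auto simp: powr_eq_0_iff not_le  order.order_iff_strict)

lemma epowr_measurable [measurable]:
  assumes [measurable]: "f \<in> borel_measurable M"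
  shows "(\<lambda>x. epowr (f x) p) \<in> borel_measurable M"
  unfolding epowr_def by measurable

abbreviation layer :: "real \<Rightarrow> ennreal \<Rightarrow> real \<Rightarrow> ennreal" where
  "layer r t s \<equiv> (if 0 < s \<and> ennreal s < t then ennreal (r * s powr (r - 1)) else 0)"

lemma nn_integral_powr_interval:
  assumes "0 < r" "0 \<le> c"
  shows "(\<integral>\<^sup>+s. layer r (ennreal c) s \<partial>lborel) = ennreal (c powr r)"
proof -
  have "((\<lambda>s. r * s powr (r - 1)) has_integral (r * (c powr (r - 1 + 1) / (r - 1 + 1)))) {0..c}"
    using assms by (intro has_integral_mult_right has_integral_powr_from_0) auto
  then have "((\<lambda>s. r * s powr (r - 1)) has_integral c powr r) {0..c}"
    using assms by simp
  then have "((\<lambda>s. if s \<in> {0..c} then r * s powr (r - 1) else 0) has_integral c powr r) UNIV"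
    by (subst has_integral_restrict_UNIV)
  then have "(\<integral>\<^sup>+s. ennreal (if s \<in> {0..c} then r * s powr (r - 1) else 0) \<partial>lborel) = ennreal (c powr r)"
    using assms by (intro nn_integral_has_integral_lborel) auto
  moreover have "(\<integral>\<^sup>+s. ennreal (if s \<in> {0..c} then r * s powr (r - 1) else 0) \<partial>lborel)
      = (\<integral>\<^sup>+s. layer r (ennreal c) s \<partial>lborel)"
  proof (rule nn_integral_cong_AE)
    have "AE s in lborel. s \<notin> {c}"
      by (rule AE_not_in) (simp add: null_sets_def)
    then show "AE s in lborel. ennreal (if s \<in> {0..c} then r * s powr (r - 1) else 0) =
        layer r (ennreal c) s"
      by eventually_elim (auto simp: ennreal_less_iff order.order_iff_strict)
  qed
  ultimately show ?thesis by simp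
qed

text \<open>The layer cake formula for a power.\<close>

lemma epowr_layer:
  assumes "0 < r"
  shows "epowr t r = (\<integral>\<^sup>+s. layer r t s \<partial>lborel)"
proof (cases t)
  case (real c)
  then show ?thesis using nn_integral_powr_interval[OF assms, of c] by simp
next
  case top
  have "ennreal m \<le> (\<integral>\<^sup>+s. layer r t s \<partial>lborel)"
    if "0 \<le> m" for m
  proof -
    have "ennreal m = ennreal ((m powr (1/r)) powr r)"
      using that assms by (simp add: powr_powr)
    also have "\<dots> = (\<integral>\<^sup>+s. layer r (ennreal (m powr (1/r))) s \<partial>lborel)"
      by (rule nn_integral_powr_interval[symmetric]) (use assms in auto)
    also have "\<dots> \<le> (\<integral>\<^sup>+s. layer r t s \<partial>lborel)"
      using top by (intro nn_integral_mono) auto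
    finally show ?thesis .
  qed
  note ge = this
  have "(\<integral>\<^sup>+s. layer r t s \<partial>lborel) = top"
  proof (rule ccontr)
    assume "\<not> ?thesis"
    then obtain m where m: "0 \<le> m"
        "(\<integral>\<^sup>+s. layer r t s \<partial>lborel) = ennreal m"
      by (auto elim: ennreal_cases)
    from ge[of "m + 1"] m show False by simp
  qed
  then show ?thesis using top by simp
qed

section \<open>Dyadic maximal functions\<close>

definition davg :: "'a measure \<Rightarrow> 'a set \<Rightarrow> ('a \<Rightarrow> ennreal) \<Rightarrow> ennreal" where
  "davg \<mu> A f = (\<integral>\<^sup>+y\<in>A. f y \<partial>\<mu>) / emeasure \<mu> A"

definition dyadic_max :: "(real^'n::finite) measure \<Rightarrow> 'n set \<Rightarrow> (real^'n \<Rightarrow> ennreal) \<Rightarrow> real^'n \<Rightarrow> ennreal" where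
  "dyadic_max \<mu> T f x = (SUP k. davg \<mu> (dcube T k x) f)"

lemma dyadic_max_measurable [measurable]: "dyadic_max \<mu> T f \<in> borel_measurable borel"
  unfolding dyadic_max_def by (intro borel_measurable_SUP measurable_dcube_fun) auto

lemma less_divide_ennreal: 
  fixes a b c :: ennreal assumes "c < a / b" shows "c * b \<le> a"
proof (rule ccontr)
  assume "\<not> c * b \<le> a"
  then have "a \<le> c * b" by simp
  then have "a / b \<le> c * b / b" by (rule divide_right_mono_ennreal)
  moreover have "c * b / b \<le> c" if "b \<noteq> 0" using that
    by (cases "b = top") (auto simp: ennreal_mult_divide_eq)
  moreover have "b \<noteq> 0" using \<open>\<not> c * b \<le> a\<close> by auto
  ultimately show False using assms by simp
qed

text \<open>On the first cubes along each chain whose average exceeds \<open>c\<close>, the measure \<open>c \<mu>\<close> is at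
  most \<open>f \<mu>\<close>. Chains have no first cube unless the level is bounded below, hence the exhaustion
  by levels \<open>\<ge> - N\<close>.\<close>

lemma dyadic_max_weak:
  fixes \<mu> :: "(real^'n::finite) measure"
  assumes sets[measurable_cong]: "sets \<mu> = sets borel" and [measurable]: "f \<in> borel_measurable borel"
  shows "c * emeasure \<mu> {x. c < dyadic_max \<mu> T f x} \<le> (\<integral>\<^sup>+x. f x \<partial>\<mu>)"
proof -
  have sp: "space \<mu> = UNIV" using sets_eq_imp_space_eq[OF sets] by simp
  define O' where "O' N = {x. \<exists>k\<ge> - int N. c < davg \<mu> (dcube T k x) f}" for N :: nat
  have [measurable]: "O' N \<in> sets borel" for N
    unfolding O'_def by (rule stopping_set_borel)
  have "{x. c < dyadic_max \<mu> T f x} = (\<Union>N. O' N)"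
  proof -
    have "\<exists>N. - int N \<le> k" for k by (rule exI[of _ "nat (-k)"]) linarith
    then show ?thesis unfolding O'_def dyadic_max_def by (auto simp: less_SUP_iff) blast
  qed
  moreover have "incseq O'" unfolding O'_def incseq_def
    by clarsimp (meson int_ops(1) le_imp_neg_le order_trans zle_int)
  ultimately have "emeasure \<mu> {x. c < dyadic_max \<mu> T f x} = (SUP N. emeasure \<mu> (O' N))"
    by (subst SUP_emeasure_incseq) (auto simp: sets)
  then have "c * emeasure \<mu> {x. c < dyadic_max \<mu> T f x} = (SUP N. c * emeasure \<mu> (O' N))"
    by (simp add: SUP_mult_left_ennreal)
  also have "\<dots> \<le> (\<integral>\<^sup>+x. f x \<partial>\<mu>)"
  proof (rule SUP_least)
    fix N
    have "emeasure (density \<mu> (\<lambda>_. c)) (O' N) \<le> emeasure (density \<mu> f) (O' N)"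
      unfolding O'_def
    proof (rule stopping_cubes)
      fix x k assume "c < davg \<mu> (dcube T k x) f"
      from less_divide_ennreal[OF this[unfolded davg_def]]
      show "emeasure (density \<mu> (\<lambda>_. c)) (dcube T k x) \<le> emeasure (density \<mu> f) (dcube T k x)"
        by (simp add: emeasure_density sets nn_integral_cmult_indicator)
    qed (auto simp: sets)
    also have "\<dots> \<le> emeasure (density \<mu> f) UNIV"
      by (rule emeasure_mono) (auto simp: sets)
    finally show "c * emeasure \<mu> (O' N) \<le> (\<integral>\<^sup>+x. f x \<partial>\<mu>)"
      by (simp add: emeasure_density sets sp nn_integral_cmult_indicator)
  qed
  finally show ?thesis .
qed

text \<open>The constant depends on \<open>p\<close> only and not on the measure; this is what makes the argument
  for Muckenhoupt weights below work. The proof is Marcinkiewicz interpolation between the weak type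
  inequality and the trivial bound by the supremum: at level \<open>s\<close> the part of \<open>f\<close> below \<open>s/2\<close>
  contributes at most \<open>s/2\<close> to the maximal function.\<close>

lemma dyadic_max_strong:
  fixes \<mu> :: "(real^'n::finite) measure"
  assumes sets[measurable_cong]: "sets \<mu> = sets borel" and sf: "sigma_finite_measure \<mu>"
    and [measurable]: "f \<in> borel_measurable borel" and p: "1 < p"
  shows "(\<integral>\<^sup>+x. epowr (dyadic_max \<mu> T f x) p \<partial>\<mu>) \<le> ennreal (2 powr p * p / (p - 1)) * (\<integral>\<^sup>+x. epowr (f x) p \<partial>\<mu>)"
proof -
  have sp: "space \<mu> = UNIV" using sets_eq_imp_space_eq[OF sets] by simp
  interpret pair_sigma_finite \<mu> lborel
    using sf by (simp add: pair_sigma_finite_def lborel.sigma_finite_measure_axioms)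
  define f1 where "f1 s x = (if ennreal s < 2 * f x then f x else 0)" for s x
  have [measurable]: "f1 s \<in> borel_measurable borel" for s unfolding f1_def by measurable
  have M1: "dyadic_max \<mu> T f x \<le> dyadic_max \<mu> T (f1 s) x + ennreal (s / 2)" if s: "0 < s" for s x
    unfolding dyadic_max_def
  proof (rule SUP_least)
    fix k
    have "davg \<mu> (dcube T k x) f \<le> davg \<mu> (dcube T k x) (f1 s) + ennreal (s / 2)"
    proof -
      have s2: "f y \<le> ennreal (s / 2)" if "\<not> ennreal s < 2 * f y" for y
      proof -
        have "2 * f y \<le> 2 * ennreal (s / 2)" using that s 
          by (simp add: ennreal_mult[symmetric] ennreal_numeral[symmetric] del: ennreal_numeral)
        then show ?thesis by (simp add: ennreal_mult_le_mult_iff)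
      qed
      have "(\<integral>\<^sup>+y\<in>dcube T k x. f y \<partial>\<mu>) \<le> (\<integral>\<^sup>+y. f1 s y * indicator (dcube T k x) y + ennreal (s/2) * indicator (dcube T k x) y \<partial>\<mu>)"
        using s2 by (intro nn_integral_mono) (auto simp: indicator_def f1_def)
      also have "\<dots> = (\<integral>\<^sup>+y\<in>dcube T k x. f1 s y \<partial>\<mu>) + ennreal (s/2) * emeasure \<mu> (dcube T k x)"
        by (simp add: nn_integral_add nn_integral_cmult_indicator sets)
      finally have "davg \<mu> (dcube T k x) f \<le> ((\<integral>\<^sup>+y\<in>dcube T k x. f1 s y \<partial>\<mu>) + ennreal (s/2) * emeasure \<mu> (dcube T k x)) / emeasure \<mu> (dcube T k x)"
        unfolding davg_def by (rule divide_right_mono_ennreal)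
      also have "\<dots> \<le> davg \<mu> (dcube T k x) (f1 s) + ennreal (s/2)"
        unfolding davg_def add_divide_distrib_ennreal
      proof (rule add_left_mono)
        show "ennreal (s/2) * emeasure \<mu> (dcube T k x) / emeasure \<mu> (dcube T k x) \<le> ennreal (s/2)"
          by (cases "emeasure \<mu> (dcube T k x) = 0"; cases "emeasure \<mu> (dcube T k x) = top") (auto simp: ennreal_mult_divide_eq)
      qed
      finally show ?thesis .
    qed
    also have "\<dots> \<le> (SUP k. davg \<mu> (dcube T k x) (f1 s)) + ennreal (s / 2)"
      by (intro add_right_mono SUP_upper) auto
    finally show "davg \<mu> (dcube T k x) f \<le> (SUP k. davg \<mu> (dcube T k x) (f1 s)) + ennreal (s / 2)" .
  qed
  have weak: "ennreal (p * s powr (p - 1)) * emeasure \<mu> {x. ennreal s < dyadic_max \<mu> T f x}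
      \<le> ennreal (2 * p * s powr (p - 2)) * (\<integral>\<^sup>+x. f1 s x \<partial>\<mu>)" if s: "0 < s" for s
  proof -
    have sub: "{x. ennreal s < dyadic_max \<mu> T f x} \<subseteq> {x. ennreal (s/2) < dyadic_max \<mu> T (f1 s) x}"
    proof safe
      fix x assume "ennreal s < dyadic_max \<mu> T f x"
      also have "\<dots> \<le> dyadic_max \<mu> T (f1 s) x + ennreal (s / 2)" by (rule M1[OF s])
      finally have h: "ennreal s < dyadic_max \<mu> T (f1 s) x + ennreal (s / 2)" .
      show "ennreal (s/2) < dyadic_max \<mu> T (f1 s) x"
      proof (rule ccontr)
        assume "\<not> ?thesis"
        then have "dyadic_max \<mu> T (f1 s) x + ennreal (s / 2) \<le> ennreal (s/2) + ennreal (s/2)"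
          by (intro add_right_mono) auto
        also have "\<dots> = ennreal s" using s by (simp flip: ennreal_plus)
        finally show False using h by simp
      qed
    qed
    have "ennreal (p * s powr (p - 1)) * emeasure \<mu> {x. ennreal s < dyadic_max \<mu> T f x}
        \<le> ennreal (2 * p * s powr (p - 2)) * ennreal (s / 2) * emeasure \<mu> {x. ennreal (s/2) < dyadic_max \<mu> T (f1 s) x}"
    proof (rule mult_mono)
      have "s powr (p - 1) = s powr (p - 2) * s"
        using s powr_add[of s "p - 2" 1] by simp
      then show "ennreal (p * s powr (p - 1)) \<le> ennreal (2 * p * s powr (p - 2)) * ennreal (s / 2)"
        using s p by (simp flip: ennreal_mult)
      show "emeasure \<mu> {x. ennreal s < dyadic_max \<mu> T f x} \<le> emeasure \<mu> {x. ennreal (s/2) < dyadic_max \<mu> T (f1 s) x}"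
        by (rule emeasure_mono[OF sub]) (simp add: sets)
    qed auto
    also have "\<dots> \<le> ennreal (2 * p * s powr (p - 2)) * (\<integral>\<^sup>+x. f1 s x \<partial>\<mu>)"
      unfolding mult.assoc by (intro mult_left_mono dyadic_max_weak) (auto simp: sets)
    finally show ?thesis .
  qed
  have "(\<integral>\<^sup>+x. epowr (dyadic_max \<mu> T f x) p \<partial>\<mu>)
    = (\<integral>\<^sup>+x. \<integral>\<^sup>+s. layer p (dyadic_max \<mu> T f x) s \<partial>lborel \<partial>\<mu>)"
    using p by (simp add: epowr_layer)
  also have "\<dots> = (\<integral>\<^sup>+s. \<integral>\<^sup>+x. layer p (dyadic_max \<mu> T f x) s \<partial>\<mu> \<partial>lborel)"
    by (rule Fubini'[symmetric]) measurable
  also have "\<dots> \<le> (\<integral>\<^sup>+s. \<integral>\<^sup>+x. (if 0 < s \<and> ennreal s < 2 * f x then ennreal (2 * p * s powr (p - 2)) * f x else 0) \<partial>\<mu> \<partial>lborel)"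
  proof (rule nn_integral_mono)
    fix s :: real
    show "(\<integral>\<^sup>+x. layer p (dyadic_max \<mu> T f x) s \<partial>\<mu>)
      \<le> (\<integral>\<^sup>+x. (if 0 < s \<and> ennreal s < 2 * f x then ennreal (2 * p * s powr (p - 2)) * f x else 0) \<partial>\<mu>)"
    proof (cases "0 < s")
      case s: True
      have "(\<integral>\<^sup>+x. layer p (dyadic_max \<mu> T f x) s \<partial>\<mu>)
          = (\<integral>\<^sup>+x. ennreal (p * s powr (p - 1)) * indicator {x. ennreal s < dyadic_max \<mu> T f x} x \<partial>\<mu>)"
        using s by (intro nn_integral_cong) (auto simp: indicator_def)
      also have "\<dots> = ennreal (p * s powr (p - 1)) * emeasure \<mu> {x. ennreal s < dyadic_max \<mu> T f x}"
        by (rule nn_integral_cmult_indicator) (simp add: sets)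
      also have "\<dots> \<le> ennreal (2 * p * s powr (p - 2)) * (\<integral>\<^sup>+x. f1 s x \<partial>\<mu>)"
        by (rule weak[OF s])
      also have "\<dots> = (\<integral>\<^sup>+x. ennreal (2 * p * s powr (p - 2)) * f1 s x \<partial>\<mu>)"
        by (rule nn_integral_cmult[symmetric]) measurable
      also have "\<dots> = (\<integral>\<^sup>+x. (if 0 < s \<and> ennreal s < 2 * f x then ennreal (2 * p * s powr (p - 2)) * f x else 0) \<partial>\<mu>)"
        using s by (intro nn_integral_cong) (auto simp: f1_def)
      finally show ?thesis .
    qed simp
  qed
  also have "\<dots> = (\<integral>\<^sup>+x. \<integral>\<^sup>+s. (if 0 < s \<and> ennreal s < 2 * f x then ennreal (2 * p * s powr (p - 2)) * f x else 0) \<partial>lborel \<partial>\<mu>)"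
    by (rule Fubini') measurable
  also have "\<dots> = (\<integral>\<^sup>+x. ennreal (2 powr p * p / (p - 1)) * epowr (f x) p \<partial>\<mu>)"
  proof (rule nn_integral_cong)
    fix x
    have "(\<integral>\<^sup>+s. (if 0 < s \<and> ennreal s < 2 * f x then ennreal (2 * p * s powr (p - 2)) * f x else 0) \<partial>lborel)
      = (\<integral>\<^sup>+s. ennreal (2 * p / (p - 1)) * f x * layer (p - 1) (2 * f x) s \<partial>lborel)"
    proof (rule nn_integral_cong)
      fix s :: real
      have "ennreal (2 * p * s powr (p - 2)) = ennreal (2 * p / (p - 1)) * ennreal ((p - 1) * s powr (p - 1 - 1))"
        using p by (simp flip: ennreal_mult)
      then show "(if 0 < s \<and> ennreal s < 2 * f x then ennreal (2 * p * s powr (p - 2)) * f x else 0)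
        = ennreal (2 * p / (p - 1)) * f x * layer (p - 1) (2 * f x) s"
        by (simp add: ac_simps)
    qed
    also have "\<dots> = ennreal (2 * p / (p - 1)) * f x * epowr (2 * f x) (p - 1)"
      using p by (subst epowr_layer[of "p - 1"]) (auto intro!: nn_integral_cmult)
    also have "\<dots> = ennreal (2 * p / (p - 1)) * ennreal (2 powr (p - 1)) * (epowr (f x) 1 * epowr (f x) (p - 1))"
      by (simp add: epowr_mult ac_simps) (metis epowr_ennreal ennreal_numeral zero_le_numeral)
    also have "\<dots> = ennreal (2 powr p * p / (p - 1)) * epowr (f x) p"
    proof -
      have "2 powr p = 2 * 2 powr (p - 1)" using powr_add[of 2 "p - 1" 1] by simp
      then have "ennreal (2 * p / (p - 1)) * ennreal (2 powr (p - 1)) = ennreal (2 powr p * p / (p - 1))"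
        using p by (simp add: ac_simps flip: ennreal_mult)
      moreover have "epowr (f x) 1 * epowr (f x) (p - 1) = epowr (f x) p"
        unfolding epowr_add[symmetric] by simp
      ultimately show ?thesis by simp
    qed
    finally show "(\<integral>\<^sup>+s. (if 0 < s \<and> ennreal s < 2 * f x then ennreal (2 * p * s powr (p - 2)) * f x else 0) \<partial>lborel)
       = ennreal (2 powr p * p / (p - 1)) * epowr (f x) p" .
  qed
  also have "\<dots> = ennreal (2 powr p * p / (p - 1)) * (\<integral>\<^sup>+x. epowr (f x) p \<partial>\<mu>)"
    by (rule nn_integral_cmult) measurable
  finally show ?thesis .
qed

section \<open>Muckenhoupt's theorem for dyadic maximal functions\<close>

lemma ennreal_mult_inner: "(a::ennreal) * b = c \<Longrightarrow> a * (e * b * i) = c * (e * i)"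
  by (auto simp: ac_simps)

lemma ennreal_mult3: "0 \<le> a \<Longrightarrow> 0 \<le> b \<Longrightarrow> 0 \<le> c \<Longrightarrow>
    ennreal a * (ennreal b * (ennreal c * i)) = ennreal (a * b * c) * i"
  by (simp add: ennreal_mult mult.assoc)

lemma ennreal_divide_real: "0 < s \<Longrightarrow> (H::ennreal) / ennreal s = ennreal (1 / s) * H"
  by (simp add: divide_ennreal_def inverse_ennreal mult.commute inverse_eq_divide)

lemma dcube_measure_pos:
  fixes x :: "real^'n::finite"
  obtains L where "0 < L" "emeasure lborel (dcube T k x) = ennreal L" "L = (2 powi (-k)) ^ CARD('n)"
  by (metis emeasure_dcube zero_less_power zero_less_power_int zero_less_numeral)

lemma dcube_integral_pos:
  assumes [measurable]: "w \<in> borel_measurable borel" and w: "\<And>x. (0::real) < w x"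
  shows "0 < (\<integral>\<^sup>+y\<in>dcube T k (x :: real^'n::finite). ennreal (w y) \<partial>lborel)"
proof (rule ccontr)
  assume "\<not> ?thesis"
  then have "(\<integral>\<^sup>+y\<in>dcube T k x. ennreal (w y) \<partial>lborel) = 0" by simp
  then have "AE y in lborel. ennreal (w y) * indicator (dcube T k x) y = 0"
    by (subst (asm) nn_integral_0_iff_AE) auto
  then have "AE y in lborel. y \<notin> dcube T k x"
    by eventually_elim (use w in \<open>auto simp: indicator_def ennreal_eq_0_iff not_le[symmetric] split: if_splits\<close>)
  then have "emeasure lborel (dcube T k x) = 0"
    by (subst (asm) AE_iff_measurable[OF _ refl]) auto
  then show False
    using dcube_measure_pos[of T k x] by (metis ennreal_eq_0_iff not_le)
qed

text \<open>The Muckenhoupt condition on all cubes of all adjacent grids, with an explicit bound.\<close>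

definition dyadic_Ap :: "real \<Rightarrow> (real^'n::finite \<Rightarrow> real) \<Rightarrow> real \<Rightarrow> bool" where
  "dyadic_Ap p w A \<longleftrightarrow> (\<forall>T k x. davg lborel (dcube T k x) (\<lambda>y. ennreal (w y))
      * epowr (davg lborel (dcube T k x) (\<lambda>y. ennreal (w y powr (- 1 / (p - 1))))) (p - 1) \<le> ennreal A)"

text \<open>Both averages are positive because the weight is, so a finite product makes both finite and the
  condition becomes an inequality between real numbers.\<close>

lemma dyadic_ApE:
  fixes x :: "real^'n::finite"
  assumes "dyadic_Ap p w A" and [measurable]: "w \<in> borel_measurable borel" and w: "\<And>x. 0 < w x" and p: "1 < p"
  obtains W S L where "0 < W" "0 < S" "0 < L"
    "(\<integral>\<^sup>+y\<in>dcube T k x. ennreal (w y) \<partial>lborel) = ennreal W"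
    "(\<integral>\<^sup>+y\<in>dcube T k x. ennreal (w y powr (- 1 / (p - 1))) \<partial>lborel) = ennreal S"
    "emeasure lborel (dcube T k x) = ennreal L"
    "W / L * (S / L) powr (p - 1) \<le> A" "L = (2 powi (-k)) ^ CARD('n)" "0 < A"
proof -
  have Ap: "davg lborel (dcube T k x) (\<lambda>y. ennreal (w y))
      * epowr (davg lborel (dcube T k x) (\<lambda>y. ennreal (w y powr (- 1 / (p - 1))))) (p - 1) \<le> ennreal A"
    using assms(1) by (simp only: dyadic_Ap_def)
  obtain L where L: "0 < L" "emeasure lborel (dcube T k x) = ennreal L" "L = (2 powi (-k)) ^ CARD('n)"
    by (rule dcube_measure_pos)
  have Wp: "0 < (\<integral>\<^sup>+y\<in>dcube T k x. ennreal (w y) \<partial>lborel)"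
    by (rule dcube_integral_pos) (use w in auto)
  have Sp: "0 < (\<integral>\<^sup>+y\<in>dcube T k x. ennreal (w y powr (- 1 / (p - 1))) \<partial>lborel)"
    by (rule dcube_integral_pos) (use w in \<open>auto simp: less_imp_neq[symmetric]\<close>)
  have fin: "davg lborel (dcube T k x) (\<lambda>y. ennreal (w y))
      * epowr (davg lborel (dcube T k x) (\<lambda>y. ennreal (w y powr (- 1 / (p - 1))))) (p - 1) \<noteq> top"
    using Ap by (auto simp: top_unique)
  have "(\<integral>\<^sup>+y\<in>dcube T k x. ennreal (w y) \<partial>lborel) \<noteq> top"
    using fin Wp Sp L by (auto simp: davg_def ennreal_mult_eq_top_iff epowr_eq_0_iff ennreal_top_divide)
  then obtain W where W: "0 < W" "(\<integral>\<^sup>+y\<in>dcube T k x. ennreal (w y) \<partial>lborel) = ennreal W"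
    using Wp by (cases "(\<integral>\<^sup>+y\<in>dcube T k x. ennreal (w y) \<partial>lborel)") auto
  have "(\<integral>\<^sup>+y\<in>dcube T k x. ennreal (w y powr (- 1 / (p - 1))) \<partial>lborel) \<noteq> top"
    using fin Wp Sp L by (auto simp: davg_def ennreal_mult_eq_top_iff epowr_eq_0_iff ennreal_top_divide)
  then obtain S where S: "0 < S" "(\<integral>\<^sup>+y\<in>dcube T k x. ennreal (w y powr (- 1 / (p - 1))) \<partial>lborel) = ennreal S"
    using Sp by (cases "(\<integral>\<^sup>+y\<in>dcube T k x. ennreal (w y powr (- 1 / (p - 1))) \<partial>lborel)") auto
  have "ennreal (W / L * (S / L) powr (p - 1)) \<le> ennreal A"
    using Ap W S L by (simp add: davg_def divide_ennreal flip: ennreal_mult)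
  moreover have pos: "0 < W / L * (S / L) powr (p - 1)" using W S L by simp
  ultimately have "W / L * (S / L) powr (p - 1) \<le> A" "0 < A"
    by (smt (verit) ennreal_le_iff2)+
  with W S L that show ?thesis by blast
qed

text \<open>Muckenhoupt's theorem with Lerner's proof. Let \<open>\<sigma> = w powr (- 1 / (p - 1))\<close>. On a cube the
  average of \<open>h\<close> is its average of \<open>h / \<sigma>\<close> with respect to \<open>\<sigma>\<close> times \<open>\<sigma>(Q)/|Q|\<close>. The former is
  bounded by the \<open>\<sigma>\<close>-maximal function at every point of the cube, and a power of it can be averaged
  again with respect to \<open>w\<close>. The Muckenhoupt condition says precisely that the factors left over
  are bounded, so the maximal function is dominated pointwise by a composition of the maximal functions
  of the measures \<open>w\<close> and \<open>\<sigma>\<close>, which are bounded with constants that do not depend on the weight. So the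
  constant depends only on \<open>p\<close> and the Muckenhoupt bound.\<close>

lemma dyadic_max_Muckenhoupt:
  fixes w :: "real^'n::finite \<Rightarrow> real"
  assumes [measurable]: "w \<in> borel_measurable borel" and w: "\<And>x. 0 < w x" and p: "1 < p"
    and Ap: "dyadic_Ap p w A"
    and [measurable]: "h \<in> borel_measurable borel"
  shows "(\<integral>\<^sup>+x. epowr (dyadic_max lborel T h x) p * ennreal (w x) \<partial>lborel)
    \<le> ennreal (A powr (p / (p - 1)) * (2 powr (p / (p - 1)) * p) * (2 powr p * p / (p - 1)))
       * (\<integral>\<^sup>+x. epowr (h x) p * ennreal (w x) \<partial>lborel)"
proof -
  define \<sigma> where "\<sigma> x = w x powr (- 1 / (p - 1))" for x
  have \<sigma>: "0 < \<sigma> x" for x using w[of x] by (simp add: \<sigma>_def)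
  have [measurable]: "\<sigma> \<in> borel_measurable borel" unfolding \<sigma>_def by measurable
  define W where "W = density lborel (\<lambda>x. ennreal (w x))"
  define S where "S = density lborel (\<lambda>x. ennreal (\<sigma> x))"
  have sets [measurable_cong, simp]: "sets W = sets borel" "sets S = sets borel" by (auto simp: W_def S_def)
  have sf: "sigma_finite_measure W" "sigma_finite_measure S"
    unfolding W_def S_def by (subst sigma_finite_measure.sigma_finite_iff_density_finite[OF lborel.sigma_finite_measure_axioms]; simp)+
  have Wint: "(\<integral>\<^sup>+x. g x \<partial>W) = (\<integral>\<^sup>+x. ennreal (w x) * g x \<partial>lborel)"
    and Sint: "(\<integral>\<^sup>+x. g x \<partial>S) = (\<integral>\<^sup>+x. ennreal (\<sigma> x) * g x \<partial>lborel)"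
    if [measurable]: "g \<in> borel_measurable borel" for g
    unfolding W_def S_def by (subst nn_integral_density; simp)+
  define h' where "h' x = h x * ennreal (1 / \<sigma> x)" for x
  have [measurable]: "h' \<in> borel_measurable borel" unfolding h'_def by measurable
  define \<kappa> where "\<kappa> x = epowr (dyadic_max S T h' x) (p - 1) * ennreal (1 / w x)" for x
  have [measurable]: "\<kappa> \<in> borel_measurable borel" unfolding \<kappa>_def by measurable
  define r where "r = 1 / (p - 1)"
  have r: "0 < r" using p by (simp add: r_def)
  have pt: "dyadic_max lborel T h x \<le> ennreal (A powr r) * epowr (dyadic_max W T \<kappa> x) r" for x
    unfolding dyadic_max_def[of lborel]
  proof (rule SUP_least)
    fix k
    let ?Q = "dcube T k x"
    obtain W0 S0 L where c: "0 < W0" "0 < S0" "0 < L"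
      "(\<integral>\<^sup>+y\<in>?Q. ennreal (w y) \<partial>lborel) = ennreal W0"
      "(\<integral>\<^sup>+y\<in>?Q. ennreal (w y powr (- 1 / (p - 1))) \<partial>lborel) = ennreal S0"
      "emeasure lborel ?Q = ennreal L"
      "W0 / L * (S0 / L) powr (p - 1) \<le> A" "0 < A"
      by (rule dyadic_ApE[OF Ap assms(1) w p, of T k x]) 
    have WQ: "emeasure W ?Q = ennreal W0" and SQ: "emeasure S ?Q = ennreal S0"
      using c by (simp_all add: W_def S_def emeasure_density \<sigma>_def)
    define H where "H = (\<integral>\<^sup>+y\<in>?Q. h y \<partial>lborel)"
    have H': "(\<integral>\<^sup>+y\<in>?Q. h' y \<partial>S) = H"
      unfolding S_def H_def
    proof (subst nn_integral_density, measurable, intro nn_integral_cong)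
      fix y
      have "ennreal (\<sigma> y) * ennreal (1 / \<sigma> y) = 1" using \<sigma>[of y] by (simp flip: ennreal_mult)
      then show "ennreal (\<sigma> y) * (h' y * indicator ?Q y) = h y * indicator ?Q y"
        unfolding h'_def by (subst ennreal_mult_inner) auto
    qed
    have MS: "H / ennreal S0 \<le> dyadic_max S T h' y" if "y \<in> ?Q" for y
    proof -
      have "H / ennreal S0 = davg S (dcube T k y) h'"
        using dcube_eq[OF that] H' SQ by (simp add: davg_def)
      also have "\<dots> \<le> dyadic_max S T h' y" unfolding dyadic_max_def by (rule SUP_upper) auto
      finally show ?thesis .
    qed
    have "ennreal L * epowr (H / ennreal S0) (p - 1) = (\<integral>\<^sup>+y. epowr (H / ennreal S0) (p - 1) * indicator ?Q y \<partial>lborel)"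
      using c(6) by (subst nn_integral_cmult_indicator) (auto simp: mult.commute)
    also have "\<dots> \<le> (\<integral>\<^sup>+y\<in>?Q. epowr (dyadic_max S T h' y) (p - 1) \<partial>lborel)"
      using MS p by (intro nn_integral_mono) (auto simp: indicator_def intro: epowr_mono)
    also have "\<dots> = (\<integral>\<^sup>+y\<in>?Q. \<kappa> y \<partial>W)"
      unfolding W_def
    proof (subst nn_integral_density, measurable, intro nn_integral_cong)
      fix y
      have "ennreal (w y) * ennreal (1 / w y) = 1" using w[of y] by (simp flip: ennreal_mult)
      then show "epowr (dyadic_max S T h' y) (p - 1) * indicator ?Q y = ennreal (w y) * (\<kappa> y * indicator ?Q y)"
        unfolding \<kappa>_def by (subst ennreal_mult_inner) auto
    qed
    finally have "ennreal L * epowr (H / ennreal S0) (p - 1) / ennreal W0 \<le> davg W ?Q \<kappa>"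
      unfolding davg_def WQ by (rule divide_right_mono_ennreal)
    also have "\<dots> \<le> dyadic_max W T \<kappa> x" unfolding dyadic_max_def by (rule SUP_upper) auto
    finally have "epowr (ennreal L * epowr (H / ennreal S0) (p - 1) / ennreal W0) r \<le> epowr (dyadic_max W T \<kappa> x) r"
      using r by (intro epowr_mono) auto
    also have "epowr (ennreal L * epowr (H / ennreal S0) (p - 1) / ennreal W0) r
        = ennreal ((L / W0) powr r / S0) * H"
    proof -
      have "ennreal L * epowr (H / ennreal S0) (p - 1) / ennreal W0 = ennreal (1 / W0) * ennreal L * epowr (H / ennreal S0) (p - 1)"
        unfolding ennreal_divide_real[OF c(1)] by (simp add: mult.assoc)
      also have "ennreal (1 / W0) * ennreal L = ennreal (L / W0)"
        using c by (simp flip: ennreal_mult)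
      finally have "ennreal L * epowr (H / ennreal S0) (p - 1) / ennreal W0 = ennreal (L / W0) * epowr (H / ennreal S0) (p - 1)" .
      then have "epowr (ennreal L * epowr (H / ennreal S0) (p - 1) / ennreal W0) r
          = ennreal ((L / W0) powr r) * epowr (H / ennreal S0) ((p - 1) * r)"
        using c by (simp add: epowr_mult epowr_epowr)
      also have "epowr (H / ennreal S0) ((p - 1) * r) = ennreal (1 / S0) * H"
        using p ennreal_divide_real[OF c(2), of H] by (simp add: r_def)
      finally show ?thesis
        using c by (simp add: mult.assoc[symmetric] flip: ennreal_mult)
    qed
    finally have le: "ennreal ((L / W0) powr r / S0) * H \<le> epowr (dyadic_max W T \<kappa> x) r" .
    have re: "1 / L \<le> A powr r * ((L / W0) powr r / S0)"
    proof -
      have "(W0 / L * (S0 / L) powr (p - 1)) powr r \<le> A powr r"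
        using c r by (intro powr_mono2) auto
      also have "(W0 / L * (S0 / L) powr (p - 1)) powr r = (W0 / L) powr r * (S0 / L)"
        unfolding powr_mult[of "W0 / L"] using c p by (simp add: powr_powr r_def)
      finally have "(W0 / L) powr r * (S0 / L) * ((L / W0) powr r / S0) \<le> A powr r * ((L / W0) powr r / S0)"
        using c by (intro mult_right_mono) auto
      moreover have "(W0 / L) powr r * (L / W0) powr r = 1"
        using c by (simp flip: powr_mult)
      then have "(W0 / L) powr r * (S0 / L) * ((L / W0) powr r / S0) = 1 / L"
        using c by (simp add: field_simps)
      ultimately show ?thesis by simp
    qed
    have "davg lborel ?Q h = ennreal (1 / L) * H"
      unfolding davg_def H_def[symmetric] c(6) by (rule ennreal_divide_real[OF c(3)])
    also have "\<dots> \<le> ennreal (A powr r * ((L / W0) powr r / S0)) * H"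
      using re by (intro mult_right_mono ennreal_leI) auto
    also have "\<dots> = ennreal (A powr r) * (ennreal ((L / W0) powr r / S0) * H)"
      using c by (subst ennreal_mult) (auto simp: mult.assoc)
    also have "\<dots> \<le> ennreal (A powr r) * epowr (dyadic_max W T \<kappa> x) r"
      by (intro mult_left_mono le) auto
    finally show "davg lborel ?Q h \<le> ennreal (A powr r) * epowr (dyadic_max W T \<kappa> x) r" .
  qed
  have rp: "r * p = p / (p - 1)" "1 < r * p" using p by (auto simp: r_def field_simps)
  have "(\<integral>\<^sup>+x. epowr (dyadic_max lborel T h x) p * ennreal (w x) \<partial>lborel)
      \<le> (\<integral>\<^sup>+x. ennreal (A powr (r * p)) * epowr (dyadic_max W T \<kappa> x) (r * p) * ennreal (w x) \<partial>lborel)"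
  proof (intro nn_integral_mono mult_right_mono)
    fix x
    have "epowr (dyadic_max lborel T h x) p \<le> epowr (ennreal (A powr r) * epowr (dyadic_max W T \<kappa> x) r) p"
      using p by (intro epowr_mono pt) auto
    then show "epowr (dyadic_max lborel T h x) p \<le> ennreal (A powr (r * p)) * epowr (dyadic_max W T \<kappa> x) (r * p)"
      by (simp add: epowr_mult epowr_epowr powr_powr)
  qed auto
  also have "\<dots> = ennreal (A powr (r * p)) * (\<integral>\<^sup>+x. epowr (dyadic_max W T \<kappa> x) (r * p) \<partial>W)"
    unfolding W_def[symmetric] mult.assoc
    by (subst nn_integral_cmult) (auto simp: W_def nn_integral_density mult.commute)
  also have "\<dots> \<le> ennreal (A powr (r * p)) * (ennreal (2 powr (r * p) * (r * p) / (r * p - 1)) * (\<integral>\<^sup>+x. epowr (\<kappa> x) (r * p) \<partial>W))"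
    by (intro mult_left_mono dyadic_max_strong sf rp) auto
  also have "(\<integral>\<^sup>+x. epowr (\<kappa> x) (r * p) \<partial>W) = (\<integral>\<^sup>+x. epowr (dyadic_max S T h' x) p \<partial>S)"
  proof (subst Wint, measurable, subst Sint, measurable, intro nn_integral_cong)
    fix x
    have "w x * (1 / w x) powr (r * p) = \<sigma> x"
    proof -
      have "w x * (1 / w x) powr (r * p) = w x powr 1 * w x powr (- (r * p))"
        using w[of x] by (simp add: powr_divide powr_minus field_simps)
      also have "\<dots> = w x powr (1 - r * p)"
        using powr_add[of "w x" 1 "- (r * p)"] by simp
      also have "1 - r * p = - 1 / (p - 1)"
        using p by (simp add: r_def field_simps)
      finally show ?thesis by (simp add: \<sigma>_def)
    qed
    then have e: "ennreal (w x) * ennreal ((1 / w x) powr (r * p)) = ennreal (\<sigma> x)"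
      using w[of x] by (simp flip: ennreal_mult)
    have pp: "(p - 1) * (r * p) = p" using p by (simp add: r_def)
    have "epowr (\<kappa> x) (r * p) = epowr (dyadic_max S T h' x) p * ennreal ((1 / w x) powr (r * p))"
      using w[of x] unfolding \<kappa>_def epowr_mult epowr_epowr pp by simp
    then show "ennreal (w x) * epowr (\<kappa> x) (r * p) = ennreal (\<sigma> x) * epowr (dyadic_max S T h' x) p"
      using ennreal_mult_inner[OF e, of "epowr (dyadic_max S T h' x) p" 1] by simp
  qed
  also have "(\<integral>\<^sup>+x. epowr (dyadic_max S T h' x) p \<partial>S) \<le> ennreal (2 powr p * p / (p - 1)) * (\<integral>\<^sup>+x. epowr (h' x) p \<partial>S)"
    by (intro dyadic_max_strong sf p) auto
  also have "(\<integral>\<^sup>+x. epowr (h' x) p \<partial>S) = (\<integral>\<^sup>+x. epowr (h x) p * ennreal (w x) \<partial>lborel)"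
  proof (subst Sint, measurable, intro nn_integral_cong)
    fix x
    have "\<sigma> x * (1 / \<sigma> x) powr p = w x"
    proof -
      have "\<sigma> x * (1 / \<sigma> x) powr p = \<sigma> x powr 1 * \<sigma> x powr (- p)"
        using \<sigma>[of x] by (simp add: powr_divide powr_minus field_simps)
      also have "\<dots> = \<sigma> x powr (1 - p)"
        using powr_add[of "\<sigma> x" 1 "- p"] by simp
      also have "\<dots> = w x powr (- 1 / (p - 1) * (1 - p))"
        by (simp add: \<sigma>_def powr_powr)
      also have "- 1 / (p - 1) * (1 - p) = 1"
        using p by (simp add: divide_simps)
      also have "w x powr 1 = w x" using w[of x] by simp
      finally show ?thesis .
    qed
    then have e: "ennreal (\<sigma> x) * ennreal ((1 / \<sigma> x) powr p) = ennreal (w x)"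
      using \<sigma>[of x] by (simp flip: ennreal_mult)
    have "epowr (h' x) p = epowr (h x) p * ennreal ((1 / \<sigma> x) powr p)"
      using \<sigma>[of x] unfolding h'_def by (simp add: epowr_mult)
    then show "ennreal (\<sigma> x) * epowr (h' x) p = epowr (h x) p * ennreal (w x)"
      using ennreal_mult_inner[OF e, of "epowr (h x) p" 1] by (simp add: mult.commute)
  qed
  finally have "(\<integral>\<^sup>+x. epowr (dyadic_max lborel T h x) p * ennreal (w x) \<partial>lborel) \<le>
     ennreal (A powr (r * p)) * (ennreal (2 powr (r * p) * (r * p) / (r * p - 1)) *
       (ennreal (2 powr p * p / (p - 1)) * (\<integral>\<^sup>+x. epowr (h x) p * ennreal (w x) \<partial>lborel)))"
    by (simp add: mult_left_mono)
  also have "\<dots> = ennreal (A powr (r * p) * (2 powr (r * p) * (r * p) / (r * p - 1)) * (2 powr p * p / (p - 1)))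
       * (\<integral>\<^sup>+x. epowr (h x) p * ennreal (w x) \<partial>lborel)"
    using p rp by (intro ennreal_mult3) auto
  also have "(r * p) / (r * p - 1) = p"
    using p by (simp add: r_def field_simps)
  then have "2 powr (r * p) * (r * p) / (r * p - 1) = 2 powr (r * p) * p"
    by (metis times_divide_eq_right)
  finally show ?thesis unfolding rp(1) .
qed

section \<open>The reverse Hoelder inequality\<close>

lemma davg_leD:
  fixes x :: "real^'n::finite"
  assumes "davg lborel (dcube T k x) f \<le> c"
  shows "(\<integral>\<^sup>+y\<in>dcube T k x. f y \<partial>lborel) \<le> c * emeasure lborel (dcube T k x)"
proof -
  obtain L where L: "0 < L" "emeasure lborel (dcube T k x) = ennreal L"
    by (rule dcube_measure_pos)
  have "(\<integral>\<^sup>+y\<in>dcube T k x. f y \<partial>lborel) = davg lborel (dcube T k x) f * ennreal L"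
    using L by (simp add: davg_def ennreal_divide_times)
  also have "\<dots> \<le> c * ennreal L" by (intro mult_right_mono assms) simp
  finally show ?thesis using L by simp
qed

lemma emeasure_dcube_parent:
  "emeasure lborel (dcube T (k - 1) (x :: real^'n::finite)) = ennreal (2 ^ CARD('n)) * emeasure lborel (dcube T k x)"
proof -
  have "(2::real) powi (- (k - 1)) = 2 * 2 powi (-k)"
    using power_int_add[of "2::real" 1 "-k"] by (simp add: algebra_simps)
  then show ?thesis
    by (simp add: emeasure_dcube power_mult_distrib ennreal_mult)
qed

lemma ennreal_other_half:
  fixes b c :: ennreal
  assumes "ennreal l = b + c" "2 * b \<le> ennreal l" shows "ennreal l \<le> 2 * c"
proof -
  have "ennreal l + ennreal l = 2 * b + 2 * c"
    unfolding assms(1) mult_2 by (simp only: ac_simps)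
  also have "\<dots> \<le> ennreal l + 2 * c"
    by (intro add_right_mono assms)
  finally show ?thesis
    by (subst (asm) ennreal_add_left_cancel_le) simp
qed

text \<open>Stop at the first cubes on which the average of \<open>w\<close> exceeds \<open>s\<close>. Their parents have average
  at most \<open>s\<close>, so \<open>\<integral> w \<le> 2 ^ n * s * |Q|\<close> on a stopping cube; and by hypothesis \<open>w\<close> exceeds \<open>\<gamma> * s\<close>
  on at least half of it. Outside the stopping cubes \<open>w \<le> s\<close> by differentiation.\<close>

lemma reverse_Holder_level:
  fixes w :: "real^'n::finite \<Rightarrow> real"
  assumes [measurable]: "w \<in> borel_measurable borel" and w: "\<And>x. 0 < w x"
    and half: "\<And>k x W L. 0 < W \<Longrightarrow> 0 < L \<Longrightarrow> (\<integral>\<^sup>+y\<in>dcube T k x. ennreal (w y) \<partial>lborel) = ennreal W \<Longrightarrow>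
      emeasure lborel (dcube T k x) = ennreal L \<Longrightarrow>
      2 * emeasure lborel {y\<in>dcube T k x. w y \<le> \<gamma> * (W / L)} \<le> ennreal L"
    and fin: "\<And>k x. (\<integral>\<^sup>+y\<in>dcube T k x. ennreal (w y) \<partial>lborel) \<noteq> top"
    and \<gamma>: "0 < \<gamma>"
    and WL: "0 < W" "0 < L" "(\<integral>\<^sup>+y\<in>dcube T k0 x0. ennreal (w y) \<partial>lborel) = ennreal W"
      "emeasure lborel (dcube T k0 x0) = ennreal L"
    and s: "W / L \<le> s"
  shows "(\<integral>\<^sup>+y\<in>{y\<in>dcube T k0 x0. s < w y}. ennreal (w y) \<partial>lborel)
    \<le> ennreal (2 ^ (CARD('n) + 1) * s) * emeasure lborel {y\<in>dcube T k0 x0. \<gamma> * s < w y}"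
proof -
  define Q0 where "Q0 = dcube T k0 x0"
  have [measurable]: "Q0 \<in> sets borel" by (simp add: Q0_def)
  have s0: "0 < s" using s WL by (smt (verit) divide_pos_pos)
  define P where "P A \<longleftrightarrow> A \<subseteq> Q0 \<and> ennreal s < davg lborel A (\<lambda>y. ennreal (w y))" for A
  define O' where "O' = {x. \<exists>k\<ge>k0. P (dcube T k x)}"
  have [measurable]: "O' \<in> sets borel" unfolding O'_def by (rule stopping_set_borel)
  have OQ: "O' \<subseteq> Q0" unfolding O'_def P_def using dcube_self by blast
  have inQ0: "dcube T k x \<subseteq> Q0" if "x \<in> Q0" "k0 \<le> k" for k x
    using dcube_mono[OF that(2), of T x] dcube_eq[of x T k0 x0] that unfolding Q0_def by simp
  have "emeasure (density lborel (\<lambda>y. ennreal (w y))) O' \<le> emeasure (density lborel (\<lambda>_. ennreal (2 ^ CARD('n) * s))) O'"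
    unfolding O'_def
  proof (rule stopping_cubes)
    fix x k assume k: "k0 \<le> k" "P (dcube T k x)" "\<And>j. k0 \<le> j \<Longrightarrow> j < k \<Longrightarrow> \<not> P (dcube T j x)"
    have xQ: "x \<in> Q0" using k(2) dcube_self unfolding P_def by blast
    have "k \<noteq> k0"
    proof
      assume "k = k0"
      then have "dcube T k x = dcube T k0 x0" using xQ dcube_eq unfolding Q0_def by metis
      then have "davg lborel (dcube T k x) (\<lambda>y. ennreal (w y)) = ennreal (W / L)"
        using WL by (simp add: davg_def divide_ennreal)
      with k(2) ennreal_leI[OF s] show False by (simp add: P_def not_le[symmetric])
    qed
    then have "\<not> P (dcube T (k - 1) x)" using k(1,3) by simp
    then have "davg lborel (dcube T (k - 1) x) (\<lambda>y. ennreal (w y)) \<le> ennreal s"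
      using inQ0[OF xQ, of "k - 1"] k(1) \<open>k \<noteq> k0\<close> by (simp add: P_def)
    from davg_leD[OF this] have "(\<integral>\<^sup>+y\<in>dcube T (k - 1) x. ennreal (w y) \<partial>lborel)
        \<le> ennreal s * (ennreal (2 ^ CARD('n)) * emeasure lborel (dcube T k x))"
      unfolding emeasure_dcube_parent .
    moreover have "(\<integral>\<^sup>+y\<in>dcube T k x. ennreal (w y) \<partial>lborel) \<le> (\<integral>\<^sup>+y\<in>dcube T (k - 1) x. ennreal (w y) \<partial>lborel)"
      using dcube_mono[of "k - 1" k T x] by (intro nn_integral_mono) (auto simp: indicator_def)
    ultimately have "(\<integral>\<^sup>+y\<in>dcube T k x. ennreal (w y) \<partial>lborel) \<le> ennreal (2 ^ CARD('n) * s) * emeasure lborel (dcube T k x)"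
      using s0 by (simp add: ennreal_mult ac_simps)
    then show "emeasure (density lborel (\<lambda>y. ennreal (w y))) (dcube T k x)
        \<le> emeasure (density lborel (\<lambda>_. ennreal (2 ^ CARD('n) * s))) (dcube T k x)"
      by (simp add: emeasure_density nn_integral_cmult_indicator)
  qed auto
  then have 1: "(\<integral>\<^sup>+y\<in>O'. ennreal (w y) \<partial>lborel) \<le> ennreal (2 ^ CARD('n) * s) * emeasure lborel O'"
    by (simp add: emeasure_density nn_integral_cmult_indicator)
  have "emeasure lborel O' \<le> emeasure (density lborel (\<lambda>y. 2 * indicator {y. \<gamma> * s < w y} y)) O'"
    unfolding O'_def
  proof (rule stopping_cubes)
    fix x k assume k: "k0 \<le> k" "P (dcube T k x)"
    define A where "A = dcube T k x"
    have [measurable]: "A \<in> sets borel" by (simp add: A_def)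
    obtain L' where L': "0 < L'" "emeasure lborel A = ennreal L'"
      unfolding A_def by (rule dcube_measure_pos)
    have "0 < (\<integral>\<^sup>+y\<in>A. ennreal (w y) \<partial>lborel)"
      unfolding A_def by (rule dcube_integral_pos) (use w in auto)
    then obtain W' where W': "0 < W'" "(\<integral>\<^sup>+y\<in>A. ennreal (w y) \<partial>lborel) = ennreal W'"
      using fin[where k=k and x=x] unfolding A_def
      by (cases "\<integral>\<^sup>+y\<in>dcube T k x. ennreal (w y) \<partial>lborel") auto
    have "ennreal s < ennreal (W' / L')"
      using k(2) W' L' unfolding P_def A_def[symmetric] davg_def by (simp add: divide_ennreal)
    then have m: "s < W' / L'" using s0 by (simp add: ennreal_less_iff)
    have h: "2 * emeasure lborel {y\<in>A. w y \<le> \<gamma> * (W' / L')} \<le> ennreal L'"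
      unfolding A_def by (rule half) (use W' L' in \<open>auto simp: A_def\<close>)
    have "ennreal L' = emeasure lborel ({y\<in>A. w y \<le> \<gamma> * (W' / L')} \<union> {y\<in>A. \<gamma> * (W' / L') < w y})"
      unfolding L'(2)[symmetric] by (rule arg_cong[where f="emeasure lborel"]) auto
    also have "\<dots> = emeasure lborel {y\<in>A. w y \<le> \<gamma> * (W' / L')} + emeasure lborel {y\<in>A. \<gamma> * (W' / L') < w y}"
      by (rule plus_emeasure[symmetric]) auto
    finally have "ennreal L' \<le> 2 * emeasure lborel {y\<in>A. \<gamma> * (W' / L') < w y}"
      using h by (rule ennreal_other_half)
    also have "\<dots> \<le> 2 * emeasure lborel {y\<in>A. \<gamma> * s < w y}"
    proof (intro mult_left_mono emeasure_mono)
      have "\<gamma> * s \<le> \<gamma> * (W' / L')" using m \<gamma> by (intro mult_left_mono) auto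
      then show "{y\<in>A. \<gamma> * (W' / L') < w y} \<subseteq> {y\<in>A. \<gamma> * s < w y}" by auto
    qed auto
    also have "\<dots> = (\<integral>\<^sup>+y. 2 * indicator {y\<in>A. \<gamma> * s < w y} y \<partial>lborel)"
      by (subst nn_integral_cmult_indicator) auto
    also have "\<dots> = emeasure (density lborel (\<lambda>y. 2 * indicator {y. \<gamma> * s < w y} y)) A"
      by (subst emeasure_density) (auto intro!: nn_integral_cong simp: indicator_def)
    finally show "emeasure lborel (dcube T k x) \<le> emeasure (density lborel (\<lambda>y. 2 * indicator {y. \<gamma> * s < w y} y)) (dcube T k x)"
      using L' by (simp add: A_def)
  qed auto
  also have "\<dots> \<le> (\<integral>\<^sup>+y. 2 * indicator {y\<in>Q0. \<gamma> * s < w y} y \<partial>lborel)"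
    using OQ by (subst emeasure_density) (auto intro!: nn_integral_mono simp: indicator_def)
  also have "\<dots> = 2 * emeasure lborel {y\<in>Q0. \<gamma> * s < w y}"
    by (subst nn_integral_cmult_indicator) auto
  finally have 2: "emeasure lborel O' \<le> 2 * emeasure lborel {y\<in>Q0. \<gamma> * s < w y}" .
  have 3: "AE y in lborel. y \<in> Q0 - O' \<longrightarrow> ennreal (w y) * indicator Q0 y \<le> ennreal s"
  proof (rule AE_le_of_cubes)
    fix R :: real
    have [measurable]: "ball (0::real^'n) R \<in> sets borel" by simp
    have "(\<integral>\<^sup>+y\<in>ball 0 R. (ennreal (w y) * indicator Q0 y + ennreal s) \<partial>lborel)
      \<le> (\<integral>\<^sup>+y. ennreal (w y) * indicator Q0 y + ennreal s * indicator (ball 0 R) y \<partial>lborel)"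
      by (intro nn_integral_mono) (auto simp: indicator_def)
    also have "\<dots> = ennreal W + ennreal s * emeasure lborel (ball (0::real^'n) R)"
      by (subst nn_integral_add) (auto simp: Q0_def nn_integral_cmult_indicator WL(3))
    also have "\<dots> < \<infinity>"
      using emeasure_bounded_finite[of "ball (0::real^'n) R"] by (simp add: ennreal_mult_less_top)
    finally show "(\<integral>\<^sup>+y\<in>ball 0 R. (ennreal (w y) * indicator Q0 y + ennreal s) \<partial>lborel) < \<infinity>" .
  next
    fix x k assume x: "x \<in> Q0 - O'" "k0 \<le> k"
    then have "\<not> P (dcube T k x)" by (auto simp: O'_def)
    then have "davg lborel (dcube T k x) (\<lambda>y. ennreal (w y)) \<le> ennreal s"
      using inQ0[of x k] x by (simp add: P_def)
    have "(\<integral>\<^sup>+y\<in>dcube T k x. (ennreal (w y) * indicator Q0 y) \<partial>lborel) \<le> (\<integral>\<^sup>+y\<in>dcube T k x. ennreal (w y) \<partial>lborel)"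
      by (intro nn_integral_mono) (auto simp: indicator_def)
    also have "\<dots> \<le> ennreal s * emeasure lborel (dcube T k x)"
      by (rule davg_leD) fact
    also have "\<dots> = (\<integral>\<^sup>+y\<in>dcube T k x. ennreal s \<partial>lborel)"
      by (simp add: nn_integral_cmult_indicator)
    finally show "(\<integral>\<^sup>+y\<in>dcube T k x. (ennreal (w y) * indicator Q0 y) \<partial>lborel) \<le> (\<integral>\<^sup>+y\<in>dcube T k x. ennreal s \<partial>lborel)" .
  qed auto
  have "(\<integral>\<^sup>+y\<in>{y\<in>Q0. s < w y}. ennreal (w y) \<partial>lborel) \<le> (\<integral>\<^sup>+y\<in>O'. ennreal (w y) \<partial>lborel)"
    using 3 by (intro nn_integral_mono_AE, eventually_elim) (use s0 in \<open>auto simp: indicator_def\<close>)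
  also have "\<dots> \<le> ennreal (2 ^ CARD('n) * s) * (2 * emeasure lborel {y\<in>Q0. \<gamma> * s < w y})"
    by (rule order_trans[OF 1]) (intro mult_left_mono 2, simp)
  also have "\<dots> = ennreal (2 ^ (CARD('n) + 1) * s) * emeasure lborel {y\<in>Q0. \<gamma> * s < w y}"
  proof -
    have "ennreal (2 ^ (CARD('n) + 1) * s) = ennreal (2 ^ CARD('n) * s) * 2"
      using s0 by (subst ennreal_numeral[symmetric], subst ennreal_mult[symmetric]) auto
    then show ?thesis by (simp add: mult.assoc)
  qed
  finally show ?thesis by (simp add: Q0_def)
qed

text \<open>Integrate the level estimate against \<open>\<eta> * s powr (\<eta> - 1)\<close> over \<open>s\<close> above the mean of \<open>w\<close>. The
  right-hand side becomes \<open>O(\<eta>)\<close> times the integral to be estimated and is absorbed for small \<open>\<eta>\<close>;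
  the exponent chosen here makes the factor \<open>1/2\<close>. Absorption requires that integral to be finite, so
  \<open>w\<close> is first truncated at height \<open>N\<close>.\<close>

lemma reverse_Holder:
  fixes w :: "real^'n::finite \<Rightarrow> real"
  assumes [measurable]: "w \<in> borel_measurable borel" and w: "\<And>x. 0 < w x"
    and half: "\<And>k x W L. 0 < W \<Longrightarrow> 0 < L \<Longrightarrow> (\<integral>\<^sup>+y\<in>dcube T k x. ennreal (w y) \<partial>lborel) = ennreal W \<Longrightarrow>
      emeasure lborel (dcube T k x) = ennreal L \<Longrightarrow>
      2 * emeasure lborel {y\<in>dcube T k x. w y \<le> \<gamma> * (W / L)} \<le> ennreal L"
    and fin: "\<And>k x. (\<integral>\<^sup>+y\<in>dcube T k x. ennreal (w y) \<partial>lborel) \<noteq> top"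
    and \<gamma>: "0 < \<gamma>" "\<gamma> \<le> 1" and \<eta>: "\<eta> = \<gamma>\<^sup>2 / 2 ^ (CARD('n) + 2)"
    and WL: "0 < W" "0 < L" "(\<integral>\<^sup>+y\<in>dcube T k0 x0. ennreal (w y) \<partial>lborel) = ennreal W"
      "emeasure lborel (dcube T k0 x0) = ennreal L"
  shows "(\<integral>\<^sup>+y\<in>dcube T k0 x0. ennreal (w y powr (1 + \<eta>)) \<partial>lborel) \<le> ennreal (2 * (W / L) powr \<eta> * W)"
proof -
  define Q0 where "Q0 = dcube T k0 x0"
  have [measurable]: "Q0 \<in> sets borel" by (simp add: Q0_def)
  define m where "m = W / L"
  have m: "0 < m" using WL by (simp add: m_def)
  have \<eta>0: "0 < \<eta>" using \<gamma> by (simp add: \<eta>)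
  have \<eta>1: "\<eta> \<le> 1"
  proof -
    have "\<gamma>\<^sup>2 \<le> 1" using \<gamma> by (simp add: power_le_one)
    moreover have "(1::real) \<le> 2 ^ (CARD('n) + 2)" by (rule one_le_power) simp
    ultimately show ?thesis unfolding \<eta> by (simp add: divide_le_eq_1)
  qed
  define c where "c = (2::real) ^ (CARD('n) + 1)"
  have c: "c * \<eta> / \<gamma>\<^sup>2 = 1 / 2" using \<gamma> by (simp add: c_def \<eta> field_simps)
  have c0: "0 < c" by (simp add: c_def)
  have X: "(\<integral>\<^sup>+y\<in>Q0. ennreal (w y * min (w y) N powr \<eta>) \<partial>lborel) \<le> ennreal (2 * m powr \<eta> * W)"
    if N: "0 < N" for N :: real
  proof -
    define X where "X = (\<integral>\<^sup>+y\<in>Q0. ennreal (w y * min (w y) N powr \<eta>) \<partial>lborel)"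
    \<comment> \<open>The truncated integral is finite, so it may be absorbed.\<close>
    have "X \<le> (\<integral>\<^sup>+y\<in>Q0. (ennreal (N powr \<eta>) * ennreal (w y)) \<partial>lborel)"
      unfolding X_def using w N \<eta>0
      by (intro nn_integral_mono mult_right_mono)
        (auto simp flip: ennreal_mult intro!: ennreal_leI powr_mono2 mult_left_mono simp: mult.commute less_imp_le)
    also have "\<dots> = ennreal (N powr \<eta>) * ennreal W"
      using WL by (simp add: nn_integral_cmult Q0_def mult.assoc)
    also have "\<dots> < top" by (simp add: ennreal_mult_less_top)
    finally have Xfin: "X < top" .
    have "X = (\<integral>\<^sup>+y. \<integral>\<^sup>+s. ennreal (w y) * indicator Q0 y * layer \<eta> (ennreal (min (w y) N)) s \<partial>lborel \<partial>lborel)"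
      unfolding X_def
    proof (intro nn_integral_cong)
      fix y
      have "(\<integral>\<^sup>+s. ennreal (w y) * indicator Q0 y * layer \<eta> (ennreal (min (w y) N)) s \<partial>lborel)
         = ennreal (w y) * indicator Q0 y * ennreal (min (w y) N powr \<eta>)"
        using w[of y] N \<eta>0 by (subst nn_integral_cmult) (auto simp: nn_integral_powr_interval)
      then show "ennreal (w y * min (w y) N powr \<eta>) * indicator Q0 y = (\<integral>\<^sup>+s. ennreal (w y) * indicator Q0 y * layer \<eta> (ennreal (min (w y) N)) s \<partial>lborel)"
        using w[of y] by (simp add: ennreal_mult less_imp_le ac_simps)
    qed
    also have "\<dots> = (\<integral>\<^sup>+s. \<integral>\<^sup>+y. ennreal (w y) * indicator Q0 y * layer \<eta> (ennreal (min (w y) N)) s \<partial>lborel \<partial>lborel)"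
      by (rule lborel_pair.Fubini'[symmetric]) measurable
    also have "\<dots> \<le> (\<integral>\<^sup>+s. layer \<eta> (ennreal m) s * ennreal W
        + (\<integral>\<^sup>+y. ennreal (c * \<eta> / (1 + \<eta>)) * indicator Q0 y * layer (1 + \<eta>) (ennreal (min (w y / \<gamma>) N)) s \<partial>lborel) \<partial>lborel)"
    proof (intro nn_integral_mono)
      fix s :: real
      let ?I = "\<integral>\<^sup>+y. ennreal (w y) * indicator Q0 y * layer \<eta> (ennreal (min (w y) N)) s \<partial>lborel"
      let ?J = "\<integral>\<^sup>+y. ennreal (c * \<eta> / (1 + \<eta>)) * indicator Q0 y * layer (1 + \<eta>) (ennreal (min (w y / \<gamma>) N)) s \<partial>lborel"
      show "?I \<le> layer \<eta> (ennreal m) s * ennreal W + ?J"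
      proof -
        \<comment> \<open>Below the mean m the crude bound by the total mass is used, above it the level estimate.\<close>
        consider "s \<le> 0" | "0 < s" "N \<le> s" | "0 < s" "s < N" "s < m" | "0 < s" "s < N" "m \<le> s" by linarith
        then show ?thesis
        proof cases
          case 2
          then have "\<not> ennreal s < ennreal (min (w y) N)" for y by (auto simp: ennreal_less_iff)
          then show ?thesis by simp
        next
          case 3
          have "?I \<le> (\<integral>\<^sup>+y. ennreal (\<eta> * s powr (\<eta> - 1)) * (ennreal (w y) * indicator Q0 y) \<partial>lborel)"
            by (intro nn_integral_mono) (auto simp: ac_simps)
          also have "\<dots> = ennreal (\<eta> * s powr (\<eta> - 1)) * ennreal W"
            using WL by (subst nn_integral_cmult) (auto simp: Q0_def)
          finally show ?thesis using 3 m by (simp add: ennreal_less_iff add_increasing2)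
        next
          case 4
          have "?I \<le> (\<integral>\<^sup>+y. ennreal (\<eta> * s powr (\<eta> - 1)) * (ennreal (w y) * indicator {y\<in>Q0. s < w y} y) \<partial>lborel)"
            using 4 by (intro nn_integral_mono) (auto simp: ac_simps indicator_def ennreal_less_iff)
          also have "\<dots> = ennreal (\<eta> * s powr (\<eta> - 1)) * (\<integral>\<^sup>+y\<in>{y\<in>Q0. s < w y}. ennreal (w y) \<partial>lborel)"
            by (subst nn_integral_cmult) auto
          also have "\<dots> \<le> ennreal (\<eta> * s powr (\<eta> - 1)) * (ennreal (c * s) * emeasure lborel {y\<in>Q0. \<gamma> * s < w y})"
            unfolding Q0_def c_def
            by (intro mult_left_mono reverse_Holder_level[OF assms(1) w half fin \<gamma>(1) WL]) (use 4 in \<open>auto simp: m_def\<close>)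
          also have "\<dots> = ennreal (c * \<eta> * s powr \<eta>) * emeasure lborel {y\<in>Q0. \<gamma> * s < w y}"
          proof -
            have "s powr \<eta> = s powr (\<eta> - 1) * s" using powr_add[of s "\<eta> - 1" 1] 4 by simp
            then have "ennreal (\<eta> * s powr (\<eta> - 1)) * ennreal (c * s) = ennreal (c * \<eta> * s powr \<eta>)"
              using \<eta>0 c0 4 by (simp add: ac_simps flip: ennreal_mult)
            then show ?thesis by (simp add: mult.assoc[symmetric])
          qed
          also have "\<dots> = (\<integral>\<^sup>+y. ennreal (c * \<eta> * s powr \<eta>) * indicator {y\<in>Q0. \<gamma> * s < w y} y \<partial>lborel)"
            by (subst nn_integral_cmult_indicator) auto
          also have "\<dots> = ?J"
          proof (intro nn_integral_cong)
            fix y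
            have "ennreal (c * \<eta> / (1 + \<eta>)) * ennreal ((1 + \<eta>) * s powr (1 + \<eta> - 1)) = ennreal (c * \<eta> * s powr \<eta>)"
              using \<eta>0 c0 by (simp flip: ennreal_mult)
            moreover have "ennreal s < ennreal (min (w y / \<gamma>) N) \<longleftrightarrow> \<gamma> * s < w y"
              using 4 \<gamma> by (auto simp: ennreal_less_iff field_simps)
            ultimately show "ennreal (c * \<eta> * s powr \<eta>) * indicator {y\<in>Q0. \<gamma> * s < w y} y
              = ennreal (c * \<eta> / (1 + \<eta>)) * indicator Q0 y * layer (1 + \<eta>) (ennreal (min (w y / \<gamma>) N)) s"
              using 4 by (simp add: indicator_def)
          qed
          finally show ?thesis using 4 m by (simp add: ennreal_less_iff)
        qed auto
      qed
    qed
    also have "\<dots> = (\<integral>\<^sup>+s. layer \<eta> (ennreal m) s * ennreal W \<partial>lborel)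
        + (\<integral>\<^sup>+s. (\<integral>\<^sup>+y. ennreal (c * \<eta> / (1 + \<eta>)) * indicator Q0 y * layer (1 + \<eta>) (ennreal (min (w y / \<gamma>) N)) s \<partial>lborel) \<partial>lborel)"
      by (rule nn_integral_add) measurable
    also have "(\<integral>\<^sup>+s. layer \<eta> (ennreal m) s * ennreal W \<partial>lborel) = ennreal (m powr \<eta>) * ennreal W"
      using m \<eta>0 by (subst nn_integral_multc) (auto simp: nn_integral_powr_interval)
    also have "(\<integral>\<^sup>+s. (\<integral>\<^sup>+y. ennreal (c * \<eta> / (1 + \<eta>)) * indicator Q0 y * layer (1 + \<eta>) (ennreal (min (w y / \<gamma>) N)) s \<partial>lborel) \<partial>lborel)
       = (\<integral>\<^sup>+y. \<integral>\<^sup>+s. ennreal (c * \<eta> / (1 + \<eta>)) * indicator Q0 y * layer (1 + \<eta>) (ennreal (min (w y / \<gamma>) N)) s \<partial>lborel \<partial>lborel)"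
      by (rule lborel_pair.Fubini') measurable
    also have "\<dots> \<le> (\<integral>\<^sup>+y. ennreal (1 / 2) * (ennreal (w y * min (w y) N powr \<eta>) * indicator Q0 y) \<partial>lborel)"
    proof (intro nn_integral_mono)
      fix y
      have "(\<integral>\<^sup>+s. ennreal (c * \<eta> / (1 + \<eta>)) * indicator Q0 y * layer (1 + \<eta>) (ennreal (min (w y / \<gamma>) N)) s \<partial>lborel)
        = ennreal (c * \<eta> / (1 + \<eta>)) * indicator Q0 y * ennreal (min (w y / \<gamma>) N powr (1 + \<eta>))"
        using w[of y] N \<eta>0 \<gamma> by (subst nn_integral_cmult) (auto simp: nn_integral_powr_interval simp del: add_diff_cancel_left')
      also have "\<dots> = ennreal (c * \<eta> / (1 + \<eta>) * min (w y / \<gamma>) N powr (1 + \<eta>)) * indicator Q0 y"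
        using c0 \<eta>0 by (subst ennreal_mult) (auto simp: ac_simps)
      also have "\<dots> \<le> ennreal (1 / 2 * (w y * min (w y) N powr \<eta>)) * indicator Q0 y"
      proof (intro mult_right_mono ennreal_leI)
        have "N * \<gamma> \<le> N" using N \<gamma> by simp
        then have "min (w y / \<gamma>) N \<le> min (w y) N / \<gamma>" using \<gamma> w[of y] by (auto simp: min_def field_simps)
        then have "min (w y / \<gamma>) N powr (1 + \<eta>) \<le> (min (w y) N / \<gamma>) powr (1 + \<eta>)"
          using \<eta>0 w[of y] N \<gamma> by (intro powr_mono2) auto
        also have "\<dots> = min (w y) N powr (1 + \<eta>) / \<gamma> powr (1 + \<eta>)"
          using w[of y] N \<gamma> by (simp add: powr_divide)
        also have "\<dots> \<le> min (w y) N powr (1 + \<eta>) / \<gamma> powr 2"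
          using w[of y] N \<gamma> \<eta>1 by (intro divide_left_mono powr_mono') auto
        also have "\<dots> = min (w y) N * min (w y) N powr \<eta> / \<gamma>\<^sup>2"
          using w[of y] N \<gamma> by (simp add: powr_add powr_numeral)
        also have "\<dots> \<le> w y * min (w y) N powr \<eta> / \<gamma>\<^sup>2"
          by (intro divide_right_mono mult_right_mono) auto
        finally have "c * \<eta> / (1 + \<eta>) * min (w y / \<gamma>) N powr (1 + \<eta>) \<le> c * \<eta> / (1 + \<eta>) * (w y * min (w y) N powr \<eta> / \<gamma>\<^sup>2)"
          using c0 \<eta>0 by (intro mult_left_mono) auto
        also have "\<dots> \<le> c * \<eta> / 1 * (w y * min (w y) N powr \<eta> / \<gamma>\<^sup>2)"
          using c0 \<eta>0 w[of y] by (intro mult_right_mono divide_left_mono) auto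
        also have "\<dots> = (c * \<eta> / \<gamma>\<^sup>2) * (w y * min (w y) N powr \<eta>)" by simp
        finally show "c * \<eta> / (1 + \<eta>) * min (w y / \<gamma>) N powr (1 + \<eta>) \<le> 1 / 2 * (w y * min (w y) N powr \<eta>)"
          unfolding c .
      qed auto
      also have "\<dots> = ennreal (1 / 2) * (ennreal (w y * min (w y) N powr \<eta>) * indicator Q0 y)"
        using w[of y] by (subst ennreal_mult) (auto simp: ac_simps less_imp_le)
      finally show "(\<integral>\<^sup>+s. ennreal (c * \<eta> / (1 + \<eta>)) * indicator Q0 y * layer (1 + \<eta>) (ennreal (min (w y / \<gamma>) N)) s \<partial>lborel)
        \<le> ennreal (1 / 2) * (ennreal (w y * min (w y) N powr \<eta>) * indicator Q0 y)" .
    qed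
    also have "\<dots> = ennreal (1 / 2) * X"
      unfolding X_def by (rule nn_integral_cmult) measurable
    finally have "X \<le> ennreal (m powr \<eta>) * ennreal W + ennreal (1 / 2) * X"
      by (simp add: add_left_mono)
    moreover obtain x where x: "0 \<le> x" "X = ennreal x" using Xfin by (cases X) auto
    moreover have "ennreal (m powr \<eta>) * ennreal W + ennreal (1 / 2) * ennreal x = ennreal (m powr \<eta> * W + 1 / 2 * x)"
    proof -
      have e1: "ennreal (1 / 2) * ennreal x = ennreal (1 / 2 * x)"
        by (rule ennreal_mult[symmetric]) (use x in auto)
      have e2: "ennreal (m powr \<eta>) * ennreal W = ennreal (m powr \<eta> * W)"
        by (rule ennreal_mult[symmetric]) (use WL in auto)
      show ?thesis unfolding e1 e2 by (rule ennreal_plus[symmetric]) (use WL x in auto)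
    qed
    ultimately have "ennreal x \<le> ennreal (m powr \<eta> * W + 1 / 2 * x)"
      by simp
    then have "x \<le> m powr \<eta> * W + 1 / 2 * x"
      using WL x by (subst (asm) ennreal_le_iff) auto
    then have "x \<le> 2 * m powr \<eta> * W" by simp
    then show ?thesis unfolding X_def[symmetric] x by (rule ennreal_leI)
  qed
  have "(\<integral>\<^sup>+y\<in>Q0. ennreal (w y powr (1 + \<eta>)) \<partial>lborel)
    \<le> (\<integral>\<^sup>+y. (SUP N. ennreal (w y * min (w y) (real (Suc N)) powr \<eta>) * indicator Q0 y) \<partial>lborel)"
  proof (intro nn_integral_mono)
    fix y
    obtain N where N: "w y \<le> real N" using real_arch_simple by blast
    have "ennreal (w y powr (1 + \<eta>)) * indicator Q0 y = ennreal (w y * min (w y) (real (Suc N)) powr \<eta>) * indicator Q0 y"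
      using N w[of y] by (simp add: powr_add min_def)
    also have "\<dots> \<le> (SUP N. ennreal (w y * min (w y) (real (Suc N)) powr \<eta>) * indicator Q0 y)"
      by (rule SUP_upper) auto
    finally show "ennreal (w y powr (1 + \<eta>)) * indicator Q0 y \<le> (SUP N. ennreal (w y * min (w y) (real (Suc N)) powr \<eta>) * indicator Q0 y)" .
  qed
  also have "\<dots> = (SUP N. (\<integral>\<^sup>+y\<in>Q0. ennreal (w y * min (w y) (real (Suc N)) powr \<eta>) \<partial>lborel))"
  proof (rule nn_integral_monotone_convergence_SUP)
    show "incseq (\<lambda>N y. ennreal (w y * min (w y) (real (Suc N)) powr \<eta>) * indicator Q0 y)"
      using w \<eta>0 by (auto simp: incseq_def le_fun_def less_imp_le intro!: mult_right_mono ennreal_leI mult_left_mono powr_mono2)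
  qed auto
  also have "\<dots> \<le> ennreal (2 * m powr \<eta> * W)"
    by (intro SUP_least X) auto
  finally show ?thesis by (simp add: Q0_def m_def)
qed

text \<open>The bound says that the average of \<open>w powr (1 + \<eta>)\<close> is at most twice the power of the
  average.\<close>

definition reverse_Holder_exponent :: "real \<Rightarrow> (real^'n::finite \<Rightarrow> real) \<Rightarrow> bool" where
  "reverse_Holder_exponent \<eta> w \<longleftrightarrow> 0 < \<eta> \<and> (\<forall>T k x W L. 0 < W \<longrightarrow> 0 < L \<longrightarrow>
      (\<integral>\<^sup>+y\<in>dcube T k x. ennreal (w y) \<partial>lborel) = ennreal W \<longrightarrow> emeasure lborel (dcube T k x) = ennreal L \<longrightarrow>
      (\<integral>\<^sup>+y\<in>dcube T k x. ennreal (w y powr (1 + \<eta>)) \<partial>lborel) \<le> ennreal (2 * (W / L) powr \<eta> * W))"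

text \<open>Only the comparison of level sets has to be supplied: if \<open>w\<close> were at most \<open>\<gamma>\<close> times its mean on
  more than half of a cube, then the dual weight would be so large there that the Muckenhoupt product
  exceeds \<open>A\<close>.\<close>

lemma dyadic_Ap_reverse_Holder:
  fixes w :: "real^'n::finite \<Rightarrow> real"
  assumes Ap: "dyadic_Ap p w A" and [measurable]: "w \<in> borel_measurable borel"
    and w: "\<And>x. 0 < w x" and p: "1 < p"
  obtains \<eta> where "reverse_Holder_exponent \<eta> w"
proof -
  define \<tau> where "\<tau> = 1 / (p - 1)"
  have \<tau>: "0 < \<tau>" "\<tau> * (p - 1) = 1" using p by (auto simp: \<tau>_def)
  have A: "0 < A" by (rule dyadic_ApE[OF Ap assms(2) w p])
  define \<gamma> where "\<gamma> = min 1 ((1 / 2) powr (p - 1) / A)"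
  have \<gamma>: "0 < \<gamma>" "\<gamma> \<le> 1" using A by (auto simp: \<gamma>_def)
  have \<gamma>A: "(\<gamma> * A) powr \<tau> \<le> 1 / 2"
  proof -
    have "\<gamma> * A \<le> (1 / 2) powr (p - 1) / A * A" using A by (intro mult_right_mono) (auto simp: \<gamma>_def)
    then have "(\<gamma> * A) powr \<tau> \<le> ((1 / 2) powr (p - 1)) powr \<tau>" using A \<gamma> \<tau> by (intro powr_mono2) auto
    also have "\<dots> = 1 / 2" using \<tau> by (simp add: powr_powr mult.commute)
    finally show ?thesis .
  qed
  have half: "2 * emeasure lborel {y\<in>dcube T k x. w y \<le> \<gamma> * (W / L)} \<le> ennreal L"
    if WL: "0 < W" "0 < L" "(\<integral>\<^sup>+y\<in>dcube T k x. ennreal (w y) \<partial>lborel) = ennreal W"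
      "emeasure lborel (dcube T k x) = ennreal L" for T k x W L
  proof -
    let ?E = "{y\<in>dcube T k x. w y \<le> \<gamma> * (W / L)}"
    obtain S where S: "0 < S" "(\<integral>\<^sup>+y\<in>dcube T k x. ennreal (w y powr (- 1 / (p - 1))) \<partial>lborel) = ennreal S"
       "W / L * (S / L) powr (p - 1) \<le> A"
      by (rule dyadic_ApE[OF Ap assms(2) w p, of T k x]) (use WL in \<open>auto simp: ennreal_inj less_imp_le\<close>)
    define t where "t = (\<gamma> * (W / L)) powr (- \<tau>)"
    have t: "0 < t" using WL \<gamma> by (simp add: t_def)
    have "ennreal t * emeasure lborel ?E = (\<integral>\<^sup>+y. ennreal t * indicator ?E y \<partial>lborel)"
      by (subst nn_integral_cmult_indicator) auto
    also have "\<dots> \<le> (\<integral>\<^sup>+y\<in>dcube T k x. ennreal (w y powr (- 1 / (p - 1))) \<partial>lborel)"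
    proof (intro nn_integral_mono)
      fix y
      have "t \<le> w y powr (- 1 / (p - 1))" if "w y \<le> \<gamma> * (W / L)"
        using powr_mono2'[of "- \<tau>" "w y" "\<gamma> * (W / L)"] that w[of y] \<tau> by (simp add: t_def \<tau>_def)
      then show "ennreal t * indicator ?E y \<le> ennreal (w y powr (- 1 / (p - 1))) * indicator (dcube T k x) y"
        by (auto simp: indicator_def intro!: ennreal_leI)
    qed
    also have "\<dots> = ennreal S" by (rule S(2))
    finally have E: "ennreal t * emeasure lborel ?E \<le> ennreal S" .
    have "emeasure lborel ?E \<le> emeasure lborel (dcube T k x)" by (rule emeasure_mono) auto
    then obtain e where e: "0 \<le> e" "emeasure lborel ?E = ennreal e"
      using WL by (cases "emeasure lborel ?E") (auto simp: top_unique)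
    have te: "t * e \<le> S" using E e t S by (simp flip: ennreal_mult)
    have "S / L = (W / L * (S / L) powr (p - 1)) powr \<tau> * (W / L) powr (- \<tau>)"
      unfolding powr_mult[of "W / L"] using WL S \<tau> by (simp add: powr_powr powr_minus mult.commute)
    also have "\<dots> \<le> A powr \<tau> * (W / L) powr (- \<tau>)"
      using WL S \<tau> by (intro mult_right_mono powr_mono2) auto
    finally have "S \<le> L * (A powr \<tau> * (W / L) powr (- \<tau>))" using WL by (simp add: field_simps)
    with te have "t * e \<le> L * (A powr \<tau> * (W / L) powr (- \<tau>))" by simp
    also have "A powr \<tau> * (W / L) powr (- \<tau>) = (\<gamma> * A) powr \<tau> * t"
      unfolding t_def powr_mult[of \<gamma>] using \<gamma> by (simp add: powr_minus)
    finally have "t * e \<le> t * (L * (\<gamma> * A) powr \<tau>)" by (simp add: ac_simps)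
    then have "e \<le> L * (\<gamma> * A) powr \<tau>" using t by simp
    also have "\<dots> \<le> L * (1 / 2)" using WL by (intro mult_left_mono \<gamma>A) auto
    finally have "2 * e \<le> L" by simp
    then have "ennreal (2 * e) \<le> ennreal L" by (rule ennreal_leI)
    then show ?thesis unfolding e(2) using e(1) by (simp add: ennreal_mult)
  qed
  have fin: "(\<integral>\<^sup>+y\<in>dcube T k x. ennreal (w y) \<partial>lborel) \<noteq> top" for T k x
    by (rule dyadic_ApE[OF Ap assms(2) w p, of T k x]) simp
  define \<eta> where "\<eta> = \<gamma>\<^sup>2 / 2 ^ (CARD('n) + 2)"
  show ?thesis
  proof (rule that[of \<eta>], unfold reverse_Holder_exponent_def, intro conjI allI impI)
    show "0 < \<eta>" using \<gamma> by (simp add: \<eta>_def)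
  qed (rule reverse_Holder[OF assms(2) w half fin \<gamma> \<eta>_def])
qed

section \<open>Stability of Muckenhoupt weights under small changes\<close>

text \<open>The weighted inequality between arithmetic and geometric mean for \<open>x\<close>, \<open>y\<close> and \<open>1\<close>.\<close>

lemma young_three:
  fixes x y :: real
  assumes "0 < x" "0 < y" "0 \<le> \<alpha>" "0 \<le> \<beta>" "\<alpha> + \<beta> \<le> 1"
  shows "x powr \<alpha> * y powr \<beta> \<le> \<alpha> * x + \<beta> * y + (1 - \<alpha> - \<beta>)"
proof -
  define S where "S = \<alpha> * x + \<beta> * y + (1 - \<alpha> - \<beta>)"
  have S: "0 < S"
  proof (cases "\<alpha> = 0 \<and> \<beta> = 0")
    case False
    then have "0 < \<alpha> * x \<or> 0 < \<beta> * y" "0 \<le> \<alpha> * x" "0 \<le> \<beta> * y" using assms by auto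
    then show ?thesis using assms unfolding S_def by linarith
  qed (simp add: S_def)
  have "\<alpha> * ln (x / S) \<le> \<alpha> * (x / S - 1)" "\<beta> * ln (y / S) \<le> \<beta> * (y / S - 1)"
    "(1 - \<alpha> - \<beta>) * ln (1 / S) \<le> (1 - \<alpha> - \<beta>) * (1 / S - 1)"
    using assms S by (intro mult_left_mono ln_le_minus_one; simp)+
  moreover have "\<alpha> * (x / S - 1) + \<beta> * (y / S - 1) + (1 - \<alpha> - \<beta>) * (1 / S - 1) = 0"
  proof -
    have "\<alpha> * (x / S - 1) + \<beta> * (y / S - 1) + (1 - \<alpha> - \<beta>) * (1 / S - 1)
        = (\<alpha> * x + \<beta> * y + (1 - \<alpha> - \<beta>)) / S - 1"
      by (simp add: algebra_simps add_divide_distrib diff_divide_distrib)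
    also have "\<dots> = S / S - 1" by (simp add: S_def)
    finally have "\<alpha> * (x / S - 1) + \<beta> * (y / S - 1) + (1 - \<alpha> - \<beta>) * (1 / S - 1) = S / S - 1" .
    then show ?thesis using S by simp
  qed
  ultimately have "\<alpha> * ln (x / S) + \<beta> * ln (y / S) + (1 - \<alpha> - \<beta>) * ln (1 / S) \<le> 0" by linarith
  then have "\<alpha> * ln x + \<beta> * ln y \<le> ln S"
    using assms S by (simp add: ln_div algebra_simps)
  then have "exp (\<alpha> * ln x + \<beta> * ln y) \<le> S" using S by (metis exp_le_cancel_iff exp_ln)
  then show ?thesis using assms by (simp add: S_def powr_def exp_add)
qed

lemma ennreal_lin3:
  "0 \<le> a \<Longrightarrow> 0 \<le> b \<Longrightarrow> 0 \<le> c \<Longrightarrow> 0 \<le> u \<Longrightarrow> 0 \<le> v \<Longrightarrow>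
    ennreal (a * u + (b * v + c)) = ennreal a * ennreal u + (ennreal b * ennreal v + ennreal c)"
  by (simp add: ennreal_plus ennreal_mult)

text \<open>Hoelder's inequality on a probability space with exponents whose sum may be less than one, so
  that Jensen's inequality is included.\<close>

lemma Holder_three:
  fixes u v :: "'a \<Rightarrow> real"
  assumes M: "emeasure M (space M) = 1"
    and [measurable]: "u \<in> borel_measurable M" "v \<in> borel_measurable M"
    and pos: "\<And>x. 0 < u x" "\<And>x. 0 < v x" "0 < X" "0 < Y"
    and le: "(\<integral>\<^sup>+x. ennreal (u x) \<partial>M) \<le> ennreal X" "(\<integral>\<^sup>+x. ennreal (v x) \<partial>M) \<le> ennreal Y"
    and ab: "0 \<le> \<alpha>" "0 \<le> \<beta>" "\<alpha> + \<beta> \<le> 1"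
  shows "(\<integral>\<^sup>+x. ennreal (u x powr \<alpha> * v x powr \<beta>) \<partial>M) \<le> ennreal (X powr \<alpha> * Y powr \<beta>)"
proof -
  define c where "c = X powr \<alpha> * Y powr \<beta>"
  have c: "0 < c" using pos by (simp add: c_def)
  have "(\<integral>\<^sup>+x. ennreal (u x powr \<alpha> * v x powr \<beta>) \<partial>M)
     \<le> (\<integral>\<^sup>+x. ennreal (c * \<alpha> / X) * ennreal (u x) + (ennreal (c * \<beta> / Y) * ennreal (v x) + ennreal (c * (1 - \<alpha> - \<beta>))) \<partial>M)"
  proof (intro nn_integral_mono)
    fix x
    have "(u x / X) powr \<alpha> * (v x / Y) powr \<beta> \<le> \<alpha> * (u x / X) + \<beta> * (v x / Y) + (1 - \<alpha> - \<beta>)"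
      using pos ab by (intro young_three) auto
    then have "c * ((u x / X) powr \<alpha> * (v x / Y) powr \<beta>) \<le> c * (\<alpha> * (u x / X) + \<beta> * (v x / Y) + (1 - \<alpha> - \<beta>))"
      using c by (intro mult_left_mono) auto
    also have "c * ((u x / X) powr \<alpha> * (v x / Y) powr \<beta>) = u x powr \<alpha> * v x powr \<beta>"
      using pos by (simp add: c_def powr_divide less_imp_le)
    also have "c * (\<alpha> * (u x / X) + \<beta> * (v x / Y) + (1 - \<alpha> - \<beta>)) = c * \<alpha> / X * u x + (c * \<beta> / Y * v x + c * (1 - \<alpha> - \<beta>))"
      by (simp add: algebra_simps)
    finally have "ennreal (u x powr \<alpha> * v x powr \<beta>) \<le> ennreal (c * \<alpha> / X * u x + (c * \<beta> / Y * v x + c * (1 - \<alpha> - \<beta>)))"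
      by (rule ennreal_leI)
    also have "\<dots> = ennreal (c * \<alpha> / X) * ennreal (u x) + (ennreal (c * \<beta> / Y) * ennreal (v x) + ennreal (c * (1 - \<alpha> - \<beta>)))"
      by (rule ennreal_lin3) (use c pos(1)[of x] pos(2)[of x] pos(3,4) ab in auto)
    finally show "ennreal (u x powr \<alpha> * v x powr \<beta>) \<le> ennreal (c * \<alpha> / X) * ennreal (u x) + (ennreal (c * \<beta> / Y) * ennreal (v x) + ennreal (c * (1 - \<alpha> - \<beta>)))" .
  qed
  also have "\<dots> = ennreal (c * \<alpha> / X) * (\<integral>\<^sup>+x. ennreal (u x) \<partial>M) + (ennreal (c * \<beta> / Y) * (\<integral>\<^sup>+x. ennreal (v x) \<partial>M) + ennreal (c * (1 - \<alpha> - \<beta>)))"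
    by (simp add: nn_integral_add nn_integral_cmult M)
  also have "\<dots> \<le> ennreal (c * \<alpha> / X) * ennreal X + (ennreal (c * \<beta> / Y) * ennreal Y + ennreal (c * (1 - \<alpha> - \<beta>)))"
    by (intro add_mono mult_left_mono le) auto
  also have "\<dots> = ennreal (c * \<alpha> / X * X + (c * \<beta> / Y * Y + c * (1 - \<alpha> - \<beta>)))"
    by (rule ennreal_lin3[symmetric]) (use c pos(3,4) ab in auto)
  also have "c * \<alpha> / X * X + (c * \<beta> / Y * Y + c * (1 - \<alpha> - \<beta>)) = c"
    using pos(3,4) by (simp add: algebra_simps)
  finally show ?thesis by (simp add: c_def)
qed

lemma davg_Holder:
  fixes x :: "real^'n::finite"
  assumes [measurable]: "u \<in> borel_measurable borel" "v \<in> borel_measurable borel"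
    and "\<And>x. (0::real) < u x" "\<And>x. (0::real) < v x" "0 < X" "0 < Y"
    and "davg lborel (dcube T k x) (\<lambda>y. ennreal (u y)) \<le> ennreal X"
      "davg lborel (dcube T k x) (\<lambda>y. ennreal (v y)) \<le> ennreal Y"
    and "0 \<le> \<alpha>" "0 \<le> \<beta>" "\<alpha> + \<beta> \<le> 1"
  shows "davg lborel (dcube T k x) (\<lambda>y. ennreal (u y powr \<alpha> * v y powr \<beta>)) \<le> ennreal (X powr \<alpha> * Y powr \<beta>)"
proof -
  obtain L where L: "0 < L" "emeasure lborel (dcube T k x) = ennreal L"
    by (rule dcube_measure_pos)
  have U: "davg lborel (dcube T k x) f = (\<integral>\<^sup>+y. f y \<partial>uniform_measure lborel (dcube T k x))"
    if [measurable]: "f \<in> borel_measurable borel" for f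
    unfolding davg_def by (subst nn_integral_uniform_measure) auto
  show ?thesis
  proof (subst U, measurable, rule Holder_three)
    show "(\<integral>\<^sup>+y. ennreal (u y) \<partial>uniform_measure lborel (dcube T k x)) \<le> ennreal X"
      using assms(7) by (subst (asm) U) auto
    show "(\<integral>\<^sup>+y. ennreal (v y) \<partial>uniform_measure lborel (dcube T k x)) \<le> ennreal Y"
      using assms(8) by (subst (asm) U) auto
    show "emeasure (uniform_measure lborel (dcube T k x)) (space (uniform_measure lborel (dcube T k x))) = 1"
      using L by (simp add: divide_ennreal)
  qed (use assms in auto)
qed

text \<open>The dual weight satisfies the dual condition: both are the same inequality between two averages.\<close>

lemma dyadic_Ap_dual:
  fixes w :: "real^'n::finite \<Rightarrow> real"
  assumes Ap: "dyadic_Ap p w A" and wm [measurable]: "w \<in> borel_measurable borel"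
    and w: "\<And>x. 0 < w x" and p: "1 < p"
  shows "dyadic_Ap (p / (p - 1)) (\<lambda>x. w x powr (- 1 / (p - 1))) (A powr (1 / (p - 1)))"
  unfolding dyadic_Ap_def
proof (intro allI)
  fix T k and x :: "real^'n"
  obtain W S L where c: "0 < W" "0 < S" "0 < L"
    "(\<integral>\<^sup>+y\<in>dcube T k x. ennreal (w y) \<partial>lborel) = ennreal W"
    "(\<integral>\<^sup>+y\<in>dcube T k x. ennreal (w y powr (- 1 / (p - 1))) \<partial>lborel) = ennreal S"
    "emeasure lborel (dcube T k x) = ennreal L" "W / L * (S / L) powr (p - 1) \<le> A" "0 < A"
    by (rule dyadic_ApE[OF Ap wm w p])
  have p1: "p / (p - 1) - 1 = 1 / (p - 1)" using p by (simp add: field_simps)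
  have "(- 1 / (p - 1)) * (- 1 / (1 / (p - 1))) = 1" using p by (simp add: divide_simps)
  then have "(w y powr (- 1 / (p - 1))) powr (- 1 / (1 / (p - 1))) = w y" for y
    using w[of y] by (simp only: powr_powr powr_one)
  then have "davg lborel (dcube T k x) (\<lambda>y. ennreal (w y powr (- 1 / (p - 1)))) *
        epowr (davg lborel (dcube T k x) (\<lambda>y. ennreal ((w y powr (- 1 / (p - 1))) powr (- 1 / (p / (p - 1) - 1))))) (p / (p - 1) - 1)
     = ennreal (S / L) * epowr (ennreal (W / L)) (1 / (p - 1))"
    unfolding p1 davg_def using c by (simp add: divide_ennreal)
  also have "\<dots> = ennreal (S / L * (W / L) powr (1 / (p - 1)))"
    using c by (subst epowr_ennreal, simp, subst ennreal_mult[symmetric]) auto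
  also have "S / L * (W / L) powr (1 / (p - 1)) = (W / L * (S / L) powr (p - 1)) powr (1 / (p - 1))"
    unfolding powr_mult[of "W / L"] using c p by (simp add: powr_powr)
  also have "\<dots> \<le> A powr (1 / (p - 1))"
    using c p by (intro powr_mono2) auto
  finally show "davg lborel (dcube T k x) (\<lambda>y. ennreal (w y powr (- 1 / (p - 1)))) *
        epowr (davg lborel (dcube T k x) (\<lambda>y. ennreal ((w y powr (- 1 / (p - 1))) powr (- 1 / (p / (p - 1) - 1))))) (p / (p - 1) - 1)
     \<le> ennreal (A powr (1 / (p - 1)))"
    by (simp add: ennreal_leI)
qed

text \<open>The exponent of a Muckenhoupt class can be lowered while the weight is multiplied by a small power of
  \<open>a\<close>, with one bound for all small \<open>\<epsilon>\<close>. By the reverse Hoelder inequality the averages of \<open>w\<close> and of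
  its dual weight remain comparable after raising both to a power slightly above one. Hoelder's
  inequality then separates the powers of \<open>w\<close> from those of \<open>a\<close>, and the two averages of \<open>a\<close> combine to
  \<open>B powr (\<epsilon> / \<delta>)\<close>.\<close>

lemma dyadic_Ap_perturb:
  fixes w a :: "real^'n::finite \<Rightarrow> real"
  assumes Ap: "dyadic_Ap q w A" and wm [measurable]: "w \<in> borel_measurable borel" and w: "\<And>x. 0 < w x"
    and am [measurable]: "a \<in> borel_measurable borel" and a: "\<And>x. 0 < a x"
    and Bp: "dyadic_Ap q (\<lambda>x. a x powr \<delta>) B" and \<delta>: "0 < \<delta>" and q: "1 < q"
  obtains \<epsilon>0 C where "0 < \<epsilon>0" "\<epsilon>0 < q - 1" "0 < C"
    "\<And>\<epsilon>. 0 < \<epsilon> \<Longrightarrow> \<epsilon> < \<epsilon>0 \<Longrightarrow> dyadic_Ap (q - \<epsilon>) (\<lambda>x. w x * a x powr \<epsilon>) C"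
proof -
  define \<sigma> where "\<sigma> x = w x powr (- 1 / (q - 1))" for x
  have [measurable]: "\<sigma> \<in> borel_measurable borel" unfolding \<sigma>_def by measurable
  have \<sigma>: "0 < \<sigma> x" for x using w[of x] by (simp add: \<sigma>_def)
  have ad: "0 < a x powr \<delta>" for x using a[of x] by simp
  have adm [measurable]: "(\<lambda>x. a x powr \<delta>) \<in> borel_measurable borel" by measurable
  have A: "0 < A" by (rule dyadic_ApE[OF Ap wm w q])
  have B: "0 < B" by (rule dyadic_ApE[OF Bp adm ad q])
  obtain \<eta> where RHw: "reverse_Holder_exponent \<eta> w"
    by (rule dyadic_Ap_reverse_Holder[OF Ap wm w q])
  then have \<eta>: "0 < \<eta>" by (simp add: reverse_Holder_exponent_def)
  have q': "1 < q / (q - 1)" using q by (simp add: field_simps)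
  obtain \<theta> where RHs: "reverse_Holder_exponent \<theta> \<sigma>"
    by (rule dyadic_Ap_reverse_Holder[OF dyadic_Ap_dual[OF Ap wm w q, folded \<sigma>_def] _ \<sigma> q']) auto
  then have \<theta>: "0 < \<theta>" by (simp add: reverse_Holder_exponent_def)
  \<comment> \<open>The two bounds on \<open>\<epsilon>\<close> that make the Hoelder exponents for the weight and for its dual sum to at most one.\<close>
  define e1 where "e1 = \<delta> * (\<eta> / (1 + \<eta>))"
  define e2 where "e2 = (q - 1) * (\<theta> / (1 + \<theta>)) / ((q - 1) / \<delta> + 1)"
  define \<epsilon>0 where "\<epsilon>0 = min e1 e2"
  have e1: "0 < e1" "e1 < \<delta>" using \<delta> \<eta> by (auto simp: e1_def field_simps)
  have e2: "0 < e2" using q \<theta> \<delta> by (auto simp: e2_def intro!: divide_pos_pos mult_pos_pos add_pos_pos)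
  have e2': "e2 < q - 1"
  proof -
    have "e2 < (q - 1) * 1 / 1"
      unfolding e2_def using q \<theta> \<delta> by (intro frac_less mult_strict_left_mono mult_nonneg_nonneg) auto
    then show ?thesis by simp
  qed
  define C where "C = 2 * 2 powr (q - 1) * A * max 1 B"
  show ?thesis
  proof (rule that[of \<epsilon>0 C])
    show "0 < \<epsilon>0" "\<epsilon>0 < q - 1" using e1 e2 e2' by (auto simp: \<epsilon>0_def)
    show "0 < C" using A by (simp add: C_def)
    fix \<epsilon> assume \<epsilon>: "0 < \<epsilon>" "\<epsilon> < \<epsilon>0"
    define p where "p = q - \<epsilon>"
    have p: "0 < p - 1" using \<epsilon> e2' by (simp add: p_def \<epsilon>0_def)
    define \<alpha> where "\<alpha> = 1 / (1 + \<eta>)"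
    define \<beta> where "\<beta> = \<epsilon> / \<delta>"
    have \<alpha>\<beta>: "0 \<le> \<alpha>" "0 \<le> \<beta>" "\<alpha> \<le> 1" "\<alpha> + \<beta> \<le> 1" "\<beta> \<le> 1"
    proof -
      have "\<epsilon> \<le> \<delta> * (\<eta> / (1 + \<eta>))" using \<epsilon> by (simp add: \<epsilon>0_def e1_def)
      then have "\<beta> \<le> \<eta> / (1 + \<eta>)" using \<delta> by (simp add: \<beta>_def pos_divide_le_eq mult.commute)
      moreover have "\<alpha> + \<eta> / (1 + \<eta>) = 1" using \<eta> by (simp add: \<alpha>_def add_divide_distrib[symmetric])
      ultimately show "\<alpha> + \<beta> \<le> 1" by simp
      show "0 \<le> \<alpha>" "0 \<le> \<beta>" "\<alpha> \<le> 1" using \<eta> \<epsilon> \<delta> by (auto simp: \<alpha>_def \<beta>_def)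
      with \<open>\<alpha> + \<beta> \<le> 1\<close> show "\<beta> \<le> 1" by simp
    qed
    define \<alpha>' where "\<alpha>' = (q - 1) / ((p - 1) * (1 + \<theta>))"
    define \<beta>' where "\<beta>' = \<epsilon> * (q - 1) / ((p - 1) * \<delta>)"
    have \<alpha>\<beta>': "0 \<le> \<alpha>'" "0 \<le> \<beta>'" "\<alpha>' + \<beta>' \<le> 1"
    proof -
      have "\<epsilon> < e2" using \<epsilon> by (simp add: \<epsilon>0_def)
      moreover have "0 < (q - 1) / \<delta> + 1" using q \<delta> by (intro add_pos_pos) auto
      ultimately have "\<epsilon> * ((q - 1) / \<delta> + 1) \<le> (q - 1) * (\<theta> / (1 + \<theta>))"
        unfolding e2_def by (subst (asm) pos_less_divide_eq) auto
      moreover have "(q - 1) * (\<theta> / (1 + \<theta>)) = (q - 1) - (q - 1) / (1 + \<theta>)"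
        using \<theta> by (simp add: field_simps)
      ultimately have "(q - 1) / (1 + \<theta>) + \<epsilon> * (q - 1) / \<delta> \<le> p - 1"
        by (simp add: p_def algebra_simps)
      then have "((q - 1) / (1 + \<theta>) + \<epsilon> * (q - 1) / \<delta>) / (p - 1) \<le> 1" using p by simp
      moreover have "((q - 1) / (1 + \<theta>) + \<epsilon> * (q - 1) / \<delta>) / (p - 1) = \<alpha>' + \<beta>'"
        by (simp add: \<alpha>'_def \<beta>'_def add_divide_distrib mult.commute)
      ultimately show "\<alpha>' + \<beta>' \<le> 1" by simp
      show "0 \<le> \<alpha>'" "0 \<le> \<beta>'" using q \<theta> \<epsilon> \<delta> p by (auto simp: \<alpha>'_def \<beta>'_def)
    qed
    show "dyadic_Ap (q - \<epsilon>) (\<lambda>x. w x * a x powr \<epsilon>) C"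
      unfolding dyadic_Ap_def p_def[symmetric]
    proof (intro allI)
      fix T k and x :: "real^'n"
      let ?Q = "dcube T k x"
      obtain W S L where c: "0 < W" "0 < S" "0 < L"
        "(\<integral>\<^sup>+y\<in>?Q. ennreal (w y) \<partial>lborel) = ennreal W"
        "(\<integral>\<^sup>+y\<in>?Q. ennreal (w y powr (- 1 / (q - 1))) \<partial>lborel) = ennreal S"
        "emeasure lborel ?Q = ennreal L" "W / L * (S / L) powr (q - 1) \<le> A"
        by (rule dyadic_ApE[OF Ap wm w q])
      obtain U V L' where d: "0 < U" "0 < V" 
        "(\<integral>\<^sup>+y\<in>?Q. ennreal (a y powr \<delta>) \<partial>lborel) = ennreal U"
        "(\<integral>\<^sup>+y\<in>?Q. ennreal ((a y powr \<delta>) powr (- 1 / (q - 1))) \<partial>lborel) = ennreal V"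
        "emeasure lborel ?Q = ennreal L'" "0 < L'" "U / L' * (V / L') powr (q - 1) \<le> B"
        by (rule dyadic_ApE[OF Bp adm ad q])
      have L': "L' = L" using c(3,6) d(5,6) by simp
      define m where "m = W / L"
      define s where "s = S / L"
      define u where "u = U / L"
      define v where "v = V / L"
      have pos: "0 < m" "0 < s" "0 < u" "0 < v" using c d by (auto simp: m_def s_def u_def v_def)
      have ms: "m * s powr (q - 1) \<le> A" and uv: "u * v powr (q - 1) \<le> B"
        using c(7) d(7) L' by (auto simp: m_def s_def u_def v_def)
      have aw: "davg lborel ?Q (\<lambda>y. ennreal (w y powr (1 + \<eta>))) \<le> ennreal (2 * m powr (1 + \<eta>))"
      proof -
        have "davg lborel ?Q (\<lambda>y. ennreal (w y powr (1 + \<eta>))) \<le> ennreal (2 * (W / L) powr \<eta> * W) / ennreal L"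
          unfolding davg_def c(6) by (intro divide_right_mono_ennreal) (use RHw c in \<open>auto simp: reverse_Holder_exponent_def\<close>)
        also have "\<dots> = ennreal (2 * m powr (1 + \<eta>))"
          using c(1,3) pos by (simp add: divide_ennreal m_def powr_add mult.commute)
        finally show ?thesis .
      qed
      have as: "davg lborel ?Q (\<lambda>y. ennreal (\<sigma> y powr (1 + \<theta>))) \<le> ennreal (2 * s powr (1 + \<theta>))"
      proof -
        have "davg lborel ?Q (\<lambda>y. ennreal (\<sigma> y powr (1 + \<theta>))) \<le> ennreal (2 * (S / L) powr \<theta> * S) / ennreal L"
          unfolding davg_def c(6) by (intro divide_right_mono_ennreal) (use RHs c in \<open>auto simp: reverse_Holder_exponent_def \<sigma>_def\<close>)
        also have "\<dots> = ennreal (2 * s powr (1 + \<theta>))"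
          using c(2,3) pos by (simp add: divide_ennreal s_def powr_add mult.commute)
        finally show ?thesis .
      qed
      have au: "davg lborel ?Q (\<lambda>y. ennreal (a y powr \<delta>)) \<le> ennreal u"
        using d c(3) L' by (simp add: davg_def divide_ennreal u_def)
      have av: "davg lborel ?Q (\<lambda>y. ennreal ((a y powr \<delta>) powr (- 1 / (q - 1)))) \<le> ennreal v"
        using d c(3) L' by (simp add: davg_def divide_ennreal v_def)
      have 1: "davg lborel ?Q (\<lambda>y. ennreal (w y * a y powr \<epsilon>)) \<le> ennreal ((2 * m powr (1 + \<eta>)) powr \<alpha> * u powr \<beta>)"
      proof -
        have "w y * a y powr \<epsilon> = (w y powr (1 + \<eta>)) powr \<alpha> * (a y powr \<delta>) powr \<beta>" for y
          using w[of y] \<eta> \<delta> by (simp add: powr_powr \<alpha>_def \<beta>_def)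
        then show ?thesis
          by (simp only:, intro davg_Holder) (use w a pos \<alpha>\<beta> aw au in \<open>auto simp: less_imp_neq[symmetric]\<close>)
      qed
      have 2: "davg lborel ?Q (\<lambda>y. ennreal ((w y * a y powr \<epsilon>) powr (- 1 / (p - 1))))
          \<le> ennreal ((2 * s powr (1 + \<theta>)) powr \<alpha>' * v powr \<beta>')"
      proof -
        have eq: "(w y * a y powr \<epsilon>) powr (- 1 / (p - 1)) = (\<sigma> y powr (1 + \<theta>)) powr \<alpha>' * ((a y powr \<delta>) powr (- 1 / (q - 1))) powr \<beta>'" for y
        proof -
          have "(- 1 / (q - 1)) * ((1 + \<theta>) * \<alpha>') = - 1 / (p - 1)"
            using q p \<theta> by (simp add: \<alpha>'_def divide_simps)
          moreover have "\<delta> * (- 1 / (q - 1) * \<beta>') = \<epsilon> * (- 1 / (p - 1))"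
            using q p \<delta> by (simp add: \<beta>'_def divide_simps)
          ultimately show ?thesis
            by (simp only: powr_mult powr_powr \<sigma>_def mult.assoc)
        qed
        show ?thesis unfolding eq
          by (intro davg_Holder) (use \<sigma> a pos \<alpha>\<beta>' as av in \<open>auto simp: less_imp_neq[symmetric]\<close>)
      qed
      have "davg lborel ?Q (\<lambda>y. ennreal (w y * a y powr \<epsilon>)) *
         epowr (davg lborel ?Q (\<lambda>y. ennreal ((w y * a y powr \<epsilon>) powr (- 1 / (p - 1))))) (p - 1)
         \<le> ennreal ((2 * m powr (1 + \<eta>)) powr \<alpha> * u powr \<beta>) *
           epowr (ennreal ((2 * s powr (1 + \<theta>)) powr \<alpha>' * v powr \<beta>')) (p - 1)"
        using p by (intro mult_mono 1 epowr_mono 2) auto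
      also have "\<dots> = ennreal (((2 * m powr (1 + \<eta>)) powr \<alpha> * u powr \<beta>) * ((2 * s powr (1 + \<theta>)) powr \<alpha>' * v powr \<beta>') powr (p - 1))"
        by (subst epowr_ennreal, simp, subst ennreal_mult[symmetric]) auto
      also have "\<dots> \<le> ennreal C"
      proof (rule ennreal_leI)
        have "(1 + \<eta>) * \<alpha> = 1" using \<eta> by (simp add: \<alpha>_def)
        then have f1: "(2 * m powr (1 + \<eta>)) powr \<alpha> = 2 powr \<alpha> * m"
          using pos by (simp add: powr_mult powr_powr)
        have g1: "(1 + \<theta>) * \<alpha>' * (p - 1) = q - 1" using p \<theta> by (simp add: \<alpha>'_def divide_simps)
        have g2: "\<beta>' * (p - 1) = \<beta> * (q - 1)" using p by (simp add: \<beta>'_def \<beta>_def divide_simps)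
        have g3: "(q - 1) * \<beta> = \<beta> * (q - 1)" by (rule mult.commute)
        have f2: "((2 * s powr (1 + \<theta>)) powr \<alpha>' * v powr \<beta>') powr (p - 1) = 2 powr (\<alpha>' * (p - 1)) * s powr (q - 1) * (v powr (q - 1)) powr \<beta>"
          by (simp only: powr_mult powr_powr g1 g2 g3)
        have "\<alpha>' * (p - 1) \<le> 1 * (q - 1)"
          using \<alpha>\<beta>' p \<epsilon> by (intro mult_mono) (auto simp: p_def)
        then have h2: "2 powr (\<alpha>' * (p - 1)) \<le> (2::real) powr (q - 1)" by simp
        have h1: "2 powr \<alpha> \<le> (2::real)" using \<alpha>\<beta> powr_mono[of \<alpha> 1 "2::real"] by simp
        have h3: "(u * v powr (q - 1)) powr \<beta> \<le> max 1 B"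
        proof -
          have "(u * v powr (q - 1)) powr \<beta> \<le> (max 1 B) powr \<beta>"
            using uv pos \<alpha>\<beta> by (intro powr_mono2) auto
          also have "\<dots> \<le> (max 1 B) powr 1" using \<alpha>\<beta> by (intro powr_mono) auto
          finally show ?thesis by simp
        qed
        have "((2 * m powr (1 + \<eta>)) powr \<alpha> * u powr \<beta>) * ((2 * s powr (1 + \<theta>)) powr \<alpha>' * v powr \<beta>') powr (p - 1)
          = 2 powr \<alpha> * 2 powr (\<alpha>' * (p - 1)) * (m * s powr (q - 1)) * (u * v powr (q - 1)) powr \<beta>"
          unfolding f1 f2 powr_mult[of u] by (simp only: ac_simps)
        also have "\<dots> \<le> C"
          unfolding C_def using A pos by (intro mult_mono h1 h2 h3 ms) auto
        finally show "((2 * m powr (1 + \<eta>)) powr \<alpha> * u powr \<beta>) * ((2 * s powr (1 + \<theta>)) powr \<alpha>' * v powr \<beta>') powr (p - 1) \<le> C" .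
      qed
      finally show "davg lborel ?Q (\<lambda>y. ennreal (w y * a y powr \<epsilon>)) *
         epowr (davg lborel ?Q (\<lambda>y. ennreal ((w y * a y powr \<epsilon>) powr (- 1 / (p - 1))))) (p - 1) \<le> ennreal C" .
    qed
  qed
qed

section \<open>Cubes of the adjacent grids around balls\<close>

text \<open>Endpoints of the unshifted and of the shifted grid are at least a third of a cell apart, so an
  interval shorter than that cannot contain endpoints of both.\<close>

lemma floor_third:
  assumes \<rho>: "0 \<le> \<rho>" "\<rho> < 1 / 6" and c: "c = 1 / 3 \<or> c = - 1 / 3"
  shows "\<lfloor>s - \<rho>\<rfloor> = \<lfloor>s + \<rho>\<rfloor> \<or> \<lfloor>s - \<rho> - c\<rfloor> = \<lfloor>s + \<rho> - (c::real)\<rfloor>"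
proof (rule ccontr)
  assume "\<not> ?thesis"
  then have "\<lfloor>s - \<rho>\<rfloor> < \<lfloor>s + \<rho>\<rfloor>" "\<lfloor>s - \<rho> - c\<rfloor> < \<lfloor>s + \<rho> - c\<rfloor>"
    using \<rho> floor_mono[of "s - \<rho>" "s + \<rho>"] floor_mono[of "s - \<rho> - c" "s + \<rho> - c"] by auto
  then have a: "s - \<rho> < of_int \<lfloor>s + \<rho>\<rfloor>" "s - \<rho> - c < of_int \<lfloor>s + \<rho> - c\<rfloor>"
    by (simp_all add: floor_less_iff)
  have b: "of_int \<lfloor>s + \<rho>\<rfloor> \<le> s + \<rho>" "of_int \<lfloor>s + \<rho> - c\<rfloor> \<le> s + \<rho> - c" by simp_all
  define j where "j = \<lfloor>s + \<rho> - c\<rfloor> - \<lfloor>s + \<rho>\<rfloor>"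
  have "of_int j + c < 1 / 3 \<and> - (1 / 3) < of_int j + c"
    using a b \<rho> unfolding j_def of_int_diff by linarith
  then have "\<bar>of_int j + c\<bar> < 1 / 3" by linarith
  then have "of_int j < (1::real)" "(-1::real) < of_int j" using c by linarith+
  then have "j = 0" by linarith
  with \<open>\<bar>of_int j + c\<bar> < 1 / 3\<close> c show False by auto
qed

lemma dyadic_scale:
  assumes "0 < (r::real)" obtains k where "r < 2 powi (-k)" "2 powi (-k) \<le> 2 * r"
proof -
  define m where "m = \<lfloor>log 2 r\<rfloor> + 1"
  have p: "(2::real) powi m = 2 powr (of_int m)" by (simp add: powr_real_of_int')
  have "r = 2 powr (log 2 r)" using assms by simp
  also have "\<dots> < 2 powr (of_int m)"
  proof (rule powr_less_mono)
    show "log 2 r < of_int m" unfolding m_def by linarith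
  qed simp
  finally have 1: "r < 2 powi m" by (simp add: p)
  have "(2::real) powr (of_int m) \<le> 2 powr (log 2 r + 1)" by (intro powr_mono) (auto simp: m_def)
  also have "\<dots> = 2 * r" using assms by (simp add: powr_add)
  finally have 2: "2 powi m \<le> 2 * r" by (simp add: p)
  show ?thesis by (rule that[of "- m"]) (use 1 2 in auto)
qed

text \<open>The one third trick, in each coordinate separately: \<open>T\<close> collects the coordinates in which the
  unshifted grid cuts the given cube.\<close>

lemma adjacent_dcube:
  fixes x :: "real^'n::finite"
  assumes r: "0 < r"
  obtains T k where "{y. \<forall>i. \<bar>y $ i - x $ i\<bar> \<le> r} \<subseteq> dcube T k x" "2 powi (-k) \<le> 12 * r"
proof -
  obtain k where k: "6 * r < 2 powi (-k)" "2 powi (-k) \<le> 2 * (6 * r)"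
    using dyadic_scale[of "6 * r"] r by auto
  define \<rho> where "\<rho> = 2 powi k * r"
  have "6 * \<rho> < 2 powi k * 2 powi (-k)" unfolding \<rho>_def using k(1) by simp
  then have \<rho>: "0 \<le> \<rho>" "\<rho> < 1 / 6" using r by (auto simp: \<rho>_def power_int_minus)
  define c :: real where "c = (-1) powi k / 3"
  have c: "c = 1 / 3 \<or> c = - 1 / 3" by (auto simp: c_def power_int_minus_left)
  define T where "T = {i. \<lfloor>2 powi k * x $ i - \<rho>\<rfloor> \<noteq> \<lfloor>2 powi k * x $ i + \<rho>\<rfloor>}"
  have cell: "dcell (i \<in> T) k (y $ i) = dcell (i \<in> T) k (x $ i)" if y: "\<bar>y $ i - x $ i\<bar> \<le> r" for y i
  proof -
    define d where "d = (if i \<in> T then c else 0)"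
    have e: "\<lfloor>2 powi k * x $ i - \<rho> - d\<rfloor> = \<lfloor>2 powi k * x $ i + \<rho> - d\<rfloor>"
      using floor_third[OF \<rho> c, of "2 powi k * x $ i"] by (auto simp: T_def d_def)
    have "\<bar>2 powi k * y $ i - 2 powi k * x $ i\<bar> \<le> \<rho>"
      unfolding \<rho>_def right_diff_distrib[symmetric] abs_mult using y by (simp add: mult_left_mono)
    then have "\<lfloor>2 powi k * x $ i - \<rho> - d\<rfloor> \<le> \<lfloor>2 powi k * y $ i - d\<rfloor>" "\<lfloor>2 powi k * y $ i - d\<rfloor> \<le> \<lfloor>2 powi k * x $ i + \<rho> - d\<rfloor>"
      by (auto intro!: floor_mono simp: abs_le_iff)
    moreover have "\<lfloor>2 powi k * x $ i - \<rho> - d\<rfloor> \<le> \<lfloor>2 powi k * x $ i - d\<rfloor>" "\<lfloor>2 powi k * x $ i - d\<rfloor> \<le> \<lfloor>2 powi k * x $ i + \<rho> - d\<rfloor>"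
      using \<rho> by (auto intro!: floor_mono)
    ultimately have "\<lfloor>2 powi k * y $ i - d\<rfloor> = \<lfloor>2 powi k * x $ i - d\<rfloor>" using e by linarith
    then show ?thesis by (cases "i \<in> T") (simp_all add: dcell_def d_def c_def)
  qed
  show ?thesis
  proof (rule that[of T k])
    show "{y. \<forall>i. \<bar>y $ i - x $ i\<bar> \<le> r} \<subseteq> dcube T k x"
      unfolding dcube_def using cell by blast
  qed (use k in simp)
qed

lemma ball_in_dcube:
  obtains T k where "ball (0::real^'n::finite) R \<subseteq> dcube T k 0"
proof -
  obtain T k where "{y. \<forall>i. \<bar>y $ i - (0::real^'n) $ i\<bar> \<le> max R 1} \<subseteq> dcube T k 0"
    by (rule adjacent_dcube[of "max R 1" "0::real^'n"]) auto
  moreover have "ball (0::real^'n) R \<subseteq> {y. \<forall>i. \<bar>y $ i - (0::real^'n) $ i\<bar> \<le> max R 1}"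
  proof safe
    fix y :: "real^'n" and i assume "y \<in> ball 0 R"
    then show "\<bar>y $ i - 0 $ i\<bar> \<le> max R 1" using component_le_norm_cart[of y i] by simp
  qed
  ultimately show ?thesis using that by blast
qed

section \<open>Muckenhoupt weights on dyadic cubes\<close>

text \<open>A half-open dyadic cube differs from a closed cube by a null set.\<close>

lemma Muckenhoupt_dyadic:
  fixes w w' :: "real^'n::finite \<Rightarrow> real"
  assumes M: "Muckenhoupt q w" and [measurable]: "w' \<in> borel_measurable borel"
    and eq: "AE x in lebesgue. w x = w' x" and q: "1 < q"
  obtains A where "dyadic_Ap q w' A"
proof -
  define s where "s = (SUP Q \<in> {cube c r | (c::real^'n) r. 0 < r}.
        ennavg Q w * epowr (ennavg Q (\<lambda>x. w x powr (- 1 / (q - 1)))) (q - 1))"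
  have "s < \<infinity>" using M by (simp add: s_def Muckenhoupt_def)
  then obtain A where A: "s = ennreal A" by (cases s) auto
  have avg: "davg lborel (dcube T k x) (\<lambda>y. ennreal (u' y)) \<le> ennavg (cube (dcorner T k x) (2 powi (-k))) u"
    if [measurable]: "u' \<in> borel_measurable borel" and u: "AE x in lebesgue. u x = u' x" for T k x and u u' :: "real^'n \<Rightarrow> real"
  proof -
    have [measurable]: "cube (dcorner T k x) (2 powi (-k)) \<in> sets borel" by (simp add: cube_def)
    have "(\<integral>\<^sup>+y\<in>dcube T k x. ennreal (u' y) \<partial>lborel) \<le> (\<integral>\<^sup>+y\<in>cube (dcorner T k x) (2 powi (-k)). ennreal (u' y) \<partial>lborel)"
      using dcube_boxes(2)[of T k x] by (intro nn_integral_mono) (auto simp: indicator_def)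
    also have "\<dots> = (\<integral>\<^sup>+y\<in>cube (dcorner T k x) (2 powi (-k)). ennreal (u' y) \<partial>lebesgue)"
      by (simp add: nn_integral_completion)
    also have "\<dots> = (\<integral>\<^sup>+y\<in>cube (dcorner T k x) (2 powi (-k)). ennreal (u y) \<partial>lebesgue)"
      by (rule nn_integral_cong_AE) (use u in \<open>eventually_elim, simp\<close>)
    finally have "davg lborel (dcube T k x) (\<lambda>y. ennreal (u' y)) \<le> (\<integral>\<^sup>+y\<in>cube (dcorner T k x) (2 powi (-k)). ennreal (u y) \<partial>lebesgue) / emeasure lborel (dcube T k x)"
      unfolding davg_def by (rule divide_right_mono_ennreal)
    also have "emeasure lborel (dcube T k x) = emeasure lebesgue (cube (dcorner T k x) (2 powi (-k)))"
      by (simp add: emeasure_dcube emeasure_cube)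
    finally show ?thesis by (simp add: ennavg_def)
  qed
  show ?thesis
  proof (rule that[of A], unfold dyadic_Ap_def, intro allI)
    fix T k and x :: "real^'n"
    let ?C = "cube (dcorner T k x) (2 powi (-k))"
    have "davg lborel (dcube T k x) (\<lambda>y. ennreal (w' y)) * epowr (davg lborel (dcube T k x) (\<lambda>y. ennreal (w' y powr (- 1 / (q - 1))))) (q - 1)
      \<le> ennavg ?C w * epowr (ennavg ?C (\<lambda>x. w x powr (- 1 / (q - 1)))) (q - 1)"
      using q by (intro mult_mono epowr_mono avg) (use eq in \<open>auto elim!: eventually_mono\<close>)
    also have "\<dots> \<le> s"
      unfolding s_def by (rule SUP_upper) (auto intro!: exI[of _ "dcorner T k x"] exI[of _ "2 powi (-k)"])
    finally show "davg lborel (dcube T k x) (\<lambda>y. ennreal (w' y)) * epowr (davg lborel (dcube T k x) (\<lambda>y. ennreal (w' y powr (- 1 / (q - 1))))) (q - 1) \<le> ennreal A"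
      by (simp add: A)
  qed
qed

section \<open>Grand Lebesgue spaces\<close>

abbreviation grand_integral ::
    "real \<Rightarrow> (real^'n::finite \<Rightarrow> real) \<Rightarrow> (real^'n \<Rightarrow> real) \<Rightarrow> (real^'n \<Rightarrow> ennreal) \<Rightarrow> real \<Rightarrow> ennreal" where
  "grand_integral q a w h \<epsilon> \<equiv> (\<integral>\<^sup>+x. epowr (h x) (q - \<epsilon>) * ennreal (w x * a x powr \<epsilon>) \<partial>lborel)"

text \<open>Finiteness of the grand norm with the outer roots removed and with \<open>\<epsilon>\<close> restricted to
  \<open>(0, e)\<close>. Since the roots are of orders between \<open>1\<close> and \<open>q\<close>, they do not affect boundedness.\<close>

definition grand_bounded :: "real \<Rightarrow> real \<Rightarrow> (real^'n::finite \<Rightarrow> real) \<Rightarrow> (real^'n \<Rightarrow> real) \<Rightarrow> (real^'n \<Rightarrow> ennreal) \<Rightarrow> bool" where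
  "grand_bounded e q a w h \<longleftrightarrow> (\<exists>B::real. \<forall>\<epsilon>. 0 < \<epsilon> \<longrightarrow> \<epsilon> < e \<longrightarrow>
     ennreal \<epsilon> * grand_integral q a w h \<epsilon> \<le> ennreal B)"

lemma grand_Lebesgue_iff:
  fixes w a w' a' g :: "real^'n::finite \<Rightarrow> real"
  assumes g: "g \<in> borel_measurable lebesgue" and [measurable]: "h \<in> borel_measurable borel"
      "w' \<in> borel_measurable borel" "a' \<in> borel_measurable borel"
    and eq: "AE x in lebesgue. h x = ennreal \<bar>g x\<bar>" "AE x in lebesgue. w x = w' x" "AE x in lebesgue. a x = a' x"
    and pos: "\<And>x. 0 < w' x" and q: "1 < q"
  shows "g \<in> grand_Lebesgue q a w \<longleftrightarrow> grand_bounded (q - 1) q a' w' h"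
proof -
  define J where "J \<epsilon> = (\<integral>\<^sup>+x. epowr (h x) (q - \<epsilon>) * ennreal (w' x * a' x powr \<epsilon>) \<partial>lborel)" for \<epsilon>
  have J: "(\<integral>\<^sup>+x. ennreal (\<bar>g x\<bar> powr (q - \<epsilon>) * w x * a x powr \<epsilon>) \<partial>lebesgue) = J \<epsilon>" for \<epsilon>
  proof -
    have "(\<integral>\<^sup>+x. ennreal (\<bar>g x\<bar> powr (q - \<epsilon>) * w x * a x powr \<epsilon>) \<partial>lebesgue)
       = (\<integral>\<^sup>+x. epowr (h x) (q - \<epsilon>) * ennreal (w' x * a' x powr \<epsilon>) \<partial>lebesgue)"
    proof (rule nn_integral_cong_AE)
      show "AE x in lebesgue. ennreal (\<bar>g x\<bar> powr (q - \<epsilon>) * w x * a x powr \<epsilon>) = epowr (h x) (q - \<epsilon>) * ennreal (w' x * a' x powr \<epsilon>)"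
        using eq
      proof eventually_elim
        case (elim x)
        then show ?case using pos[of x] by (simp add: ennreal_mult[symmetric] mult.assoc)
      qed
    qed
    then show ?thesis by (simp add: J_def nn_integral_completion)
  qed
  have "grand_norm q a w g < \<infinity> \<longleftrightarrow> (\<exists>B::real. \<forall>\<epsilon>. 0 < \<epsilon> \<longrightarrow> \<epsilon> < q - 1 \<longrightarrow> ennreal \<epsilon> * J \<epsilon> \<le> ennreal B)"
  proof
    assume "grand_norm q a w g < \<infinity>"
    then obtain N where N: "grand_norm q a w g = ennreal N" "0 \<le> N" by (cases "grand_norm q a w g") auto
    show "\<exists>B::real. \<forall>\<epsilon>. 0 < \<epsilon> \<longrightarrow> \<epsilon> < q - 1 \<longrightarrow> ennreal \<epsilon> * J \<epsilon> \<le> ennreal B"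
    proof (intro exI[of _ "max 1 N powr q"] allI impI)
      fix \<epsilon> assume \<epsilon>: "0 < \<epsilon>" "\<epsilon> < q - 1"
      have "epowr (ennreal \<epsilon> * J \<epsilon>) (1 / (q - \<epsilon>)) \<le> ennreal N"
        unfolding N(1)[symmetric] grand_norm_def J using \<epsilon> by (intro SUP_upper2[of \<epsilon>]) auto
      then have "epowr (epowr (ennreal \<epsilon> * J \<epsilon>) (1 / (q - \<epsilon>))) (q - \<epsilon>) \<le> epowr (ennreal N) (q - \<epsilon>)"
        using \<epsilon> by (intro epowr_mono) auto
      also have "epowr (epowr (ennreal \<epsilon> * J \<epsilon>) (1 / (q - \<epsilon>))) (q - \<epsilon>) = ennreal \<epsilon> * J \<epsilon>"
        using \<epsilon> by (simp add: epowr_epowr)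
      also have "epowr (ennreal N) (q - \<epsilon>) = ennreal (N powr (q - \<epsilon>))" using N by simp
      also have "\<dots> \<le> ennreal (max 1 N powr q)"
      proof (rule ennreal_leI)
        have "N powr (q - \<epsilon>) \<le> max 1 N powr (q - \<epsilon>)" using N \<epsilon> by (intro powr_mono2) auto
        also have "\<dots> \<le> max 1 N powr q" using \<epsilon> by (intro powr_mono) auto
        finally show "N powr (q - \<epsilon>) \<le> max 1 N powr q" .
      qed
      finally show "ennreal \<epsilon> * J \<epsilon> \<le> ennreal (max 1 N powr q)" .
    qed
  next
    assume "\<exists>B::real. \<forall>\<epsilon>. 0 < \<epsilon> \<longrightarrow> \<epsilon> < q - 1 \<longrightarrow> ennreal \<epsilon> * J \<epsilon> \<le> ennreal B"
    then obtain B where B: "\<And>\<epsilon>. 0 < \<epsilon> \<Longrightarrow> \<epsilon> < q - 1 \<Longrightarrow> ennreal \<epsilon> * J \<epsilon> \<le> ennreal B" by blast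
    have "grand_norm q a w g \<le> ennreal (max 1 B)"
      unfolding grand_norm_def J
    proof (rule SUP_least)
      fix \<epsilon> assume "\<epsilon> \<in> {0<..<q - 1}"
      then have \<epsilon>: "0 < \<epsilon>" "\<epsilon> < q - 1" by auto
      have "ennreal \<epsilon> * J \<epsilon> \<le> ennreal (max 1 B)" using B[OF \<epsilon>] by (rule order_trans) (simp add: ennreal_leI)
      then have "epowr (ennreal \<epsilon> * J \<epsilon>) (1 / (q - \<epsilon>)) \<le> epowr (ennreal (max 1 B)) (1 / (q - \<epsilon>))"
        using \<epsilon> by (intro epowr_mono) auto
      also have "\<dots> = ennreal (max 1 B powr (1 / (q - \<epsilon>)))" by simp
      also have "\<dots> \<le> ennreal (max 1 B powr 1)"
        using \<epsilon> by (intro ennreal_leI powr_mono) auto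
      finally show "epowr (ennreal \<epsilon> * J \<epsilon>) (1 / (q - \<epsilon>)) \<le> ennreal (max 1 B)" by simp
    qed
    then show "grand_norm q a w g < \<infinity>" by (simp add: le_less_trans)
  qed
  then show ?thesis using g by (simp add: grand_Lebesgue_def grand_bounded_def J_def)
qed

lemma grand_bounded_mono:
  assumes "grand_bounded e q a w h" "AE x in lborel. h' x \<le> h x" "e \<le> q"
  shows "grand_bounded e q a w h'"
proof -
  obtain B :: real where B: "\<And>\<epsilon>. 0 < \<epsilon> \<Longrightarrow> \<epsilon> < e \<Longrightarrow> ennreal \<epsilon> * grand_integral q a w h \<epsilon> \<le> ennreal B"
    using assms(1) unfolding grand_bounded_def by blast
  show ?thesis
    unfolding grand_bounded_def
  proof (intro exI[of _ B] allI impI)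
    fix \<epsilon> assume \<epsilon>: "0 < \<epsilon>" "\<epsilon> < e"
    have "grand_integral q a w h' \<epsilon> \<le> grand_integral q a w h \<epsilon>"
      using assms(2) by (intro nn_integral_mono_AE, eventually_elim) (use \<epsilon> assms(3) in \<open>auto intro!: mult_right_mono epowr_mono\<close>)
    then show "ennreal \<epsilon> * grand_integral q a w h' \<epsilon> \<le> ennreal B"
      using B[OF \<epsilon>] by (meson mult_left_mono order_trans zero_le)
  qed
qed

lemma epowr_add_le:
  assumes "0 < p" "p \<le> q"
  shows "epowr (s + t) p \<le> ennreal (2 powr q) * (epowr s p + epowr t p)"
proof -
  have "s + t \<le> 2 * max s t" by (simp add: mult_2 add_mono)
  then have "epowr (s + t) p \<le> epowr (2 * max s t) p" using assms by (intro epowr_mono) auto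
  also have "\<dots> = epowr 2 p * epowr (max s t) p" by (rule epowr_mult)
  also have "\<dots> \<le> ennreal (2 powr q) * (epowr s p + epowr t p)"
  proof (rule mult_mono)
    have "epowr 2 p = ennreal (2 powr p)" using epowr_ennreal[of 2 p] by (simp del: epowr_ennreal)
    then show "epowr 2 p \<le> ennreal (2 powr q)" using assms by (auto intro!: ennreal_leI powr_mono)
    show "epowr (max s t) p \<le> epowr s p + epowr t p" by (simp add: max_def add_increasing add_increasing2)
  qed auto
  finally show ?thesis .
qed

lemma grand_bounded_add:
  assumes [measurable]: "h \<in> borel_measurable borel" "h' \<in> borel_measurable borel"
      "w \<in> borel_measurable borel" "a \<in> borel_measurable borel"
    and "grand_bounded e q a w h" "grand_bounded e q a w h'" "e < q"
  shows "grand_bounded e q a w (\<lambda>x. h x + h' x)"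
proof -
  obtain B :: real where B: "\<And>\<epsilon>. 0 < \<epsilon> \<Longrightarrow> \<epsilon> < e \<Longrightarrow> ennreal \<epsilon> * grand_integral q a w h \<epsilon> \<le> ennreal B"
    using assms(5) unfolding grand_bounded_def by blast
  obtain B' :: real where B': "\<And>\<epsilon>. 0 < \<epsilon> \<Longrightarrow> \<epsilon> < e \<Longrightarrow> ennreal \<epsilon> * grand_integral q a w h' \<epsilon> \<le> ennreal B'"
    using assms(6) unfolding grand_bounded_def by blast
  show ?thesis
    unfolding grand_bounded_def
  proof (intro exI[of _ "2 powr q * (max 0 B + max 0 B')"] allI impI)
    fix \<epsilon> assume \<epsilon>: "0 < \<epsilon>" "\<epsilon> < e"
    let ?v = "\<lambda>x. ennreal (w x * a x powr \<epsilon>)"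
    have "(\<integral>\<^sup>+x. epowr (h x + h' x) (q - \<epsilon>) * ?v x \<partial>lborel) \<le> (\<integral>\<^sup>+x. ennreal (2 powr q) * (epowr (h x) (q - \<epsilon>) * ?v x + epowr (h' x) (q - \<epsilon>) * ?v x) \<partial>lborel)"
      unfolding distrib_right[symmetric] mult.assoc[symmetric] using \<epsilon> assms(7)
      by (intro nn_integral_mono mult_right_mono epowr_add_le) auto
    also have "\<dots> = ennreal (2 powr q) * ((\<integral>\<^sup>+x. epowr (h x) (q - \<epsilon>) * ?v x \<partial>lborel) + (\<integral>\<^sup>+x. epowr (h' x) (q - \<epsilon>) * ?v x \<partial>lborel))"
      by (simp add: nn_integral_cmult nn_integral_add)
    finally have "ennreal \<epsilon> * (\<integral>\<^sup>+x. epowr (h x + h' x) (q - \<epsilon>) * ?v x \<partial>lborel) \<le> ennreal \<epsilon> * (ennreal (2 powr q) * ((\<integral>\<^sup>+x. epowr (h x) (q - \<epsilon>) * ?v x \<partial>lborel) + (\<integral>\<^sup>+x. epowr (h' x) (q - \<epsilon>) * ?v x \<partial>lborel)))"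
      by (rule mult_left_mono) simp
    also have "\<dots> = ennreal (2 powr q) * (ennreal \<epsilon> * (\<integral>\<^sup>+x. epowr (h x) (q - \<epsilon>) * ?v x \<partial>lborel) + ennreal \<epsilon> * (\<integral>\<^sup>+x. epowr (h' x) (q - \<epsilon>) * ?v x \<partial>lborel))"
      by (simp add: distrib_left ac_simps)
    also have "\<dots> \<le> ennreal (2 powr q) * (ennreal (max 0 B) + ennreal (max 0 B'))"
      by (intro mult_left_mono add_mono order_trans[OF B[OF \<epsilon>]] order_trans[OF B'[OF \<epsilon>]] ennreal_leI) auto
    also have "\<dots> = ennreal (2 powr q * (max 0 B + max 0 B'))"
      by (subst ennreal_plus[symmetric]) (auto simp: ennreal_mult[symmetric] simp del: ennreal_plus)
    finally show "ennreal \<epsilon> * (\<integral>\<^sup>+x. epowr (h x + h' x) (q - \<epsilon>) * ?v x \<partial>lborel) \<le> ennreal (2 powr q * (max 0 B + max 0 B'))" .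
  qed
qed

lemma grand_bounded_sum:
  assumes "finite I" "\<And>i. i \<in> I \<Longrightarrow> h i \<in> borel_measurable borel"
      "w \<in> borel_measurable borel" "a \<in> borel_measurable borel"
    and "\<And>i. i \<in> I \<Longrightarrow> grand_bounded e q a w (h i)" "e < q"
  shows "grand_bounded e q a w (\<lambda>x. \<Sum>i\<in>I. h i x)"
  using assms
proof (induction I)
  case empty
  then show ?case unfolding grand_bounded_def by (auto intro!: exI[of _ 0])
next
  case (insert i I)
  then have "grand_bounded e q a w (\<lambda>x. h i x + (\<Sum>i\<in>I. h i x))"
    by (intro grand_bounded_add borel_measurable_sum) auto
  then show ?case using insert by simp
qed

text \<open>Multiplication by a natural number is repeated addition.\<close>

lemma grand_bounded_cmult:
  assumes [measurable]: "h \<in> borel_measurable borel" "w \<in> borel_measurable borel" "a \<in> borel_measurable borel"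
    and "grand_bounded e q a w h" "e < q"
  shows "grand_bounded e q a w (\<lambda>x. ennreal c * h x)"
proof -
  obtain m :: nat where m: "c \<le> real m" using real_arch_simple by blast
  have "grand_bounded e q a w (\<lambda>x. \<Sum>i\<in>{..<m}. h x)"
    using assms by (intro grand_bounded_sum) auto
  then show ?thesis
  proof (rule grand_bounded_mono)
    show "AE x in lborel. ennreal c * h x \<le> (\<Sum>i<m. h x)"
      using m by (auto intro!: mult_right_mono simp: ennreal_of_nat_eq_real_of_nat ennreal_leI)
  qed (use assms in auto)
qed

text \<open>Only small \<open>\<epsilon>\<close> matter. With \<open>k = h / a\<close> the integral is that of \<open>k powr (q - \<epsilon>)\<close> over the finite
  measure \<open>a powr q * w\<close>, and \<open>k powr (q - \<epsilon>) \<le> 1 + k powr (q - \<epsilon>')\<close> for \<open>\<epsilon>' \<le> \<epsilon>\<close>.\<close>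

lemma grand_bounded_extend:
  assumes [measurable]: "h \<in> borel_measurable borel" "w \<in> borel_measurable borel" "a \<in> borel_measurable borel"
    and w: "\<And>x. 0 < w x" and a: "\<And>x. 0 < a x"
    and fin: "(\<integral>\<^sup>+x. ennreal (a x powr q * w x) \<partial>lborel) < \<infinity>" and e: "0 < e" "e < q"
    and gb: "grand_bounded e q a w h" and q: "1 < q"
  shows "grand_bounded (q - 1) q a w h"
proof -
  obtain B :: real where B: "\<And>\<epsilon>. 0 < \<epsilon> \<Longrightarrow> \<epsilon> < e \<Longrightarrow> ennreal \<epsilon> * grand_integral q a w h \<epsilon> \<le> ennreal B"
    using gb unfolding grand_bounded_def by blast
  define e' where "e' = e / 2"
  have e': "0 < e'" "e' < e" "e' < q" using e by (auto simp: e'_def)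
  define I where "I = (\<integral>\<^sup>+x. epowr (h x) (q - e') * ennreal (w x * a x powr e') \<partial>lborel)"
  have "ennreal e' * I < \<infinity>" using B[OF e'(1,2)] unfolding I_def by (rule le_less_trans) simp
  then have I: "I < \<infinity>" using e' by (auto simp: ennreal_mult_less_top)
  define F where "F = (\<integral>\<^sup>+x. ennreal (a x powr q * w x) \<partial>lborel)"
  have "ennreal q * (F + I) < \<infinity>" using I fin by (simp add: F_def ennreal_mult_less_top)
  then obtain B2 where B2: "ennreal q * (F + I) = ennreal B2" by (cases "ennreal q * (F + I)") auto
  show ?thesis
    unfolding grand_bounded_def
  proof (intro exI[of _ "max B B2"] allI impI)
    fix \<epsilon> assume \<epsilon>: "0 < \<epsilon>" "\<epsilon> < q - 1"
    show "ennreal \<epsilon> * grand_integral q a w h \<epsilon> \<le> ennreal (max B B2)"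
    proof (cases "\<epsilon> < e")
      case True
      from B[OF \<epsilon>(1) this] show ?thesis by (rule order_trans) (simp add: ennreal_leI)
    next
      case False
      have pt: "epowr (h x) (q - \<epsilon>) * ennreal (w x * a x powr \<epsilon>)
          \<le> ennreal (a x powr q * w x) + epowr (h x) (q - e') * ennreal (w x * a x powr e')" for x
      proof (cases "h x \<le> ennreal (a x)")
        case True
        then have "epowr (h x) (q - \<epsilon>) \<le> epowr (ennreal (a x)) (q - \<epsilon>)" using \<epsilon> by (intro epowr_mono) auto
        then have "epowr (h x) (q - \<epsilon>) * ennreal (w x * a x powr \<epsilon>) \<le> epowr (ennreal (a x)) (q - \<epsilon>) * ennreal (w x * a x powr \<epsilon>)"
          by (rule mult_right_mono) simp
        also have "\<dots> = ennreal (a x powr q * w x)"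
        proof -
          have "a x powr (q - \<epsilon>) * a x powr \<epsilon> = a x powr q" by (simp flip: powr_add)
          then show ?thesis using a[of x] w[of x]
            by (simp add: ennreal_mult[symmetric] ac_simps)
        qed
        finally show ?thesis by (simp add: add_increasing2)
      next
        case False
        then have ha: "ennreal (a x) \<le> h x" by simp
        have "epowr (h x) (q - \<epsilon>) * ennreal (w x * a x powr \<epsilon>) = epowr (h x) (q - \<epsilon>) * (epowr (ennreal (a x)) (\<epsilon> - e') * ennreal (w x * a x powr e'))"
        proof -
          have "a x powr (\<epsilon> - e') * a x powr e' = a x powr \<epsilon>" by (simp flip: powr_add)
          then show ?thesis using a[of x] w[of x] by (simp add: ennreal_mult[symmetric] ac_simps)
        qed
        also have "\<dots> \<le> epowr (h x) (q - \<epsilon>) * (epowr (h x) (\<epsilon> - e') * ennreal (w x * a x powr e'))"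
          using ha \<open>\<not> \<epsilon> < e\<close> e' by (intro mult_left_mono mult_right_mono epowr_mono) auto
        also have "\<dots> = epowr (h x) (q - e') * ennreal (w x * a x powr e')"
          using epowr_add[of "h x" "q - \<epsilon>" "\<epsilon> - e'"] by (simp add: mult.assoc)
        finally show ?thesis by (simp add: add_increasing)
      qed
      have "grand_integral q a w h \<epsilon> \<le> F + I"
        unfolding F_def I_def by (subst nn_integral_add[symmetric]) (auto intro!: nn_integral_mono pt)
      then have "ennreal \<epsilon> * grand_integral q a w h \<epsilon> \<le> ennreal q * (F + I)"
        using \<epsilon> by (intro mult_mono ennreal_leI) auto
      then show ?thesis unfolding B2 by (rule order_trans) (simp add: ennreal_leI)
    qed
  qed
qed

text \<open>Muckenhoupt's theorem is applied for each small \<open>\<epsilon>\<close> to the exponent \<open>q - \<epsilon>\<close> and the weight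
  \<open>w * a powr \<epsilon>\<close>; its constant is uniform because the exponents stay away from one.\<close>

lemma grand_bounded_dyadic_max:
  fixes w a :: "real^'n::finite \<Rightarrow> real"
  assumes [measurable]: "h \<in> borel_measurable borel" "w \<in> borel_measurable borel" "a \<in> borel_measurable borel"
    and w: "\<And>x. 0 < w x" and a: "\<And>x. 0 < a x" and q: "1 < q"
    and e: "0 < e" "e < q - 1" and C: "0 < C"
    and Ap: "\<And>\<epsilon>. 0 < \<epsilon> \<Longrightarrow> \<epsilon> < e \<Longrightarrow> dyadic_Ap (q - \<epsilon>) (\<lambda>x. w x * a x powr \<epsilon>) C"
    and gb: "grand_bounded e q a w h"
  shows "grand_bounded e q a w (dyadic_max lborel T h)"
proof -
  obtain B :: real where B: "\<And>\<epsilon>. 0 < \<epsilon> \<Longrightarrow> \<epsilon> < e \<Longrightarrow> ennreal \<epsilon> * grand_integral q a w h \<epsilon> \<le> ennreal B"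
    using gb unfolding grand_bounded_def by blast
  define r where "r = q / (q - e - 1)"
  have r: "0 < r" using q e by (simp add: r_def)
  define K where "K = max 1 C powr r * (2 powr r * q) * (2 powr q * r)"
  have K: "0 \<le> K" using r q by (simp add: K_def)
  show ?thesis
    unfolding grand_bounded_def
  proof (intro exI[of _ "K * max 0 B"] allI impI)
    fix \<epsilon> assume \<epsilon>: "0 < \<epsilon>" "\<epsilon> < e"
    define p where "p = q - \<epsilon>"
    have p: "1 < p" "p \<le> q" "q - e - 1 < p - 1" using \<epsilon> e by (auto simp: p_def)
    have pr: "p / (p - 1) \<le> r"
      unfolding r_def using p e q by (intro frac_le) auto
    have wm: "0 < w x * a x powr \<epsilon>" for x using w[of x] a[of x] by simp
    have Ap': "dyadic_Ap p (\<lambda>x. w x * a x powr \<epsilon>) C" using Ap[OF \<epsilon>] by (simp add: p_def)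
    have "(\<integral>\<^sup>+x. epowr (dyadic_max lborel T h x) p * ennreal (w x * a x powr \<epsilon>) \<partial>lborel)
      \<le> ennreal (C powr (p / (p - 1)) * (2 powr (p / (p - 1)) * p) * (2 powr p * p / (p - 1)))
       * (\<integral>\<^sup>+x. epowr (h x) p * ennreal (w x * a x powr \<epsilon>) \<partial>lborel)"
      by (rule dyadic_max_Muckenhoupt[OF _ wm p(1)]) (use Ap' in auto)
    also have "\<dots> \<le> ennreal K * (\<integral>\<^sup>+x. epowr (h x) p * ennreal (w x * a x powr \<epsilon>) \<partial>lborel)"
    proof (intro mult_right_mono ennreal_leI)
      have "C powr (p / (p - 1)) \<le> max 1 C powr (p / (p - 1))" using C p by (intro powr_mono2) auto
      also have "\<dots> \<le> max 1 C powr r" using pr by (intro powr_mono) auto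
      finally have 1: "C powr (p / (p - 1)) \<le> max 1 C powr r" .
      have 2: "2 powr (p / (p - 1)) * p \<le> 2 powr r * q" using pr p by (intro mult_mono powr_mono) auto
      have 3: "2 powr p * (p / (p - 1)) \<le> 2 powr q * r" using pr p r by (intro mult_mono powr_mono) auto
      show "C powr (p / (p - 1)) * (2 powr (p / (p - 1)) * p) * (2 powr p * p / (p - 1)) \<le> K"
        unfolding K_def times_divide_eq_right[symmetric] using p q r by (intro mult_mono 1 2 3 mult_nonneg_nonneg) auto
    qed simp
    finally have "ennreal \<epsilon> * (\<integral>\<^sup>+x. epowr (dyadic_max lborel T h x) p * ennreal (w x * a x powr \<epsilon>) \<partial>lborel)
       \<le> ennreal \<epsilon> * (ennreal K * (\<integral>\<^sup>+x. epowr (h x) p * ennreal (w x * a x powr \<epsilon>) \<partial>lborel))"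
      by (rule mult_left_mono) simp
    also have "\<dots> = ennreal K * (ennreal \<epsilon> * (\<integral>\<^sup>+x. epowr (h x) p * ennreal (w x * a x powr \<epsilon>) \<partial>lborel))"
      by (simp add: ac_simps)
    also have "\<dots> \<le> ennreal K * ennreal (max 0 B)"
      unfolding p_def by (intro mult_left_mono order_trans[OF B[OF \<epsilon>]] ennreal_leI) auto
    also have "\<dots> = ennreal (K * max 0 B)" using K by (simp add: ennreal_mult)
    finally show "ennreal \<epsilon> * (\<integral>\<^sup>+x. epowr (dyadic_max lborel T h x) (q - \<epsilon>) * ennreal (w x * a x powr \<epsilon>) \<partial>lborel) \<le> ennreal (K * max 0 B)"
      by (simp add: p_def)
  qed
qed

text \<open>For a single small \<open>\<epsilon>\<close> let \<open>p = q - \<epsilon>\<close> and \<open>v = w * a powr \<epsilon>\<close>. Then \<open>h\<close> is at most the sum of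
  \<open>h powr p * v\<close> and \<open>v powr (- 1 / (p - 1))\<close>, and the latter is integrable on cubes by the
  Muckenhoupt condition.\<close>

lemma grand_bounded_locally_integrable:
  fixes w a :: "real^'n::finite \<Rightarrow> real"
  assumes [measurable]: "h \<in> borel_measurable borel" "w \<in> borel_measurable borel" "a \<in> borel_measurable borel"
    and w: "\<And>x. 0 < w x" and a: "\<And>x. 0 < a x" and q: "1 < q"
    and e: "0 < e" "e < q - 1" 
    and Ap: "\<And>\<epsilon>. 0 < \<epsilon> \<Longrightarrow> \<epsilon> < e \<Longrightarrow> dyadic_Ap (q - \<epsilon>) (\<lambda>x. w x * a x powr \<epsilon>) C"
    and gb: "grand_bounded e q a w h"
  shows "(\<integral>\<^sup>+x\<in>ball 0 R. h x \<partial>lborel) < \<infinity>"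
proof -
  obtain B :: real where B: "\<And>\<epsilon>. 0 < \<epsilon> \<Longrightarrow> \<epsilon> < e \<Longrightarrow> ennreal \<epsilon> * grand_integral q a w h \<epsilon> \<le> ennreal B"
    using gb unfolding grand_bounded_def by blast
  define \<epsilon> where "\<epsilon> = e / 2"
  have \<epsilon>: "0 < \<epsilon>" "\<epsilon> < e" using e by (auto simp: \<epsilon>_def)
  define v where "v x = w x * a x powr \<epsilon>" for x
  define p where "p = q - \<epsilon>"
  have p: "1 < p" using \<epsilon> e by (auto simp: p_def)
  have v: "0 < v x" for x using w[of x] a[of x] by (simp add: v_def)
  have vm [measurable]: "v \<in> borel_measurable borel" unfolding v_def by measurable
  have Ap': "dyadic_Ap p v C" using Ap[OF \<epsilon>] unfolding v_def p_def .
  define I where "I = (\<integral>\<^sup>+x. epowr (h x) p * ennreal (v x) \<partial>lborel)"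
  have "ennreal \<epsilon> * I < \<infinity>" using B[OF \<epsilon>] unfolding I_def p_def v_def by (rule le_less_trans) simp
  then have I: "I < \<infinity>" using \<epsilon> by (auto simp: ennreal_mult_less_top)
  obtain T k where Q: "ball (0::real^'n) R \<subseteq> dcube T k 0" by (rule ball_in_dcube)
  obtain S where S: "(\<integral>\<^sup>+y\<in>dcube T k 0. ennreal (v y powr (- 1 / (p - 1))) \<partial>lborel) = ennreal S"
    by (rule dyadic_ApE[OF Ap' vm v p])
  have "(\<integral>\<^sup>+x\<in>ball 0 R. h x \<partial>lborel) \<le> (\<integral>\<^sup>+x. epowr (h x) p * ennreal (v x) + ennreal (v x powr (- 1 / (p - 1))) * indicator (dcube T k 0) x \<partial>lborel)"
  proof (intro nn_integral_mono)
    fix x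
    define \<tau> where "\<tau> = v x powr (- 1 / (p - 1))"
    have "h x \<le> epowr (h x) p * ennreal (v x) + ennreal \<tau>"
    proof (cases "h x \<le> ennreal \<tau>")
      case True
      then show ?thesis by (simp add: add_increasing)
    next
      case False
      have "(- 1 / (p - 1)) * (p - 1) = - 1" using p by simp
      then have "\<tau> powr (p - 1) = v x powr (- 1)" unfolding \<tau>_def powr_powr by (rule arg_cong)
      then have "\<tau> powr (p - 1) * v x = 1"
        using v[of x] by (simp add: powr_minus)
      then have "epowr (ennreal \<tau>) (p - 1) * ennreal (v x) = 1"
        using v[of x] by (simp add: \<tau>_def flip: ennreal_mult)
      then have "h x = h x * (epowr (ennreal \<tau>) (p - 1) * ennreal (v x))" by simp
      also have "\<dots> \<le> h x * (epowr (h x) (p - 1) * ennreal (v x))"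
        using False p by (intro mult_left_mono mult_right_mono epowr_mono) auto
      also have "\<dots> = epowr (h x) p * ennreal (v x)"
        using epowr_add[of "h x" 1 "p - 1"] by (simp add: mult.assoc)
      finally show ?thesis by (simp add: add_increasing2)
    qed
    then show "h x * indicator (ball 0 R) x \<le> epowr (h x) p * ennreal (v x) + ennreal (v x powr (- 1 / (p - 1))) * indicator (dcube T k 0) x"
      using Q by (auto simp: indicator_def \<tau>_def)
  qed
  also have "\<dots> = I + ennreal S"
    unfolding I_def S[symmetric] by (rule nn_integral_add) measurable
  also have "\<dots> < \<infinity>" using I by simp
  finally show ?thesis .
qed

section \<open>Test functions\<close>

lemma partial_deriv_eq:
  assumes "(\<phi> has_derivative D) (at x)" shows "partial_deriv i \<phi> x = D (axis i 1)"
  using frechet_derivative_at[OF assms] by (simp add: partial_deriv_def)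

lemma C_class_const: "C_class k (\<lambda>x::real^'n. c)"
proof (induction k arbitrary: c)
  case (Suc k)
  have "partial_deriv i (\<lambda>x::real^'n. c) = (\<lambda>x. 0)" for i
    by (rule ext, subst partial_deriv_eq[OF has_derivative_const]) simp
  then show ?case using Suc[of 0] by simp
qed simp

lemma C_class_continuous: "C_class k \<phi> \<Longrightarrow> continuous_on UNIV \<phi>"
  by (cases k) (auto intro!: continuous_at_imp_continuous_on differentiable_imp_continuous_within)

lemma C_class_SucD: "C_class (Suc k) \<phi> \<Longrightarrow> C_class k \<phi>"
proof (induction k arbitrary: \<phi>)
  case 0
  then show ?case using C_class_continuous[OF 0] by simp
next
  case (Suc k)
  have "C_class k (partial_deriv i \<phi>)" for i using Suc by simp
  then show ?case using Suc.prems by simp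
qed

lemma C_class_add:
  "C_class k \<phi> \<Longrightarrow> C_class k \<psi> \<Longrightarrow> C_class k (\<lambda>x. \<phi> x + \<psi> x)"
proof (induction k arbitrary: \<phi> \<psi>)
  case (Suc k)
  then have d: "\<phi> differentiable (at x)" "\<psi> differentiable (at x)" for x by auto
  have "partial_deriv i (\<lambda>x. \<phi> x + \<psi> x) = (\<lambda>x. partial_deriv i \<phi> x + partial_deriv i \<psi> x)" for i
  proof
    fix x
    from d[of x] obtain D E where "(\<phi> has_derivative D) (at x)" "(\<psi> has_derivative E) (at x)"
      unfolding differentiable_def by blast
    then show "partial_deriv i (\<lambda>x. \<phi> x + \<psi> x) x = partial_deriv i \<phi> x + partial_deriv i \<psi> x"
      by (subst partial_deriv_eq[OF has_derivative_add], auto simp: partial_deriv_eq)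
  qed
  then show ?case using Suc d by (auto intro: differentiable_add)
qed (auto intro: continuous_intros)

lemma C_class_mult:
  "C_class k \<phi> \<Longrightarrow> C_class k \<psi> \<Longrightarrow> C_class k (\<lambda>x. \<phi> x * \<psi> x)"
proof (induction k arbitrary: \<phi> \<psi>)
  case (Suc k)
  then have d: "\<phi> differentiable (at x)" "\<psi> differentiable (at x)" for x by auto
  have "partial_deriv i (\<lambda>x. \<phi> x * \<psi> x) = (\<lambda>x. \<phi> x * partial_deriv i \<psi> x + partial_deriv i \<phi> x * \<psi> x)" for i
  proof
    fix x
    from d[of x] obtain D E where "(\<phi> has_derivative D) (at x)" "(\<psi> has_derivative E) (at x)"
      unfolding differentiable_def by blast
    then show "partial_deriv i (\<lambda>x. \<phi> x * \<psi> x) x = \<phi> x * partial_deriv i \<psi> x + partial_deriv i \<phi> x * \<psi> x"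
      by (subst partial_deriv_eq[OF has_derivative_mult], auto simp: partial_deriv_eq)
  qed
  moreover have "C_class k \<phi>" "C_class k \<psi>" using Suc.prems C_class_SucD by auto
  ultimately show ?case using Suc d by (auto intro!: differentiable_mult C_class_add Suc.IH)
qed (auto intro: continuous_intros)

lemma C_class_prod:
  "finite I \<Longrightarrow> (\<And>i. i \<in> I \<Longrightarrow> C_class k (\<phi> i)) \<Longrightarrow> C_class k (\<lambda>x. \<Prod>i\<in>I. \<phi> i x)"
  by (induction I rule: finite_induct) (auto intro: C_class_const C_class_mult)

lemma C_class_translate: "C_class k \<phi> \<Longrightarrow> C_class k (\<lambda>x. \<phi> (x + v))"
proof (induction k arbitrary: \<phi>)
  case 0
  then have "continuous_on (range (\<lambda>x. x + v)) \<phi>" by (auto intro: continuous_on_subset)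
  then have "continuous_on UNIV (\<lambda>x. \<phi> (x + v))"
    by (intro continuous_on_compose2[of "range (\<lambda>x. x + v)" \<phi> UNIV "\<lambda>x. x + v"]) (auto intro: continuous_intros)
  then show ?case by simp
next
  case (Suc k)
  have D: "((\<lambda>x. \<phi> (x + v)) has_derivative frechet_derivative \<phi> (at (x + v))) (at x)" for x
  proof -
    have "(\<phi> has_derivative frechet_derivative \<phi> (at (x + v))) (at (x + v))"
      using Suc.prems frechet_derivative_works by auto
    then have "(\<phi> \<circ> (\<lambda>x. x + v) has_derivative frechet_derivative \<phi> (at (x + v)) \<circ> (\<lambda>h. h)) (at x)"
      by (intro diff_chain_at) (auto intro!: derivative_eq_intros)
    then show ?thesis by (simp add: o_def)
  qed
  have "partial_deriv i (\<lambda>x. \<phi> (x + v)) = (\<lambda>x. partial_deriv i \<phi> (x + v))" for i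
    using partial_deriv_eq[OF D] by (auto simp: partial_deriv_def)
  then show ?case using Suc D by (auto simp: differentiable_def)
qed

text \<open>The functions \<open>exp (-1/t) / t ^ n\<close>, extended by zero to \<open>t \<le> 0\<close>. The derivative of each is a linear
  combination of two others, so smoothness of all of them is proved by one induction.\<close>

definition flat :: "nat \<Rightarrow> real \<Rightarrow> real" where
  "flat n t = (if 0 < t then inverse t ^ n * exp (- inverse t) else 0)"

lemma flat_tendsto_0: "(flat n \<longlongrightarrow> 0) (at 0)"
proof (rule filterlim_split_at)
  have "\<forall>\<^sub>F t in at_left 0. flat n t = 0"
    by (auto simp: eventually_at_filter flat_def)
  then show "(flat n \<longlongrightarrow> 0) (at_left 0)" by (rule tendsto_eventually)
  have "((\<lambda>t. inverse t ^ n / exp (inverse t)) \<longlongrightarrow> (0::real)) (at_right 0)"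
    by (rule filterlim_compose[OF tendsto_power_div_exp_0 filterlim_inverse_at_top_right])
  moreover have "\<forall>\<^sub>F t in at_right 0. inverse t ^ n / exp (inverse t) = flat n t"
    by (auto simp: eventually_at_filter flat_def exp_minus divide_inverse)
  ultimately show "(flat n \<longlongrightarrow> 0) (at_right 0)"
    by (rule Lim_transform_eventually)
qed

lemma flat_deriv: "(flat n has_real_derivative (- real n * flat (Suc n) t + flat (Suc (Suc n)) t)) (at t)"
proof -
  consider "0 < t" | "t < 0" | "t = 0" by linarith
  then show ?thesis
  proof cases
    case 1
    have "((\<lambda>t. inverse t ^ n * exp (- inverse t)) has_real_derivative (- real n * flat (Suc n) t + flat (Suc (Suc n)) t)) (at t)"
    proof (cases n)
      case 0
      then show ?thesis using 1
        by (auto intro!: derivative_eq_intros simp: flat_def field_simps power2_eq_square)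
    next
      case (Suc l)
      have i: "(inverse has_real_derivative - (inverse t)\<^sup>2) (at t)"
        using 1 DERIV_inverse[of t UNIV] by (simp add: power2_eq_square)
      have e: "((\<lambda>t. exp (- inverse t)) has_real_derivative exp (- inverse t) * (inverse t)\<^sup>2) (at t)"
        using 1 by (auto intro!: derivative_eq_intros simp: power2_eq_square)
      show ?thesis
        unfolding Suc
        by (rule DERIV_cong[OF DERIV_mult[OF DERIV_power_Suc[OF i] e]])
          (use 1 in \<open>simp add: flat_def algebra_simps power2_eq_square\<close>)
    qed
    moreover have ev: "\<forall>\<^sub>F s in nhds t. inverse s ^ n * exp (- inverse s) = flat n s"
      using 1 eventually_nhds_in_open[of "{0<..}" t] by (auto elim!: eventually_mono simp: flat_def)
    ultimately show ?thesis by (simp only: DERIV_cong_ev[OF refl ev refl])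
  next
    case 2
    have "((\<lambda>t. 0) has_real_derivative (- real n * flat (Suc n) t + flat (Suc (Suc n)) t)) (at t)"
      using 2 by (auto simp: flat_def)
    moreover have ev: "\<forall>\<^sub>F s in nhds t. 0 = flat n s"
      using 2 eventually_nhds_in_open[of "{..<0}" t] by (auto elim!: eventually_mono simp: flat_def)
    ultimately show ?thesis by (simp only: DERIV_cong_ev[OF refl ev refl])
  next
    case 3
    have "flat n h / h = flat (Suc n) h" if "h \<noteq> 0" for h using that by (auto simp: flat_def divide_inverse)
    then have "\<forall>\<^sub>F h in at 0. flat (Suc n) h = flat n h / h" by (auto simp: eventually_at_filter)
    with flat_tendsto_0[of "Suc n"] have "((\<lambda>h. flat n h / h) \<longlongrightarrow> 0) (at 0)"
      by (rule Lim_transform_eventually)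
    then show ?thesis using 3 by (simp add: DERIV_def flat_def)
  qed
qed

lemma C_class_flat: "C_class k (\<lambda>x::real^'n. flat n (c * x $ i + d))"
proof (induction k arbitrary: n)
  case 0
  have "isCont (flat n) t" for t using flat_deriv DERIV_isCont by blast
  then have "continuous_on UNIV (flat n)" by (simp add: continuous_at_imp_continuous_on)
  then have "continuous_on UNIV (\<lambda>x::real^'n. flat n (c * x $ i + d))"
    by (rule continuous_on_compose2) (auto intro!: continuous_intros)
  then show ?case by simp
next
  case (Suc k)
  have D: "((\<lambda>x::real^'n. flat n (c * x $ i + d)) has_derivative
      (\<lambda>h. (c * h $ i) * (- real n * flat (Suc n) (c * x $ i + d) + flat (Suc (Suc n)) (c * x $ i + d)))) (at x)" for x
  proof -
    have a: "((\<lambda>x::real^'n. c * x $ i + d) has_derivative (\<lambda>h. c * h $ i)) (at x)"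
      by (rule derivative_eq_intros bounded_linear_imp_has_derivative[OF bounded_linear_vec_nth] | simp)+
    show ?thesis by (rule DERIV_compose_FDERIV[OF flat_deriv a])
  qed
  have pd: "partial_deriv j (\<lambda>x::real^'n. flat n (c * x $ i + d)) = (\<lambda>x. (if j = i then c else 0) * ((- real n) * flat (Suc n) (c * x $ i + d) + flat (Suc (Suc n)) (c * x $ i + d)))" for j
    using partial_deriv_eq[OF D] by (auto simp: axis_def)
  have "C_class k (partial_deriv j (\<lambda>x::real^'n. flat n (c * x $ i + d)))" for j
    unfolding pd by (intro C_class_mult C_class_add C_class_const Suc)
  then show ?case
    unfolding C_class.simps differentiable_def using D by blast
qed

text \<open>A product of \<open>flat\<close> functions of the distances to the faces of a box. It increases to the
  indicator of the box as \<open>m\<close> tends to infinity.\<close>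

definition bump :: "real^'n \<Rightarrow> real^'n \<Rightarrow> real \<Rightarrow> real^'n::finite \<Rightarrow> real" where
  "bump a b m x = (\<Prod>i\<in>UNIV. flat 0 (m * x $ i + (- m * a $ i)) * flat 0 ((- m) * x $ i + m * b $ i))"

lemma flat0_bounds: "0 \<le> flat 0 t" "flat 0 t \<le> 1"
  by (auto simp: flat_def)

lemma bump_bounds: "0 \<le> bump a b m x" "bump a b m x \<le> 1"
proof -
  show "0 \<le> bump a b m x" unfolding bump_def by (intro prod_nonneg) (simp add: flat0_bounds)
  show "bump a b m x \<le> 1" unfolding bump_def by (intro prod_le_1) (auto simp: flat0_bounds mult_le_one)
qed

lemma bump_outside: "0 < m \<Longrightarrow> x \<notin> box a b \<Longrightarrow> bump a b m x = 0"
proof -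
  assume m: "0 < m" "x \<notin> box a b"
  then obtain i where "x $ i \<le> a $ i \<or> b $ i \<le> x $ i" by (auto simp: mem_box_cart not_less)
  then have "m * x $ i \<le> m * a $ i \<or> m * b $ i \<le> m * x $ i" using m by auto
  then have "flat 0 (m * x $ i + (- m * a $ i)) * flat 0 ((- m) * x $ i + m * b $ i) = 0"
    by (auto simp: flat_def)
  then show ?thesis unfolding bump_def by (intro prod_zero) auto
qed

lemma flat0_tendsto_1:
  assumes "0 < t" shows "(\<lambda>m. flat 0 (real (Suc m) * t)) \<longlonglongrightarrow> 1"
proof -
  have "(\<lambda>m. exp (- (inverse (real (Suc m)) * inverse t))) \<longlonglongrightarrow> exp (- (0 * inverse t))"
    by (intro tendsto_intros LIMSEQ_inverse_real_of_nat)
  then show ?thesis using assms by (simp add: flat_def)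
qed

lemma bump_tendsto: "(\<lambda>m. bump a b (real (Suc m)) x) \<longlonglongrightarrow> indicator (box a b) x"
proof (cases "x \<in> box a b")
  case True
  have "(\<lambda>m. bump a b (real (Suc m)) x) \<longlonglongrightarrow> (\<Prod>i\<in>(UNIV::'a set). 1 * 1)"
    unfolding bump_def
  proof (intro tendsto_prod tendsto_mult)
    fix i
    have "0 < x $ i - a $ i" "0 < b $ i - x $ i" using True by (auto simp: mem_box_cart)
    from this[THEN flat0_tendsto_1]
    show "(\<lambda>m. flat 0 (real (Suc m) * x $ i + - real (Suc m) * a $ i)) \<longlonglongrightarrow> 1"
         "(\<lambda>m. flat 0 (- real (Suc m) * x $ i + real (Suc m) * b $ i)) \<longlonglongrightarrow> 1"
      by (simp_all add: algebra_simps)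
  qed
  then show ?thesis using True by simp
qed (simp add: bump_outside)

lemma test_function_bump: "0 < m \<Longrightarrow> test_function (bump a b m)"
  unfolding test_function_def
proof (intro conjI allI)
  show "C_class k (bump a b m)" for k
    unfolding bump_def by (intro C_class_prod C_class_mult C_class_flat) simp
  assume m: "0 < m"
  have "{x. bump a b m x \<noteq> 0} \<subseteq> cbox a b" using bump_outside[OF m] box_subset_cbox by blast
  then have "closure {x. bump a b m x \<noteq> 0} \<subseteq> cbox a b" by (rule closure_minimal) (rule closed_cbox)
  then show "compact (closure {x. bump a b m x \<noteq> 0})"
    by (meson bounded_cbox bounded_subset closed_closure compact_eq_bounded_closed)
qed

lemma test_function_add: "test_function \<phi> \<Longrightarrow> test_function \<psi> \<Longrightarrow> test_function (\<lambda>x. \<phi> x + \<psi> x)"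
  unfolding test_function_def
proof (intro conjI allI)
  assume t: "(\<forall>k. C_class k \<phi>) \<and> compact (closure {x. \<phi> x \<noteq> 0})" "(\<forall>k. C_class k \<psi>) \<and> compact (closure {x. \<psi> x \<noteq> 0})"
  then show "C_class k (\<lambda>x. \<phi> x + \<psi> x)" for k by (auto intro: C_class_add)
  have "{x. \<phi> x + \<psi> x \<noteq> 0} \<subseteq> closure {x. \<phi> x \<noteq> 0} \<union> closure {x. \<psi> x \<noteq> 0}"
    using closure_subset[of "{x. \<phi> x \<noteq> 0}"] closure_subset[of "{x. \<psi> x \<noteq> 0}"] by fastforce
  moreover have "compact (closure {x. \<phi> x \<noteq> 0} \<union> closure {x. \<psi> x \<noteq> 0})" using t by (intro compact_Un) auto
  ultimately show "compact (closure {x. \<phi> x + \<psi> x \<noteq> 0})"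
    by (meson bounded_subset compact_closure compact_imp_bounded)
qed

lemma test_function_cmult: "test_function \<phi> \<Longrightarrow> test_function (\<lambda>x. c * \<phi> x)"
  unfolding test_function_def
proof (intro conjI allI)
  assume t: "(\<forall>k. C_class k \<phi>) \<and> compact (closure {x. \<phi> x \<noteq> 0})"
  then show "C_class k (\<lambda>x. c * \<phi> x)" for k by (auto intro: C_class_mult C_class_const)
  have "{x. c * \<phi> x \<noteq> 0} \<subseteq> closure {x. \<phi> x \<noteq> 0}"
    using closure_subset[of "{x. \<phi> x \<noteq> 0}"] by fastforce
  then show "compact (closure {x. c * \<phi> x \<noteq> 0})"
    using t by (meson bounded_subset compact_closure compact_imp_bounded)
qed

lemma test_function_translate: "test_function \<phi> \<Longrightarrow> test_function (\<lambda>x. \<phi> (x + v))"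
  unfolding test_function_def
proof (intro conjI allI)
  assume t: "(\<forall>k. C_class k \<phi>) \<and> compact (closure {x. \<phi> x \<noteq> 0})"
  then show "C_class k (\<lambda>x. \<phi> (x + v))" for k by (auto intro: C_class_translate)
  have "{x. \<phi> (x + v) \<noteq> 0} \<subseteq> (\<lambda>x. - v + x) ` closure {x. \<phi> x \<noteq> 0}"
  proof
    fix x assume "x \<in> {x. \<phi> (x + v) \<noteq> 0}"
    then have "x + v \<in> closure {x. \<phi> x \<noteq> 0}" using closure_subset by fastforce
    then show "x \<in> (\<lambda>x. - v + x) ` closure {x. \<phi> x \<noteq> 0}" by (intro image_eqI[of _ _ "x + v"]) auto
  qed
  moreover have "compact ((\<lambda>x. - v + x) ` closure {x. \<phi> x \<noteq> 0})" using t by (intro compact_translation) auto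
  ultimately show "compact (closure {x. \<phi> (x + v) \<noteq> 0})"
    by (meson bounded_subset compact_closure compact_imp_bounded)
qed

lemma test_function_has_derivative:
  fixes \<phi> :: "real^'n::finite \<Rightarrow> real"
  assumes "test_function \<phi>"
  shows "(\<phi> has_derivative (\<lambda>v. \<Sum>i\<in>UNIV. v $ i * partial_deriv i \<phi> x)) (at x)"
proof -
  have "C_class (Suc 0) \<phi>" using assms by (simp add: test_function_def del: C_class.simps)
  then have "\<phi> differentiable (at x)" by simp
  then have D: "(\<phi> has_derivative frechet_derivative \<phi> (at x)) (at x)"
    using frechet_derivative_works by blast
  then interpret bounded_linear "frechet_derivative \<phi> (at x)" by (rule has_derivative_bounded_linear)
  have "frechet_derivative \<phi> (at x) v = (\<Sum>i\<in>UNIV. v $ i * partial_deriv i \<phi> x)" for v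
  proof -
    have "v = (\<Sum>i\<in>UNIV. (v $ i) *\<^sub>R axis i 1)"
      using basis_expansion[of v] by (simp add: scalar_mult_eq_scaleR)
    then have "frechet_derivative \<phi> (at x) v = frechet_derivative \<phi> (at x) (\<Sum>i\<in>UNIV. (v $ i) *\<^sub>R axis i 1)" by simp
    also have "\<dots> = (\<Sum>i\<in>UNIV. v $ i * partial_deriv i \<phi> x)"
      by (simp add: sum scaleR partial_deriv_def)
    finally show ?thesis .
  qed
  then have "frechet_derivative \<phi> (at x) = (\<lambda>v. \<Sum>i\<in>UNIV. v $ i * partial_deriv i \<phi> x)" by auto
  with D show ?thesis by simp
qed

lemma test_function_continuous: "test_function \<phi> \<Longrightarrow> continuous_on UNIV \<phi>"
  unfolding test_function_def using C_class_continuous by blast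

lemma test_function_partial_continuous: "test_function \<phi> \<Longrightarrow> continuous_on UNIV (partial_deriv i \<phi>)"
  unfolding test_function_def using C_class_continuous[of 0 "partial_deriv i \<phi>"] C_class.simps(2)[of 0 \<phi>] by blast

lemma test_function_bounds:
  fixes \<phi> :: "real^'n::finite \<Rightarrow> real"
  assumes t: "test_function \<phi>"
  obtains R C where "0 < R" "0 < C" "\<And>x. norm x \<ge> R \<Longrightarrow> \<phi> x = 0" "\<And>x i. norm x \<ge> R \<Longrightarrow> partial_deriv i \<phi> x = 0"
    "\<And>x. \<bar>\<phi> x\<bar> \<le> C" "\<And>x i. \<bar>partial_deriv i \<phi> x\<bar> \<le> C"
proof -
  define K where "K = closure {x. \<phi> x \<noteq> 0}"
  have K: "compact K" using t by (simp add: K_def test_function_def)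
  obtain R0 where R0: "\<And>x. x \<in> K \<Longrightarrow> norm x \<le> R0"
    using compact_imp_bounded[OF K] by (auto simp: bounded_iff)
  define R where "R = max 1 (R0 + 1)"
  have R: "0 < R" by (simp add: R_def)
  have nK: "x \<notin> K" if "norm x \<ge> R" for x using R0[of x] that by (auto simp: R_def)
  have z: "\<phi> x = 0" if "x \<notin> K" for x using that closure_subset[of "{x. \<phi> x \<noteq> 0}"] by (auto simp: K_def)
  have pz: "partial_deriv i \<phi> x = 0" if "x \<notin> K" for x i
  proof -
    have "open (- K)" by (simp add: K_def open_Compl)
    then have "\<forall>\<^sub>F y in at x. 0 = \<phi> y" 
      using eventually_at_in_open'[of "- K" x] that z by (auto elim!: eventually_mono)
    then have "(\<phi> has_derivative (\<lambda>_. 0)) (at x)"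
      using has_derivative_transform_eventually[of "\<lambda>_. 0" "\<lambda>_. 0" x UNIV \<phi>] z[OF that] by auto
    then show ?thesis by (subst partial_deriv_eq) auto
  qed
  have bd: "\<exists>C. \<forall>x. \<bar>g x\<bar> \<le> C" if "continuous_on UNIV g" "\<And>x. x \<notin> K \<Longrightarrow> g x = 0" for g :: "real^'n \<Rightarrow> real"
  proof -
    have "bounded (g ` K)"
      using K that by (intro compact_imp_bounded compact_continuous_image) (auto intro: continuous_on_subset)
    then obtain C where C: "\<And>x. x \<in> K \<Longrightarrow> \<bar>g x\<bar> \<le> C" by (auto simp: bounded_iff)
    then have "\<bar>g x\<bar> \<le> max 0 C" for x
      using that(2)[of x] by (cases "x \<in> K") (auto intro: max.coboundedI2)
    then show ?thesis by blast
  qed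
  obtain C0 where C0: "\<And>x. \<bar>\<phi> x\<bar> \<le> C0" using bd[OF test_function_continuous[OF t] z] by blast
  have "\<forall>i. \<exists>C. \<forall>x. \<bar>partial_deriv i \<phi> x\<bar> \<le> C"
    using bd[OF test_function_partial_continuous[OF t] pz] by blast
  then obtain C1 where C1: "\<And>i x. \<bar>partial_deriv i \<phi> x\<bar> \<le> C1 i" by metis
  define C where "C = 1 + \<bar>C0\<bar> + (\<Sum>i\<in>UNIV. \<bar>C1 i\<bar>)"
  have C1le: "\<bar>C1 i\<bar> \<le> (\<Sum>i\<in>UNIV. \<bar>C1 i\<bar>)" for i by (rule member_le_sum) auto
  show ?thesis
  proof (rule that[of R C])
    have "0 \<le> (\<Sum>i\<in>UNIV. \<bar>C1 i\<bar>)" by (rule sum_nonneg) auto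
    then show "0 < C" "\<bar>\<phi> x\<bar> \<le> C" for x
      using C0[of x] abs_ge_zero[of "\<phi> x"] unfolding C_def by linarith+
    show "\<bar>partial_deriv i \<phi> x\<bar> \<le> C" for i x using C1[of i x] C1le[of i] by (simp add: C_def)
  qed (use R nK z pz in auto)
qed

section \<open>Bounds by testing\<close>

text \<open>Local integrability for functions with values in the extended half-line.\<close>

definition locint :: "(real^'n::finite \<Rightarrow> ennreal) \<Rightarrow> bool" where
  "locint u \<longleftrightarrow> (\<forall>R. (\<integral>\<^sup>+x\<in>ball 0 R. u x \<partial>lborel) < \<infinity>)"

lemma integrable_locint_mult:
  fixes F :: "real^'n::finite \<Rightarrow> real"
  assumes [measurable]: "F \<in> borel_measurable borel" "\<psi> \<in> borel_measurable borel"
    and l: "locint (\<lambda>x. ennreal \<bar>F x\<bar>)" and R: "\<And>x. norm x \<ge> R \<Longrightarrow> \<psi> x = 0" and C: "\<And>x. \<bar>\<psi> x\<bar> \<le> C"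
  shows "integrable lborel (\<lambda>x. F x * \<psi> x)"
proof (rule integrableI_bounded)
  have C0: "0 \<le> C" using C[of 0] by simp
  have [measurable]: "ball (0::real^'n) R \<in> sets borel" by simp
  have "(\<integral>\<^sup>+x. ennreal (norm (F x * \<psi> x)) \<partial>lborel) \<le> (\<integral>\<^sup>+x. ennreal C * (ennreal \<bar>F x\<bar> * indicator (ball 0 R) x) \<partial>lborel)"
  proof (intro nn_integral_mono)
    fix x
    show "ennreal (norm (F x * \<psi> x)) \<le> ennreal C * (ennreal \<bar>F x\<bar> * indicator (ball 0 R) x)"
    proof (cases "norm x \<ge> R")
      case False
      have "\<bar>F x\<bar> * \<bar>\<psi> x\<bar> \<le> C * \<bar>F x\<bar>" using mult_left_mono[OF C[of x], of "\<bar>F x\<bar>"] by (simp add: mult.commute)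
      then show ?thesis using False C0 by (simp add: abs_mult ennreal_mult[symmetric] ennreal_leI indicator_def)
    qed (simp add: R)
  qed
  also have "\<dots> = ennreal C * (\<integral>\<^sup>+x\<in>ball 0 R. ennreal \<bar>F x\<bar> \<partial>lborel)"
    by (rule nn_integral_cmult) measurable
  also have "\<dots> < \<infinity>" using l by (simp add: locint_def ennreal_mult_less_top)
  finally show "(\<integral>\<^sup>+x. ennreal (norm (F x * \<psi> x)) \<partial>lborel) < \<infinity>" .
qed measurable

text \<open>Testing with bump functions that approximate the indicator of a box gives \<open>\<integral> F \<le> \<integral> b\<close> over every
  box, hence over every dyadic cube, and the comparison of densities on cubes applies to
  the positive part of \<open>F\<close> and the sum of \<open>b\<close> and the negative part. With \<open>b = 0\<close> this is the
  fundamental lemma of the calculus of variations; with general \<open>b\<close> it also transfers bounds.\<close>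

lemma bound_of_tests:
  fixes F :: "real^'n::finite \<Rightarrow> real"
  assumes [measurable]: "F \<in> borel_measurable borel" "b \<in> borel_measurable borel"
    and lF: "locint (\<lambda>x. ennreal \<bar>F x\<bar>)" and lb: "locint b"
    and test: "\<And>\<phi>. test_function \<phi> \<Longrightarrow> (\<And>x. 0 \<le> \<phi> x) \<Longrightarrow>
      ennreal (\<integral>x. F x * \<phi> x \<partial>lborel) \<le> (\<integral>\<^sup>+x. b x * ennreal (\<phi> x) \<partial>lborel)"
  shows "AE x in lborel. ennreal (F x) \<le> b x"
proof -
  have box: "(\<integral>\<^sup>+x\<in>box c d. ennreal (F x) \<partial>lborel) \<le> (\<integral>\<^sup>+x\<in>box c d. (ennreal (- F x) + b x) \<partial>lborel)" for c d :: "real^'n"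
  proof -
    obtain R0 where R0: "box c d \<subseteq> ball 0 R0"
      using bounded_box[of c d] by (metis bounded_subset_ballD dist_0_norm)
    have out: "norm x \<ge> R0 \<Longrightarrow> x \<notin> box c d" for x using R0 by auto
    have int: "integrable lborel (\<lambda>x. F x * indicator (box c d) x)"
      by (rule integrable_locint_mult[OF _ _ lF, of _ R0 1]) (use out in \<open>auto simp: indicator_def\<close>)
    have bm [measurable]: "bump c d (real (Suc m)) \<in> borel_measurable borel" for m
      by (intro borel_measurable_continuous_onI test_function_continuous test_function_bump) simp
    have lim: "(\<lambda>m. \<integral>x. F x * bump c d (real (Suc m)) x \<partial>lborel) \<longlonglongrightarrow> (\<integral>x. F x * indicator (box c d) x \<partial>lborel)"
    proof (rule integral_dominated_convergence)
      show "integrable lborel (\<lambda>x. \<bar>F x * indicator (box c d) x\<bar>)" using int by (rule integrable_abs)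
      show "AE x in lborel. (\<lambda>m. F x * bump c d (real (Suc m)) x) \<longlonglongrightarrow> F x * indicator (box c d) x"
        by (intro AE_I2 tendsto_mult tendsto_const bump_tendsto)
      show "AE x in lborel. norm (F x * bump c d (real (Suc m)) x) \<le> \<bar>F x * indicator (box c d) x\<bar>" for m
      proof (intro AE_I2)
        fix x show "norm (F x * bump c d (real (Suc m)) x) \<le> \<bar>F x * indicator (box c d) x\<bar>"
          using bump_bounds[of c d "real (Suc m)" x] bump_outside[of "real (Suc m)" x c d]
          by (cases "x \<in> box c d") (auto simp: abs_mult mult_left_le)
      qed
    qed measurable
    have "ennreal (\<integral>x. F x * bump c d (real (Suc m)) x \<partial>lborel) \<le> (\<integral>\<^sup>+x\<in>box c d. b x \<partial>lborel)" for m
    proof -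
      have "ennreal (\<integral>x. F x * bump c d (real (Suc m)) x \<partial>lborel) \<le> (\<integral>\<^sup>+x. b x * ennreal (bump c d (real (Suc m)) x) \<partial>lborel)"
        by (intro test test_function_bump bump_bounds) simp
      also have "\<dots> \<le> (\<integral>\<^sup>+x\<in>box c d. b x \<partial>lborel)"
      proof (intro nn_integral_mono mult_left_mono)
        fix x show "ennreal (bump c d (real (Suc m)) x) \<le> indicator (box c d) x"
          using bump_bounds[of c d "real (Suc m)" x] bump_outside[of "real (Suc m)" x c d]
          by (cases "x \<in> box c d") (auto simp: ennreal_le_1)
      qed simp
      finally show ?thesis .
    qed
    then have le: "ennreal (\<integral>x. F x * indicator (box c d) x \<partial>lborel) \<le> (\<integral>\<^sup>+x\<in>box c d. b x \<partial>lborel)"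
      using tendsto_ennrealI[OF lim] by (intro LIMSEQ_le_const2[of _ _ "\<integral>\<^sup>+x\<in>box c d. b x \<partial>lborel"]) auto
    define P where "P = (\<integral>\<^sup>+x\<in>box c d. ennreal (F x) \<partial>lborel)"
    define N where "N = (\<integral>\<^sup>+x\<in>box c d. ennreal (- F x) \<partial>lborel)"
    have P: "P = (\<integral>\<^sup>+x. ennreal (F x * indicator (box c d) x) \<partial>lborel)" and N: "N = (\<integral>\<^sup>+x. ennreal (- (F x * indicator (box c d) x)) \<partial>lborel)"
      unfolding P_def N_def by (auto intro!: nn_integral_cong simp: indicator_def)
    have PN: "P \<noteq> \<infinity>" "N \<noteq> \<infinity>" using int unfolding P N real_integrable_def by auto
    have "(\<integral>x. F x * indicator (box c d) x \<partial>lborel) = enn2real P - enn2real N"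
      unfolding P N by (rule real_lebesgue_integral_def[OF int])
    then have "enn2real P = (\<integral>x. F x * indicator (box c d) x \<partial>lborel) + enn2real N" by simp
    then have "P = ennreal ((\<integral>x. F x * indicator (box c d) x \<partial>lborel) + enn2real N)" using PN by (metis ennreal_enn2real_if infinity_ennreal_def)
    also have "\<dots> \<le> ennreal (\<integral>x. F x * indicator (box c d) x \<partial>lborel) + ennreal (enn2real N)"
      by (cases "0 \<le> (\<integral>x. F x * indicator (box c d) x \<partial>lborel)") (auto simp: ennreal_plus ennreal_neg intro!: ennreal_leI)
    also have "\<dots> \<le> (\<integral>\<^sup>+x\<in>box c d. b x \<partial>lborel) + N"
      using le PN by (intro add_mono) (auto simp: ennreal_enn2real_if)
    also have "\<dots> = (\<integral>\<^sup>+x\<in>box c d. (ennreal (- F x) + b x) \<partial>lborel)"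
      unfolding N_def by (subst nn_integral_add[symmetric]) (auto simp: distrib_right intro!: nn_integral_cong)
    finally show ?thesis unfolding P_def .
  qed
  have "AE x in lborel. x \<in> UNIV \<longrightarrow> ennreal (F x) \<le> ennreal (- F x) + b x"
  proof (rule AE_le_of_cubes[where K=0 and T="{}"])
    fix x :: "real^'n" and k :: int
    let ?Q = "dcube {} k x"
    define B where "B = box (dcorner {} k x) (dcorner {} k x + (\<chi> i. 2 powi (-k)))"
    have [measurable]: "B \<in> sets borel" by (simp add: B_def)
    have "emeasure lborel (?Q - B) = emeasure lborel ?Q - emeasure lborel B"
      using dcube_boxes(1)[of "{}" k x] by (intro emeasure_Diff) (auto simp: B_def emeasure_cube)
    also have "\<dots> = 0" unfolding B_def by (simp add: emeasure_dcube emeasure_cube)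
    finally have AE: "AE y in lborel. y \<notin> ?Q - B"
      by (intro AE_not_in) (simp add: null_sets_def)
    have eq: "(\<integral>\<^sup>+y\<in>?Q. u y \<partial>lborel) = (\<integral>\<^sup>+y\<in>B. u y \<partial>lborel)" for u :: "real^'n \<Rightarrow> ennreal"
      by (rule nn_integral_cong_AE, use AE in eventually_elim) (use dcube_boxes(1)[of "{}" k x] in \<open>auto simp: B_def indicator_def\<close>)
    show "(\<integral>\<^sup>+y\<in>?Q. ennreal (F y) \<partial>lborel) \<le> (\<integral>\<^sup>+y\<in>?Q. (ennreal (- F y) + b y) \<partial>lborel)"
      unfolding eq unfolding B_def by (rule box)
  next
    fix R :: real
    have [measurable]: "ball (0::real^'n) R \<in> sets borel" by simp
    have "(\<integral>\<^sup>+x\<in>ball 0 R. (ennreal (F x) + (ennreal (- F x) + b x)) \<partial>lborel) \<le> (\<integral>\<^sup>+x. ennreal \<bar>F x\<bar> * indicator (ball 0 R) x + b x * indicator (ball 0 R) x \<partial>lborel)"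
    proof (intro nn_integral_mono)
      fix x
      have "ennreal (F x) + ennreal (- F x) = ennreal \<bar>F x\<bar>" by (cases "0 \<le> F x") (auto simp: ennreal_neg)
      then show "(ennreal (F x) + (ennreal (- F x) + b x)) * indicator (ball 0 R) x \<le> ennreal \<bar>F x\<bar> * indicator (ball 0 R) x + b x * indicator (ball 0 R) x"
        by (simp add: add.assoc[symmetric] distrib_right[symmetric])
    qed
    also have "\<dots> = (\<integral>\<^sup>+x\<in>ball 0 R. ennreal \<bar>F x\<bar> \<partial>lborel) + (\<integral>\<^sup>+x\<in>ball 0 R. b x \<partial>lborel)"
      by (rule nn_integral_add) measurable
    also have "\<dots> < \<infinity>" using lF lb by (simp add: locint_def)
    finally show "(\<integral>\<^sup>+x\<in>ball 0 R. (ennreal (F x) + (ennreal (- F x) + b x)) \<partial>lborel) < \<infinity>" .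
  qed measurable
  then show ?thesis
  proof eventually_elim
    case (elim x)
    then show ?case by (cases "0 \<le> F x") (auto simp: ennreal_neg)
  qed
qed

section \<open>Translations\<close>

lemma nn_integral_translate:
  fixes g :: "real^'n::finite \<Rightarrow> ennreal"
  assumes [measurable]: "g \<in> borel_measurable borel"
  shows "(\<integral>\<^sup>+x. g (x + v) \<partial>lborel) = (\<integral>\<^sup>+x. g x \<partial>lborel)"
proof -
  have "(\<integral>\<^sup>+x. g x \<partial>lborel) = (\<integral>\<^sup>+x. g x \<partial>distr lborel borel ((+) v))"
    by (simp add: lborel_distr_plus)
  also have "\<dots> = (\<integral>\<^sup>+x. g (v + x) \<partial>lborel)" by (subst nn_integral_distr) auto
  finally show ?thesis by (simp add: add.commute)
qed

lemma integral_translate: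
  fixes g :: "real^'n::finite \<Rightarrow> real"
  assumes [measurable]: "g \<in> borel_measurable borel"
  shows "(\<integral>x. g (x + v) \<partial>lborel) = (\<integral>x. g x \<partial>lborel)"
proof -
  have "(\<integral>x. g x \<partial>lborel) = (\<integral>x. g x \<partial>distr lborel borel ((+) v))"
    by (simp add: lborel_distr_plus)
  also have "\<dots> = (\<integral>x. g (v + x) \<partial>lborel)" by (subst integral_distr) auto
  finally show ?thesis by (simp add: add.commute)
qed

lemma ennreal_abs_integral_le:
  fixes g :: "'a \<Rightarrow> real" shows "ennreal \<bar>\<integral>x. g x \<partial>M\<bar> \<le> (\<integral>\<^sup>+x. ennreal \<bar>g x\<bar> \<partial>M)"
  using integral_norm_bound_ennreal[of M g] by (cases "integrable M g") (auto simp: not_integrable_integral_eq)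

lemma locint_translate:
  assumes [measurable]: "u \<in> borel_measurable borel" and l: "locint u"
  shows "(\<integral>\<^sup>+x\<in>ball 0 R. u (x + v) \<partial>lborel) \<le> (\<integral>\<^sup>+x\<in>ball 0 (R + norm v). u x \<partial>lborel)"
    "locint (\<lambda>x. u (x + v))"
proof -
  show *: "(\<integral>\<^sup>+x\<in>ball 0 R. u (x + v) \<partial>lborel) \<le> (\<integral>\<^sup>+x\<in>ball 0 (R + norm v). u x \<partial>lborel)" for R
  proof -
    have [measurable]: "ball (0::real^'a) (R + norm v) \<in> sets borel" by simp
    have "(\<integral>\<^sup>+x\<in>ball 0 R. u (x + v) \<partial>lborel) \<le> (\<integral>\<^sup>+x. (\<lambda>x. u x * indicator (ball 0 (R + norm v)) x) (x + v) \<partial>lborel)"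
    proof (intro nn_integral_mono)
      fix x
      have "norm (x + v) < R + norm v" if "norm x < R" using norm_triangle_ineq[of x v] that by linarith
      then show "u (x + v) * indicator (ball 0 R) x \<le> (\<lambda>x. u x * indicator (ball 0 (R + norm v)) x) (x + v)"
        by (auto simp: indicator_def)
    qed
    also have "\<dots> = (\<integral>\<^sup>+x\<in>ball 0 (R + norm v). u x \<partial>lborel)"
      by (rule nn_integral_translate) measurable
    finally show ?thesis .
  qed
  show "locint (\<lambda>x. u (x + v))" 
    unfolding locint_def
  proof
    fix R
    show "(\<integral>\<^sup>+x\<in>ball 0 R. u (x + v) \<partial>lborel) < \<infinity>"
      using l unfolding locint_def by (intro le_less_trans[OF *[of R]]) blast
  qed
qed

lemma locint_mono: "locint u \<Longrightarrow> (\<And>x. u' x \<le> u x) \<Longrightarrow> locint u'"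
  unfolding locint_def
  by (meson le_less_trans mult_right_mono nn_integral_mono zero_le)

lemma locint_add:
  assumes [measurable]: "u \<in> borel_measurable borel" "u' \<in> borel_measurable borel"
  shows "locint u \<Longrightarrow> locint u' \<Longrightarrow> locint (\<lambda>x. u x + u' x)"
  unfolding locint_def
proof (intro allI)
  fix R :: real assume l: "\<forall>R. (\<integral>\<^sup>+x\<in>ball 0 R. u x \<partial>lborel) < \<infinity>" "\<forall>R. (\<integral>\<^sup>+x\<in>ball 0 R. u' x \<partial>lborel) < \<infinity>"
  have [measurable]: "ball (0::real^'a) R \<in> sets borel" by simp
  have "(\<integral>\<^sup>+x\<in>ball 0 R. (u x + u' x) \<partial>lborel) = (\<integral>\<^sup>+x\<in>ball 0 R. u x \<partial>lborel) + (\<integral>\<^sup>+x\<in>ball 0 R. u' x \<partial>lborel)"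
    unfolding distrib_right by (rule nn_integral_add) measurable
  then show "(\<integral>\<^sup>+x\<in>ball 0 R. (u x + u' x) \<partial>lborel) < \<infinity>" using l by simp
qed

section \<open>Weak gradients along segments\<close>

text \<open>Weak gradients for Borel functions, to which Fubini's theorem for the product of \<open>lborel\<close> with
  itself applies.\<close>

definition borel_weak_gradient :: "(real^'n::finite \<Rightarrow> real) \<Rightarrow> (real^'n \<Rightarrow> real^'n) \<Rightarrow> bool" where
  "borel_weak_gradient f G \<longleftrightarrow> f \<in> borel_measurable borel \<and> G \<in> borel_measurable borel \<and>
    locint (\<lambda>x. ennreal \<bar>f x\<bar>) \<and> locint (\<lambda>x. ennreal (norm (G x))) \<and>
    (\<forall>\<phi> i. test_function \<phi> \<longrightarrow> (\<integral>x. f x * partial_deriv i \<phi> x \<partial>lborel) = - (\<integral>x. G x $ i * \<phi> x \<partial>lborel))"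

lemma partial_deriv_translate:
  assumes "test_function \<phi>" shows "partial_deriv i (\<lambda>x. \<phi> (x + v)) x = partial_deriv i \<phi> (x + v)"
proof -
  let ?D = "\<lambda>h. \<Sum>i\<in>UNIV. h $ i * partial_deriv i \<phi> (x + v)"
  have "(\<phi> \<circ> (\<lambda>x. x + v) has_derivative ?D \<circ> (\<lambda>h. h)) (at x)"
    by (intro diff_chain_at test_function_has_derivative assms) (auto intro!: derivative_eq_intros)
  then have "((\<lambda>x. \<phi> (x + v)) has_derivative ?D) (at x)" by (simp add: o_def)
  then have "partial_deriv i (\<lambda>x. \<phi> (x + v)) x = ?D (axis i 1)" by (rule partial_deriv_eq)
  also have "\<dots> = partial_deriv i \<phi> (x + v)"
    by (simp add: axis_def if_distrib[of "\<lambda>t. t * _"] sum.delta cong: if_cong)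
  finally show ?thesis .
qed

definition dir_deriv :: "real^'n::finite \<Rightarrow> (real^'n \<Rightarrow> real) \<Rightarrow> real^'n \<Rightarrow> real" where
  "dir_deriv v \<phi> x = (\<Sum>i\<in>UNIV. v $ i * partial_deriv i \<phi> x)"

lemma test_function_segment:
  assumes t: "test_function \<phi>"
  shows "(\<integral>t. indicator {0..1} t *\<^sub>R dir_deriv v \<phi> (x + (- t) *\<^sub>R v) \<partial>lborel) = \<phi> x - \<phi> (x - v)"
proof -
  have "(\<integral>t. indicator {0..1} t *\<^sub>R dir_deriv v \<phi> (x + (- t) *\<^sub>R v) \<partial>lborel) = - \<phi> (x + (- 1) *\<^sub>R v) - - \<phi> (x + (- 0) *\<^sub>R v)"
  proof (rule integral_FTC_atLeastAtMost)
    fix t :: real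
    have "((\<lambda>t. x + (- t) *\<^sub>R v) has_derivative (\<lambda>h. (- h) *\<^sub>R v)) (at t)"
      by (auto intro!: derivative_eq_intros)
    from diff_chain_at[OF this test_function_has_derivative[OF t]]
    have "((\<lambda>t. \<phi> (x + (- t) *\<^sub>R v)) has_derivative (\<lambda>h. \<Sum>i\<in>UNIV. ((- h) *\<^sub>R v) $ i * partial_deriv i \<phi> (x + (- t) *\<^sub>R v))) (at t)"
      by (simp add: o_def)
    from has_derivative_minus[OF this]
    have "((\<lambda>t. - \<phi> (x + (- t) *\<^sub>R v)) has_derivative (\<lambda>h. h *\<^sub>R dir_deriv v \<phi> (x + (- t) *\<^sub>R v))) (at t)"
      by (rule has_derivative_eq_rhs) (auto simp: dir_deriv_def sum_negf sum_distrib_left ac_simps)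
    then have "((\<lambda>t. - \<phi> (x + (- t) *\<^sub>R v)) has_vector_derivative dir_deriv v \<phi> (x + (- t) *\<^sub>R v)) (at t)"
      by (simp add: has_vector_derivative_def)
    then show "((\<lambda>t. - \<phi> (x + (- t) *\<^sub>R v)) has_vector_derivative dir_deriv v \<phi> (x + (- t) *\<^sub>R v)) (at t within {0..1})"
      by (rule has_vector_derivative_at_within)
  next
    show "continuous_on {0..1} (\<lambda>t. dir_deriv v \<phi> (x + (- t) *\<^sub>R v))"
      unfolding dir_deriv_def
      by (intro continuous_intros continuous_on_compose2[OF test_function_partial_continuous[OF t]]) auto
  qed simp
  then show ?thesis by simp
qed

text \<open>Move the translation to \<open>\<phi>\<close>, write the difference of \<open>\<phi>\<close> as the integral of its derivative
  along the segment, exchange the integrals, and use the definition of the weak gradient for each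
  translate of \<open>\<phi>\<close>.\<close>

lemma weak_gradient_translation_test:
  assumes wg: "borel_weak_gradient f G" and t: "test_function \<phi>" and pos: "\<And>x. 0 \<le> \<phi> x"
  shows "ennreal \<bar>\<integral>x. (f (x + v) - f x) * \<phi> x \<partial>lborel\<bar>
    \<le> (\<integral>\<^sup>+x. (\<integral>\<^sup>+s\<in>{0..1}. ennreal (norm (G (x + s *\<^sub>R v)) * norm v) \<partial>lborel) * ennreal (\<phi> x) \<partial>lborel)"
proof -
  have [measurable]: "f \<in> borel_measurable borel" "G \<in> borel_measurable borel"
    and lf: "locint (\<lambda>x. ennreal \<bar>f x\<bar>)" and lG: "locint (\<lambda>x. ennreal (norm (G x)))"
    and weak: "\<And>\<phi> i. test_function \<phi> \<Longrightarrow> (\<integral>x. f x * partial_deriv i \<phi> x \<partial>lborel) = - (\<integral>x. G x $ i * \<phi> x \<partial>lborel)"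
    using wg by (auto simp: borel_weak_gradient_def)
  have [measurable]: "\<phi> \<in> borel_measurable borel" "partial_deriv i \<phi> \<in> borel_measurable borel" for i
    using t by (auto intro!: borel_measurable_continuous_onI test_function_continuous test_function_partial_continuous)
  obtain R C where RC: "0 < R" "0 < C" "\<And>x. norm x \<ge> R \<Longrightarrow> \<phi> x = 0" "\<And>x i. norm x \<ge> R \<Longrightarrow> partial_deriv i \<phi> x = 0"
    "\<And>x. \<bar>\<phi> x\<bar> \<le> C" "\<And>x i. \<bar>partial_deriv i \<phi> x\<bar> \<le> C"
    by (rule test_function_bounds[OF t]) blast
  define D where "D = dir_deriv v \<phi>"
  have [measurable]: "D \<in> borel_measurable borel" unfolding D_def dir_deriv_def by measurable
  define C' where "C' = (\<Sum>i\<in>UNIV. \<bar>v $ i\<bar> * C)"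
  have DC: "\<bar>D x\<bar> \<le> C'" for x
    unfolding D_def dir_deriv_def C'_def
    by (rule order_trans[OF sum_abs]) (auto intro!: sum_mono mult_left_mono RC simp: abs_mult)
  have C'0: "0 \<le> C'" using DC[of 0] by simp
  have D0: "D x = 0" if "norm x \<ge> R" for x using RC(4)[OF that] by (simp add: D_def dir_deriv_def)
  define R' where "R' = R + norm v"
  have far: "norm (x + (- s) *\<^sub>R v) \<ge> R" if "norm x \<ge> R'" "s \<in> {0..1}" for x s
  proof -
    have "norm x \<le> norm (x + (- s) *\<^sub>R v) + norm (s *\<^sub>R v)"
      using norm_triangle_ineq[of "x + (- s) *\<^sub>R v" "s *\<^sub>R v"] by simp
    moreover have "norm (s *\<^sub>R v) \<le> norm v" using that by (simp add: mult_left_le_one_le)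
    ultimately show ?thesis using that by (simp add: R'_def)
  qed
  have lfv: "locint (\<lambda>x. ennreal \<bar>f (x + v)\<bar>)" by (rule locint_translate(2)[of "\<lambda>x. ennreal \<bar>f x\<bar>"]) (use lf in auto)
  have i1: "integrable lborel (\<lambda>x. f (x + v) * \<phi> x)"
    by (rule integrable_locint_mult[OF _ _ lfv RC(3,5)]) auto
  have i2: "integrable lborel (\<lambda>x. f x * \<phi> x)"
    by (rule integrable_locint_mult[OF _ _ lf RC(3,5)]) auto
  have i3: "integrable lborel (\<lambda>x. f x * \<phi> (x - v))"
  proof (rule integrable_locint_mult[OF _ _ lf, of _ R' C])
    show "norm x \<ge> R' \<Longrightarrow> \<phi> (x - v) = 0" for x using far[of x 1] RC(3) by simp
  qed (use RC in auto)
  have "(\<integral>x. (f (x + v) - f x) * \<phi> x \<partial>lborel) = (\<integral>x. f (x + v) * \<phi> x \<partial>lborel) - (\<integral>x. f x * \<phi> x \<partial>lborel)"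
    unfolding left_diff_distrib by (rule Bochner_Integration.integral_diff[OF i1 i2])
  also have "(\<integral>x. f (x + v) * \<phi> x \<partial>lborel) = (\<integral>x. f x * \<phi> (x - v) \<partial>lborel)"
    using integral_translate[of "\<lambda>x. f x * \<phi> (x - v)" v] by simp
  also have "(\<integral>x. f x * \<phi> (x - v) \<partial>lborel) - (\<integral>x. f x * \<phi> x \<partial>lborel) = (\<integral>x. f x * \<phi> (x - v) - f x * \<phi> x \<partial>lborel)"
    by (rule Bochner_Integration.integral_diff[OF i3 i2, symmetric])
  also have "\<dots> = (\<integral>x. (\<integral>s. - (indicator {0..1} s * (f x * D (x + (- s) *\<^sub>R v))) \<partial>lborel) \<partial>lborel)"
  proof (rule Bochner_Integration.integral_cong[OF refl])
    fix x
    have "(\<integral>s. - (indicator {0..1} s * (f x * D (x + (- s) *\<^sub>R v))) \<partial>lborel) = (\<integral>s. (- f x) * (indicator {0..1} s *\<^sub>R D (x + (- s) *\<^sub>R v)) \<partial>lborel)"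
      by (intro Bochner_Integration.integral_cong) auto
    also have "\<dots> = (- f x) * (\<integral>s. indicator {0..1} s *\<^sub>R D (x + (- s) *\<^sub>R v) \<partial>lborel)"
      by (rule integral_mult_right_zero)
    also have "\<dots> = f x * \<phi> (x - v) - f x * \<phi> x"
      unfolding D_def test_function_segment[OF t] by (simp add: algebra_simps)
    finally show "f x * \<phi> (x - v) - f x * \<phi> x = (\<integral>s. - (indicator {0..1} s * (f x * D (x + (- s) *\<^sub>R v))) \<partial>lborel)" by simp
  qed
  also have "\<dots> = (\<integral>s. (\<integral>x. - (indicator {0..1} s * (f x * D (x + (- s) *\<^sub>R v))) \<partial>lborel) \<partial>lborel)"
  proof (rule lborel_pair.Fubini_integral[symmetric])
    have [measurable]: "ball (0::real^'a) R' \<in> sets borel" by simp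
    show "integrable (lborel \<Otimes>\<^sub>M lborel) (\<lambda>(x, s). - (indicator {0..1} s * (f x * D (x + (- s) *\<^sub>R v))))"
    proof (rule integrableI_bounded)
      have "(\<integral>\<^sup>+z. ennreal (norm (case z of (x, s) \<Rightarrow> - (indicator {0..1} s * (f x * D (x + (- s) *\<^sub>R v))))) \<partial>(lborel \<Otimes>\<^sub>M lborel))
        \<le> (\<integral>\<^sup>+z. (case z of (x, s) \<Rightarrow> ennreal C' * (ennreal \<bar>f x\<bar> * indicator (ball 0 R') x) * indicator {0..1::real} s) \<partial>(lborel \<Otimes>\<^sub>M lborel))"
      proof (intro nn_integral_mono, clarify)
        fix x :: "real^'a" and s :: real
        show "ennreal (norm (- (indicator {0..1} s * (f x * D (x + (- s) *\<^sub>R v))))) \<le> ennreal C' * (ennreal \<bar>f x\<bar> * indicator (ball 0 R') x) * indicator {0..1} s"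
        proof (cases "s \<in> {0..1} \<and> norm x < R'")
          case True
          have "\<bar>f x\<bar> * \<bar>D (x + (- s) *\<^sub>R v)\<bar> \<le> C' * \<bar>f x\<bar>"
            using mult_left_mono[OF DC[of "x + (- s) *\<^sub>R v"], of "\<bar>f x\<bar>"] by (simp add: mult.commute)
          then show ?thesis using True C'0 by (simp add: abs_mult ennreal_mult[symmetric] ennreal_leI)
        next
          case False
          then show ?thesis using far[of x s] D0 by (auto simp: indicator_def)
        qed
      qed
      also have "\<dots> = (\<integral>\<^sup>+x. \<integral>\<^sup>+s. ennreal C' * (ennreal \<bar>f x\<bar> * indicator (ball 0 R') x) * indicator {0..1::real} s \<partial>lborel \<partial>lborel)"
        by (subst lborel.nn_integral_fst[symmetric]) auto
      also have "\<dots> = (\<integral>\<^sup>+x. ennreal C' * (ennreal \<bar>f x\<bar> * indicator (ball 0 R') x) \<partial>lborel)"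
        by (subst nn_integral_cmult_indicator) auto
      also have "\<dots> = ennreal C' * (\<integral>\<^sup>+x\<in>ball 0 R'. ennreal \<bar>f x\<bar> \<partial>lborel)"
        by (rule nn_integral_cmult) measurable
      also have "\<dots> < \<infinity>" using lf by (simp add: locint_def ennreal_mult_less_top)
      finally show "(\<integral>\<^sup>+z. ennreal (norm (case z of (x, s) \<Rightarrow> - (indicator {0..1} s * (f x * D (x + (- s) *\<^sub>R v))))) \<partial>(lborel \<Otimes>\<^sub>M lborel)) < \<infinity>" .
    qed measurable
  qed
  also have "\<dots> = (\<integral>s. indicator {0..1} s * (\<integral>x. (G x \<bullet> v) * \<phi> (x + (- s) *\<^sub>R v) \<partial>lborel) \<partial>lborel)"
  proof (rule Bochner_Integration.integral_cong[OF refl])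
    fix s :: real
    define \<psi> where "\<psi> x = \<phi> (x + (- s) *\<^sub>R v)" for x
    have t\<psi>: "test_function \<psi>" unfolding \<psi>_def by (rule test_function_translate[OF t])
    have p\<psi>: "partial_deriv i \<psi> x = partial_deriv i \<phi> (x + (- s) *\<^sub>R v)" for i x
      unfolding \<psi>_def by (rule partial_deriv_translate[OF t])
    have m\<psi> [measurable]: "\<psi> \<in> borel_measurable borel" "partial_deriv i \<psi> \<in> borel_measurable borel" for i
      using t\<psi> by (auto intro!: borel_measurable_continuous_onI test_function_continuous test_function_partial_continuous)
    obtain R1 C1 where RC1: "\<And>x. norm x \<ge> R1 \<Longrightarrow> \<psi> x = 0" "\<And>x i. norm x \<ge> R1 \<Longrightarrow> partial_deriv i \<psi> x = 0"
      "\<And>x. \<bar>\<psi> x\<bar> \<le> C1" "\<And>x i. \<bar>partial_deriv i \<psi> x\<bar> \<le> C1"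
      by (rule test_function_bounds[OF t\<psi>]) blast
    have [measurable]: "(\<lambda>x. G x $ i) \<in> borel_measurable borel" for i
    proof -
      have "(\<lambda>x. G x \<bullet> axis i 1) \<in> borel_measurable borel" by measurable
      then show ?thesis by (simp add: inner_axis)
    qed
    have lGi: "locint (\<lambda>x. ennreal \<bar>G x $ i\<bar>)" for i
      by (rule locint_mono[OF lG]) (simp add: ennreal_leI component_le_norm_cart)
    have ii: "integrable lborel (\<lambda>x. f x * partial_deriv i \<psi> x)" "integrable lborel (\<lambda>x. G x $ i * \<psi> x)" for i
      by (rule integrable_locint_mult[OF _ _ lf RC1(2,4)], auto)
         (rule integrable_locint_mult[OF _ _ lGi RC1(1,3)], auto)
    have "(\<integral>x. f x * D (x + (- s) *\<^sub>R v) \<partial>lborel) = (\<integral>x. (\<Sum>i\<in>UNIV. v $ i * (f x * partial_deriv i \<psi> x)) \<partial>lborel)"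
      by (intro Bochner_Integration.integral_cong) (auto simp: D_def dir_deriv_def p\<psi> sum_distrib_left ac_simps)
    also have "\<dots> = (\<Sum>i\<in>UNIV. v $ i * (\<integral>x. f x * partial_deriv i \<psi> x \<partial>lborel))"
      using ii by (subst Bochner_Integration.integral_sum) auto
    also have "\<dots> = - (\<Sum>i\<in>UNIV. v $ i * (\<integral>x. G x $ i * \<psi> x \<partial>lborel))"
      using weak[OF t\<psi>] by (simp add: sum_negf)
    also have "(\<Sum>i\<in>UNIV. v $ i * (\<integral>x. G x $ i * \<psi> x \<partial>lborel)) = (\<integral>x. (\<Sum>i\<in>UNIV. v $ i * (G x $ i * \<psi> x)) \<partial>lborel)"
      using ii by (subst Bochner_Integration.integral_sum) auto
    also have "\<dots> = (\<integral>x. (G x \<bullet> v) * \<psi> x \<partial>lborel)"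
      by (intro Bochner_Integration.integral_cong) (auto simp: inner_vec_def sum_distrib_left sum_distrib_right ac_simps)
    finally have "(\<integral>x. f x * D (x + (- s) *\<^sub>R v) \<partial>lborel) = - (\<integral>x. (G x \<bullet> v) * \<psi> x \<partial>lborel)" .
    then show "(\<integral>x. - (indicator {0..1} s * (f x * D (x + (- s) *\<^sub>R v))) \<partial>lborel) = indicator {0..1} s * (\<integral>x. (G x \<bullet> v) * \<phi> (x + (- s) *\<^sub>R v) \<partial>lborel)"
      by (simp add: \<psi>_def)
  qed
  finally have eq: "(\<integral>x. (f (x + v) - f x) * \<phi> x \<partial>lborel) = (\<integral>s. indicator {0..1} s * (\<integral>x. (G x \<bullet> v) * \<phi> (x + (- s) *\<^sub>R v) \<partial>lborel) \<partial>lborel)" .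
  have "ennreal \<bar>\<integral>x. (f (x + v) - f x) * \<phi> x \<partial>lborel\<bar>
      \<le> (\<integral>\<^sup>+s. ennreal \<bar>indicator {0..1} s * (\<integral>x. (G x \<bullet> v) * \<phi> (x + (- s) *\<^sub>R v) \<partial>lborel)\<bar> \<partial>lborel)"
    unfolding eq by (rule ennreal_abs_integral_le)
  also have "\<dots> \<le> (\<integral>\<^sup>+s. indicator {0..1} s * (\<integral>\<^sup>+x. ennreal (norm (G x) * norm v) * ennreal (\<phi> (x + (- s) *\<^sub>R v)) \<partial>lborel) \<partial>lborel)"
  proof (intro nn_integral_mono)
    fix s :: real
    have "ennreal \<bar>\<integral>x. (G x \<bullet> v) * \<phi> (x + (- s) *\<^sub>R v) \<partial>lborel\<bar> \<le> (\<integral>\<^sup>+x. ennreal \<bar>(G x \<bullet> v) * \<phi> (x + (- s) *\<^sub>R v)\<bar> \<partial>lborel)"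
      by (rule ennreal_abs_integral_le)
    also have "\<dots> \<le> (\<integral>\<^sup>+x. ennreal (norm (G x) * norm v) * ennreal (\<phi> (x + (- s) *\<^sub>R v)) \<partial>lborel)"
      using pos Cauchy_Schwarz_ineq2
      by (intro nn_integral_mono) (auto simp: abs_mult ennreal_mult[symmetric] intro!: ennreal_leI mult_right_mono)
    finally show "ennreal \<bar>indicator {0..1} s * (\<integral>x. (G x \<bullet> v) * \<phi> (x + (- s) *\<^sub>R v) \<partial>lborel)\<bar> \<le> indicator {0..1} s * (\<integral>\<^sup>+x. ennreal (norm (G x) * norm v) * ennreal (\<phi> (x + (- s) *\<^sub>R v)) \<partial>lborel)"
      by (auto simp: indicator_def)
  qed
  also have "\<dots> = (\<integral>\<^sup>+s. \<integral>\<^sup>+x. indicator {0..1} s * (ennreal (norm (G (x + s *\<^sub>R v)) * norm v) * ennreal (\<phi> x)) \<partial>lborel \<partial>lborel)"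
  proof (intro nn_integral_cong)
    fix s :: real
    have "(\<integral>\<^sup>+x. ennreal (norm (G x) * norm v) * ennreal (\<phi> (x + (- s) *\<^sub>R v)) \<partial>lborel) = (\<integral>\<^sup>+x. ennreal (norm (G (x + s *\<^sub>R v)) * norm v) * ennreal (\<phi> x) \<partial>lborel)"
      using nn_integral_translate[of "\<lambda>x. ennreal (norm (G x) * norm v) * ennreal (\<phi> (x + (- s) *\<^sub>R v))" "s *\<^sub>R v"] by simp
    then show "indicator {0..1} s * (\<integral>\<^sup>+x. ennreal (norm (G x) * norm v) * ennreal (\<phi> (x + (- s) *\<^sub>R v)) \<partial>lborel) = (\<integral>\<^sup>+x. indicator {0..1} s * (ennreal (norm (G (x + s *\<^sub>R v)) * norm v) * ennreal (\<phi> x)) \<partial>lborel)"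
      by (simp add: nn_integral_cmult)
  qed
  also have "\<dots> = (\<integral>\<^sup>+x. \<integral>\<^sup>+s. indicator {0..1} s * (ennreal (norm (G (x + s *\<^sub>R v)) * norm v) * ennreal (\<phi> x)) \<partial>lborel \<partial>lborel)"
    by (rule lborel_pair.Fubini') measurable
  also have "\<dots> = (\<integral>\<^sup>+x. (\<integral>\<^sup>+s\<in>{0..1}. ennreal (norm (G (x + s *\<^sub>R v)) * norm v) \<partial>lborel) * ennreal (\<phi> x) \<partial>lborel)"
    by (intro nn_integral_cong, subst nn_integral_multc[symmetric]) (auto simp: ac_simps)
  finally show ?thesis .
qed

text \<open>The bound on tests is localised by comparison, applied to the difference and to its negative.\<close>

lemma weak_gradient_translation:
  assumes wg: "borel_weak_gradient f G"
  shows "AE x in lborel. ennreal \<bar>f (x + v) - f x\<bar> \<le> (\<integral>\<^sup>+s\<in>{0..1}. ennreal (norm (G (x + s *\<^sub>R v)) * norm v) \<partial>lborel)"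
proof -
  have [measurable]: "f \<in> borel_measurable borel" "G \<in> borel_measurable borel"
    and lf: "locint (\<lambda>x. ennreal \<bar>f x\<bar>)" and lG: "locint (\<lambda>x. ennreal (norm (G x)))"
    using wg by (auto simp: borel_weak_gradient_def)
  define b where "b x = (\<integral>\<^sup>+s\<in>{0..1}. ennreal (norm (G (x + s *\<^sub>R v)) * norm v) \<partial>lborel)" for x
  have [measurable]: "b \<in> borel_measurable borel" unfolding b_def by measurable
  have lfv: "locint (\<lambda>x. ennreal \<bar>f (x + v)\<bar>)" by (rule locint_translate(2)[of "\<lambda>x. ennreal \<bar>f x\<bar>"]) (use lf in auto)
  have lF: "locint (\<lambda>x. ennreal \<bar>f (x + v) - f x\<bar>)"
    by (rule locint_mono[OF locint_add[OF _ _ lfv lf]]) (auto simp flip: ennreal_plus intro!: ennreal_leI)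
  have lb: "locint b"
    unfolding locint_def
  proof
    fix R :: real
    have [measurable]: "ball (0::real^'a) R \<in> sets borel" by simp
    let ?I = "\<integral>\<^sup>+x\<in>ball 0 (R + norm v). ennreal (norm (G x)) \<partial>lborel"
    have "(\<integral>\<^sup>+x\<in>ball 0 R. b x \<partial>lborel) = (\<integral>\<^sup>+x. \<integral>\<^sup>+s. ennreal (norm (G (x + s *\<^sub>R v)) * norm v) * indicator {0..1} s * indicator (ball 0 R) x \<partial>lborel \<partial>lborel)"
      unfolding b_def by (intro nn_integral_cong, subst nn_integral_multc) auto
    also have "\<dots> = (\<integral>\<^sup>+s. \<integral>\<^sup>+x. ennreal (norm (G (x + s *\<^sub>R v)) * norm v) * indicator {0..1} s * indicator (ball 0 R) x \<partial>lborel \<partial>lborel)"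
      by (rule lborel_pair.Fubini'[symmetric]) measurable
    also have "\<dots> \<le> (\<integral>\<^sup>+s. (ennreal (norm v) * ?I) * indicator {0..1::real} s \<partial>lborel)"
    proof (intro nn_integral_mono)
      fix s :: real
      show "(\<integral>\<^sup>+x. ennreal (norm (G (x + s *\<^sub>R v)) * norm v) * indicator {0..1} s * indicator (ball 0 R) x \<partial>lborel) \<le> (ennreal (norm v) * ?I) * indicator {0..1} s"
      proof (cases "s \<in> {0..1}")
        case True
        have "(\<integral>\<^sup>+x. ennreal (norm (G (x + s *\<^sub>R v)) * norm v) * indicator {0..1} s * indicator (ball 0 R) x \<partial>lborel)
            = (\<integral>\<^sup>+x. ennreal (norm v) * (ennreal (norm (G (x + s *\<^sub>R v))) * indicator (ball 0 R) x) \<partial>lborel)"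
          using True by (intro nn_integral_cong) (auto simp: ennreal_mult ac_simps)
        also have "\<dots> = ennreal (norm v) * (\<integral>\<^sup>+x\<in>ball 0 R. ennreal (norm (G (x + s *\<^sub>R v))) \<partial>lborel)"
          by (rule nn_integral_cmult) measurable
        also have "\<dots> \<le> ennreal (norm v) * (\<integral>\<^sup>+x\<in>ball 0 (R + norm (s *\<^sub>R v)). ennreal (norm (G x)) \<partial>lborel)"
          by (intro mult_left_mono locint_translate(1)[of "\<lambda>x. ennreal (norm (G x))"] lG) auto
        also have "\<dots> \<le> ennreal (norm v) * ?I"
        proof (rule mult_left_mono[OF nn_integral_mono])
          fix x
          have "norm (s *\<^sub>R v) \<le> norm v" using True by (simp add: mult_left_le_one_le)
          then show "ennreal (norm (G x)) * indicator (ball 0 (R + norm (s *\<^sub>R v))) x \<le> ennreal (norm (G x)) * indicator (ball 0 (R + norm v)) x"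
            by (auto simp: indicator_def)
        qed simp
        finally show ?thesis using True by simp
      qed simp
    qed
    also have "\<dots> = ennreal (norm v) * ?I"
      by (subst nn_integral_cmult_indicator) auto
    also have "\<dots> < \<infinity>" using lG by (simp add: locint_def ennreal_mult_less_top)
    finally show "(\<integral>\<^sup>+x\<in>ball 0 R. b x \<partial>lborel) < \<infinity>" .
  qed
  have t1: "ennreal (\<integral>x. (f (x + v) - f x) * \<phi> x \<partial>lborel) \<le> (\<integral>\<^sup>+x. b x * ennreal (\<phi> x) \<partial>lborel)"
    and t2: "ennreal (\<integral>x. (- (f (x + v) - f x)) * \<phi> x \<partial>lborel) \<le> (\<integral>\<^sup>+x. b x * ennreal (\<phi> x) \<partial>lborel)"
    if "test_function \<phi>" "\<And>x. 0 \<le> \<phi> x" for \<phi>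
  proof -
    note le = weak_gradient_translation_test[OF wg that, of v, folded b_def]
    have "ennreal (\<integral>x. (f (x + v) - f x) * \<phi> x \<partial>lborel) \<le> ennreal \<bar>\<integral>x. (f (x + v) - f x) * \<phi> x \<partial>lborel\<bar>"
      by (rule ennreal_leI) simp
    then show "ennreal (\<integral>x. (f (x + v) - f x) * \<phi> x \<partial>lborel) \<le> (\<integral>\<^sup>+x. b x * ennreal (\<phi> x) \<partial>lborel)"
      using le by (rule order_trans)
    have "ennreal (\<integral>x. (- (f (x + v) - f x)) * \<phi> x \<partial>lborel) \<le> ennreal \<bar>\<integral>x. (f (x + v) - f x) * \<phi> x \<partial>lborel\<bar>"
      unfolding mult_minus_left integral_minus by (rule ennreal_leI) simp
    then show "ennreal (\<integral>x. (- (f (x + v) - f x)) * \<phi> x \<partial>lborel) \<le> (\<integral>\<^sup>+x. b x * ennreal (\<phi> x) \<partial>lborel)"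
      using le by (rule order_trans)
  qed
  have "AE x in lborel. ennreal (f (x + v) - f x) \<le> b x"
    by (rule bound_of_tests[OF _ _ lF lb t1]) auto
  moreover have "AE x in lborel. ennreal (- (f (x + v) - f x)) \<le> b x"
    by (rule bound_of_tests[OF _ _ _ lb t2]) (use lF in \<open>auto simp: abs_minus_commute\<close>)
  ultimately show ?thesis
    unfolding b_def[symmetric] by eventually_elim (auto simp: abs_real_def)
qed

section \<open>The Poincare inequality and the pointwise bound\<close>

text \<open>Substitute \<open>y = x + v\<close>. By convexity the segment from \<open>x\<close> to \<open>y\<close> stays in the cube, so for each \<open>v\<close>
  and each parameter \<open>s\<close> the integral over \<open>x\<close> is at most \<open>|v|\<close> times that of the gradient over the
  cube; finally \<open>v\<close> ranges over a cube of twice the side.\<close>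

lemma poincare_double:
  fixes f :: "real^'n::finite \<Rightarrow> real"
  assumes wg: "borel_weak_gradient f G"
  shows "(\<integral>\<^sup>+x\<in>dcube T k z. (\<integral>\<^sup>+y\<in>dcube T k z. ennreal \<bar>f y - f x\<bar> \<partial>lborel) \<partial>lborel)
    \<le> ennreal (real CARD('n) * 2 powi (-k) * (2 * 2 powi (-k)) ^ CARD('n)) * (\<integral>\<^sup>+x\<in>dcube T k z. ennreal (norm (G x)) \<partial>lborel)"
proof -
  have [measurable]: "f \<in> borel_measurable borel" "G \<in> borel_measurable borel"
    using wg by (auto simp: borel_weak_gradient_def)
  define Q where "Q = dcube T k z"
  have [measurable]: "Q \<in> sets borel" by (simp add: Q_def)
  define r where "r = (2::real) powi (-k)"
  have r: "0 < r" by (simp add: r_def)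
  define V :: "(real^'n) set" where "V = cube (\<chi> i. - r) (2 * r)"
  have [measurable]: "V \<in> sets borel" by (simp add: V_def cube_def)
  have Vmem: "v \<in> V \<longleftrightarrow> (\<forall>i. \<bar>v $ i\<bar> \<le> r)" for v
    unfolding V_def cube_def mem_box_cart by (auto simp: abs_le_iff) (smt (verit))+
  have norm_V: "norm v \<le> real CARD('n) * r" if "v \<in> V" for v
  proof -
    have "norm v \<le> (\<Sum>i\<in>UNIV. \<bar>v $ i\<bar>)" by (rule norm_le_l1_cart)
    also have "\<dots> \<le> (\<Sum>i\<in>(UNIV::'n set). r)" using that Vmem by (intro sum_mono) auto
    finally show ?thesis by simp
  qed
  have inV: "v \<in> V" if "x \<in> Q" "x + v \<in> Q" for x v
    using dcube_diff[of "x + v" T k z x] that unfolding Vmem Q_def r_def by auto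
  define I where "I = (\<integral>\<^sup>+x\<in>Q. ennreal (norm (G x)) \<partial>lborel)"
  have "(\<integral>\<^sup>+x\<in>Q. (\<integral>\<^sup>+y\<in>Q. ennreal \<bar>f y - f x\<bar> \<partial>lborel) \<partial>lborel)
    = (\<integral>\<^sup>+x. \<integral>\<^sup>+v. ennreal \<bar>f (v + x) - f x\<bar> * indicator Q (v + x) * indicator Q x \<partial>lborel \<partial>lborel)"
  proof (intro nn_integral_cong)
    fix x
    have "(\<integral>\<^sup>+y\<in>Q. ennreal \<bar>f y - f x\<bar> \<partial>lborel) = (\<integral>\<^sup>+v. ennreal \<bar>f (v + x) - f x\<bar> * indicator Q (v + x) \<partial>lborel)"
      using nn_integral_translate[of "\<lambda>y. ennreal \<bar>f y - f x\<bar> * indicator Q y" x] by simp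
    then show "(\<integral>\<^sup>+y\<in>Q. ennreal \<bar>f y - f x\<bar> \<partial>lborel) * indicator Q x = (\<integral>\<^sup>+v. ennreal \<bar>f (v + x) - f x\<bar> * indicator Q (v + x) * indicator Q x \<partial>lborel)"
      by (simp add: nn_integral_multc)
  qed
  also have "\<dots> = (\<integral>\<^sup>+v. \<integral>\<^sup>+x. ennreal \<bar>f (v + x) - f x\<bar> * indicator Q (v + x) * indicator Q x \<partial>lborel \<partial>lborel)"
    by (rule lborel_pair.Fubini'[symmetric]) measurable
  also have "\<dots> \<le> (\<integral>\<^sup>+v. (ennreal (real CARD('n) * r) * I) * indicator V v \<partial>lborel)"
  proof (intro nn_integral_mono)
    fix v :: "real^'n"
    show "(\<integral>\<^sup>+x. ennreal \<bar>f (v + x) - f x\<bar> * indicator Q (v + x) * indicator Q x \<partial>lborel) \<le> (ennreal (real CARD('n) * r) * I) * indicator V v"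
    proof (cases "v \<in> V")
      case False
      then have z: "ennreal \<bar>f (v + x) - f x\<bar> * indicator Q (v + x) * indicator Q x = 0" for x
        using inV[of x v] by (auto simp: indicator_def add.commute)
      have "(\<integral>\<^sup>+x. ennreal \<bar>f (v + x) - f x\<bar> * indicator Q (v + x) * indicator Q x \<partial>lborel) = (\<integral>\<^sup>+x. 0 \<partial>(lborel :: (real^'n) measure))"
        by (rule nn_integral_cong) (rule z)
      then show ?thesis by simp
    next
      case True
      have "(\<integral>\<^sup>+x. ennreal \<bar>f (v + x) - f x\<bar> * indicator Q (v + x) * indicator Q x \<partial>lborel)
        \<le> (\<integral>\<^sup>+x. \<integral>\<^sup>+s. ennreal (norm v) * (ennreal (norm (G (x + s *\<^sub>R v))) * indicator Q (x + s *\<^sub>R v)) * indicator {0..1} s \<partial>lborel \<partial>lborel)"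
      proof (rule nn_integral_mono_AE, use weak_gradient_translation[OF wg, of v] in eventually_elim)
        fix x assume h: "ennreal \<bar>f (x + v) - f x\<bar> \<le> (\<integral>\<^sup>+s\<in>{0..1}. ennreal (norm (G (x + s *\<^sub>R v)) * norm v) \<partial>lborel)"
        show "ennreal \<bar>f (v + x) - f x\<bar> * indicator Q (v + x) * indicator Q x
          \<le> (\<integral>\<^sup>+s. ennreal (norm v) * (ennreal (norm (G (x + s *\<^sub>R v))) * indicator Q (x + s *\<^sub>R v)) * indicator {0..1} s \<partial>lborel)"
        proof (cases "x \<in> Q \<and> x + v \<in> Q")
          case xv: True
          have "x + s *\<^sub>R v \<in> Q" if "s \<in> {0..1}" for s
          proof -
            have "(1 - s) *\<^sub>R x + s *\<^sub>R (x + v) \<in> Q"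
              using dcube_convex[of T k z] xv that unfolding Q_def convex_alt by auto
            then show ?thesis by (simp add: algebra_simps)
          qed
          then have "(\<integral>\<^sup>+s\<in>{0..1}. ennreal (norm (G (x + s *\<^sub>R v)) * norm v) \<partial>lborel) = (\<integral>\<^sup>+s. ennreal (norm v) * (ennreal (norm (G (x + s *\<^sub>R v))) * indicator Q (x + s *\<^sub>R v)) * indicator {0..1} s \<partial>lborel)"
            by (intro nn_integral_cong) (auto simp: indicator_def ennreal_mult mult.commute)
          then show ?thesis using h xv by (simp add: add.commute)
        next
          case False
          then show ?thesis by (auto simp: indicator_def add.commute)
        qed
      qed
      also have "\<dots> = (\<integral>\<^sup>+s. \<integral>\<^sup>+x. ennreal (norm v) * (ennreal (norm (G (x + s *\<^sub>R v))) * indicator Q (x + s *\<^sub>R v)) * indicator {0..1} s \<partial>lborel \<partial>lborel)"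
        by (rule lborel_pair.Fubini'[symmetric]) measurable
      also have "\<dots> = (\<integral>\<^sup>+s. (ennreal (norm v) * I) * indicator {0..1::real} s \<partial>lborel)"
      proof (intro nn_integral_cong)
        fix s :: real
        have "(\<integral>\<^sup>+x. ennreal (norm v) * (ennreal (norm (G (x + s *\<^sub>R v))) * indicator Q (x + s *\<^sub>R v)) * indicator {0..1} s \<partial>lborel)
           = ennreal (norm v) * (\<integral>\<^sup>+x. ennreal (norm (G (x + s *\<^sub>R v))) * indicator Q (x + s *\<^sub>R v) \<partial>lborel) * indicator {0..1} s"
          by (subst nn_integral_multc, measurable, subst nn_integral_cmult) auto
        also have "(\<integral>\<^sup>+x. ennreal (norm (G (x + s *\<^sub>R v))) * indicator Q (x + s *\<^sub>R v) \<partial>lborel) = I"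
          unfolding I_def by (rule nn_integral_translate) measurable
        finally show "(\<integral>\<^sup>+x. ennreal (norm v) * (ennreal (norm (G (x + s *\<^sub>R v))) * indicator Q (x + s *\<^sub>R v)) * indicator {0..1} s \<partial>lborel) = (ennreal (norm v) * I) * indicator {0..1} s" .
      qed
      also have "\<dots> = ennreal (norm v) * I" by (subst nn_integral_cmult_indicator) auto
      also have "\<dots> \<le> ennreal (real CARD('n) * r) * I" by (intro mult_right_mono ennreal_leI norm_V True) simp
      finally show ?thesis using True by simp
    qed
  qed
  also have "\<dots> = (ennreal (real CARD('n) * r) * I) * emeasure lborel V"
    by (rule nn_integral_cmult_indicator) simp
  also have "\<dots> = ennreal (real CARD('n) * r * (2 * r) ^ CARD('n)) * I"
    using r by (simp add: V_def emeasure_cube ennreal_mult ac_simps)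
  finally show ?thesis unfolding I_def Q_def r_def .
qed

definition dmean :: "(real^'n::finite \<Rightarrow> real) \<Rightarrow> 'n set \<Rightarrow> int \<Rightarrow> real^'n \<Rightarrow> real" where
  "dmean f T k x = (\<integral>y. f y * indicator (dcube T k x) y \<partial>lborel) / (2 powi (-k)) ^ CARD('n)"

lemma dmean_cong: "y \<in> dcube T k x \<Longrightarrow> dmean f T k y = dmean f T k x"
  by (simp add: dmean_def dcube_eq)

lemma integrable_dcube:
  fixes f :: "real^'n::finite \<Rightarrow> real"
  assumes [measurable]: "f \<in> borel_measurable borel" and l: "locint (\<lambda>x. ennreal \<bar>f x\<bar>)"
  shows "integrable lborel (\<lambda>y. f y * indicator (dcube T k x) y)"
proof (rule integrable_locint_mult[OF _ _ l, of _ "norm x + real CARD('n) * 2 powi (-k) + 1" 1])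
  fix y :: "real^'n" assume y: "norm x + real CARD('n) * 2 powi (-k) + 1 \<le> norm y"
  have "y \<notin> dcube T k x"
  proof
    assume "y \<in> dcube T k x"
    from dcube_norm[OF this] have "norm y \<le> norm x + real CARD('n) * 2 powi (-k)"
      using norm_triangle_sub[of y x] by linarith
    with y show False by simp
  qed
  then show "indicator (dcube T k x) y = (0::real)" by simp
qed (auto simp: indicator_def)

lemma dmean_dev:
  fixes f :: "real^'n::finite \<Rightarrow> real"
  assumes [measurable]: "f \<in> borel_measurable borel" and l: "locint (\<lambda>x. ennreal \<bar>f x\<bar>)"
  shows "ennreal \<bar>dmean f T k x - c\<bar> \<le> davg lborel (dcube T k x) (\<lambda>y. ennreal \<bar>f y - c\<bar>)"
proof -
  let ?Q = "dcube T k x"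
  define L where "L = ((2::real) powi (-k)) ^ CARD('n)"
  have L: "0 < L" "emeasure lborel ?Q = ennreal L" by (auto simp: L_def emeasure_dcube)
  have i: "integrable lborel (\<lambda>y. f y * indicator ?Q y)" by (rule integrable_dcube[OF _ l]) simp
  have ic: "integrable lborel (\<lambda>y. c * indicator ?Q y)"
    using L by (intro integrable_mult_right integrable_real_indicator) (auto simp: emeasure_dcube)
  have "(\<integral>y. (f y - c) * indicator ?Q y \<partial>lborel) = (\<integral>y. f y * indicator ?Q y \<partial>lborel) - (\<integral>y. c * indicator ?Q y \<partial>lborel)"
    unfolding left_diff_distrib by (rule Bochner_Integration.integral_diff[OF i ic])
  also have "(\<integral>y. c * indicator ?Q y \<partial>lborel) = c * L"
    using L by (simp add: measure_def)
  also have "(\<integral>y. f y * indicator ?Q y \<partial>lborel) = dmean f T k x * L" using L by (simp add: dmean_def L_def)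
  finally have "(\<integral>y. (f y - c) * indicator ?Q y \<partial>lborel) = (dmean f T k x - c) * L" by (simp add: algebra_simps)
  then have "ennreal \<bar>(dmean f T k x - c) * L\<bar> \<le> (\<integral>\<^sup>+y. ennreal \<bar>(f y - c) * indicator ?Q y\<bar> \<partial>lborel)"
    using ennreal_abs_integral_le[of lborel "\<lambda>y. (f y - c) * indicator ?Q y"] by simp
  also have "\<dots> = (\<integral>\<^sup>+y\<in>?Q. ennreal \<bar>f y - c\<bar> \<partial>lborel)"
    by (intro nn_integral_cong) (auto simp: indicator_def)
  finally have "ennreal \<bar>(dmean f T k x - c) * L\<bar> / ennreal L \<le> davg lborel ?Q (\<lambda>y. ennreal \<bar>f y - c\<bar>)"
    unfolding davg_def L(2) by (rule divide_right_mono_ennreal)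
  moreover have "ennreal \<bar>(dmean f T k x - c) * L\<bar> / ennreal L = ennreal \<bar>dmean f T k x - c\<bar>"
    using L by (simp add: divide_ennreal abs_mult)
  ultimately show ?thesis by simp
qed

lemma poincare:
  fixes f :: "real^'n::finite \<Rightarrow> real"
  assumes wg: "borel_weak_gradient f G"
  shows "davg lborel (dcube T k x) (\<lambda>y. ennreal \<bar>f y - dmean f T k x\<bar>)
    \<le> ennreal (real CARD('n) * 2 ^ CARD('n) * 2 powi (-k)) * davg lborel (dcube T k x) (\<lambda>y. ennreal (norm (G y)))"
proof -
  have [measurable]: "f \<in> borel_measurable borel" "G \<in> borel_measurable borel"
    and lf: "locint (\<lambda>x. ennreal \<bar>f x\<bar>)"
    using wg by (auto simp: borel_weak_gradient_def)
  let ?Q = "dcube T k x"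
  define r where "r = (2::real) powi (-k)"
  define L where "L = r ^ CARD('n)"
  have r: "0 < r" by (simp add: r_def)
  have L: "0 < L" "emeasure lborel ?Q = ennreal L" by (auto simp: L_def r_def emeasure_dcube)
  define I where "I = (\<integral>\<^sup>+y\<in>?Q. ennreal (norm (G y)) \<partial>lborel)"
  have "(\<integral>\<^sup>+y\<in>?Q. ennreal \<bar>f y - dmean f T k x\<bar> \<partial>lborel) \<le> (\<integral>\<^sup>+y. ennreal (1 / L) * ((\<integral>\<^sup>+z\<in>?Q. ennreal \<bar>f z - f y\<bar> \<partial>lborel) * indicator ?Q y) \<partial>lborel)"
  proof (intro nn_integral_mono)
    fix y
    have "ennreal \<bar>f y - dmean f T k x\<bar> \<le> davg lborel ?Q (\<lambda>z. ennreal \<bar>f z - f y\<bar>)"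
      using dmean_dev[OF _ lf, of T k x "f y"] by (simp add: abs_minus_commute)
    also have "\<dots> = ennreal (1 / L) * (\<integral>\<^sup>+z\<in>?Q. ennreal \<bar>f z - f y\<bar> \<partial>lborel)"
      unfolding davg_def L(2) by (rule ennreal_divide_real[OF L(1)])
    finally show "ennreal \<bar>f y - dmean f T k x\<bar> * indicator ?Q y \<le> ennreal (1 / L) * ((\<integral>\<^sup>+z\<in>?Q. ennreal \<bar>f z - f y\<bar> \<partial>lborel) * indicator ?Q y)"
      unfolding mult.assoc[symmetric] by (rule mult_right_mono) simp
  qed
  also have "\<dots> = ennreal (1 / L) * (\<integral>\<^sup>+y\<in>?Q. (\<integral>\<^sup>+z\<in>?Q. ennreal \<bar>f z - f y\<bar> \<partial>lborel) \<partial>lborel)"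
    by (rule nn_integral_cmult) measurable
  also have "\<dots> \<le> ennreal (1 / L) * (ennreal (real CARD('n) * r * (2 * r) ^ CARD('n)) * I)"
    unfolding r_def I_def by (intro mult_left_mono poincare_double[OF wg]) simp
  also have "\<dots> = ennreal (real CARD('n) * 2 ^ CARD('n) * r) * I"
  proof -
    have "1 / L * (real CARD('n) * r * (2 * r) ^ CARD('n)) = real CARD('n) * 2 ^ CARD('n) * r"
      using r by (simp add: L_def power_mult_distrib)
    then show ?thesis using L r by (simp add: mult.assoc[symmetric] flip: ennreal_mult)
  qed
  finally have "davg lborel ?Q (\<lambda>y. ennreal \<bar>f y - dmean f T k x\<bar>) \<le> ennreal (real CARD('n) * 2 ^ CARD('n) * r) * I / ennreal L"
    unfolding davg_def L(2) by (rule divide_right_mono_ennreal)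
  then show ?thesis unfolding r_def davg_def L(2) I_def by (simp add: ennreal_times_divide)
qed

lemma davg_add_const:
  fixes x :: "real^'n::finite"
  assumes [measurable]: "g \<in> borel_measurable borel"
  shows "davg lborel (dcube T k x) (\<lambda>y. g y + c) = davg lborel (dcube T k x) g + c"
proof -
  obtain L where L: "0 < L" "emeasure lborel (dcube T k x) = ennreal L"
    by (rule dcube_measure_pos)
  have "(\<integral>\<^sup>+y\<in>dcube T k x. (g y + c) \<partial>lborel) = (\<integral>\<^sup>+y\<in>dcube T k x. g y \<partial>lborel) + c * ennreal L"
    unfolding distrib_right using L by (subst nn_integral_add) (auto simp: nn_integral_cmult_indicator)
  then show ?thesis
    using L by (simp add: davg_def add_divide_distrib_ennreal ennreal_mult_divide_eq)
qed

lemma davg_mono: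
  "(\<And>y. g y \<le> h y) \<Longrightarrow> davg \<mu> A g \<le> davg \<mu> A h"
  unfolding davg_def by (intro divide_right_mono_ennreal nn_integral_mono mult_right_mono) auto

lemma davg_child:
  fixes x :: "real^'n::finite"
  shows "davg lborel (dcube T (k + 1) x) g \<le> ennreal (2 ^ CARD('n)) * davg lborel (dcube T k x) g"
proof -
  obtain L where L: "0 < L" "emeasure lborel (dcube T (k + 1) x) = ennreal L"
    by (rule dcube_measure_pos)
  have Lp: "emeasure lborel (dcube T k x) = ennreal (2 ^ CARD('n) * L)"
    using emeasure_dcube_parent[of T "k + 1" x] L by (simp add: ennreal_mult)
  have "(\<integral>\<^sup>+y\<in>dcube T (k + 1) x. g y \<partial>lborel) \<le> (\<integral>\<^sup>+y\<in>dcube T k x. g y \<partial>lborel)"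
    using dcube_Suc_subset[of T k x] by (intro nn_integral_mono) (auto simp: indicator_def)
  then have "davg lborel (dcube T (k + 1) x) g \<le> ennreal (1 / L) * (\<integral>\<^sup>+y\<in>dcube T k x. g y \<partial>lborel)"
    unfolding davg_def L(2) ennreal_divide_real[OF L(1)] by (rule mult_left_mono) simp
  also have "ennreal (1 / L) = ennreal (2 ^ CARD('n)) * ennreal (1 / (2 ^ CARD('n) * L))"
    using L by (simp flip: ennreal_mult)
  also have "ennreal (2 ^ CARD('n)) * ennreal (1 / (2 ^ CARD('n) * L)) * (\<integral>\<^sup>+y\<in>dcube T k x. g y \<partial>lborel) = ennreal (2 ^ CARD('n)) * davg lborel (dcube T k x) g"
    unfolding davg_def Lp using L by (subst ennreal_divide_real) (auto simp: mult.assoc)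
  finally show ?thesis .
qed

text \<open>Rational \<open>c\<close> and \<open>d\<close> make a single exceptional null set possible.\<close>

lemma lebesgue_point_bound:
  fixes f :: "real^'n::finite \<Rightarrow> real"
  assumes [measurable]: "f \<in> borel_measurable borel" and l: "locint (\<lambda>x. ennreal \<bar>f x\<bar>)"
  shows "AE x in lborel. \<forall>T (c::rat) (d::rat) K. (\<forall>k\<ge>K. davg lborel (dcube T k x) (\<lambda>y. ennreal \<bar>f y - of_rat c\<bar>) \<le> ennreal (of_rat d))
    \<longrightarrow> ennreal \<bar>f x - of_rat c\<bar> \<le> ennreal (of_rat d)"
proof -
  have "AE x in lborel. (\<forall>k\<ge>K. davg lborel (dcube T k x) (\<lambda>y. ennreal \<bar>f y - c\<bar>) \<le> ennreal d)
    \<longrightarrow> ennreal \<bar>f x - c\<bar> \<le> ennreal d" for T K and c d :: real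
  proof -
    define E where "E = {x. \<forall>k\<ge>K. davg lborel (dcube T k x) (\<lambda>y. ennreal \<bar>f y - c\<bar>) \<le> ennreal d}"
    have E: "E = - {x. \<exists>k\<ge>K. \<not> davg lborel (dcube T k x) (\<lambda>y. ennreal \<bar>f y - c\<bar>) \<le> ennreal d}"
      by (auto simp: E_def)
    have [measurable]: "E \<in> sets borel"
      unfolding E by (intro borel_comp stopping_set_borel)
    have "AE x in lborel. x \<in> E \<longrightarrow> ennreal \<bar>f x - c\<bar> \<le> ennreal d"
    proof (rule AE_le_of_cubes)
      fix R :: real
      have [measurable]: "ball (0::real^'n) R \<in> sets borel" by simp
      have "(\<integral>\<^sup>+x\<in>ball 0 R. (ennreal \<bar>f x - c\<bar> + ennreal d) \<partial>lborel)
        \<le> (\<integral>\<^sup>+x. ennreal \<bar>f x\<bar> * indicator (ball 0 R) x + ennreal (\<bar>c\<bar> + \<bar>d\<bar>) * indicator (ball 0 R) x \<partial>lborel)"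
      proof (intro nn_integral_mono)
        fix x
        have "ennreal \<bar>f x - c\<bar> + ennreal d \<le> ennreal \<bar>f x - c\<bar> + ennreal \<bar>d\<bar>"
          by (intro add_left_mono ennreal_leI) simp
        also have "\<dots> = ennreal (\<bar>f x - c\<bar> + \<bar>d\<bar>)" by (rule ennreal_plus[symmetric]) auto
        also have "\<dots> \<le> ennreal (\<bar>f x\<bar> + (\<bar>c\<bar> + \<bar>d\<bar>))" by (rule ennreal_leI) linarith
        also have "\<dots> = ennreal \<bar>f x\<bar> + ennreal (\<bar>c\<bar> + \<bar>d\<bar>)" by (rule ennreal_plus) auto
        finally have "(ennreal \<bar>f x - c\<bar> + ennreal d) * indicator (ball 0 R) x \<le> (ennreal \<bar>f x\<bar> + ennreal (\<bar>c\<bar> + \<bar>d\<bar>)) * indicator (ball 0 R) x"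
          by (rule mult_right_mono) simp
        then show "(ennreal \<bar>f x - c\<bar> + ennreal d) * indicator (ball 0 R) x \<le> ennreal \<bar>f x\<bar> * indicator (ball 0 R) x + ennreal (\<bar>c\<bar> + \<bar>d\<bar>) * indicator (ball 0 R) x"
          unfolding distrib_right .
      qed
      also have "\<dots> = (\<integral>\<^sup>+x\<in>ball 0 R. ennreal \<bar>f x\<bar> \<partial>lborel) + ennreal (\<bar>c\<bar> + \<bar>d\<bar>) * emeasure lborel (ball (0::real^'n) R)"
        by (subst nn_integral_add) (auto simp: nn_integral_cmult_indicator)
      also have "\<dots> < \<infinity>"
        using l emeasure_bounded_finite[of "ball (0::real^'n) R"] by (auto simp: locint_def ennreal_mult_less_top)
      finally show "(\<integral>\<^sup>+x\<in>ball 0 R. (ennreal \<bar>f x - c\<bar> + ennreal d) \<partial>lborel) < \<infinity>" .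
    next
      fix x k assume "x \<in> E" "K \<le> k"
      then have "davg lborel (dcube T k x) (\<lambda>y. ennreal \<bar>f y - c\<bar>) \<le> ennreal d" by (simp add: E_def)
      from davg_leD[OF this]
      show "(\<integral>\<^sup>+y\<in>dcube T k x. ennreal \<bar>f y - c\<bar> \<partial>lborel) \<le> (\<integral>\<^sup>+y\<in>dcube T k x. ennreal d \<partial>lborel)"
        by (simp add: nn_integral_cmult_indicator)
    qed measurable
    then show ?thesis by (simp add: E_def)
  qed
  then show ?thesis
    unfolding AE_all_countable by blast
qed

text \<open>The means of \<open>f\<close> over the shrinking cubes at \<open>x\<close> differ from one level to the next by at most the
  side length times the maximal function of the gradient, by the Poincare inequality, and the side
  lengths form a geometric series. That the limit of the means is \<open>f x\<close> almost everywhere is obtained from the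
  bound at Lebesgue points, with a rational constant close to one of the means.\<close>

lemma weak_gradient_dmean:
  fixes f :: "real^'n::finite \<Rightarrow> real"
  assumes wg: "borel_weak_gradient f G"
  defines "K' \<equiv> real CARD('n) * 2 ^ CARD('n) * (1 + 2 * 2 ^ CARD('n))"
  shows "AE x in lborel. \<forall>T k. ennreal \<bar>f x - dmean f T k x\<bar> \<le> ennreal (K' * 2 powi (-k)) * dyadic_max lborel T (\<lambda>y. ennreal (norm (G y))) x"
proof -
  have [measurable]: "f \<in> borel_measurable borel" "G \<in> borel_measurable borel"
    and lf: "locint (\<lambda>x. ennreal \<bar>f x\<bar>)"
    using wg by (auto simp: borel_weak_gradient_def)
  define K where "K = real CARD('n) * 2 ^ CARD('n)"
  have K: "0 < K" by (simp add: K_def)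
  have K': "K' = K * (1 + 2 * 2 ^ CARD('n))" "0 < K'"
    by (auto simp: K'_def K_def intro!: mult_pos_pos add_pos_pos)
  note lp = lebesgue_point_bound[OF \<open>f \<in> borel_measurable borel\<close> lf]
  show ?thesis
    using lp
  proof eventually_elim
    case (elim x)
    show ?case
    proof (intro allI)
      fix T k
      let ?M = "dyadic_max lborel T (\<lambda>y. ennreal (norm (G y))) x"
      show "ennreal \<bar>f x - dmean f T k x\<bar> \<le> ennreal (K' * 2 powi (-k)) * ?M"
      proof (cases ?M)
        case top
        then show ?thesis using K'(2) by (simp add: ennreal_mult_top)
      next
        case (real m)
        have avgM: "davg lborel (dcube T j x) (\<lambda>y. ennreal (norm (G y))) \<le> ennreal m" for j
          unfolding real(2)[symmetric] dyadic_max_def by (rule SUP_upper) simp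
        have P: "davg lborel (dcube T j x) (\<lambda>y. ennreal \<bar>f y - dmean f T j x\<bar>) \<le> ennreal (K * 2 powi (-j) * m)" for j
        proof -
          have "davg lborel (dcube T j x) (\<lambda>y. ennreal \<bar>f y - dmean f T j x\<bar>) \<le> ennreal (K * 2 powi (-j)) * ennreal m"
            unfolding K_def by (rule order_trans[OF poincare[OF wg]]) (intro mult_left_mono avgM, simp)
          then show ?thesis using K real by (simp add: ennreal_mult)
        qed
        have step: "\<bar>dmean f T (j + 1) x - dmean f T j x\<bar> \<le> 2 ^ CARD('n) * K * m * 2 powi (-j)" for j
        proof -
          have "ennreal \<bar>dmean f T (j + 1) x - dmean f T j x\<bar> \<le> davg lborel (dcube T (j + 1) x) (\<lambda>y. ennreal \<bar>f y - dmean f T j x\<bar>)"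
            by (rule dmean_dev[OF _ lf]) simp
          also have "\<dots> \<le> ennreal (2 ^ CARD('n)) * davg lborel (dcube T j x) (\<lambda>y. ennreal \<bar>f y - dmean f T j x\<bar>)"
            by (rule davg_child)
          also have "\<dots> \<le> ennreal (2 ^ CARD('n)) * ennreal (K * 2 powi (-j) * m)"
            by (intro mult_left_mono P) simp
          also have "\<dots> = ennreal (2 ^ CARD('n) * K * m * 2 powi (-j))"
            using K real by (simp add: ac_simps flip: ennreal_mult)
          finally show ?thesis using K real by (subst (asm) ennreal_le_iff) auto
        qed
        define c where "c = 2 ^ CARD('n) * K * m"
        have c: "0 \<le> c" using K real by (simp add: c_def)
        have tele: "\<bar>dmean f T (k + int i) x - dmean f T k x\<bar> \<le> 2 * c * (2 powi (-k) - 2 powi (-(k + int i)))" for i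
        proof (induction i)
          case (Suc i)
          have e: "k + int (Suc i) = (k + int i) + 1" by simp
          have h: "(2::real) powi (-(k + int i)) = 2 * 2 powi (-(k + int i + 1))"
            using power_int_add[of "2::real" 1 "-(k + int i + 1)"] by (simp add: algebra_simps)
          have "\<bar>dmean f T (k + int i + 1) x - dmean f T k x\<bar> \<le> c * 2 powi (-(k + int i)) + 2 * c * (2 powi (-k) - 2 powi (-(k + int i)))"
            using step[of "k + int i"] Suc unfolding c_def by linarith
          also have "\<dots> = 2 * c * (2 powi (-k) - 2 powi (-(k + int i + 1)))"
            unfolding h by (simp add: algebra_simps)
          finally show ?case unfolding e .
        qed simp
        have tele': "\<bar>dmean f T j x - dmean f T k x\<bar> \<le> 2 * c * 2 powi (-k)" if "k \<le> j" for j
        proof -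
          have "\<bar>dmean f T j x - dmean f T k x\<bar> \<le> 2 * c * (2 powi (-k) - 2 powi (-j))"
            using tele[of "nat (j - k)"] that by simp
          also have "\<dots> \<le> 2 * c * 2 powi (-k)" using c by (intro mult_left_mono) auto
          finally show ?thesis .
        qed
        define A where "A = K' * 2 powi (-k) * m"
        have Aeq: "A = K * 2 powi (-k) * m + 2 * c * 2 powi (-k)" by (simp add: A_def K'(1) c_def algebra_simps)
        have A0: "0 \<le> A" using K'(2) real by (simp add: A_def)
        have "\<bar>f x - dmean f T k x\<bar> \<le> A"
        proof (rule ccontr)
          assume na: "\<not> \<bar>f x - dmean f T k x\<bar> \<le> A"
          define d where "d = \<bar>f x - dmean f T k x\<bar> - A"
          have d: "0 < d" using na by (simp add: d_def)
          \<comment> \<open>A rational number near the mean on level k, and a rational bound between A and A + d.\<close>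
          obtain p :: rat where p: "dmean f T k x - d / 4 < of_rat p" "of_rat p < dmean f T k x + d / 4"
            using of_rat_dense[of "dmean f T k x - d / 4" "dmean f T k x + d / 4"] d by auto
          obtain e :: rat where e: "A + d / 4 < of_rat e" "of_rat e < A + d / 2"
            using of_rat_dense[of "A + d / 4" "A + d / 2"] d by auto
          have "davg lborel (dcube T j x) (\<lambda>y. ennreal \<bar>f y - of_rat p\<bar>) \<le> ennreal (of_rat e)" if "k \<le> j" for j
          proof -
            have tri: "ennreal \<bar>f y - of_rat p\<bar> \<le> ennreal \<bar>f y - dmean f T j x\<bar> + ennreal (2 * c * 2 powi (-k) + d / 4)" for y
              using tele'[OF that] p c d by (subst ennreal_plus[symmetric]) (auto intro!: ennreal_leI simp del: ennreal_plus)
            have "davg lborel (dcube T j x) (\<lambda>y. ennreal \<bar>f y - of_rat p\<bar>)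
              \<le> davg lborel (dcube T j x) (\<lambda>y. ennreal \<bar>f y - dmean f T j x\<bar> + ennreal (2 * c * 2 powi (-k) + d / 4))"
              by (rule davg_mono[OF tri])
            also have "\<dots> = davg lborel (dcube T j x) (\<lambda>y. ennreal \<bar>f y - dmean f T j x\<bar>) + ennreal (2 * c * 2 powi (-k) + d / 4)"
              by (rule davg_add_const) measurable
            also have "\<dots> \<le> ennreal (K * 2 powi (-j) * m) + ennreal (2 * c * 2 powi (-k) + d / 4)"
              by (intro add_right_mono P)
            also have "\<dots> = ennreal (K * 2 powi (-j) * m + (2 * c * 2 powi (-k) + d / 4))"
              using K real c d by (subst ennreal_plus) auto
            also have "\<dots> \<le> ennreal (of_rat e)"
            proof (rule ennreal_leI)
              have "(2::real) powi (-j) \<le> 2 powi (-k)" using that by (intro power_int_increasing) auto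
              then have "K * 2 powi (-j) * m \<le> K * 2 powi (-k) * m"
                using K real by (intro mult_right_mono mult_left_mono) auto
              then show "K * 2 powi (-j) * m + (2 * c * 2 powi (-k) + d / 4) \<le> of_rat e"
                using e(1) unfolding Aeq by linarith
            qed
            finally show ?thesis .
          qed
          then have "ennreal \<bar>f x - of_rat p\<bar> \<le> ennreal (of_rat e)" using elim by blast
          then have "\<bar>f x - of_rat p\<bar> \<le> of_rat e" 
          proof (subst (asm) ennreal_le_iff)
            show "0 \<le> (of_rat e :: real)" using e A0 d by linarith
          qed
          moreover have "\<bar>f x - dmean f T k x\<bar> \<le> \<bar>f x - of_rat p\<bar> + \<bar>of_rat p - dmean f T k x\<bar>"
            using abs_triangle_ineq[of "f x - of_rat p" "of_rat p - dmean f T k x"] by simp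
          moreover have "\<bar>of_rat p - dmean f T k x\<bar> < d / 4"
            using p by (auto simp: abs_if)
          moreover have "\<bar>f x - dmean f T k x\<bar> = A + d" by (simp add: d_def)
          ultimately show False using e(2) d by linarith
        qed
        then have "ennreal \<bar>f x - dmean f T k x\<bar> \<le> ennreal A" by (rule ennreal_leI)
        also have "ennreal A = ennreal (K' * 2 powi (-k)) * ?M" using real K'(2) by (simp add: A_def ennreal_mult)
        finally show ?thesis .
      qed
    qed
  qed
qed

text \<open>Two points \<open>x\<close> and \<open>y\<close> lie in a common cube of some adjacent grid with side comparable to their
  distance, and both values of \<open>f\<close> are compared with the mean over this cube.\<close>

lemma weak_gradient_pointwise:
  fixes f :: "real^'n::finite \<Rightarrow> real"
  assumes wg: "borel_weak_gradient f G"
  obtains C S where "0 < C" "S \<in> null_sets lborel"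
    "\<And>x y. x \<notin> S \<Longrightarrow> y \<notin> S \<Longrightarrow> ennreal \<bar>f x - f y\<bar> \<le> ennreal (norm (x - y)) *
      (ennreal C * (\<Sum>T\<in>UNIV. dyadic_max lborel T (\<lambda>z. ennreal (norm (G z))) x) + ennreal C * (\<Sum>T\<in>UNIV. dyadic_max lborel T (\<lambda>z. ennreal (norm (G z))) y))"
proof -
  define K' where "K' = real CARD('n) * 2 ^ CARD('n) * (1 + 2 * 2 ^ CARD('n))"
  have K': "0 < K'" unfolding K'_def by (intro mult_pos_pos add_pos_pos) auto
  let ?M = "\<lambda>T. dyadic_max lborel T (\<lambda>z. ennreal (norm (G z)))"
  obtain S where S: "S \<in> null_sets lborel" and bd: "\<And>x T k. x \<notin> S \<Longrightarrow>
      ennreal \<bar>f x - dmean f T k x\<bar> \<le> ennreal (K' * 2 powi (-k)) * ?M T x"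
    using weak_gradient_dmean[OF wg, folded K'_def] by (auto elim!: AE_E3)
  show ?thesis
  proof (rule that[of "12 * K'" S])
    show "0 < 12 * K'" using K' by simp
    show "S \<in> null_sets lborel" by (rule S)
    fix x y assume xy: "x \<notin> S" "y \<notin> S"
    show "ennreal \<bar>f x - f y\<bar> \<le> ennreal (norm (x - y)) * (ennreal (12 * K') * (\<Sum>T\<in>UNIV. ?M T x) + ennreal (12 * K') * (\<Sum>T\<in>UNIV. ?M T y))"
    proof (cases "x = y")
      case False
      obtain T k where T: "{z. \<forall>i. \<bar>z $ i - x $ i\<bar> \<le> norm (x - y)} \<subseteq> dcube T k x" "2 powi (-k) \<le> 12 * norm (x - y)"
        using adjacent_dcube[of "norm (x - y)" x] False by auto
      have "y \<in> dcube T k x"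
        using T(1) component_le_norm_cart[of "y - x"] by (auto simp: norm_minus_commute)
      then have m: "dmean f T k y = dmean f T k x" by (rule dmean_cong)
      have "ennreal \<bar>f x - f y\<bar> \<le> ennreal (\<bar>f x - dmean f T k x\<bar> + \<bar>f y - dmean f T k y\<bar>)"
        unfolding m by (rule ennreal_leI) linarith
      also have "\<dots> = ennreal \<bar>f x - dmean f T k x\<bar> + ennreal \<bar>f y - dmean f T k y\<bar>" by simp
      also have "\<dots> \<le> ennreal (K' * 2 powi (-k)) * ?M T x + ennreal (K' * 2 powi (-k)) * ?M T y"
        by (intro add_mono bd xy)
      also have "\<dots> = ennreal (K' * 2 powi (-k)) * (?M T x + ?M T y)" by (simp add: distrib_left)
      also have "\<dots> \<le> ennreal (norm (x - y) * (12 * K')) * ((\<Sum>T\<in>UNIV. ?M T x) + (\<Sum>T\<in>UNIV. ?M T y))"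
      proof (rule mult_mono[OF ennreal_leI add_mono])
        show "K' * 2 powi (-k) \<le> norm (x - y) * (12 * K')"
          using mult_left_mono[OF T(2), of K'] K' by (simp add: ac_simps)
        show "?M T x \<le> (\<Sum>T\<in>UNIV. ?M T x)" "?M T y \<le> (\<Sum>T\<in>UNIV. ?M T y)"
          by (intro member_le_sum; simp)+
      qed auto
      also have "\<dots> = ennreal (norm (x - y)) * (ennreal (12 * K') * (\<Sum>T\<in>UNIV. ?M T x) + ennreal (12 * K') * (\<Sum>T\<in>UNIV. ?M T y))"
        using K' by (simp add: ennreal_mult distrib_left mult.assoc)
      finally show ?thesis .
    qed simp
  qed
qed

section \<open>Functionals from difference quotients\<close>

lemma test_function_line:
  fixes \<phi> :: "real^'n::finite \<Rightarrow> real"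
  assumes t: "test_function \<phi>"
  shows "((\<lambda>s. \<phi> (x + s *\<^sub>R axis i 1)) has_real_derivative partial_deriv i \<phi> (x + s *\<^sub>R axis i 1)) (at s)"
proof -
  have "((\<lambda>s. x + s *\<^sub>R axis i (1::real)) has_derivative (\<lambda>h. h *\<^sub>R axis i 1)) (at s)"
    by (auto intro!: derivative_eq_intros)
  from diff_chain_at[OF this test_function_has_derivative[OF t]]
  have "((\<lambda>s. \<phi> (x + s *\<^sub>R axis i 1)) has_derivative (\<lambda>h. \<Sum>j\<in>UNIV. (h *\<^sub>R axis i 1) $ j * partial_deriv j \<phi> (x + s *\<^sub>R axis i 1))) (at s)"
    by (simp add: o_def)
  then have "((\<lambda>s. \<phi> (x + s *\<^sub>R axis i 1)) has_derivative (\<lambda>h. partial_deriv i \<phi> (x + s *\<^sub>R axis i 1) * h)) (at s)"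
    by (rule has_derivative_eq_rhs) (auto simp: axis_def if_distrib[of "\<lambda>t. t * _"] if_distrib[of "\<lambda>t. _ * t"] sum.delta mult.commute cong: if_cong)
  then show ?thesis by (simp add: has_field_derivative_def)
qed

text \<open>Replace the derivative of \<open>\<phi>\<close> by difference quotients and move the translation to \<open>f\<close>; the pointwise
  inequality bounds the difference quotients of \<open>f\<close> by \<open>g\<close> plus a translate of \<open>g\<close>, and the translate
  is moved back to \<open>\<phi>\<close>.\<close>

lemma pointwise_functional_bound:
  fixes f g :: "real^'n::finite \<Rightarrow> real"
  assumes fm [measurable]: "f \<in> borel_measurable borel" and gm [measurable]: "g \<in> borel_measurable borel"
    and lf: "locint (\<lambda>x. ennreal \<bar>f x\<bar>)" and lg: "locint (\<lambda>x. ennreal (g x))" and g0: "\<And>x. 0 \<le> g x"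
    and S: "S \<in> null_sets lborel"
    and pt: "\<And>x y. x \<notin> S \<Longrightarrow> y \<notin> S \<Longrightarrow> \<bar>f x - f y\<bar> \<le> norm (x - y) * (g x + g y)"
    and t: "test_function \<phi>"
  shows "\<bar>\<integral>x. f x * partial_deriv i \<phi> x \<partial>lborel\<bar> \<le> 2 * (\<integral>x. g x * \<bar>\<phi> x\<bar> \<partial>lborel)"
proof -
  have [measurable]: "\<phi> \<in> borel_measurable borel" "partial_deriv j \<phi> \<in> borel_measurable borel" for j
    using t by (auto intro!: borel_measurable_continuous_onI test_function_continuous test_function_partial_continuous)
  obtain R C where RC: "0 < R" "0 < C" "\<And>x. norm x \<ge> R \<Longrightarrow> \<phi> x = 0" "\<And>x i. norm x \<ge> R \<Longrightarrow> partial_deriv i \<phi> x = 0"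
    "\<And>x. \<bar>\<phi> x\<bar> \<le> C" "\<And>x i. \<bar>partial_deriv i \<phi> x\<bar> \<le> C"
    by (rule test_function_bounds[OF t]) blast
  have lg': "locint (\<lambda>x. ennreal \<bar>g x\<bar>)" using lg g0 by simp
  define e :: "real^'n" where "e = axis i 1"
  have e1: "norm e = 1" by (simp add: e_def)
  define h where "h m = inverse (real (Suc m))" for m
  have h: "0 < h m" "h m \<le> 1" for m by (auto simp: h_def inverse_le_1_iff)
  have h0: "h \<longlonglongrightarrow> 0" unfolding h_def by (rule LIMSEQ_inverse_real_of_nat)
  have far: "norm (x + h m *\<^sub>R e) \<ge> R" if "norm x \<ge> R + 1" for x m
  proof -
    have "norm x \<le> norm (x + h m *\<^sub>R e) + norm (h m *\<^sub>R e)"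
      using norm_triangle_ineq4[of "x + h m *\<^sub>R e" "h m *\<^sub>R e"] by simp
    then show ?thesis using that h[of m] e1 by simp
  qed
  define q where "q m x = (\<phi> (x + h m *\<^sub>R e) - \<phi> x) / h m" for m x
  have [measurable]: "q m \<in> borel_measurable borel" for m unfolding q_def by measurable
  have qC: "\<bar>q m x\<bar> \<le> C" for m x
  proof -
    have "\<exists>z. 0 < z \<and> z < h m \<and> \<phi> (x + h m *\<^sub>R e) - \<phi> (x + 0 *\<^sub>R e) = (h m - 0) * partial_deriv i \<phi> (x + z *\<^sub>R e)"
      unfolding e_def by (rule MVT2) (use h test_function_line[OF t] in auto)
    then obtain z where "\<phi> (x + h m *\<^sub>R e) - \<phi> x = h m * partial_deriv i \<phi> (x + z *\<^sub>R e)" by auto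
    then have "q m x = partial_deriv i \<phi> (x + z *\<^sub>R e)" using h[of m] by (simp add: q_def)
    then show ?thesis using RC(6) by simp
  qed
  have q0: "q m x = 0" if "norm x \<ge> R + 1" for m x
    using far[OF that, of m] that RC(3) by (simp add: q_def)
  have qlim: "(\<lambda>m. q m x) \<longlonglongrightarrow> partial_deriv i \<phi> x" for x
  proof -
    have "((\<lambda>s. (\<phi> (x + s *\<^sub>R e) - \<phi> x) / s) \<longlongrightarrow> partial_deriv i \<phi> x) (at 0)"
      using test_function_line[OF t, of x i 0] by (simp add: DERIV_def e_def)
    moreover have "filterlim h (at 0) sequentially"
      using h0 by (auto simp: filterlim_at h less_imp_neq[OF h(1), symmetric])
    ultimately have "(\<lambda>m. (\<phi> (x + h m *\<^sub>R e) - \<phi> x) / h m) \<longlonglongrightarrow> partial_deriv i \<phi> x"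
      by (rule filterlim_compose)
    then show ?thesis by (simp add: q_def)
  qed
  have lim1: "(\<lambda>m. \<integral>x. f x * q m x \<partial>lborel) \<longlonglongrightarrow> (\<integral>x. f x * partial_deriv i \<phi> x \<partial>lborel)"
  proof (rule integral_dominated_convergence)
    show "integrable lborel (\<lambda>x. \<bar>f x * (C * indicator (ball 0 (R + 1)) x)\<bar>)"
      by (intro integrable_abs integrable_locint_mult[OF _ _ lf, of _ "R + 1" C]) (use RC in \<open>auto simp: indicator_def\<close>)
    show "AE x in lborel. (\<lambda>m. f x * q m x) \<longlonglongrightarrow> f x * partial_deriv i \<phi> x"
      by (intro AE_I2 tendsto_mult tendsto_const qlim)
    show "AE x in lborel. norm (f x * q m x) \<le> \<bar>f x * (C * indicator (ball 0 (R + 1)) x)\<bar>" for m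
    proof (intro AE_I2)
      fix x show "norm (f x * q m x) \<le> \<bar>f x * (C * indicator (ball 0 (R + 1)) x)\<bar>"
        using q0[of x m] qC[of m x] RC(2) by (cases "norm x < R + 1") (auto simp: abs_mult mult_left_mono)
    qed
  qed measurable
  have lim2: "(\<lambda>m. \<integral>x. g x * \<bar>\<phi> (x + h m *\<^sub>R e)\<bar> \<partial>lborel) \<longlonglongrightarrow> (\<integral>x. g x * \<bar>\<phi> x\<bar> \<partial>lborel)"
  proof (rule integral_dominated_convergence)
    show "integrable lborel (\<lambda>x. \<bar>g x * (C * indicator (ball 0 (R + 1)) x)\<bar>)"
      by (intro integrable_abs integrable_locint_mult[OF _ _ lg', of _ "R + 1" C]) (use RC in \<open>auto simp: indicator_def\<close>)
    show "AE x in lborel. (\<lambda>m. g x * \<bar>\<phi> (x + h m *\<^sub>R e)\<bar>) \<longlonglongrightarrow> g x * \<bar>\<phi> x\<bar>"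
    proof (intro AE_I2 tendsto_mult tendsto_const tendsto_rabs)
      fix x
      have "isCont \<phi> x" using test_function_continuous[OF t] continuous_on_eq_continuous_at[of UNIV \<phi>] by simp
      moreover have "(\<lambda>m. x + h m *\<^sub>R e) \<longlonglongrightarrow> x + 0 *\<^sub>R e" by (intro tendsto_intros h0)
      ultimately show "(\<lambda>m. \<phi> (x + h m *\<^sub>R e)) \<longlonglongrightarrow> \<phi> x"
        using isCont_tendsto_compose[of x \<phi> "\<lambda>m. x + h m *\<^sub>R e"] by simp
    qed
    show "AE x in lborel. norm (g x * \<bar>\<phi> (x + h m *\<^sub>R e)\<bar>) \<le> \<bar>g x * (C * indicator (ball 0 (R + 1)) x)\<bar>" for m
    proof (intro AE_I2)
      fix x show "norm (g x * \<bar>\<phi> (x + h m *\<^sub>R e)\<bar>) \<le> \<bar>g x * (C * indicator (ball 0 (R + 1)) x)\<bar>"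
        using far[of x m] RC(3)[of "x + h m *\<^sub>R e"] RC(5)[of "x + h m *\<^sub>R e"] RC(2)
        by (cases "norm x < R + 1") (auto simp: abs_mult mult_left_mono)
    qed
  qed measurable
  have le: "\<bar>\<integral>x. f x * q m x \<partial>lborel\<bar> \<le> (\<integral>x. g x * \<bar>\<phi> (x + h m *\<^sub>R e)\<bar> \<partial>lborel) + (\<integral>x. g x * \<bar>\<phi> x\<bar> \<partial>lborel)" for m
  proof -
    define d where "d = (- h m) *\<^sub>R e"
    have lfd: "locint (\<lambda>x. ennreal \<bar>f (x + d)\<bar>)" by (rule locint_translate(2)[of "\<lambda>x. ennreal \<bar>f x\<bar>"]) (use lf in auto)
    have lgd: "locint (\<lambda>x. ennreal \<bar>g (x + d)\<bar>)" by (rule locint_translate(2)[of "\<lambda>x. ennreal \<bar>g x\<bar>"]) (use lg' in auto)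
    have i1: "integrable lborel (\<lambda>x. f (x + d) * \<phi> x)" "integrable lborel (\<lambda>x. f x * \<phi> x)"
      "integrable lborel (\<lambda>x. g (x + d) * \<bar>\<phi> x\<bar>)" "integrable lborel (\<lambda>x. g x * \<bar>\<phi> x\<bar>)"
      by (rule integrable_locint_mult[OF _ _ lfd RC(3,5)], auto)
         (rule integrable_locint_mult[OF _ _ lf RC(3,5)], auto,
          rule integrable_locint_mult[OF _ _ lgd, of _ R C], auto simp: RC,
          rule integrable_locint_mult[OF _ _ lg', of _ R C], auto simp: RC)
    have i2: "integrable lborel (\<lambda>x. f x * \<phi> (x + h m *\<^sub>R e))"
      by (rule integrable_locint_mult[OF _ _ lf, of _ "R + 1" C]) (use RC far in auto)
    have tr: "(\<integral>x. f x * \<phi> (x + h m *\<^sub>R e) \<partial>lborel) = (\<integral>x. f (x + d) * \<phi> x \<partial>lborel)"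
      "(\<integral>x. g x * \<bar>\<phi> (x + h m *\<^sub>R e)\<bar> \<partial>lborel) = (\<integral>x. g (x + d) * \<bar>\<phi> x\<bar> \<partial>lborel)"
      using integral_translate[of "\<lambda>x. f x * \<phi> (x + h m *\<^sub>R e)" d] integral_translate[of "\<lambda>x. g x * \<bar>\<phi> (x + h m *\<^sub>R e)\<bar>" d]
      by (auto simp: d_def)
    have "(\<integral>x. f x * q m x \<partial>lborel) = (\<integral>x. (f x * \<phi> (x + h m *\<^sub>R e) - f x * \<phi> x) / h m \<partial>lborel)"
      by (intro Bochner_Integration.integral_cong) (auto simp: q_def right_diff_distrib)
    also have "\<dots> = ((\<integral>x. f x * \<phi> (x + h m *\<^sub>R e) \<partial>lborel) - (\<integral>x. f x * \<phi> x \<partial>lborel)) / h m"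
      using i1 i2 by simp
    also have "\<dots> = ((\<integral>x. f (x + d) * \<phi> x \<partial>lborel) - (\<integral>x. f x * \<phi> x \<partial>lborel)) / h m"
      unfolding tr ..
    also have "\<dots> = (\<integral>x. (f (x + d) - f x) / h m * \<phi> x \<partial>lborel)"
      using i1 by (simp add: left_diff_distrib diff_divide_distrib)
    also have "\<bar>\<dots>\<bar> \<le> (\<integral>x. g (x + d) * \<bar>\<phi> x\<bar> + g x * \<bar>\<phi> x\<bar> \<partial>lborel)"
    proof -
      have AE: "AE x in lborel. \<bar>(f (x + d) - f x) / h m * \<phi> x\<bar> \<le> g (x + d) * \<bar>\<phi> x\<bar> + g x * \<bar>\<phi> x\<bar>"
      proof -
        have "AE x in lborel. x \<notin> S" by (rule AE_not_in[OF S])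
        moreover have "AE x in lborel. x + d \<notin> S"
        proof -
          have "distr lborel borel ((+) d) = (lborel :: (real^'n) measure)" by (rule lborel_distr_plus)
          moreover have "AE x in lborel. x \<notin> S" by (rule AE_not_in[OF S])
          ultimately have "AE x in distr lborel borel ((+) d). x \<notin> S" by metis
          then have "AE x in lborel. d + x \<notin> S" by (rule AE_distrD[rotated]) simp
          then show ?thesis by (simp add: add.commute)
        qed
        ultimately show ?thesis
        proof eventually_elim
          case (elim x)
          have "\<bar>f (x + d) - f x\<bar> \<le> norm (x + d - x) * (g (x + d) + g x)" by (rule pt) (use elim in auto)
          also have "norm (x + d - x) = h m" using h[of m] e1 by (simp add: d_def)
          finally have "\<bar>f (x + d) - f x\<bar> / h m \<le> g (x + d) + g x" using h[of m] by (simp add: field_simps)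
          then have "\<bar>f (x + d) - f x\<bar> / h m * \<bar>\<phi> x\<bar> \<le> (g (x + d) + g x) * \<bar>\<phi> x\<bar>" by (rule mult_right_mono) simp
          then show ?case using h[of m] by (simp add: abs_mult distrib_right)
        qed
      qed
      have id: "integrable lborel (\<lambda>x. (f (x + d) - f x) / h m * \<phi> x)"
        using i1 by (simp add: left_diff_distrib diff_divide_distrib)
      have "\<bar>\<integral>x. (f (x + d) - f x) / h m * \<phi> x \<partial>lborel\<bar> \<le> (\<integral>x. \<bar>(f (x + d) - f x) / h m * \<phi> x\<bar> \<partial>lborel)"
        by (rule integral_abs_bound)
      also have "\<dots> \<le> (\<integral>x. g (x + d) * \<bar>\<phi> x\<bar> + g x * \<bar>\<phi> x\<bar> \<partial>lborel)"
        by (rule integral_mono_AE[OF integrable_abs[OF id] _ AE]) (use i1 in simp)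
      finally show ?thesis .
    qed
    also have "\<dots> = (\<integral>x. g x * \<bar>\<phi> (x + h m *\<^sub>R e)\<bar> \<partial>lborel) + (\<integral>x. g x * \<bar>\<phi> x\<bar> \<partial>lborel)"
      unfolding tr using i1 by simp
    finally show ?thesis .
  qed
  have "(\<lambda>m. (\<integral>x. g x * \<bar>\<phi> (x + h m *\<^sub>R e)\<bar> \<partial>lborel) + (\<integral>x. g x * \<bar>\<phi> x\<bar> \<partial>lborel)) \<longlonglongrightarrow> (\<integral>x. g x * \<bar>\<phi> x\<bar> \<partial>lborel) + (\<integral>x. g x * \<bar>\<phi> x\<bar> \<partial>lborel)"
    by (intro tendsto_add lim2 tendsto_const)
  then have "\<bar>\<integral>x. f x * partial_deriv i \<phi> x \<partial>lborel\<bar> \<le> (\<integral>x. g x * \<bar>\<phi> x\<bar> \<partial>lborel) + (\<integral>x. g x * \<bar>\<phi> x\<bar> \<partial>lborel)"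
    by (rule LIMSEQ_le[OF tendsto_rabs[OF lim1]]) (use le in auto)
  then show ?thesis by simp
qed

section \<open>A Riesz representation by minimisation\<close>

lemma mult_le_squares: fixes a b s :: real assumes "0 < s" shows "\<bar>a * b\<bar> \<le> (s * a\<^sup>2 + b\<^sup>2 / s) / 2"
proof -
  have "0 \<le> (s * \<bar>a\<bar> - \<bar>b\<bar>)\<^sup>2 / s" using assms by simp
  also have "(s * \<bar>a\<bar> - \<bar>b\<bar>)\<^sup>2 / s = s * a\<^sup>2 + b\<^sup>2 / s - 2 * \<bar>a * b\<bar>"
    using assms by (simp add: power2_eq_square abs_mult field_simps)
  finally show ?thesis by simp
qed

lemma integrable_mult_squares:
  fixes a b :: "'a \<Rightarrow> real"
  assumes [measurable]: "a \<in> borel_measurable M" "b \<in> borel_measurable M"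
    and "integrable M (\<lambda>x. (a x)\<^sup>2)" "integrable M (\<lambda>x. (b x)\<^sup>2)"
  shows "integrable M (\<lambda>x. a x * b x)"
proof (rule Bochner_Integration.integrable_bound)
  show "integrable M (\<lambda>x. ((a x)\<^sup>2 + (b x)\<^sup>2) / 2)" using assms by simp
  show "AE x in M. norm (a x * b x) \<le> norm (((a x)\<^sup>2 + (b x)\<^sup>2) / 2)"
  proof (intro AE_I2)
    fix x
    have "\<bar>a x * b x\<bar> \<le> (1 * (a x)\<^sup>2 + (b x)\<^sup>2 / 1) / 2" by (rule mult_le_squares) simp
    then show "norm (a x * b x) \<le> norm (((a x)\<^sup>2 + (b x)\<^sup>2) / 2)" by simp
  qed
qed measurable

lemma quadratic_minimum: "0 < (c::real) \<Longrightarrow> 2 * (- m / c) * m + (- m / c)\<^sup>2 * c = - (m\<^sup>2 / c)"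
  by (simp add: power2_eq_square field_simps)

text \<open>The Riesz representation theorem on a subspace of the square integrable functions.
  Minimise the energy \<open>\<integral> \<phi>^2 - 2 * \<Lambda> \<phi>\<close>, which is bounded below by hypothesis. By the parallelogram law
  a minimising sequence is a Cauchy sequence; it is chosen so fast that it also converges almost
  everywhere. The first variation vanishes in the limit, which is the representation.\<close>

lemma quadratic_Riesz:
  fixes V :: "('a \<Rightarrow> real) set" and \<Lambda> :: "('a \<Rightarrow> real) \<Rightarrow> real"
  assumes ne: "V \<noteq> {}" and Vadd: "\<And>\<phi> \<psi>. \<phi> \<in> V \<Longrightarrow> \<psi> \<in> V \<Longrightarrow> (\<lambda>x. \<phi> x + \<psi> x) \<in> V"
    and Vmult: "\<And>\<phi> c. \<phi> \<in> V \<Longrightarrow> (\<lambda>x. c * \<phi> x) \<in> V"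
    and Vm: "\<And>\<phi>. \<phi> \<in> V \<Longrightarrow> \<phi> \<in> borel_measurable M"
    and Vi: "\<And>\<phi>. \<phi> \<in> V \<Longrightarrow> integrable M (\<lambda>x. (\<phi> x)\<^sup>2)"
    and Ladd: "\<And>\<phi> \<psi>. \<phi> \<in> V \<Longrightarrow> \<psi> \<in> V \<Longrightarrow> \<Lambda> (\<lambda>x. \<phi> x + \<psi> x) = \<Lambda> \<phi> + \<Lambda> \<psi>"
    and Lmult: "\<And>\<phi> c. \<phi> \<in> V \<Longrightarrow> \<Lambda> (\<lambda>x. c * \<phi> x) = c * \<Lambda> \<phi>"
    and bound: "\<And>\<phi>. \<phi> \<in> V \<Longrightarrow> 2 * \<Lambda> \<phi> \<le> (\<integral>x. (\<phi> x)\<^sup>2 \<partial>M) + C"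
  obtains u where "u \<in> borel_measurable M" "integrable M (\<lambda>x. (u x)\<^sup>2)"
    "\<And>\<phi>. \<phi> \<in> V \<Longrightarrow> \<Lambda> \<phi> = (\<integral>x. u x * \<phi> x \<partial>M)"
proof -
  define J where "J \<phi> = (\<integral>x. (\<phi> x)\<^sup>2 \<partial>M) - 2 * \<Lambda> \<phi>" for \<phi>
  define I where "I = Inf (J ` V)"
  have bdd: "bdd_below (J ` V)" unfolding bdd_below_def J_def using bound by (auto intro!: exI[of _ "- C"]) (smt (verit))
  have Ile: "I \<le> J \<phi>" if "\<phi> \<in> V" for \<phi> unfolding I_def by (rule cInf_lower[OF _ bdd]) (use that in auto)
  have "\<exists>\<phi>\<in>V. J \<phi> < I + (1 / 8) ^ k" for k :: nat
  proof -
    have "Inf (J ` V) < I + (1 / 8) ^ k" by (simp add: I_def)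
    then show ?thesis using ne bdd by (subst (asm) cInf_less_iff) auto
  qed
  then obtain \<phi> where \<phi>V: "\<And>k. \<phi> k \<in> V" and \<phi>J: "\<And>k. J (\<phi> k) < I + (1 / 8) ^ k" by metis
  note [measurable] = Vm[OF \<phi>V]
  have Vprod: "integrable M (\<lambda>x. a x * b x)" if "a \<in> V" "b \<in> V" for a b
    using that by (intro integrable_mult_squares Vm Vi)
  have Jplus: "J (\<lambda>x. a x + s * b x) = J a + 2 * s * ((\<integral>x. a x * b x \<partial>M) - \<Lambda> b) + s\<^sup>2 * (\<integral>x. (b x)\<^sup>2 \<partial>M)"
    if ab: "a \<in> V" "b \<in> V" for a b s
  proof -
    have "(\<integral>x. (a x + s * b x)\<^sup>2 \<partial>M) = (\<integral>x. (a x)\<^sup>2 + (2 * s * (a x * b x) + s\<^sup>2 * (b x)\<^sup>2) \<partial>M)"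
      by (intro Bochner_Integration.integral_cong) (auto simp: power2_eq_square algebra_simps)
    also have "\<dots> = (\<integral>x. (a x)\<^sup>2 \<partial>M) + (2 * s * (\<integral>x. a x * b x \<partial>M) + s\<^sup>2 * (\<integral>x. (b x)\<^sup>2 \<partial>M))"
      using Vi[OF ab(1)] Vi[OF ab(2)] Vprod[OF ab] by simp
    moreover have "\<Lambda> (\<lambda>x. a x + s * b x) = \<Lambda> a + s * \<Lambda> b"
      using Ladd[OF ab(1) Vmult[OF ab(2)]] Lmult[OF ab(2)] by simp
    ultimately show ?thesis by (simp add: J_def algebra_simps)
  qed
  have dist: "(\<integral>x. (\<phi> k x - \<phi> l x)\<^sup>2 \<partial>M) \<le> 2 * (1 / 8) ^ k + 2 * (1 / 8) ^ l" 
    and disti: "integrable M (\<lambda>x. (\<phi> k x - \<phi> l x)\<^sup>2)" for k l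
  proof -
    define b where "b x = \<phi> l x + (- 1) * \<phi> k x" for x
    have b: "b \<in> V" unfolding b_def using \<phi>V Vadd Vmult by blast
    have bb: "(\<phi> k x - \<phi> l x)\<^sup>2 = (b x)\<^sup>2" for x by (simp add: b_def power2_commute)
    show "integrable M (\<lambda>x. (\<phi> k x - \<phi> l x)\<^sup>2)" unfolding bb by (rule Vi[OF b])
    define N where "N = (\<integral>x. (b x)\<^sup>2 \<partial>M)"
    define m where "m = (\<integral>x. \<phi> k x * b x \<partial>M) - \<Lambda> b"
    have "(\<lambda>x. \<phi> k x + 1 * b x) = \<phi> l" by (auto simp: b_def)
    then have 1: "J (\<phi> l) = J (\<phi> k) + 2 * m + N" using Jplus[OF \<phi>V[of k] b, of 1] by (simp add: m_def N_def)
    have "I \<le> J (\<lambda>x. \<phi> k x + (1 / 2) * b x)" by (intro Ile Vadd Vmult \<phi>V b)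
    then have 2: "I \<le> J (\<phi> k) + m + N / 4" using Jplus[OF \<phi>V[of k] b, of "1 / 2"] by (simp add: m_def N_def power2_eq_square)
    have "N \<le> 2 * (1 / 8) ^ k + 2 * (1 / 8) ^ l" using 1 2 \<phi>J[of k] \<phi>J[of l] by linarith
    then show "(\<integral>x. (\<phi> k x - \<phi> l x)\<^sup>2 \<partial>M) \<le> 2 * (1 / 8) ^ k + 2 * (1 / 8) ^ l" unfolding bb N_def .
  qed
  have "(\<integral>\<^sup>+x. (\<Sum>k. ennreal (2 ^ k * (\<phi> (Suc k) x - \<phi> k x)\<^sup>2)) \<partial>M) = (\<Sum>k. \<integral>\<^sup>+x. ennreal (2 ^ k * (\<phi> (Suc k) x - \<phi> k x)\<^sup>2) \<partial>M)"
    by (rule nn_integral_suminf) measurable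
  also have "\<dots> \<le> (\<Sum>k. ennreal (4 * (1 / 4) ^ k))"
  proof (rule suminf_le)
    fix k :: nat
    have "(\<integral>\<^sup>+x. ennreal (2 ^ k * (\<phi> (Suc k) x - \<phi> k x)\<^sup>2) \<partial>M) = ennreal (\<integral>x. 2 ^ k * (\<phi> (Suc k) x - \<phi> k x)\<^sup>2 \<partial>M)"
      by (rule nn_integral_eq_integral) (use disti in auto)
    also have "\<dots> \<le> ennreal (4 * (1 / 4) ^ k)"
    proof (rule ennreal_leI)
      have "(\<integral>x. 2 ^ k * (\<phi> (Suc k) x - \<phi> k x)\<^sup>2 \<partial>M) = 2 ^ k * (\<integral>x. (\<phi> (Suc k) x - \<phi> k x)\<^sup>2 \<partial>M)" by simp
      also have "\<dots> \<le> 2 ^ k * (4 * (1 / 8) ^ k)"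
      proof (rule mult_left_mono)
        have "(1 / 8 :: real) ^ Suc k \<le> (1 / 8) ^ k" by (rule power_decreasing) auto
        then show "(\<integral>x. (\<phi> (Suc k) x - \<phi> k x)\<^sup>2 \<partial>M) \<le> 4 * (1 / 8) ^ k" using dist[of "Suc k" k] by linarith
      qed simp
      also have "\<dots> = 4 * (2 * (1 / 8)) ^ k" unfolding power_mult_distrib by simp
      also have "\<dots> = 4 * (1 / 4) ^ k" by simp
      finally show "(\<integral>x. 2 ^ k * (\<phi> (Suc k) x - \<phi> k x)\<^sup>2 \<partial>M) \<le> 4 * (1 / 4) ^ k" .
    qed
    finally show "(\<integral>\<^sup>+x. ennreal (2 ^ k * (\<phi> (Suc k) x - \<phi> k x)\<^sup>2) \<partial>M) \<le> ennreal (4 * (1 / 4) ^ k)" .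
  qed auto
  also have "\<dots> = ennreal (\<Sum>k. 4 * (1 / 4) ^ k)"
    by (rule suminf_ennreal2) (auto intro!: summable_mult summable_geometric)
  also have "\<dots> < \<infinity>" by simp
  finally have fin: "(\<integral>\<^sup>+x. (\<Sum>k. ennreal (2 ^ k * (\<phi> (Suc k) x - \<phi> k x)\<^sup>2)) \<partial>M) \<noteq> \<infinity>" by simp
  have sm: "(\<lambda>x. \<Sum>k. ennreal (2 ^ k * (\<phi> (Suc k) x - \<phi> k x)\<^sup>2)) \<in> borel_measurable M" by measurable
  have conv: "AE x in M. convergent (\<lambda>k. \<phi> k x)"
  proof (use nn_integral_PInf_AE[OF sm fin] in eventually_elim)
    fix x assume "(\<Sum>k. ennreal (2 ^ k * (\<phi> (Suc k) x - \<phi> k x)\<^sup>2)) \<noteq> \<infinity>"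
    then have s: "summable (\<lambda>k. 2 ^ k * (\<phi> (Suc k) x - \<phi> k x)\<^sup>2)"
      by (intro summable_suminf_not_top) auto
    have "summable (\<lambda>k. \<bar>\<phi> (Suc k) x - \<phi> k x\<bar>)"
    proof (rule summable_comparison_test')
      show "summable (\<lambda>k. (2 ^ k * (\<phi> (Suc k) x - \<phi> k x)\<^sup>2 + (1 / 2) ^ k) / 2)"
        using s by (intro summable_divide summable_add summable_geometric) auto
      show "norm \<bar>\<phi> (Suc k) x - \<phi> k x\<bar> \<le> (2 ^ k * (\<phi> (Suc k) x - \<phi> k x)\<^sup>2 + (1 / 2) ^ k) / 2" if "0 \<le> k" for k
        using mult_le_squares[of "2 ^ k" "\<phi> (Suc k) x - \<phi> k x" 1] by (simp add: power_one_over)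
    qed
    then have "summable (\<lambda>k. \<phi> (Suc k) x - \<phi> k x)" by (rule summable_rabs_cancel)
    then have "convergent (\<lambda>n. \<Sum>k<n. \<phi> (Suc k) x - \<phi> k x)" by (simp add: summable_iff_convergent)
    then have "convergent (\<lambda>n. \<phi> n x - \<phi> 0 x)" using sum_lessThan_telescope[of "\<lambda>k. \<phi> k x"] by simp
    then show "convergent (\<lambda>k. \<phi> k x)" using convergent_add[OF _ convergent_const[of "\<phi> 0 x"]] by force
  qed
  define u where "u x = lim (\<lambda>k. \<phi> k x)" for x
  have um [measurable]: "u \<in> borel_measurable M" unfolding u_def by measurable
  have u_lim: "AE x in M. (\<lambda>k. \<phi> k x) \<longlonglongrightarrow> u x"
    using conv by eventually_elim (auto simp: u_def convergent_LIMSEQ_iff)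
  have du: "(\<integral>\<^sup>+x. ennreal ((u x - \<phi> k x)\<^sup>2) \<partial>M) \<le> ennreal (4 * (1 / 8) ^ k)" for k
  proof -
    have "(\<integral>\<^sup>+x. ennreal ((u x - \<phi> k x)\<^sup>2) \<partial>M) = (\<integral>\<^sup>+x. liminf (\<lambda>j. ennreal ((\<phi> j x - \<phi> k x)\<^sup>2)) \<partial>M)"
    proof (rule nn_integral_cong_AE, use u_lim in eventually_elim)
      fix x assume "(\<lambda>k. \<phi> k x) \<longlonglongrightarrow> u x"
      then have "(\<lambda>j. ennreal ((\<phi> j x - \<phi> k x)\<^sup>2)) \<longlonglongrightarrow> ennreal ((u x - \<phi> k x)\<^sup>2)"
        by (intro tendsto_ennrealI tendsto_intros)
      then show "ennreal ((u x - \<phi> k x)\<^sup>2) = liminf (\<lambda>j. ennreal ((\<phi> j x - \<phi> k x)\<^sup>2))"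
        by (metis lim_imp_Liminf sequentially_bot)
    qed
    also have "\<dots> \<le> liminf (\<lambda>j. \<integral>\<^sup>+x. ennreal ((\<phi> j x - \<phi> k x)\<^sup>2) \<partial>M)"
      by (rule nn_integral_liminf) measurable
    also have "\<dots> \<le> ennreal (4 * (1 / 8) ^ k)"
    proof (rule Liminf_le)
      show "\<forall>\<^sub>F j in sequentially. (\<integral>\<^sup>+x. ennreal ((\<phi> j x - \<phi> k x)\<^sup>2) \<partial>M) \<le> ennreal (4 * (1 / 8) ^ k)"
        using eventually_ge_at_top[of k]
      proof eventually_elim
        case (elim j)
        have "(\<integral>\<^sup>+x. ennreal ((\<phi> j x - \<phi> k x)\<^sup>2) \<partial>M) = ennreal (\<integral>x. (\<phi> j x - \<phi> k x)\<^sup>2 \<partial>M)"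
          by (rule nn_integral_eq_integral) (use disti in auto)
        also have "\<dots> \<le> ennreal (4 * (1 / 8) ^ k)"
        proof (rule ennreal_leI)
          have "(1 / 8 :: real) ^ j \<le> (1 / 8) ^ k" using elim by (intro power_decreasing) auto
          then show "(\<integral>x. (\<phi> j x - \<phi> k x)\<^sup>2 \<partial>M) \<le> 4 * (1 / 8) ^ k" using dist[of j k] by linarith
        qed
        finally show ?case .
      qed
    qed simp
    finally show ?thesis .
  qed
  have dui: "integrable M (\<lambda>x. (u x - \<phi> k x)\<^sup>2)" for k
    by (rule integrableI_bounded) (use du[of k] in \<open>auto intro: le_less_trans\<close>)
  have dur: "(\<integral>x. (u x - \<phi> k x)\<^sup>2 \<partial>M) \<le> 4 * (1 / 8) ^ k" for k
    using du[of k] by (subst (asm) nn_integral_eq_integral[OF dui]) (auto simp: ennreal_le_iff)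
  have ui: "integrable M (\<lambda>x. (u x)\<^sup>2)"
  proof (rule Bochner_Integration.integrable_bound)
    show "integrable M (\<lambda>x. 2 * (u x - \<phi> 0 x)\<^sup>2 + 2 * (\<phi> 0 x)\<^sup>2)" using dui[of 0] Vi[OF \<phi>V[of 0]] by simp
    have "(u x)\<^sup>2 \<le> 2 * (u x - \<phi> 0 x)\<^sup>2 + 2 * (\<phi> 0 x)\<^sup>2" for x
      using zero_le_power2[of "u x - 2 * \<phi> 0 x"] by (simp add: power2_eq_square algebra_simps)
    then show "AE x in M. norm ((u x)\<^sup>2) \<le> norm (2 * (u x - \<phi> 0 x)\<^sup>2 + 2 * (\<phi> 0 x)\<^sup>2)"
      by (intro AE_I2) simp
  qed measurable
  show ?thesis
  proof (rule that[OF um ui])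
    fix \<psi> assume \<psi>: "\<psi> \<in> V"
    note [measurable] = Vm[OF \<psi>]
    define N where "N = (\<integral>x. (\<psi> x)\<^sup>2 \<partial>M)"
    have N: "0 \<le> N" unfolding N_def by simp
    define m where "m k = (\<integral>x. \<phi> k x * \<psi> x \<partial>M) - \<Lambda> \<psi>" for k
    \<comment> \<open>The energy is tested at a nearly optimal multiple of \<open>\<psi>\<close>; N + 1 instead of N avoids a zero denominator.\<close>
    have msq: "(m k)\<^sup>2 \<le> (N + 1) * (1 / 8) ^ k" for k
    proof -
      define s where "s = - m k / (N + 1)"
      have "I \<le> J (\<lambda>x. \<phi> k x + s * \<psi> x)" by (intro Ile Vadd Vmult \<phi>V \<psi>)
      then have "- ((1 / 8) ^ k) \<le> 2 * s * m k + s\<^sup>2 * N"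
        using Jplus[OF \<phi>V[of k] \<psi>, of s] \<phi>J[of k] unfolding m_def N_def by linarith
      also have "\<dots> \<le> 2 * s * m k + s\<^sup>2 * (N + 1)" by (intro add_left_mono mult_left_mono) auto
      also have "\<dots> = - ((m k)\<^sup>2 / (N + 1))" 
        using quadratic_minimum[of "N + 1" "m k"] N by (simp add: s_def)
      finally show ?thesis using N by (simp add: field_simps)
    qed
    have ule: "\<bar>(\<integral>x. u x * \<psi> x \<partial>M) - (\<integral>x. \<phi> k x * \<psi> x \<partial>M)\<bar> \<le> (4 * (1 / 4) ^ k + N * (1 / 2) ^ k) / 2" for k
    proof -
      have i: "integrable M (\<lambda>x. u x * \<psi> x)" "integrable M (\<lambda>x. \<phi> k x * \<psi> x)"
        by (intro integrable_mult_squares um Vm \<psi> ui Vi \<phi>V)+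
      have "(\<integral>x. u x * \<psi> x \<partial>M) - (\<integral>x. \<phi> k x * \<psi> x \<partial>M) = (\<integral>x. (u x - \<phi> k x) * \<psi> x \<partial>M)"
        unfolding left_diff_distrib using i by simp
      also have "\<bar>\<dots>\<bar> \<le> (\<integral>x. \<bar>(u x - \<phi> k x) * \<psi> x\<bar> \<partial>M)" by (rule integral_abs_bound)
      also have "\<dots> \<le> (\<integral>x. (2 ^ k * (u x - \<phi> k x)\<^sup>2 + (\<psi> x)\<^sup>2 / 2 ^ k) / 2 \<partial>M)"
      proof (rule integral_mono)
        show "integrable M (\<lambda>x. \<bar>(u x - \<phi> k x) * \<psi> x\<bar>)" using i by (simp add: left_diff_distrib)
        show "integrable M (\<lambda>x. (2 ^ k * (u x - \<phi> k x)\<^sup>2 + (\<psi> x)\<^sup>2 / 2 ^ k) / 2)" using dui Vi[OF \<psi>] by simp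
      qed (rule mult_le_squares, simp)
      also have "\<dots> = (2 ^ k * (\<integral>x. (u x - \<phi> k x)\<^sup>2 \<partial>M) + N / 2 ^ k) / 2"
        unfolding N_def using dui Vi[OF \<psi>] by simp
      also have "\<dots> \<le> (2 ^ k * (4 * (1 / 8) ^ k) + N / 2 ^ k) / 2"
        by (intro divide_right_mono add_right_mono mult_left_mono dur) auto
      also have "2 ^ k * (4 * (1 / 8) ^ k) = (4 * (2 * (1 / 8)) ^ k :: real)" unfolding power_mult_distrib by simp
      finally show ?thesis by (simp add: power_one_over)
    qed
    have "(\<lambda>k. (m k)\<^sup>2) \<longlonglongrightarrow> 0"
    proof (rule tendsto_sandwich[OF _ _ tendsto_const])
      have "(\<lambda>k. (N + 1) * (1 / 8) ^ k) \<longlonglongrightarrow> (N + 1) * 0" by (intro tendsto_mult tendsto_const LIMSEQ_power_zero) simp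
      then show "(\<lambda>k. (N + 1) * (1 / 8) ^ k) \<longlonglongrightarrow> 0" by simp
    qed (use msq in auto)
    from tendsto_real_sqrt[OF this] have "m \<longlonglongrightarrow> 0"
      by (simp add: tendsto_rabs_zero_iff)
    have "(\<lambda>k. (\<integral>x. u x * \<psi> x \<partial>M) - (\<integral>x. \<phi> k x * \<psi> x \<partial>M)) \<longlonglongrightarrow> 0"
    proof (rule tendsto_rabs_zero_cancel, rule tendsto_sandwich[OF _ _ tendsto_const])
      have "(\<lambda>k. (4 * (1 / 4) ^ k + N * (1 / 2) ^ k) / 2) \<longlonglongrightarrow> (4 * 0 + N * 0) / 2"
        by (intro tendsto_intros LIMSEQ_power_zero) auto
      then show "(\<lambda>k. (4 * (1 / 4) ^ k + N * (1 / 2) ^ k) / 2) \<longlonglongrightarrow> 0" by simp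
    qed (use ule in auto)
    from tendsto_add[OF this \<open>m \<longlonglongrightarrow> 0\<close>]
    have "(\<lambda>k. (\<integral>x. u x * \<psi> x \<partial>M) - \<Lambda> \<psi>) \<longlonglongrightarrow> 0" by (simp add: m_def)
    then show "\<Lambda> \<psi> = (\<integral>x. u x * \<psi> x \<partial>M)" by (simp add: LIMSEQ_const_iff)
  qed
qed

section \<open>Weak gradients from the pointwise inequality\<close>

text \<open>A weighted sum of indicators of balls, with weights that decrease faster than the integrals of \<open>g\<close>
  over these balls grow.\<close>

lemma locint_weight:
  fixes g :: "real^'n::finite \<Rightarrow> real"
  assumes [measurable]: "g \<in> borel_measurable borel" and l: "locint (\<lambda>x. ennreal (g x))"
  obtains \<theta> where "\<theta> \<in> borel_measurable borel" "\<And>x. (0::real) < \<theta> x" "(\<integral>\<^sup>+x. ennreal (g x) * ennreal (\<theta> x) \<partial>lborel) < \<infinity>"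
    "\<And>R. \<exists>c>0. \<forall>x\<in>ball 0 R. c \<le> \<theta> x"
proof -
  define I where "I m = enn2real (\<integral>\<^sup>+x\<in>ball 0 (real (Suc m)). ennreal (g x) \<partial>lborel)" for m
  have I: "(\<integral>\<^sup>+x\<in>ball 0 (real (Suc m)). ennreal (g x) \<partial>lborel) = ennreal (I m)" for m
    using l by (simp add: I_def locint_def less_top)
  have I0: "0 \<le> I m" for m by (simp add: I_def)
  define c where "c m = (1 / 2) ^ m / (1 + I m)" for m
  have c: "0 < c m" "c m \<le> (1 / 2) ^ m" "c m * I m \<le> (1 / 2) ^ m" for m
  proof -
    show "0 < c m" using I0[of m] by (auto simp: c_def intro!: divide_pos_pos)
    have "(1 / 2) ^ m / (1 + I m) \<le> (1 / 2) ^ m / (1::real)" using I0[of m] by (intro divide_left_mono) auto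
    then show "c m \<le> (1 / 2) ^ m" by (simp add: c_def)
    have "(1 / 2) ^ m * (I m / (1 + I m)) \<le> (1 / 2) ^ m * 1" using I0[of m] by (intro mult_left_mono) (auto simp: divide_le_eq_1)
    then show "c m * I m \<le> (1 / 2) ^ m" by (simp add: c_def)
  qed
  define \<theta>' where "\<theta>' x = (\<Sum>m. ennreal (c m) * indicator (ball 0 (real (Suc m))) x)" for x :: "real^'n"
  have ball [measurable]: "ball (0::real^'n) (real (Suc m)) \<in> sets borel" for m by simp
  have [measurable]: "\<theta>' \<in> borel_measurable borel" unfolding \<theta>'_def by measurable
  have geo: "(\<Sum>m. ennreal ((1 / 2) ^ m)) < \<infinity>"
    by (subst suminf_ennreal2) (auto intro: summable_geometric)
  have fin: "\<theta>' x < \<infinity>" for x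
  proof -
    have "\<theta>' x \<le> (\<Sum>m. ennreal ((1 / 2) ^ m))"
      unfolding \<theta>'_def using c by (intro suminf_le) (auto simp: indicator_def intro: ennreal_leI)
    with geo show ?thesis by (rule le_less_trans[rotated])
  qed
  have lower: "ennreal (c m) \<le> \<theta>' x" if "norm x < real (Suc m)" for m x
  proof -
    have "(\<Sum>k\<in>{m}. ennreal (c k) * indicator (ball 0 (real (Suc k))) x) \<le> \<theta>' x"
      unfolding \<theta>'_def by (rule sum_le_suminf) auto
    then show ?thesis using that by simp
  qed
  have e: "\<theta>' x = ennreal (enn2real (\<theta>' x))" for x using fin[of x] by simp
  have lower': "c m \<le> enn2real (\<theta>' x)" if "norm x < real (Suc m)" for m x
    using lower[OF that] c(1)[of m] by (subst (asm) e) (simp add: ennreal_le_iff)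
  show ?thesis
  proof (rule that[of "\<lambda>x. enn2real (\<theta>' x)"])
    show "0 < enn2real (\<theta>' x)" for x
    proof -
      obtain m :: nat where "norm x < real m" using reals_Archimedean2 by blast
      then have "norm x < real (Suc m)" by simp
      from lower'[OF this] c(1)[of m] show ?thesis by linarith
    qed
    show "\<exists>c>0. \<forall>x\<in>ball 0 R. c \<le> enn2real (\<theta>' x)" for R
    proof -
      obtain m :: nat where "R < real m" using reals_Archimedean2 by blast
      then have "c m \<le> enn2real (\<theta>' x)" if "x \<in> ball 0 R" for x
        using that by (intro lower') simp
      with c(1)[of m] show ?thesis by blast
    qed
    have "(\<integral>\<^sup>+x. ennreal (g x) * ennreal (enn2real (\<theta>' x)) \<partial>lborel) = (\<integral>\<^sup>+x. (\<Sum>m. ennreal (c m) * (ennreal (g x) * indicator (ball 0 (real (Suc m))) x)) \<partial>lborel)"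
    proof (intro nn_integral_cong)
      fix x
      have "ennreal (g x) * ennreal (enn2real (\<theta>' x)) = ennreal (g x) * \<theta>' x" by (subst e[symmetric]) (rule refl)
      also have "\<dots> = (\<Sum>m. ennreal (g x) * (ennreal (c m) * indicator (ball 0 (real (Suc m))) x))"
        unfolding \<theta>'_def by (rule ennreal_suminf_cmult[symmetric])
      finally show "ennreal (g x) * ennreal (enn2real (\<theta>' x)) = (\<Sum>m. ennreal (c m) * (ennreal (g x) * indicator (ball 0 (real (Suc m))) x))"
        by (simp only: mult.left_commute)
    qed
    also have "\<dots> = (\<Sum>m. \<integral>\<^sup>+x. ennreal (c m) * (ennreal (g x) * indicator (ball 0 (real (Suc m))) x) \<partial>lborel)"
      by (rule nn_integral_suminf) measurable
    also have "\<dots> = (\<Sum>m. ennreal (c m * I m))"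
    proof (intro suminf_cong)
      fix m
      have "(\<integral>\<^sup>+x. ennreal (c m) * (ennreal (g x) * indicator (ball 0 (real (Suc m))) x) \<partial>lborel) = ennreal (c m) * ennreal (I m)"
        unfolding I[symmetric] by (rule nn_integral_cmult) measurable
      also have "\<dots> = ennreal (c m * I m)" using c(1)[of m] I0[of m] by (simp add: ennreal_mult)
      finally show "(\<integral>\<^sup>+x. ennreal (c m) * (ennreal (g x) * indicator (ball 0 (real (Suc m))) x) \<partial>lborel) = ennreal (c m * I m)" .
    qed
    also have "\<dots> \<le> (\<Sum>m. ennreal ((1 / 2) ^ m))" using c by (intro suminf_le) (auto intro: ennreal_leI)
    also note geo
    finally show "(\<integral>\<^sup>+x. ennreal (g x) * ennreal (enn2real (\<theta>' x)) \<partial>lborel) < \<infinity>" .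
  qed measurable
qed

text \<open>The functional is bounded with respect to the norm of the integrable functions with weight \<open>g\<close>; to
  use the quadratic theory it is also bounded, up to an additive constant, by the energy
  \<open>\<integral> \<phi>^2 * \<rho>\<close> for a suitable density \<open>\<rho>\<close>. The bound \<open>2 * g\<close> for the representing function follows by testing.\<close>

lemma test_functional_representation:
  fixes g :: "real^'n::finite \<Rightarrow> real" and \<Lambda> :: "(real^'n \<Rightarrow> real) \<Rightarrow> real"
  assumes gm [measurable]: "g \<in> borel_measurable borel" and lg: "locint (\<lambda>x. ennreal (g x))" and g0: "\<And>x. 0 \<le> g x"
    and Ladd: "\<And>\<phi> \<psi>. test_function \<phi> \<Longrightarrow> test_function \<psi> \<Longrightarrow> \<Lambda> (\<lambda>x. \<phi> x + \<psi> x) = \<Lambda> \<phi> + \<Lambda> \<psi>"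
    and Lmult: "\<And>\<phi> c. test_function \<phi> \<Longrightarrow> \<Lambda> (\<lambda>x. c * \<phi> x) = c * \<Lambda> \<phi>"
    and bound: "\<And>\<phi>. test_function \<phi> \<Longrightarrow> \<bar>\<Lambda> \<phi>\<bar> \<le> 2 * (\<integral>x. g x * \<bar>\<phi> x\<bar> \<partial>lborel)"
  obtains F where "F \<in> borel_measurable borel" "locint (\<lambda>x. ennreal \<bar>F x\<bar>)"
    "\<And>\<phi>. test_function \<phi> \<Longrightarrow> \<Lambda> \<phi> = (\<integral>x. F x * \<phi> x \<partial>lborel)" "AE x in lborel. \<bar>F x\<bar> \<le> 2 * g x"
proof -
  obtain \<theta> where \<theta>m [measurable]: "\<theta> \<in> borel_measurable borel" and \<theta>: "\<And>x. (0::real) < \<theta> x"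
    and \<theta>g: "(\<integral>\<^sup>+x. ennreal (g x) * ennreal (\<theta> x) \<partial>lborel) < \<infinity>" and \<theta>l: "\<And>R. \<exists>c>0. \<forall>x\<in>ball 0 R. c \<le> \<theta> x"
    by (rule locint_weight[OF gm lg]) blast
  \<comment> \<open>With this density \<open>4 * g * |\<phi>| \<le> \<phi>^2 * \<rho> + 4 * g * \<theta>\<close>, and the last term is integrable. The summand 1 keeps \<open>\<rho>\<close> positive.\<close>
  define \<rho> where "\<rho> x = (g x + 1) / \<theta> x" for x
  have [measurable]: "\<rho> \<in> borel_measurable borel" unfolding \<rho>_def by measurable
  have \<rho>: "0 < \<rho> x" for x unfolding \<rho>_def using \<theta>[of x] g0[of x] by (intro divide_pos_pos) auto
  have lg': "locint (\<lambda>x. ennreal \<bar>g x\<bar>)" using lg g0 by simp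
  have l\<rho>: "locint (\<lambda>x. ennreal \<bar>\<rho> x\<bar>)"
    unfolding locint_def
  proof
    fix R :: real
    have [measurable]: "ball (0::real^'n) R \<in> sets borel" by simp
    obtain c where c: "c > 0" "\<And>x. x \<in> ball 0 R \<Longrightarrow> c \<le> \<theta> x" using \<theta>l[of R] by blast
    have "(\<integral>\<^sup>+x\<in>ball 0 R. ennreal \<bar>\<rho> x\<bar> \<partial>lborel) \<le> (\<integral>\<^sup>+x. ennreal (1 / c) * (ennreal (g x) * indicator (ball 0 R) x + indicator (ball 0 R) x) \<partial>lborel)"
    proof (intro nn_integral_mono)
      fix x :: "real^'n"
      show "ennreal \<bar>\<rho> x\<bar> * indicator (ball 0 R) x \<le> ennreal (1 / c) * (ennreal (g x) * indicator (ball 0 R) x + indicator (ball 0 R) x)"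
      proof (cases "x \<in> ball 0 R")
        case True
        have "\<rho> x \<le> (g x + 1) / c" unfolding \<rho>_def using c True g0[of x] \<theta>[of x] by (intro divide_left_mono mult_pos_pos) auto
        then have "ennreal \<bar>\<rho> x\<bar> \<le> ennreal (1 / c * (g x + 1))" using \<rho>[of x] by (intro ennreal_leI) simp
        also have "\<dots> = ennreal (1 / c) * (ennreal (g x) + 1)"
          using c g0[of x] by (subst ennreal_mult) (auto simp: ennreal_plus)
        finally show ?thesis using True by simp
      qed simp
    qed
    also have "\<dots> = ennreal (1 / c) * ((\<integral>\<^sup>+x\<in>ball 0 R. ennreal (g x) \<partial>lborel) + emeasure lborel (ball (0::real^'n) R))"
      by (subst nn_integral_cmult, measurable, subst nn_integral_add) auto
    also have "\<dots> < \<infinity>"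
      using lg emeasure_bounded_finite[of "ball (0::real^'n) R"] by (auto simp: locint_def ennreal_mult_less_top)
    finally show "(\<integral>\<^sup>+x\<in>ball 0 R. ennreal \<bar>\<rho> x\<bar> \<partial>lborel) < \<infinity>" .
  qed
  define M where "M = density lborel (\<lambda>x. ennreal (\<rho> x))"
  have [measurable_cong, simp]: "sets M = sets borel" by (simp add: M_def)
  have Mi: "integrable M h \<longleftrightarrow> integrable lborel (\<lambda>x. \<rho> x * h x)" and Mint: "(\<integral>x. h x \<partial>M) = (\<integral>x. \<rho> x * h x \<partial>lborel)"
    if [measurable]: "h \<in> borel_measurable borel" for h :: "real^'n \<Rightarrow> real"
    unfolding M_def using \<rho> by (subst integrable_real_density integral_real_density; simp add: less_imp_le)+
  have tm: "\<phi> \<in> borel_measurable borel" if "test_function \<phi>" for \<phi> :: "real^'n \<Rightarrow> real"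
    using that by (intro borel_measurable_continuous_onI test_function_continuous)
  have ti: "integrable lborel (\<lambda>x. h x * \<phi> x)" "integrable lborel (\<lambda>x. h x * \<bar>\<phi> x\<bar>)" "integrable lborel (\<lambda>x. h x * (\<phi> x)\<^sup>2)"
    if t: "test_function \<phi>" and hm [measurable]: "h \<in> borel_measurable borel" and lh: "locint (\<lambda>x. ennreal \<bar>h x\<bar>)" for h \<phi> :: "real^'n \<Rightarrow> real"
  proof -
    note [measurable] = tm[OF t]
    obtain R C where RC: "0 < R" "0 < C" "\<And>x. norm x \<ge> R \<Longrightarrow> \<phi> x = 0" "\<And>x. \<bar>\<phi> x\<bar> \<le> C"
      by (rule test_function_bounds[OF t]) blast
    show "integrable lborel (\<lambda>x. h x * \<phi> x)" by (rule integrable_locint_mult[OF _ _ lh RC(3,4)]) auto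
    show "integrable lborel (\<lambda>x. h x * \<bar>\<phi> x\<bar>)" by (rule integrable_locint_mult[OF _ _ lh, of _ R C]) (use RC in auto)
    have "(\<phi> x)\<^sup>2 \<le> C\<^sup>2" for x using RC(4)[of x] by (metis abs_le_square_iff abs_of_pos RC(2))
    then show "integrable lborel (\<lambda>x. h x * (\<phi> x)\<^sup>2)" by (intro integrable_locint_mult[OF _ _ lh, of _ R "C\<^sup>2"]) (use RC in auto)
  qed
  define C where "C = 4 * (\<integral>x. g x * \<theta> x \<partial>lborel)"
  have g\<theta>i: "integrable lborel (\<lambda>x. g x * \<theta> x)"
  proof (rule integrableI_nonneg)
    show "(\<integral>\<^sup>+x. ennreal (g x * \<theta> x) \<partial>lborel) < \<infinity>" using \<theta>g g0 \<theta> by (simp add: ennreal_mult less_imp_le)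
  qed (use g0 \<theta> in \<open>auto simp: less_imp_le\<close>)
  obtain u where um: "u \<in> borel_measurable M" and ui: "integrable M (\<lambda>x. (u x)\<^sup>2)"
    and u: "\<And>\<phi>. \<phi> \<in> Collect test_function \<Longrightarrow> \<Lambda> \<phi> = (\<integral>x. u x * \<phi> x \<partial>M)"
  proof (rule quadratic_Riesz[of "Collect test_function" M \<Lambda> C])
    show "Collect test_function \<noteq> ({} :: (real^'n \<Rightarrow> real) set)" using test_function_bump[OF zero_less_one] by blast
    fix \<phi> :: "real^'n \<Rightarrow> real" assume "\<phi> \<in> Collect test_function"
    then have t: "test_function \<phi>" by simp
    note [measurable] = tm[OF t]
    show "\<phi> \<in> borel_measurable M" by measurable
    show "integrable M (\<lambda>x. (\<phi> x)\<^sup>2)" by (subst Mi) (auto intro: ti[OF t _ l\<rho>])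
    have "2 * \<Lambda> \<phi> \<le> 4 * (\<integral>x. g x * \<bar>\<phi> x\<bar> \<partial>lborel)" using bound[OF t] by linarith
    also have "\<dots> = (\<integral>x. 4 * (g x * \<bar>\<phi> x\<bar>) \<partial>lborel)" by simp
    also have "\<dots> \<le> (\<integral>x. \<rho> x * (\<phi> x)\<^sup>2 + 4 * (g x * \<theta> x) \<partial>lborel)"
    proof (rule integral_mono)
      show "integrable lborel (\<lambda>x. 4 * (g x * \<bar>\<phi> x\<bar>))" using ti(2)[OF t gm lg'] by simp
      show "integrable lborel (\<lambda>x. \<rho> x * (\<phi> x)\<^sup>2 + 4 * (g x * \<theta> x))" using ti(3)[OF t _ l\<rho>] g\<theta>i by simp
      fix x
      have "4 * (g x * \<bar>\<phi> x\<bar>) \<le> g x * ((\<phi> x)\<^sup>2 / \<theta> x + 4 * \<theta> x)"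
      proof -
        have "\<bar>2 * \<bar>\<phi> x\<bar>\<bar> \<le> (\<theta> x * 2\<^sup>2 + \<bar>\<phi> x\<bar>\<^sup>2 / \<theta> x) / 2" using mult_le_squares[OF \<theta>[of x], of 2 "\<bar>\<phi> x\<bar>"] by simp
        then have "4 * \<bar>\<phi> x\<bar> \<le> (\<phi> x)\<^sup>2 / \<theta> x + 4 * \<theta> x" by simp
        from mult_left_mono[OF this g0[of x]] show ?thesis by simp
      qed
      also have "\<dots> \<le> \<rho> x * (\<phi> x)\<^sup>2 + 4 * (g x * \<theta> x)"
        unfolding \<rho>_def using \<theta>[of x] by (simp add: field_simps)
      finally show "4 * (g x * \<bar>\<phi> x\<bar>) \<le> \<rho> x * (\<phi> x)\<^sup>2 + 4 * (g x * \<theta> x)" .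
    qed
    also have "\<dots> = (\<integral>x. (\<phi> x)\<^sup>2 \<partial>M) + C"
      using ti(3)[OF t _ l\<rho>] g\<theta>i by (subst Mint) (auto simp: C_def)
    finally show "2 * \<Lambda> \<phi> \<le> (\<integral>x. (\<phi> x)\<^sup>2 \<partial>M) + C" .
  qed (auto intro: test_function_add test_function_cmult Ladd Lmult)
  have [measurable]: "u \<in> borel_measurable borel" using um by simp
  define F where "F x = \<rho> x * u x" for x
  have Fm [measurable]: "F \<in> borel_measurable borel" unfolding F_def by measurable
  have ui': "integrable lborel (\<lambda>x. \<rho> x * (u x)\<^sup>2)" using ui by (subst (asm) Mi) auto
  have lF: "locint (\<lambda>x. ennreal \<bar>F x\<bar>)"
  proof (rule locint_mono[OF locint_add[OF _ _ _ l\<rho>]])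
    show "locint (\<lambda>x. ennreal (\<rho> x * (u x)\<^sup>2))"
      unfolding locint_def
    proof
      fix R :: real
      have "(\<integral>\<^sup>+x\<in>ball 0 R. ennreal (\<rho> x * (u x)\<^sup>2) \<partial>lborel) \<le> (\<integral>\<^sup>+x. ennreal (\<rho> x * (u x)\<^sup>2) \<partial>lborel)"
        by (intro nn_integral_mono) (auto simp: indicator_def)
      also have "\<dots> < \<infinity>"
        using ui' \<rho> by (subst nn_integral_eq_integral) (auto simp: less_imp_le)
      finally show "(\<integral>\<^sup>+x\<in>ball 0 R. ennreal (\<rho> x * (u x)\<^sup>2) \<partial>lborel) < \<infinity>" .
    qed
    fix x
    have "\<bar>u x\<bar> \<le> (u x)\<^sup>2 + 1" using mult_le_squares[of 1 "u x" 1] by (simp add: add_increasing)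
    then have "\<bar>F x\<bar> \<le> \<rho> x * ((u x)\<^sup>2 + 1)" using \<rho>[of x] by (simp add: F_def abs_mult mult_left_mono)
    then have "\<bar>F x\<bar> \<le> \<rho> x * (u x)\<^sup>2 + \<bar>\<rho> x\<bar>" using \<rho>[of x] by (simp add: distrib_left)
    then have "ennreal \<bar>F x\<bar> \<le> ennreal (\<rho> x * (u x)\<^sup>2 + \<bar>\<rho> x\<bar>)" by (rule ennreal_leI)
    then show "ennreal \<bar>F x\<bar> \<le> ennreal (\<rho> x * (u x)\<^sup>2) + ennreal \<bar>\<rho> x\<bar>"
      using \<rho>[of x] by (simp add: ennreal_plus less_imp_le)
  qed auto
  have rep: "\<Lambda> \<phi> = (\<integral>x. F x * \<phi> x \<partial>lborel)" if t: "test_function \<phi>" for \<phi>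
    using u[of \<phi>] t tm[OF t] by (simp add: Mint F_def mult.assoc)
  have lb: "locint (\<lambda>x. ennreal (2 * g x))"
    by (rule locint_mono[OF locint_add[OF _ _ lg lg]]) (use g0 in \<open>auto simp flip: ennreal_plus\<close>)
  have test: "ennreal (s * (\<integral>x. F x * \<phi> x \<partial>lborel)) \<le> (\<integral>\<^sup>+x. ennreal (2 * g x) * ennreal (\<phi> x) \<partial>lborel)"
    if t: "test_function \<phi>" and p: "\<And>x. 0 \<le> \<phi> x" and s: "\<bar>s\<bar> \<le> 1" for s \<phi>
  proof -
    note [measurable] = tm[OF t]
    have "s * (\<integral>x. F x * \<phi> x \<partial>lborel) \<le> \<bar>s\<bar> * \<bar>\<Lambda> \<phi>\<bar>" unfolding rep[OF t] abs_mult[symmetric] by simp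
    also have "\<dots> \<le> 1 * \<bar>\<Lambda> \<phi>\<bar>" using s by (intro mult_right_mono) auto
    also have "\<dots> \<le> (\<integral>x. (2 * g x) * \<phi> x \<partial>lborel)" using bound[OF t] p by (simp add: mult.assoc)
    finally have "ennreal (s * (\<integral>x. F x * \<phi> x \<partial>lborel)) \<le> ennreal (\<integral>x. (2 * g x) * \<phi> x \<partial>lborel)" by (rule ennreal_leI)
    also have "\<dots> = (\<integral>\<^sup>+x. ennreal ((2 * g x) * \<phi> x) \<partial>lborel)"
      using ti(1)[OF t gm lg'] g0 p by (intro nn_integral_eq_integral[symmetric]) (auto simp: mult.assoc)
    also have "\<dots> = (\<integral>\<^sup>+x. ennreal (2 * g x) * ennreal (\<phi> x) \<partial>lborel)"
      using g0 p by (intro nn_integral_cong ennreal_mult) auto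
    finally show ?thesis .
  qed
  have "AE x in lborel. ennreal (F x) \<le> ennreal (2 * g x)"
    by (rule bound_of_tests[OF _ _ lF lb]) (use test[of _ 1] in auto)
  moreover have "AE x in lborel. ennreal (- F x) \<le> ennreal (2 * g x)"
    by (rule bound_of_tests[OF _ _ _ lb]) (use test[of _ "- 1"] lF in auto)
  ultimately have Fg: "AE x in lborel. \<bar>F x\<bar> \<le> 2 * g x"
  proof eventually_elim
    case (elim x)
    then show ?case using g0[of x] by (auto simp: ennreal_le_iff)
  qed
  show ?thesis by (rule that[OF Fm lF rep Fg])
qed

text \<open>Each functional \<open>\<phi> \<mapsto> - \<integral> f * \<partial>\<^sub>i \<phi>\<close> is represented by a function, which is the partial
  derivative.\<close>

lemma pointwise_weak_gradient:
  fixes f g :: "real^'n::finite \<Rightarrow> real"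
  assumes fm [measurable]: "f \<in> borel_measurable borel" and gm [measurable]: "g \<in> borel_measurable borel"
    and lf: "locint (\<lambda>x. ennreal \<bar>f x\<bar>)" and lg: "locint (\<lambda>x. ennreal (g x))" and g0: "\<And>x. 0 \<le> g x"
    and S: "S \<in> null_sets lborel"
    and pt: "\<And>x y. x \<notin> S \<Longrightarrow> y \<notin> S \<Longrightarrow> \<bar>f x - f y\<bar> \<le> norm (x - y) * (g x + g y)"
  obtains G where "borel_weak_gradient f G" "AE x in lborel. norm (G x) \<le> 2 * real CARD('n) * g x"
proof -
  have "\<exists>F. F \<in> borel_measurable borel \<and> locint (\<lambda>x. ennreal \<bar>F x\<bar>) \<and>
    (\<forall>\<phi>. test_function \<phi> \<longrightarrow> - (\<integral>x. f x * partial_deriv i \<phi> x \<partial>lborel) = (\<integral>x. F x * \<phi> x \<partial>lborel)) \<and> (AE x in lborel. \<bar>F x\<bar> \<le> 2 * g x)" for i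
  proof (rule test_functional_representation[OF gm lg g0, of "\<lambda>\<phi>. - (\<integral>x. f x * partial_deriv i \<phi> x \<partial>lborel)"])
    have pi: "integrable lborel (\<lambda>x. f x * partial_deriv i \<phi> x)" if t: "test_function \<phi>" for \<phi>
    proof -
      obtain R C where "0 < R" "0 < C" "\<And>x i. norm x \<ge> R \<Longrightarrow> partial_deriv i \<phi> x = 0" "\<And>x i. \<bar>partial_deriv i \<phi> x\<bar> \<le> C"
        by (rule test_function_bounds[OF t]) blast
      moreover have "partial_deriv i \<phi> \<in> borel_measurable borel"
        by (intro borel_measurable_continuous_onI test_function_partial_continuous t)
      ultimately show ?thesis by (intro integrable_locint_mult[OF fm _ lf, of _ R C]) auto
    qed
    fix \<phi> :: "real^'n \<Rightarrow> real" assume t: "test_function \<phi>"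
    {
      fix \<psi> :: "real^'n \<Rightarrow> real" assume t2: "test_function \<psi>"
      have "partial_deriv i (\<lambda>x. \<phi> x + \<psi> x) = (\<lambda>x. partial_deriv i \<phi> x + partial_deriv i \<psi> x)"
      proof
        fix x
        from partial_deriv_eq[OF has_derivative_add[OF test_function_has_derivative[OF t] test_function_has_derivative[OF t2]], of i x]
        show "partial_deriv i (\<lambda>x. \<phi> x + \<psi> x) x = partial_deriv i \<phi> x + partial_deriv i \<psi> x"
          using partial_deriv_eq[OF test_function_has_derivative[OF t], of i x] partial_deriv_eq[OF test_function_has_derivative[OF t2], of i x] by simp
      qed
      then show "- (\<integral>x. f x * partial_deriv i (\<lambda>x. \<phi> x + \<psi> x) x \<partial>lborel) = - (\<integral>x. f x * partial_deriv i \<phi> x \<partial>lborel) + - (\<integral>x. f x * partial_deriv i \<psi> x \<partial>lborel)"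
        using pi[OF t] pi[OF t2] by (simp add: distrib_left)
    }
    {
      fix c
      have "partial_deriv i (\<lambda>x. c * \<phi> x) = (\<lambda>x. c * partial_deriv i \<phi> x)"
      proof
        fix x
        from partial_deriv_eq[OF has_derivative_mult_right[OF test_function_has_derivative[OF t]], of i c x]
        show "partial_deriv i (\<lambda>x. c * \<phi> x) x = c * partial_deriv i \<phi> x"
          using partial_deriv_eq[OF test_function_has_derivative[OF t], of i x] by simp
      qed
      then show "- (\<integral>x. f x * partial_deriv i (\<lambda>x. c * \<phi> x) x \<partial>lborel) = c * - (\<integral>x. f x * partial_deriv i \<phi> x \<partial>lborel)"
        by (simp add: mult.left_commute[of _ c])
    }
    show "\<bar>- (\<integral>x. f x * partial_deriv i \<phi> x \<partial>lborel)\<bar> \<le> 2 * (\<integral>x. g x * \<bar>\<phi> x\<bar> \<partial>lborel)"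
      using pointwise_functional_bound[OF fm gm lf lg g0 S pt t, of i] by simp
  next
    fix F :: "real^'n \<Rightarrow> real"
    assume "F \<in> borel_measurable borel" "locint (\<lambda>x. ennreal \<bar>F x\<bar>)"
      "\<And>\<phi>. test_function \<phi> \<Longrightarrow> - (\<integral>x. f x * partial_deriv i \<phi> x \<partial>lborel) = (\<integral>x. F x * \<phi> x \<partial>lborel)"
      "AE x in lborel. \<bar>F x\<bar> \<le> 2 * g x"
    then show ?thesis by (intro exI[of _ F] conjI allI impI)
  qed
  then have "\<forall>i. \<exists>F. F \<in> borel_measurable borel \<and> locint (\<lambda>x. ennreal \<bar>F x\<bar>) \<and>
    (\<forall>\<phi>. test_function \<phi> \<longrightarrow> - (\<integral>x. f x * partial_deriv i \<phi> x \<partial>lborel) = (\<integral>x. F x * \<phi> x \<partial>lborel)) \<and> (AE x in lborel. \<bar>F x\<bar> \<le> 2 * g x)"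
    by (rule allI)
  from choice[OF this] obtain F where F: "\<forall>i. F i \<in> borel_measurable borel \<and> locint (\<lambda>x. ennreal \<bar>F i x\<bar>) \<and>
    (\<forall>\<phi>. test_function \<phi> \<longrightarrow> - (\<integral>x. f x * partial_deriv i \<phi> x \<partial>lborel) = (\<integral>x. F i x * \<phi> x \<partial>lborel)) \<and> (AE x in lborel. \<bar>F i x\<bar> \<le> 2 * g x)"
    by (rule exE)
  from F have Fm: "\<And>i. F i \<in> borel_measurable borel" and lF: "\<And>i. locint (\<lambda>x. ennreal \<bar>F i x\<bar>)"
    and Fw: "\<And>i \<phi>. test_function \<phi> \<Longrightarrow> - (\<integral>x. f x * partial_deriv i \<phi> x \<partial>lborel) = (\<integral>x. F i x * \<phi> x \<partial>lborel)"
    and Fg: "\<And>i. AE x in lborel. \<bar>F i x\<bar> \<le> 2 * g x" by (simp_all only:)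
  define G where "G x = (\<chi> i. F i x)" for x
  have Gs: "G = (\<lambda>x. \<Sum>i\<in>UNIV. F i x *\<^sub>R axis i 1)"
    by (auto simp: G_def fun_eq_iff vec_eq_iff axis_def if_distrib[of "\<lambda>t. _ * t"] sum.delta cong: if_cong)
  have Gm [measurable]: "G \<in> borel_measurable borel" unfolding Gs using Fm by measurable
  have nG: "norm (G x) \<le> (\<Sum>i\<in>UNIV. \<bar>F i x\<bar>)" for x using norm_le_l1_cart[of "G x"] by (simp add: G_def)
  have lG: "locint (\<lambda>x. ennreal (norm (G x)))"
  proof (rule locint_mono)
    show "locint (\<lambda>x. \<Sum>i\<in>UNIV. ennreal \<bar>F i x\<bar>)"
    proof -
      have "locint (\<lambda>x. \<Sum>i\<in>A. ennreal \<bar>F i x\<bar>)" if "finite A" for A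
        using that
      proof induction
        case empty
        show ?case by (simp add: locint_def)
      next
        case (insert i A)
        have "locint (\<lambda>x. ennreal \<bar>F i x\<bar> + (\<Sum>i\<in>A. ennreal \<bar>F i x\<bar>))"
          by (intro locint_add lF insert.IH) (use Fm in measurable)
        then show ?case using insert by simp
      qed
      then show ?thesis by simp
    qed
    show "ennreal (norm (G x)) \<le> (\<Sum>i\<in>UNIV. ennreal \<bar>F i x\<bar>)" for x
      using nG[of x] by (subst sum_ennreal) (auto intro: ennreal_leI)
  qed
  show ?thesis
  proof (rule that[of G])
    show "borel_weak_gradient f G"
      unfolding borel_weak_gradient_def
    proof (intro conjI allI impI fm Gm lf lG)
      fix \<phi> :: "real^'n \<Rightarrow> real" and i assume "test_function \<phi>"
      from Fw[OF this, of i] show "(\<integral>x. f x * partial_deriv i \<phi> x \<partial>lborel) = - (\<integral>x. G x $ i * \<phi> x \<partial>lborel)"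
        by (simp add: G_def)
    qed
    have "AE x in lborel. \<forall>i. \<bar>F i x\<bar> \<le> 2 * g x" using Fg by (simp add: AE_all_countable)
    then show "AE x in lborel. norm (G x) \<le> 2 * real CARD('n) * g x"
    proof eventually_elim
      case (elim x)
      have "(\<Sum>i\<in>(UNIV::'n set). \<bar>F i x\<bar>) \<le> (\<Sum>i\<in>(UNIV::'n set). 2 * g x)" using elim by (intro sum_mono) auto
      with nG[of x] show ?case by (simp add: mult.commute mult.left_commute)
    qed
  qed
qed

section \<open>Borel representatives\<close>

lemma borel_rep:
  assumes "f \<in> borel_measurable lebesgue"
  obtains f' :: "real^'n::finite \<Rightarrow> real" where "f' \<in> borel_measurable borel" "AE x in lborel. f x = f' x"
  using completion_ex_borel_measurable_real[OF assms] by auto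

lemma weight_rep:
  assumes "weight w"
  obtains w' :: "real^'n::finite \<Rightarrow> real" where "w' \<in> borel_measurable borel" "\<And>x. 0 < w' x" "AE x in lborel. w x = w' x"
proof -
  obtain w0 where w0 [measurable]: "w0 \<in> borel_measurable borel" and eq: "AE x in lborel. w x = w0 x"
    using borel_rep[of w] assms unfolding weight_def by blast
  have pos: "AE x in lborel. 0 < w x" using assms by (simp add: weight_def AE_completion_iff)
  show ?thesis
  proof (rule that[of "\<lambda>x. if 0 < w0 x then w0 x else 1"])
    show "(\<lambda>x. if 0 < w0 x then w0 x else 1) \<in> borel_measurable borel" by measurable
    show "AE x in lborel. w x = (if 0 < w0 x then w0 x else 1)" using eq pos by eventually_elim auto
  qed auto
qed

text \<open>Integrability on compact balls makes the truncations measurable, and \<open>G\<close> is their limit.\<close>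

lemma locally_integrable_measurable:
  fixes G :: "real^'n::finite \<Rightarrow> 'b::euclidean_space"
  assumes "locally_integrable G" shows "G \<in> borel_measurable lebesgue"
proof (rule borel_measurable_LIMSEQ_metric)
  show "(\<lambda>x. indicator (cball 0 (real m)) x *\<^sub>R G x) \<in> borel_measurable lebesgue" for m
    using assms unfolding locally_integrable_def set_integrable_def by (intro borel_measurable_integrable) auto
  fix x :: "real^'n"
  obtain m0 :: nat where m0: "norm x \<le> real m0" using real_arch_simple by blast
  have "\<forall>\<^sub>F m in sequentially. indicator (cball 0 (real m)) x *\<^sub>R G x = G x"
    using eventually_ge_at_top[of m0] by eventually_elim (use m0 in auto)
  then show "(\<lambda>m. indicator (cball 0 (real m)) x *\<^sub>R G x) \<longlonglongrightarrow> G x" by (rule tendsto_eventually)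
qed

lemma borel_rep_vec:
  assumes "G \<in> borel_measurable lebesgue"
  obtains G' :: "real^'n::finite \<Rightarrow> real^'n" where "G' \<in> borel_measurable borel" "AE x in lborel. G x = G' x"
proof -
  have "\<exists>F. F \<in> borel_measurable borel \<and> (AE x in lborel. G x $ i = F x)" for i
  proof -
    have "(\<lambda>x. G x \<bullet> axis i 1) \<in> borel_measurable lebesgue" using assms by measurable
    then have "(\<lambda>x. G x $ i) \<in> borel_measurable lebesgue" by (simp add: inner_axis)
    from completion_ex_borel_measurable_real[OF this] show ?thesis by auto
  qed
  then obtain F where F: "\<And>i. F i \<in> borel_measurable borel" "\<And>i. AE x in lborel. G x $ i = F i x" by metis
  define G' where "G' x = (\<chi> i. F i x)" for x
  have Gs: "G' = (\<lambda>x. \<Sum>i\<in>UNIV. F i x *\<^sub>R axis i 1)"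
    by (auto simp: G'_def fun_eq_iff vec_eq_iff axis_def if_distrib[of "\<lambda>t. _ * t"] sum.delta cong: if_cong)
  have "G' \<in> borel_measurable borel" unfolding Gs using F(1) by measurable
  moreover have "AE x in lborel. \<forall>i. G x $ i = F i x" using F(2) by (simp add: AE_all_countable)
  then have "AE x in lborel. G x = G' x" by eventually_elim (auto simp: G'_def vec_eq_iff)
  ultimately show ?thesis by (rule that)
qed

lemma locally_integrable_of_locint:
  fixes f :: "real^'n::finite \<Rightarrow> 'b::euclidean_space"
  assumes f: "f \<in> borel_measurable lebesgue" and u [measurable]: "u \<in> borel_measurable borel" and l: "locint u"
    and le: "AE x in lborel. ennreal (norm (f x)) \<le> u x"
  shows "locally_integrable f"
  unfolding locally_integrable_def
proof (intro allI impI)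
  fix K :: "(real^'n) set" assume K: "compact K"
  then obtain R where R: "K \<subseteq> ball 0 R" by (metis bounded_subset_ballD compact_imp_bounded)
  have [measurable]: "K \<in> sets lebesgue" using K by (simp add: borel_compact)
  have [measurable]: "ball (0::real^'n) R \<in> sets borel" by simp
  show "f absolutely_integrable_on K"
    unfolding set_integrable_def
  proof (rule integrableI_bounded)
    show "(\<lambda>x. indicator K x *\<^sub>R f x) \<in> borel_measurable lebesgue" using f by measurable
    have "(\<integral>\<^sup>+x. ennreal (norm (indicator K x *\<^sub>R f x)) \<partial>lebesgue) \<le> (\<integral>\<^sup>+x. u x * indicator (ball 0 R) x \<partial>lebesgue)"
      using AE_completion[OF le] by (intro nn_integral_mono_AE, eventually_elim) (use R in \<open>auto simp: indicator_def\<close>)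
    also have "\<dots> = (\<integral>\<^sup>+x\<in>ball 0 R. u x \<partial>lborel)" by (rule nn_integral_completion)
    also have "\<dots> < \<infinity>" using l by (simp add: locint_def)
    finally show "(\<integral>\<^sup>+x. ennreal (norm (indicator K x *\<^sub>R f x)) \<partial>lebesgue) < \<infinity>" .
  qed
qed

lemma weak_gradient_rep:
  fixes f f' :: "real^'n::finite \<Rightarrow> real"
  assumes [measurable]: "f' \<in> borel_measurable borel" "G' \<in> borel_measurable borel"
    and f: "AE x in lborel. f x = f' x" and G: "AE x in lborel. G x = G' x"
    and mf: "f \<in> borel_measurable lebesgue" and mG: "G \<in> borel_measurable lebesgue"
    and t: "test_function \<phi>"
  shows "(LINT x|lebesgue. f x * partial_deriv i \<phi> x) = (\<integral>x. f' x * partial_deriv i \<phi> x \<partial>lborel)"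
    "(LINT x|lebesgue. G x $ i * \<phi> x) = (\<integral>x. G' x $ i * \<phi> x \<partial>lborel)"
proof -
  have bm: "\<phi> \<in> borel_measurable borel" "partial_deriv i \<phi> \<in> borel_measurable borel" 
    using t by (auto intro!: borel_measurable_continuous_onI test_function_continuous test_function_partial_continuous)
  note [measurable] = bm
  have l: "h \<in> borel_measurable lebesgue" if "h \<in> borel_measurable borel" for h :: "real^'n \<Rightarrow> real"
    using that by (intro measurable_completion) simp
  have G'i [measurable]: "(\<lambda>x. G' x $ i) \<in> borel_measurable borel"
  proof -
    have "(\<lambda>x. G' x \<bullet> axis i 1) \<in> borel_measurable borel" by measurable
    then show ?thesis by (simp add: inner_axis)
  qed
  have Gi: "(\<lambda>x. G x $ i) \<in> borel_measurable lebesgue"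
  proof -
    have "(\<lambda>x. G x \<bullet> axis i 1) \<in> borel_measurable lebesgue" using mG by measurable
    then show ?thesis by (simp add: inner_axis)
  qed
  have "(LINT x|lebesgue. f x * partial_deriv i \<phi> x) = (LINT x|lebesgue. f' x * partial_deriv i \<phi> x)"
    using AE_completion[OF f] mf l[OF bm(2)] l[OF \<open>f' \<in> _\<close>]
    by (intro integral_cong_AE) (auto elim!: eventually_mono)
  also have "\<dots> = (\<integral>x. f' x * partial_deriv i \<phi> x \<partial>lborel)" by (rule integral_completion) measurable
  finally show "(LINT x|lebesgue. f x * partial_deriv i \<phi> x) = (\<integral>x. f' x * partial_deriv i \<phi> x \<partial>lborel)" .
  have "(LINT x|lebesgue. G x $ i * \<phi> x) = (LINT x|lebesgue. G' x $ i * \<phi> x)"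
    using AE_completion[OF G] Gi l[OF bm(1)] l[OF G'i]
    by (intro integral_cong_AE) (auto elim!: eventually_mono)
  also have "\<dots> = (\<integral>x. G' x $ i * \<phi> x \<partial>lborel)" by (rule integral_completion) measurable
  finally show "(LINT x|lebesgue. G x $ i * \<phi> x) = (\<integral>x. G' x $ i * \<phi> x \<partial>lborel)" .
qed

lemma grand_bounded_restrict: "grand_bounded e q a w h \<Longrightarrow> e' \<le> e \<Longrightarrow> grand_bounded e' q a w h"
  unfolding grand_bounded_def by (meson less_le_trans)

section \<open>The characterisation\<close>

lemma AE_lborel_E:
  assumes "AE x in lborel. P x"
  obtains N where "N \<in> null_sets lborel" "\<And>x. x \<notin> N \<Longrightarrow> P x"
proof -
  obtain N where "\<And>x. x \<in> space lborel - N \<Longrightarrow> P x" "N \<in> null_sets lborel"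
    using AE_E3[OF assms] by blast
  then show ?thesis by (intro that[of N]) auto
qed

theorem corollary4p24:
  fixes q \<delta> :: real
    and w a f :: "real ^ 'n \<Rightarrow> real"
  assumes "1 < q"
    and "weight w"
    and "weight a"
    and "Muckenhoupt q w"
    and "a \<in> weighted_Lebesgue q w"
    and "0 < \<delta>"
    and "Muckenhoupt q (\<lambda>x. a x powr \<delta>)"
  shows "f \<in> grand_Sobolev q a w \<longleftrightarrow>
    f \<in> grand_Lebesgue q a w \<and>
    (\<exists>g \<in> grand_Lebesgue q a w. (\<forall>x. 0 \<le> g x) \<and>
      (\<exists>S \<in> null_sets lebesgue. \<forall>x \<in> - S. \<forall>y \<in> - S.
         \<bar>f x - f y\<bar> \<le> norm (x - y) * (g x + g y)))"
proof -
  note q = assms(1) and \<delta> = assms(6)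
  obtain w' where wm [measurable]: "w' \<in> borel_measurable borel" and wpos: "\<And>x. 0 < w' x" and ww: "AE x in lborel. w x = w' x"
    by (rule weight_rep[OF assms(2)]) blast
  obtain a' where am [measurable]: "a' \<in> borel_measurable borel" and apos: "\<And>x. 0 < a' x" and aa: "AE x in lborel. a x = a' x"
    by (rule weight_rep[OF assms(3)]) blast
  note ww' = AE_completion[OF ww] and aa' = AE_completion[OF aa]
  obtain A where A: "dyadic_Ap q w' A"
    by (rule Muckenhoupt_dyadic[OF assms(4) wm ww' q])
  obtain B where B: "dyadic_Ap q (\<lambda>x. a' x powr \<delta>) B"
  proof (rule Muckenhoupt_dyadic[OF assms(7) _ _ q])
    show "(\<lambda>x. a' x powr \<delta>) \<in> borel_measurable borel" by measurable
    show "AE x in lebesgue. a x powr \<delta> = a' x powr \<delta>" using aa' by eventually_elim simp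
  qed
  obtain e C where e: "0 < e" "e < q - 1" and C: "0 < C"
    and Ap: "\<And>\<epsilon>. 0 < \<epsilon> \<Longrightarrow> \<epsilon> < e \<Longrightarrow> dyadic_Ap (q - \<epsilon>) (\<lambda>x. w' x * a' x powr \<epsilon>) C"
    by (rule dyadic_Ap_perturb[OF A wm wpos am apos B \<delta> q]) blast
  have fin: "(\<integral>\<^sup>+x. ennreal (a' x powr q * w' x) \<partial>lborel) < \<infinity>"
  proof -
    have "(\<integral>\<^sup>+x. ennreal (\<bar>a x\<bar> powr q * w x) \<partial>lebesgue) \<noteq> top"
      using assms(5) by (auto simp: weighted_Lebesgue_def epowr_def split: if_splits)
    also have "(\<integral>\<^sup>+x. ennreal (\<bar>a x\<bar> powr q * w x) \<partial>lebesgue) = (\<integral>\<^sup>+x. ennreal (a' x powr q * w' x) \<partial>lebesgue)"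
    proof (rule nn_integral_cong_AE, use ww' aa' in eventually_elim)
      fix x assume "w x = w' x" "a x = a' x"
      then show "ennreal (\<bar>a x\<bar> powr q * w x) = ennreal (a' x powr q * w' x)" using apos[of x] by simp
    qed
    finally show ?thesis by (simp add: nn_integral_completion less_top)
  qed
  have grand: "g \<in> grand_Lebesgue q a w \<longleftrightarrow> grand_bounded (q - 1) q a' w' h"
    if "g \<in> borel_measurable lebesgue" "h \<in> borel_measurable borel" "AE x in lborel. h x = ennreal \<bar>g x\<bar>" for g h
    by (rule grand_Lebesgue_iff[OF that(1,2) wm am AE_completion[OF that(3)] ww' aa' wpos q])
  have li: "locint h" if "h \<in> borel_measurable borel" "grand_bounded (q - 1) q a' w' h" for h
    unfolding locint_def
    using grand_bounded_locally_integrable[OF that(1) wm am wpos apos q e Ap grand_bounded_restrict[OF that(2)]] e by auto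
  show ?thesis
  proof
    assume "f \<in> grand_Sobolev q a w"
    then obtain G where f: "f \<in> grand_Lebesgue q a w" and wG: "weak_gradient f G" and G: "(\<lambda>x. norm (G x)) \<in> grand_Lebesgue q a w"
      unfolding grand_Sobolev_def by blast
    have mf: "f \<in> borel_measurable lebesgue" using f by (simp add: grand_Lebesgue_def)
    have mG: "G \<in> borel_measurable lebesgue" using wG by (intro locally_integrable_measurable) (simp add: weak_gradient_def)
    obtain f' where mf' [measurable]: "f' \<in> borel_measurable borel" and ff: "AE x in lborel. f x = f' x"
      by (rule borel_rep[OF mf])
    obtain G' where mG' [measurable]: "G' \<in> borel_measurable borel" and GG: "AE x in lborel. G x = G' x"
      by (rule borel_rep_vec[OF mG])
    have gf: "grand_bounded (q - 1) q a' w' (\<lambda>x. ennreal \<bar>f' x\<bar>)"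
      using ff by (subst grand[OF mf, symmetric]) (auto simp: f elim!: eventually_mono)
    have gG: "grand_bounded (q - 1) q a' w' (\<lambda>x. ennreal (norm (G' x)))"
      using GG mG by (subst grand[symmetric, of "\<lambda>x. norm (G x)"]) (auto simp: G elim!: eventually_mono)
    have wg: "borel_weak_gradient f' G'"
      unfolding borel_weak_gradient_def
    proof (intro conjI allI impI mf' mG' li gf gG)
      fix \<phi> :: "real^'n \<Rightarrow> real" and i assume t: "test_function \<phi>"
      have "(LINT x|lebesgue. f x * partial_deriv i \<phi> x) = - (LINT x|lebesgue. G x $ i * \<phi> x)"
        using wG t unfolding weak_gradient_def by blast
      then show "(\<integral>x. f' x * partial_deriv i \<phi> x \<partial>lborel) = - (\<integral>x. G' x $ i * \<phi> x \<partial>lborel)"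
        unfolding weak_gradient_rep[OF mf' mG' ff GG mf mG t] .
    qed measurable
    let ?M = "\<lambda>T. dyadic_max lborel T (\<lambda>z. ennreal (norm (G' z)))"
    obtain C' S where C': "0 < C'" and S: "S \<in> null_sets lborel"
      and pt: "\<And>x y. x \<notin> S \<Longrightarrow> y \<notin> S \<Longrightarrow> ennreal \<bar>f' x - f' y\<bar> \<le> ennreal (norm (x - y)) *
         (ennreal C' * (\<Sum>T\<in>UNIV. ?M T x) + ennreal C' * (\<Sum>T\<in>UNIV. ?M T y))"
      by (rule weak_gradient_pointwise[OF wg]) blast
    define h where "h x = ennreal C' * (\<Sum>T\<in>UNIV. ?M T x)" for x
    have hm [measurable]: "h \<in> borel_measurable borel" unfolding h_def by measurable
    have "grand_bounded e q a' w' h"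
      unfolding h_def
    proof (intro grand_bounded_cmult grand_bounded_sum wm am)
      show "grand_bounded e q a' w' (?M T)" for T
        by (rule grand_bounded_dyadic_max[OF _ wm am wpos apos q e C Ap grand_bounded_restrict[OF gG]]) (use e in auto)
    qed (use e in auto)
    then have gh: "grand_bounded (q - 1) q a' w' h"
      by (rule grand_bounded_extend[OF hm wm am wpos apos fin e(1) _ _ q, rotated]) (use e in auto)
    have hfin: "AE x in lborel. h x \<noteq> \<infinity>"
    proof -
      have "AE x in lborel. h x * indicator (ball 0 (real m)) x \<noteq> \<infinity>" for m
      proof (rule nn_integral_PInf_AE)
        have [measurable]: "ball (0::real^'n) (real m) \<in> sets borel" by simp
        show "(\<lambda>x. h x * indicator (ball 0 (real m)) x) \<in> borel_measurable lborel" by measurable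
        show "(\<integral>\<^sup>+x\<in>ball 0 (real m). h x \<partial>lborel) \<noteq> \<infinity>" using li[OF hm gh] by (auto simp: locint_def less_top)
      qed
      then have "AE x in lborel. \<forall>m. h x * indicator (ball 0 (real m)) x \<noteq> \<infinity>" by (subst AE_all_countable) blast
      then show ?thesis
      proof eventually_elim
        case (elim x)
        obtain m :: nat where "norm x < real m" using reals_Archimedean2 by blast
        with elim[rule_format, of m] show ?case by simp
      qed
    qed
    define g where "g x = enn2real (h x)" for x
    have gm: "g \<in> borel_measurable lebesgue" unfolding g_def by (intro measurable_completion) measurable
    have gg: "AE x in lborel. h x = ennreal \<bar>g x\<bar>" using hfin by eventually_elim (simp add: g_def less_top)
    have "g \<in> grand_Lebesgue q a w" using grand[OF gm hm gg] gh by simp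
    moreover have "\<forall>x. 0 \<le> g x" by (simp add: g_def)
    moreover have "\<exists>S \<in> null_sets lebesgue. \<forall>x \<in> - S. \<forall>y \<in> - S. \<bar>f x - f y\<bar> \<le> norm (x - y) * (g x + g y)"
    proof -
      have "AE x in lborel. f x = f' x \<and> h x = ennreal (g x) \<and> x \<notin> S"
        using ff gg AE_not_in[OF S] by eventually_elim (simp add: g_def)
      then obtain N where N: "\<And>x. x \<notin> N \<Longrightarrow> f x = f' x \<and> h x = ennreal (g x) \<and> x \<notin> S" "N \<in> null_sets lborel"
        by (rule AE_lborel_E) blast
      have "\<bar>f x - f y\<bar> \<le> norm (x - y) * (g x + g y)" if "x \<notin> N" "y \<notin> N" for x y
      proof -
        have "ennreal \<bar>f x - f y\<bar> \<le> ennreal (norm (x - y)) * (h x + h y)"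
          using pt[of x y] N(1)[OF that(1)] N(1)[OF that(2)] by (simp add: h_def)
        also have "\<dots> = ennreal (norm (x - y) * (g x + g y))"
          using N(1)[OF that(1)] N(1)[OF that(2)] by (simp add: ennreal_mult g_def)
        finally show ?thesis by (subst (asm) ennreal_le_iff) (auto simp: g_def)
      qed
      then show ?thesis using null_sets_completionI[OF N(2)] by blast
    qed
    ultimately show "f \<in> grand_Lebesgue q a w \<and> (\<exists>g \<in> grand_Lebesgue q a w. (\<forall>x. 0 \<le> g x) \<and>
      (\<exists>S \<in> null_sets lebesgue. \<forall>x \<in> - S. \<forall>y \<in> - S. \<bar>f x - f y\<bar> \<le> norm (x - y) * (g x + g y)))"
      using f by blast
  next
    assume "f \<in> grand_Lebesgue q a w \<and> (\<exists>g \<in> grand_Lebesgue q a w. (\<forall>x. 0 \<le> g x) \<and>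
      (\<exists>S \<in> null_sets lebesgue. \<forall>x \<in> - S. \<forall>y \<in> - S. \<bar>f x - f y\<bar> \<le> norm (x - y) * (g x + g y)))"
    then obtain g S where f: "f \<in> grand_Lebesgue q a w" and g: "g \<in> grand_Lebesgue q a w" and g0: "\<And>x. 0 \<le> g x"
      and S: "S \<in> null_sets lebesgue" and pt: "\<And>x y. x \<notin> S \<Longrightarrow> y \<notin> S \<Longrightarrow> \<bar>f x - f y\<bar> \<le> norm (x - y) * (g x + g y)"
      by auto
    have mf: "f \<in> borel_measurable lebesgue" and mg: "g \<in> borel_measurable lebesgue" using f g by (auto simp: grand_Lebesgue_def)
    obtain f' where mf' [measurable]: "f' \<in> borel_measurable borel" and ff: "AE x in lborel. f x = f' x"
      by (rule borel_rep[OF mf])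
    obtain g1 where mg1 [measurable]: "g1 \<in> borel_measurable borel" and gg1: "AE x in lborel. g x = g1 x"
      by (rule borel_rep[OF mg])
    define g' where "g' x = max 0 (g1 x)" for x
    have mg' [measurable]: "g' \<in> borel_measurable borel" unfolding g'_def by measurable
    have g'0: "0 \<le> g' x" for x by (simp add: g'_def)
    have gg: "AE x in lborel. g x = g' x" using gg1
    proof eventually_elim
      case (elim x) then show ?case using g0[of x] by (simp add: g'_def)
    qed
    have gf: "grand_bounded (q - 1) q a' w' (\<lambda>x. ennreal \<bar>f' x\<bar>)"
      using ff by (subst grand[OF mf, symmetric]) (auto simp: f elim!: eventually_mono)
    have gbg: "grand_bounded (q - 1) q a' w' (\<lambda>x. ennreal (g' x))"
      using gg g'0 by (subst grand[OF mg, symmetric]) (auto simp: g elim!: eventually_mono)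
    have lf: "locint (\<lambda>x. ennreal \<bar>f' x\<bar>)" and lg: "locint (\<lambda>x. ennreal (g' x))"
      by (rule li[OF _ gf], measurable) (rule li[OF _ gbg], measurable)
    have "AE x in lborel. x \<notin> S" using AE_not_in[OF S] by (simp add: AE_completion_iff)
    then have "AE x in lborel. f x = f' x \<and> g x = g' x \<and> x \<notin> S" using ff gg by eventually_elim simp
    then obtain N where N: "\<And>x. x \<notin> N \<Longrightarrow> f x = f' x \<and> g x = g' x \<and> x \<notin> S" "N \<in> null_sets lborel"
      by (rule AE_lborel_E) blast
    have pt': "\<bar>f' x - f' y\<bar> \<le> norm (x - y) * (g' x + g' y)" if "x \<notin> N" "y \<notin> N" for x y
      using pt[of x y] N(1)[OF that(1)] N(1)[OF that(2)] by simp
    obtain G where wg: "borel_weak_gradient f' G" and Gg: "AE x in lborel. norm (G x) \<le> 2 * real CARD('n) * g' x"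
      by (rule pointwise_weak_gradient[OF mf' mg' lf lg g'0 N(2) pt'])
    have mG [measurable]: "G \<in> borel_measurable borel" using wg by (simp add: borel_weak_gradient_def)
    have mGl: "G \<in> borel_measurable lebesgue" by (intro measurable_completion) simp
    have "weak_gradient f G"
      unfolding weak_gradient_def
    proof (intro conjI allI impI)
      show "locally_integrable f"
        by (rule locally_integrable_of_locint[OF mf _ lf]) (use ff in \<open>auto elim!: eventually_mono\<close>)
      show "locally_integrable G"
        by (rule locally_integrable_of_locint[OF mGl, of "\<lambda>x. ennreal (norm (G x))"]) (use wg in \<open>auto simp: borel_weak_gradient_def\<close>)
      fix \<phi> :: "real^'n \<Rightarrow> real" and i assume t: "test_function \<phi>"
      show "(LINT x|lebesgue. f x * partial_deriv i \<phi> x) = - (LINT x|lebesgue. G x $ i * \<phi> x)"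
        unfolding weak_gradient_rep[OF mf' mG ff AE_I2[OF refl] mf mGl t] using wg t by (simp add: borel_weak_gradient_def)
    qed
    moreover have "(\<lambda>x. norm (G x)) \<in> grand_Lebesgue q a w"
    proof -
      have "grand_bounded (q - 1) q a' w' (\<lambda>x. ennreal (2 * real CARD('n)) * ennreal (g' x))"
        by (rule grand_bounded_cmult[OF _ wm am gbg]) auto
      then have "grand_bounded (q - 1) q a' w' (\<lambda>x. ennreal (norm (G x)))"
      proof (rule grand_bounded_mono)
        show "AE x in lborel. ennreal (norm (G x)) \<le> ennreal (2 * real CARD('n)) * ennreal (g' x)"
          using Gg
        proof eventually_elim
          case (elim x)
          then show ?case using g'0[of x] by (simp add: ennreal_mult[symmetric] ennreal_leI)
        qed
      qed simp
      moreover have "(\<lambda>x. norm (G x)) \<in> borel_measurable lebesgue" using mGl by measurable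
      ultimately show ?thesis using grand[of "\<lambda>x. norm (G x)" "\<lambda>x. ennreal (norm (G x))"] by simp
    qed
    ultimately show "f \<in> grand_Sobolev q a w" using f unfolding grand_Sobolev_def by blast
  qed
qed

end
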